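(* Let $n\to+\infty$ and $p=p_n\to+\infty$ with $n>p$. For each $n$ let $X^{(1)},\dots,X^{(n)}$ be i.i.d. $\mathcal{N}(\mu,\Sigma)$ in $\mathbb{R}^p$ and let $\tilde Y^{(l)}=\beta_0+\beta^TX^{(l)}+\epsilon^{(l)}$, $l=1,\dots,n$, where the $\epsilon^{(l)}$ are i.i.d. $\mathcal N(0,\sigma_n^2)$, independent of the $X^{(l)}$, with $\sigma_n\le C_{\sup}$ for a fixed finite constant $C_{\sup}$. Here $\mu\in\mathbb R^p$, $\beta_0\in\mathbb R$, $\beta\in\mathbb R^p$, $\sigma_n$ and the symmetric positive definite matrix $\Sigma$ are unknown and may depend on $n$. Let $B^*=B(\Sigma)$ be the finest block decomposition of $\Sigma$. Assume: (1) $p/n\to y\in\,]0,1[$; (2) there exist $\lambda_{\inf}>0$ and $\lambda_{\sup}<+\infty$ such that for all $n$ the eigenvalues of $\Sigma$ lie in $[\lambda_{\inf},\lambda_{\sup}]$; (3) there exists $m\in\mathbb{N}^*$ such that for all $n$, $|A|\le m$ for every $A\in B^*$; (4) there exists $a>0$ such that for all $n$ and all partitions $B<B^*$, $\|\Sigma_B-\Sigma\|_{\max}\ge a\,n^{-1/4}$; (5) there exist $\beta_{\inf}>0$ and $\beta_{\sup}<+\infty$ such that for all $n$ and all $j\le p$, $\beta_{\inf}\le|\beta_j|\le\beta_{\sup}$. Let $\delta\in\,]1/2,1[$, $\kappa=\frac1{pn^\delta}$, let $\widehat B$ be any one of the estimators $\widehat{B}_{tot},\widehat{B}_{\widehat{C}},\widehat{B}_\lambda,\widehat{B}_s$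 of $B^*$, let $\eta=(\eta_i)_{i\le p}$ be the Shapley effects and $\widehat\eta=(\widehat\eta_i)_{i\le p}$ their plug-in estimators based on $(\widehat B,S_{\widehat B},\widehat\beta)$ (all defined in the context). Then for all $\gamma>1/2$, $$\sum_{i=1}^p|\widehat\eta_i-\eta_i|=o_p\left(\frac{\log(n)^\gamma}{\sqrt n}\right).$$
   Context: Partitions: $[1:p]=\{1,\dots,p\}$ and $\mathcal{P}_p$ is the set of partitions of $[1:p]$. $B\le B'$ ($B$ is finer than $B'$) if every element of $B'$ is a disjoint union of elements of $B$; $B<B'$ means $B\le B'$ and $B\ne B'$. $(i,j)\in B$ means $i,j$ belong to the same element of $B$. For a symmetric matrix $\Gamma=(\gamma_{ij})$, $\Gamma_B$ has entries $\gamma_{ij}$ if $(i,j)\in B$ and $0$ otherwise; $B(\Gamma)$ is the unique finest partition $B$ with $\Gamma=\Gamma_B$. $\|M\|_{\max}=\max_{i,j}|m_{ij}|$. $\Gamma_{u,v}=(\Gamma_{ij})_{i\in u,j\in v}$, $\beta_u=(\beta_i)_{i\in u}$, and $w-v=w\setminus v$. Empirical quantities: $\overline{X}=\frac1n\sum_lX^{(l)}$, $S=(s_{ij})=\frac1n\sum_{l}(X^{(l)}-\overline X)(X^{(l)}-\overline X)^T$, $\widehat C_{ij}=s_{ij}/\sqrt{s_{ii}s_{jj}}$. Criterion: $l_\Gamma=\frac1p(\log|\Gamma|+\mathrm{Tr}(\Gamma^{-1}S))$ for $\Gamma$ symmetric positive definite; $\mathrm{pen}(\Gamma)=\sum_{k=1}^Kp_k^2$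 if $B(\Gamma)=\{B_1,\dots,B_K\}$, $|B_k|=p_k$; $\Phi(\Gamma)=l_\Gamma+\kappa\,\mathrm{pen}(\Gamma)$; $\Psi(B)=\Phi(S_B)$. For $\lambda\in[0,1]$, $B_\lambda=B((\widehat C_{ij}\mathbf 1_{|\widehat C_{ij}|>\lambda})_{i,j})$. Estimators of $B^*$: $\widehat B_{tot}=\operatorname{argmin}_{B\in\mathcal P_p}\Psi(B)$; $\widehat B_{\widehat C}=\operatorname{argmin}\{\Psi(B):B=B_\lambda,\lambda\in A_{\widehat C}\}$, $A_{\widehat C}=\{|\widehat C_{ij}|:1\le i<j\le p\}$; $\widehat B_\lambda=B_{n^{-1/3}}$; $\widehat B_s=\operatorname{argmin}\{\Psi(B):B=B_\lambda,\lambda\in A_s\}$, $A_s=\{s/p,(s+1)/p,\dots,1\}$, with $s$ the smallest integer such that all groups of $B_{s/p}$ have cardinality at most $m$. Regression estimator: $(\widehat\beta_0,\widehat\beta^T)^T=(A^TA)^{-1}A^T\tilde Y$, where $\tilde Y=(\tilde Y^{(l)})_{l}$ and $A\in\mathbb R^{n\times(p+1)}$, $A_{l,1}=1$, $A_{l,i+1}=X_i^{(l)}$. Shapley effects: for $X\sim\mathcal N(\mu,\Sigma)$ and $Y=\beta_0+\beta^TX$, $$\eta_i=\frac1{p\,\mathrm{Var}(Y)}\sum_{u\subset[1:p]\setminus\{i\}}\binom{p-1}{|u|}^{-1}\left(\mathrm{Var}(Y|X_u)-\mathrm{Var}(Y|X_{u\cup\{i\}})\right),$$ with $\mathrm{Var}(Y|X_u)=\beta_{-u}^T(\Sigma_{-u,-u}-\Sigma_{-u,u}\Sigma_{u,u}^{-1}\Sigma_{u,-u})\beta_{-u}$,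 $-u=[1:p]\setminus u$. For a partition $B$, a matrix $\Gamma=\Gamma_B$ symmetric positive definite and a vector $b$, define, with $G$ the element of $B$ containing $i$, $$\eta_i(B,\Gamma,b)=\frac1{b^T\Gamma b}\,\frac1{|G|}\sum_{u\subset G\setminus\{i\}}\binom{|G|-1}{|u|}^{-1}\left(V_u^G-V_{u\cup\{i\}}^G\right),\quad V_v^G=b_{G-v}^T\left(\Gamma_{G-v,G-v}-\Gamma_{G-v,v}\Gamma_{v,v}^{-1}\Gamma_{v,G-v}\right)b_{G-v}$$ (with $V_\emptyset^G=b_G^T\Gamma_{G,G}b_G$ and $V_G^G=0$). One has $\eta_i=\eta_i(B^*,\Sigma,\beta)$. The estimator is $\widehat\eta_i=\eta_i(\widehat B,S_{\widehat B},\widehat\beta)$. *)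

theory Defs
  imports
    "HOL-Probability.Probability"
    "HOL-Library.Disjoint_Sets"
    "Jordan_Normal_Form.Char_Poly"
    "Jordan_Normal_Form.Gauss_Jordan_Elimination"
    "Jordan_Normal_Form.DL_Submatrix"
begin

hide_const (open) Finite_Cartesian_Product.vec Finite_Cartesian_Product.mat Determinants.det
hide_type (open) Finite_Cartesian_Product.vec

text \<open>
  Vectors and matrices are those of \<^theory>\<open>Jordan_Normal_Form.Matrix\<close>, so all index sets are
  0-based: coordinates range over \<open>{..<p}\<close> and the observations of a sample over \<open>{..<n}\<close>.
\<close>


section \<open>Gaussian laws and stochastic order\<close>

text \<open>The normal law with mean \<open>m\<close> and standard deviation \<open>s \<ge> 0\<close>; a point mass if \<open>s = 0\<close>.\<close>

definition normal_law :: "real \<Rightarrow> real \<Rightarrow> real measure" where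
  "normal_law m s =
     (if s = 0 then return borel m else density lborel (\<lambda>x. ennreal (normal_density m s x)))"

text \<open>
  \<open>X\<close> has law \<open>N(\<mu>, \<Sigma>)\<close> on \<open>\<real>\<^sup>p\<close>: every linear combination \<open>a \<bullet> X\<close> has the normal law with mean
  \<open>a \<bullet> \<mu>\<close> and variance \<open>a \<bullet> \<Sigma> a\<close>.
\<close>

definition gaussian_vector ::
  "'a measure \<Rightarrow> nat \<Rightarrow> ('a \<Rightarrow> nat \<Rightarrow> real) \<Rightarrow> real vec \<Rightarrow> real mat \<Rightarrow> bool" where
  "gaussian_vector M p X \<mu> \<Sigma> \<longleftrightarrow>
     X \<in> measurable M (PiM {..<p} (\<lambda>_. borel)) \<and>
     (\<forall>a\<in>carrier_vec p.
        distr M borel (\<lambda>\<omega>. scalar_prod a (vec p (X \<omega>)))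
          = normal_law (scalar_prod a \<mu>) (sqrt (scalar_prod a (\<Sigma> *\<^sub>v a))))"

text \<open>
  \<open>Z\<^sub>n = o\<^sub>p(r\<^sub>n)\<close>, where \<open>Z\<^sub>n\<close> lives on its own probability space \<open>M n\<close>. Measurability of \<open>Z\<^sub>n\<close>
  is part of the notion; without it \<^const>\<open>measure\<close> would return 0 on non-measurable sets.
\<close>

definition small_o_p ::
  "(nat \<Rightarrow> 'a measure) \<Rightarrow> (nat \<Rightarrow> 'a \<Rightarrow> real) \<Rightarrow> (nat \<Rightarrow> real) \<Rightarrow> bool" where
  "small_o_p M Z r \<longleftrightarrow>
     (\<forall>\<^sub>F n in sequentially. Z n \<in> borel_measurable (M n)) \<and>
     (\<forall>\<epsilon>>0. (\<lambda>n. measure (M n) {\<omega> \<in> space (M n). \<bar>Z n \<omega>\<bar> > \<epsilon> * r n}) \<longlonglongrightarrow> 0)"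


section \<open>Matrices\<close>

definition sym_pos_def :: "real mat \<Rightarrow> bool" where
  "sym_pos_def A \<longleftrightarrow>
     square_mat A \<and> transpose_mat A = A \<and>
     (\<forall>v\<in>carrier_vec (dim_row A). v \<noteq> 0\<^sub>v (dim_row A) \<longrightarrow> scalar_prod v (A *\<^sub>v v) > 0)"

text \<open>Inverse of a square matrix, totalized by the zero matrix on singular matrices.\<close>

definition minv :: "real mat \<Rightarrow> real mat" where
  "minv A = (case mat_inverse A of Some B \<Rightarrow> B | None \<Rightarrow> 0\<^sub>m (dim_row A) (dim_row A))"

definition max_norm :: "real mat \<Rightarrow> real" where
  "max_norm A = Max {\<bar>A $$ (i, j)\<bar> | i j. i < dim_row A \<and> j < dim_col A}"

text \<open>
  The subvector \<open>b\<^sub>u\<close>, with the entries in increasing order of their indices as in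
  \<^const>\<open>submatrix\<close>.
\<close>

definition subvector :: "real vec \<Rightarrow> nat set \<Rightarrow> real vec" where
  "subvector b u = vec (card {i. i < dim_vec b \<and> i \<in> u}) (\<lambda>k. b $ pick u k)"


section \<open>Partitions and block structures\<close>

definition strictly_finer :: "nat \<Rightarrow> nat set set \<Rightarrow> nat set set \<Rightarrow> bool" where
  "strictly_finer p B B' \<longleftrightarrow> refines {..<p} B B' \<and> B \<noteq> B'"

definition same_block :: "nat set set \<Rightarrow> nat \<Rightarrow> nat \<Rightarrow> bool" where
  "same_block B i j \<longleftrightarrow> (\<exists>G\<in>B. i \<in> G \<and> j \<in> G)"

definition block_restrict :: "nat set set \<Rightarrow> real mat \<Rightarrow> real mat" where
  "block_restrict B A =
     mat (dim_row A) (dim_col A) (\<lambda>(i, j). if same_block B i j then A $$ (i, j) else 0)"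

text \<open>The finest partition \<open>B\<close> with \<open>A = A\<^sub>B\<close>.\<close>

definition finest_blocks :: "real mat \<Rightarrow> nat set set" where
  "finest_blocks A =
     (THE B. partition_on {..<dim_row A} B \<and> A = block_restrict B A \<and>
        (\<forall>B'. partition_on {..<dim_row A} B' \<and> A = block_restrict B' A
               \<longrightarrow> refines {..<dim_row A} B B'))"


section \<open>Empirical quantities\<close>

text \<open>A sample is a function \<open>x\<close> with \<open>x l i\<close> the \<open>i\<close>-th coordinate of the \<open>l\<close>-th observation.\<close>

definition sample_mean :: "nat \<Rightarrow> (nat \<Rightarrow> nat \<Rightarrow> real) \<Rightarrow> nat \<Rightarrow> real" where
  "sample_mean n x i = (\<Sum>l<n. x l i) / real n"

definition sample_cov :: "nat \<Rightarrow> nat \<Rightarrow> (nat \<Rightarrow> nat \<Rightarrow> real) \<Rightarrow> real mat" where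
  "sample_cov n p x =
     mat p p (\<lambda>(i, j). (\<Sum>l<n. (x l i - sample_mean n x i) * (x l j - sample_mean n x j)) / real n)"

definition correlation :: "real mat \<Rightarrow> real mat" where
  "correlation S =
     mat (dim_row S) (dim_col S) (\<lambda>(i, j). S $$ (i, j) / sqrt (S $$ (i, i) * S $$ (j, j)))"

text \<open>The least squares estimator of \<open>(\<beta>\<^sub>0, \<beta>)\<close> from a sample \<open>x\<close> and responses \<open>y\<close>.\<close>

definition design_matrix :: "nat \<Rightarrow> nat \<Rightarrow> (nat \<Rightarrow> nat \<Rightarrow> real) \<Rightarrow> real mat" where
  "design_matrix n p x = mat n (p + 1) (\<lambda>(l, k). if k = 0 then 1 else x l (k - 1))"

definition least_squares ::
  "nat \<Rightarrow> nat \<Rightarrow> (nat \<Rightarrow> nat \<Rightarrow> real) \<Rightarrow> (nat \<Rightarrow> real) \<Rightarrow> real vec" where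
  "least_squares n p x y =
     (let A = design_matrix n p x
      in (minv (transpose_mat A * A) * transpose_mat A) *\<^sub>v vec n y)"

definition slope_estimate ::
  "nat \<Rightarrow> nat \<Rightarrow> (nat \<Rightarrow> nat \<Rightarrow> real) \<Rightarrow> (nat \<Rightarrow> real) \<Rightarrow> real vec" where
  "slope_estimate n p x y = vec p (\<lambda>i. least_squares n p x y $ (i + 1))"


section \<open>Penalized likelihood and the partition estimators\<close>

text \<open>Here \<open>S\<close> is the empirical covariance matrix, of dimension \<open>p = dim_row S\<close>.\<close>

definition neg_log_lik :: "real mat \<Rightarrow> real mat \<Rightarrow> real" where
  "neg_log_lik S \<Gamma> =
     (ln (det \<Gamma>) + (\<Sum>i<dim_row S. (minv \<Gamma> * S) $$ (i, i))) / real (dim_row S)"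

definition pen :: "real mat \<Rightarrow> real" where
  "pen \<Gamma> = (\<Sum>G\<in>finest_blocks \<Gamma>. (real (card G))\<^sup>2)"

definition Phi :: "real \<Rightarrow> real mat \<Rightarrow> real mat \<Rightarrow> real" where
  "Phi \<kappa> S \<Gamma> = neg_log_lik S \<Gamma> + \<kappa> * pen \<Gamma>"

definition Psi :: "real \<Rightarrow> real mat \<Rightarrow> nat set set \<Rightarrow> real" where
  "Psi \<kappa> S B = Phi \<kappa> S (block_restrict B S)"

definition threshold_blocks :: "real mat \<Rightarrow> real \<Rightarrow> nat set set" where
  "threshold_blocks S t =
     (let C = correlation S
      in finest_blocks (mat (dim_row C) (dim_col C)
           (\<lambda>(i, j). if \<bar>C $$ (i, j)\<bar> > t then C $$ (i, j) else 0)))"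

text \<open>
  Minimizers need not be unique, so each estimator is rendered as the predicate stating that \<open>B\<close> is
  a possible value of it.
\<close>

definition is_B_tot :: "real \<Rightarrow> real mat \<Rightarrow> nat set set \<Rightarrow> bool" where
  "is_B_tot \<kappa> S B \<longleftrightarrow> is_arg_min (Psi \<kappa> S) (\<lambda>B. partition_on {..<dim_row S} B) B"

definition is_B_corr :: "real \<Rightarrow> real mat \<Rightarrow> nat set set \<Rightarrow> bool" where
  "is_B_corr \<kappa> S B \<longleftrightarrow>
     is_arg_min (Psi \<kappa> S)
       (\<lambda>B. \<exists>t\<in>{\<bar>correlation S $$ (i, j)\<bar> | i j. i < j \<and> j < dim_row S}. B = threshold_blocks S t) B"

definition is_B_threshold :: "nat \<Rightarrow> real mat \<Rightarrow> nat set set \<Rightarrow> bool" where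
  "is_B_threshold n S B \<longleftrightarrow> B = threshold_blocks S (real n powr (- 1 / 3))"

definition grid_start :: "nat \<Rightarrow> real mat \<Rightarrow> nat" where
  "grid_start m S =
     (LEAST s. \<forall>G\<in>threshold_blocks S (real s / real (dim_row S)). card G \<le> m)"

definition is_B_grid :: "nat \<Rightarrow> real \<Rightarrow> real mat \<Rightarrow> nat set set \<Rightarrow> bool" where
  "is_B_grid m \<kappa> S B \<longleftrightarrow>
     is_arg_min (Psi \<kappa> S)
       (\<lambda>B. \<exists>t\<in>{real k / real (dim_row S) | k. grid_start m S \<le> k \<and> k \<le> dim_row S}.
              B = threshold_blocks S t) B"


section \<open>Shapley effects\<close>

text \<open>
  \<open>cond_var \<Gamma> b G v\<close> is \<open>V\<^sub>v\<^sup>G\<close>. The conventions for \<open>v = \<emptyset>\<close> and \<open>v = G\<close> need no separate cases, as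
  the matrices involved then have a dimension equal to 0. For \<open>G = {..<p}\<close> it is the conditional
  variance of \<open>\<beta>\<^sub>0 + b \<bullet> X\<close> given \<open>X\<^sub>v\<close> for \<open>X\<close> of law \<open>N(\<mu>, \<Gamma>)\<close>.
\<close>

definition cond_var :: "real mat \<Rightarrow> real vec \<Rightarrow> nat set \<Rightarrow> nat set \<Rightarrow> real" where
  "cond_var \<Gamma> b G v =
     (let w = G - v
      in scalar_prod (subvector b w)
           ((submatrix \<Gamma> w w - submatrix \<Gamma> w v * minv (submatrix \<Gamma> v v) * submatrix \<Gamma> v w)
              *\<^sub>v subvector b w))"

definition shapley_on :: "real mat \<Rightarrow> real vec \<Rightarrow> nat set \<Rightarrow> nat \<Rightarrow> real" where
  "shapley_on \<Gamma> b G i =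
     1 / scalar_prod b (\<Gamma> *\<^sub>v b) * (1 / real (card G)) *
     (\<Sum>u\<in>Pow (G - {i}).
        1 / real ((card G - 1) choose card u) * (cond_var \<Gamma> b G u - cond_var \<Gamma> b G (insert i u)))"

definition shapley_effect :: "real mat \<Rightarrow> real vec \<Rightarrow> nat \<Rightarrow> real" where
  "shapley_effect \<Sigma> \<beta> i = shapley_on \<Sigma> \<beta> {..<dim_vec \<beta>} i"

definition block_shapley :: "nat set set \<Rightarrow> real mat \<Rightarrow> real vec \<Rightarrow> nat \<Rightarrow> real" where
  "block_shapley B \<Gamma> b i = shapley_on \<Gamma> b (THE G. G \<in> B \<and> i \<in> G) i"

definition shapley_estimate ::
  "nat \<Rightarrow> nat \<Rightarrow> (nat \<Rightarrow> nat \<Rightarrow> real) \<Rightarrow> (nat \<Rightarrow> real) \<Rightarrow> nat set set \<Rightarrow> nat \<Rightarrow> real" where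
  "shapley_estimate n p x y B i =
     block_shapley B (block_restrict B (sample_cov n p x)) (slope_estimate n p x y) i"

end

theory Submission
  imports Defs "Jordan_Normal_Form.Schur_Decomposition" "HOL-Real_Asymp.Real_Asymp"
begin

text \<open>
  On an event whose probability tends to 1, everything follows from deterministic estimates; the
  theorem combines a concentration part with a perturbation part.

  \<^emph>\<open>Concentration.\<close> Let \<open>Z\<close> be the \<open>n \<times> p\<close> matrix of the centred observations. By Chernoff bounds
  and polarisation, all entries of the empirical covariance matrix \<open>S\<close> are within
  \<open>e = O(sqrt(ln n / n))\<close> of those of \<open>\<Sigma>\<close>. By union bounds over nets of the unit ball,
  \<open>|Zv| \<le> K sqrt n |v|\<close> and \<open>|c 1 + Zv| \<ge> \<epsilon> sqrt n |v|\<close> for all vectors \<open>v\<close> and all intercepts \<open>c\<close>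
  at once, with constants \<open>K, \<epsilon> > 0\<close>; the lower bound is where \<open>p/n \<rightarrow> y < 1\<close> enters: a net has
  \<open>(C/\<epsilon>)^p\<close> points, each of them fails with probability at most \<open>(C\<epsilon>)^n\<close>, and \<open>\<epsilon>^(n-p)\<close> beats all
  constants (\<open>row_form_lower_event\<close>). Consequently the spectrum of \<open>S\<close> lies in \<open>[\<epsilon>\<^sup>2, K\<^sup>2]\<close>. The
  normal equations bound the error of the fitted values by the norm of the noise, so that the
  least squares estimate \<open>b\<close> of \<open>\<beta>\<close> satisfies \<open>|b - \<beta>|\<^sup>2 = O(1)\<close> (\<open>slope_estimate_error\<close>).

  \<^emph>\<open>Block recovery.\<close> Deleting from a matrix with spectrum in \<open>[c, K]\<close> the entries \<open>E\<close> outside the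
  blocks of a partition increases \<open>ln det\<close> by at most \<open>|E|\<^sup>2/c\<^sup>2\<close> and at least \<open>|E|\<^sup>2/(8K\<^sup>2)\<close>
  (Frobenius norm). The scaled penalty \<open>p \<kappa> = n^(-\<delta>)\<close> lies strictly between the scale \<open>ln n / n\<close>
  of the squares of the noise entries of \<open>S\<close> and the scale \<open>n^(-1/2)\<close> of the squares of the
  entries that must not be lost. Hence comparing a partition \<open>B\<close> and the true partition \<open>B\<^sup>*\<close> with
  their common refinement shows that \<open>\<Psi>(B) \<le> \<Psi>(B\<^sup>*)\<close> forces \<open>S\<^sub>B = S\<^bsub>B*\<^esub>\<close>
  (\<open>Psi_le_imp_finest_blocks_eq\<close>). All families over which the estimators minimise contain \<open>B\<^sup>*\<close>,
  and the threshold \<open>n^(-1/3)\<close> returns it, because these thresholds separate the correlations of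
  the two scales (\<open>estimators_recover_blocks\<close>).

  \<^emph>\<open>Shapley effects.\<close> A conditional variance is the minimum of the quadratic form of the
  covariance matrix over the vectors that agree with \<open>\<beta>\<close> on the coordinates that are not
  conditioned on. This variational formula makes conditional variances additive over blocks, so
  that the effects are sums over subsets of blocks of size at most \<open>m\<close>, and it makes them
  Lipschitz in the matrix and the vector with constants depending on \<open>m\<close> and the spectral bounds
  only. The common denominator is of order \<open>p\<close>, as all \<open>|\<beta>\<^sub>j|\<close> are bounded below. Summing the
  errors of the \<open>p\<close> effects and using Cauchy--Schwarz for \<open>\<Sum>\<^sub>j |b\<^sub>j - \<beta>\<^sub>j| = O(sqrt p)\<close> gives a
  total error \<open>O(e + 1/sqrt p) = O(sqrt(ln n / n))\<close> (\<open>shapley_total_error\<close>).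
\<close>

(* These bundles give "$" and other symbols a second meaning, for vectors of fixed dimension. *)
unbundle no vec_syntax and no inner_syntax

section \<open>Traces, quadratic forms and inverses\<close>

definition mtrace :: "'a::comm_monoid_add mat \<Rightarrow> 'a" where
  "mtrace A = (\<Sum>i<dim_row A. A $$ (i, i))"

lemma mtrace_mult_commute:
  fixes A B :: "'a::comm_semiring_0 mat"
  assumes "A \<in> carrier_mat n m" "B \<in> carrier_mat m n"
  shows "mtrace (A * B) = mtrace (B * A)"
proof -
  have "mtrace (A * B) = (\<Sum>i<n. \<Sum>j<m. A $$ (i, j) * B $$ (j, i))"
    using assms by (auto simp: mtrace_def scalar_prod_def atLeast0LessThan intro!: sum.cong)
  also have "\<dots> = (\<Sum>j<m. \<Sum>i<n. B $$ (j, i) * A $$ (i, j))"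
    by (subst sum.swap) (simp add: mult.commute)
  also have "\<dots> = mtrace (B * A)"
    using assms by (auto simp: mtrace_def scalar_prod_def atLeast0LessThan intro!: sum.cong)
  finally show ?thesis .
qed

lemma mtrace_similar:
  fixes A B :: "'a::comm_ring_1 mat"
  assumes "similar_mat A B"
  shows "mtrace A = mtrace B"
proof -
  obtain n P Q where w: "{A, B, P, Q} \<subseteq> carrier_mat n n" "P * Q = 1\<^sub>m n" "Q * P = 1\<^sub>m n" "A = P * B * Q"
    using similar_matD[OF assms] by blast
  then have c: "A \<in> carrier_mat n n" "B \<in> carrier_mat n n" "P \<in> carrier_mat n n" "Q \<in> carrier_mat n n"
    by auto
  have "mtrace A = mtrace (Q * (P * B))"
    unfolding w(4) by (rule mtrace_mult_commute[of _ n n]) (use c in auto)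
  also have "Q * (P * B) = B"
    using c w by (simp flip: assoc_mult_mat[of Q n n P n B n])
  finally show ?thesis .
qed

lemma mtrace_add:
  "A \<in> carrier_mat n n \<Longrightarrow> B \<in> carrier_mat n n \<Longrightarrow> mtrace (A + B) = mtrace A + mtrace B"
  by (auto simp: mtrace_def sum.distrib)

lemma mtrace_minus:
  fixes A B :: "'a::ab_group_add mat"
  shows "A \<in> carrier_mat n n \<Longrightarrow> B \<in> carrier_mat n n \<Longrightarrow> mtrace (A - B) = mtrace A - mtrace B"
  by (auto simp: mtrace_def sum_subtractf)

lemma mtrace_smult:
  fixes A :: "'a::comm_ring_1 mat"
  shows "A \<in> carrier_mat n n \<Longrightarrow> mtrace (c \<cdot>\<^sub>m A) = c * mtrace A"
  by (auto simp: mtrace_def sum_distrib_left)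

lemma mtrace_one: "mtrace (1\<^sub>m n :: 'a::comm_semiring_1 mat) = of_nat n"
  by (simp add: mtrace_def)

abbreviation bform :: "real mat \<Rightarrow> real vec \<Rightarrow> real vec \<Rightarrow> real" where
  "bform A x y \<equiv> scalar_prod x (A *\<^sub>v y)"

lemma bform_sum:
  assumes "A \<in> carrier_mat n n" "x \<in> carrier_vec n" "y \<in> carrier_vec n"
  shows "bform A x y = (\<Sum>i<n. \<Sum>j<n. x $ i * A $$ (i, j) * y $ j)"
  using assms by (auto simp: scalar_prod_def atLeast0LessThan sum_distrib_left mult.assoc intro!: sum.cong)

lemma scalar_prod_sum:
  "x \<in> carrier_vec n \<Longrightarrow> y \<in> carrier_vec n \<Longrightarrow> scalar_prod x y = (\<Sum>i<n. x $ i * y $ i)"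
  by (auto simp: scalar_prod_def atLeast0LessThan)

lemma scalar_prod_self_nonneg: "0 \<le> scalar_prod x (x :: real vec)"
  by (auto simp: scalar_prod_def intro: sum_nonneg)

lemma bform_commute:
  assumes "A \<in> carrier_mat n n" "transpose_mat A = A" "x \<in> carrier_vec n" "y \<in> carrier_vec n"
  shows "bform A x y = bform A y x"
proof -
  have t: "A $$ (i, j) = A $$ (j, i)" if "i < n" "j < n" for i j
    using assms(1,2) that by (metis carrier_matD index_transpose_mat(1))
  show ?thesis
    unfolding bform_sum[OF assms(1,3,4)] bform_sum[OF assms(1,4,3)]
    by (subst sum.swap) (auto intro!: sum.cong simp: t)
qed

lemma bform_linear:
  assumes "A \<in> carrier_mat n n" "x \<in> carrier_vec n" "y \<in> carrier_vec n" "z \<in> carrier_vec n"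
  shows "bform A (x + c \<cdot>\<^sub>v y) z = bform A x z + c * bform A y z"
    "bform A z (x + c \<cdot>\<^sub>v y) = bform A z x + c * bform A z y"
proof -
  have [simp]: "A *\<^sub>v z \<in> carrier_vec n" "A *\<^sub>v y \<in> carrier_vec n" "A *\<^sub>v x \<in> carrier_vec n"
    using assms by auto
  show "bform A (x + c \<cdot>\<^sub>v y) z = bform A x z + c * bform A y z"
    using assms by (simp add: add_scalar_prod_distrib[of _ n])
  show "bform A z (x + c \<cdot>\<^sub>v y) = bform A z x + c * bform A z y"
    using assms by (simp add: mult_add_distrib_mat_vec[of _ n n] mult_mat_vec[of _ n n]
       scalar_prod_add_distrib[of _ n])
qed

text \<open>
  The leading coefficient may vanish, so that the usual test at the vertex has to be supplemented
  by the degenerate case; a negative leading coefficient is excluded by a large \<open>t\<close>.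
\<close>

lemma nonneg_quadratic_discriminant:
  fixes a b c :: real
  assumes "\<And>t. 0 \<le> a + 2 * b * t + c * t\<^sup>2"
  shows "b\<^sup>2 \<le> a * c"
proof -
  have "0 \<le> a" using assms[of 0] by simp
  show ?thesis
  proof (cases "c = 0")
    case True
    have "b = 0"
    proof (rule ccontr)
      assume "b \<noteq> 0"
      then have "2 * b * (- (a + 1) / (2 * b)) = - (a + 1)" by simp
      then show False using assms[of "- (a + 1) / (2 * b)"] True by simp
    qed
    with True show ?thesis by simp
  next
    case False
    have "c > 0"
    proof (rule ccontr)
      assume "\<not> c > 0"
      with False have c: "c < 0" by simp
      define t where "t = (\<bar>a\<bar> + 2 * \<bar>b\<bar> + 1) / (- c) + 1"
      have t: "t \<ge> 1" using c by (simp add: t_def divide_nonneg_neg divide_nonpos_neg)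
      have "- c * t \<ge> \<bar>a\<bar> + 2 * \<bar>b\<bar> + 1" using c by (simp add: t_def field_simps)
      then have "- c * t * t \<ge> (\<bar>a\<bar> + 2 * \<bar>b\<bar> + 1) * t" using t by (intro mult_right_mono) auto
      moreover have "\<bar>a\<bar> * t \<ge> \<bar>a\<bar>" "\<bar>b\<bar> * t \<ge> b * t"
        using t mult_left_mono[of 1 t "\<bar>a\<bar>"] by (auto intro: mult_right_mono)
      moreover have "(\<bar>a\<bar> + 2 * \<bar>b\<bar> + 1) * t = \<bar>a\<bar> * t + 2 * (\<bar>b\<bar> * t) + t"
        "c * t\<^sup>2 = c * t * t" by (simp_all add: algebra_simps power2_eq_square)
      ultimately show False using assms[of t] t by linarith
    qed
    then show ?thesis using assms[of "- b / c"] by (auto simp: field_simps power2_eq_square)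
  qed
qed

lemma bform_Cauchy_Schwarz:
  assumes A: "A \<in> carrier_mat n n" "transpose_mat A = A"
    and psd: "\<And>x. x \<in> carrier_vec n \<Longrightarrow> 0 \<le> bform A x x"
    and x: "x \<in> carrier_vec n" and y: "y \<in> carrier_vec n"
  shows "(bform A x y)\<^sup>2 \<le> bform A x x * bform A y y"
proof (rule nonneg_quadratic_discriminant)
  fix t
  have c: "x + t \<cdot>\<^sub>v y \<in> carrier_vec n" using x y by auto
  have "bform A (x + t \<cdot>\<^sub>v y) (x + t \<cdot>\<^sub>v y) = bform A x x + t * bform A x y + t * (bform A y x + t * bform A y y)"
    unfolding bform_linear(1)[OF A(1) x y c] bform_linear(2)[OF A(1) x y x] bform_linear(2)[OF A(1) x y y]
    by simp
  then show "0 \<le> bform A x x + 2 * bform A x y * t + bform A y y * t\<^sup>2"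
    using psd[OF c] bform_commute[OF A y x] by (simp add: algebra_simps power2_eq_square)
qed

lemma scalar_prod_Cauchy_Schwarz:
  fixes x y :: "real vec"
  assumes "x \<in> carrier_vec n" "y \<in> carrier_vec n"
  shows "(scalar_prod x y)\<^sup>2 \<le> scalar_prod x x * scalar_prod y y"
  using bform_Cauchy_Schwarz[of "1\<^sub>m n" n x y] assms
  by (auto simp: scalar_prod_self_nonneg)

text \<open>
  Upper and lower bounds on the spectrum of a symmetric matrix enter all estimates below through
  its quadratic form only, which also makes them stable under the restriction to blocks.
\<close>

definition form_between :: "nat \<Rightarrow> real \<Rightarrow> real \<Rightarrow> real mat \<Rightarrow> bool" where
  "form_between n lo hi A \<longleftrightarrow> A \<in> carrier_mat n n \<and> transpose_mat A = A \<and>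
     (\<forall>x\<in>carrier_vec n. lo * scalar_prod x x \<le> bform A x x \<and> bform A x x \<le> hi * scalar_prod x x)"

lemma scalar_prod_self_pos:
  fixes x :: "real vec"
  assumes "x \<in> carrier_vec n" "x \<noteq> 0\<^sub>v n"
  shows "0 < scalar_prod x x"
proof -
  obtain i where i: "i < n" "x $ i \<noteq> 0"
    using assms by (metis carrier_vecD eq_vecI index_zero_vec(1) index_zero_vec(2))
  have "0 < x $ i * x $ i" using i by (simp add: zero_less_mult_iff) argo
  also have "\<dots> \<le> (\<Sum>i<n. x $ i * x $ i)"
    using i by (intro member_le_sum) auto
  finally show ?thesis using assms by (simp add: scalar_prod_sum)
qed

lemma form_between_sym_pos_def:
  assumes "form_between n lo hi A" "0 < lo"
  shows "sym_pos_def A"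
  using assms scalar_prod_self_pos[of _ n]
  by (force simp: form_between_def sym_pos_def_def intro: less_le_trans[OF mult_pos_pos])

text \<open>
  Injectivity is the form in which invertibility is available for positive definite and for Gram
  matrices.
\<close>

lemma minv_correct:
  assumes A: "A \<in> carrier_mat n n" and ker: "\<And>x. x \<in> carrier_vec n \<Longrightarrow> A *\<^sub>v x = 0\<^sub>v n \<Longrightarrow> x = 0\<^sub>v n"
  shows "minv A \<in> carrier_mat n n" "A * minv A = 1\<^sub>m n" "minv A * A = 1\<^sub>m n"
proof -
  have "det A \<noteq> 0"
    using det_0_iff_vec_prod_zero[OF A] ker by blast
  then have "A \<in> Units (ring_mat TYPE(real) n ())"
    by (rule det_non_zero_imp_unit[OF A])
  then obtain B where B: "mat_inverse A = Some B"
    using mat_inverse(1)[OF A, where b = "()"] by (cases "mat_inverse A") auto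
  then have "minv A = B" by (simp add: minv_def)
  then show "minv A \<in> carrier_mat n n" "A * minv A = 1\<^sub>m n" "minv A * A = 1\<^sub>m n"
    using mat_inverse(2)[OF A B] by auto
qed

lemma sym_pos_def_minv:
  assumes A: "A \<in> carrier_mat n n" "sym_pos_def A"
  shows "minv A \<in> carrier_mat n n" "A * minv A = 1\<^sub>m n" "minv A * A = 1\<^sub>m n"
proof -
  have "x = 0\<^sub>v n" if "x \<in> carrier_vec n" "A *\<^sub>v x = 0\<^sub>v n" for x
    using A that by (auto simp: sym_pos_def_def)
  from minv_correct[OF A(1) this] show "minv A \<in> carrier_mat n n" "A * minv A = 1\<^sub>m n" "minv A * A = 1\<^sub>m n"
    by blast+
qed

lemma inverse_mat_unique:
  fixes A B C :: "real mat"
  assumes "A \<in> carrier_mat n n" "B \<in> carrier_mat n n" "C \<in> carrier_mat n n" "A * B = 1\<^sub>m n" "C * A = 1\<^sub>m n"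
  shows "B = C"
proof -
  have "B = (C * A) * B" using assms by simp
  also have "\<dots> = C * (A * B)" using assms(1-3) by (simp add: assoc_mult_mat[of _ n n _ n _ n])
  also have "\<dots> = C" using assms by simp
  finally show ?thesis .
qed

lemma transpose_minv:
  assumes A: "A \<in> carrier_mat n n" "sym_pos_def A"
  shows "transpose_mat (minv A) = minv A"
proof -
  note i = sym_pos_def_minv[OF A]
  have t: "transpose_mat A = A" using A by (simp add: sym_pos_def_def)
  have "transpose_mat (minv A) * A = 1\<^sub>m n"
    using transpose_mult[of A n n "minv A" n] i A t by simp
  then show ?thesis
    using inverse_mat_unique[of A n "minv A" "transpose_mat (minv A)"] i A by auto
qed

text \<open>
  Cauchy--Schwarz for the form of \<open>A\<close>, applied to \<open>x\<close> and \<open>Ax\<close>, replaces the spectral theorem.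
\<close>

lemma norm_mat_vec_le:
  assumes A: "form_between n 0 hi A" and x: "x \<in> carrier_vec n" and hi: "0 \<le> hi"
  shows "scalar_prod (A *\<^sub>v x) (A *\<^sub>v x) \<le> hi\<^sup>2 * scalar_prod x x"
proof -
  define y where "y = A *\<^sub>v x"
  have c: "A \<in> carrier_mat n n" "transpose_mat A = A" and y: "y \<in> carrier_vec n"
    using A x by (auto simp: form_between_def y_def)
  have nn: "0 \<le> bform A z z" "bform A z z \<le> hi * scalar_prod z z" if "z \<in> carrier_vec n" for z
    using A that by (auto simp: form_between_def)
  have n0: "0 \<le> scalar_prod y y" "0 \<le> scalar_prod x x" using scalar_prod_self_nonneg by blast+
  have "(scalar_prod y y)\<^sup>2 \<le> bform A y y * bform A x x"
    using bform_Cauchy_Schwarz[OF c nn(1) y x] by (simp add: y_def)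
  also have "\<dots> \<le> (hi * scalar_prod y y) * (hi * scalar_prod x x)"
    using nn[OF x] nn[OF y] n0 hi by (intro mult_mono) auto
  finally have "scalar_prod y y * scalar_prod y y \<le> scalar_prod y y * (hi\<^sup>2 * scalar_prod x x)"
    by (simp add: power2_eq_square algebra_simps)
  then have "scalar_prod y y \<le> hi\<^sup>2 * scalar_prod x x"
    using n0 by (cases "scalar_prod y y = 0") auto
  then show ?thesis by (simp add: y_def)
qed

text \<open>
  Both bounds are Cauchy--Schwarz inequalities for \<open>x\<close> and \<open>y = A\<^sup>-\<^sup>1 x\<close>: for the form of \<open>A\<close> in
  the lower bound and for the Euclidean product in the upper bound.
\<close>

lemma form_between_minv:
  assumes A: "form_between n lo hi A" and lo: "0 < lo" and hi: "0 < hi"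
  shows "form_between n (1 / hi) (1 / lo) (minv A)"
  unfolding form_between_def
proof (intro conjI ballI)
  have c: "A \<in> carrier_mat n n" "transpose_mat A = A" and s: "sym_pos_def A"
    using A form_between_sym_pos_def[OF A lo] by (auto simp: form_between_def)
  note i = sym_pos_def_minv[OF c(1) s]
  show "minv A \<in> carrier_mat n n" "transpose_mat (minv A) = minv A"
    using i transpose_minv[OF c(1) s] by auto
  fix x :: "real vec" assume x: "x \<in> carrier_vec n"
  define y where "y = minv A *\<^sub>v x"
  have y: "y \<in> carrier_vec n" using i x by (auto simp: y_def)
  have Ay: "A *\<^sub>v y = x" using i c x by (simp add: y_def flip: assoc_mult_mat_vec[of A n n "minv A" n x])
  have b: "bform (minv A) x x = bform A y y"
    using Ay y_def comm_scalar_prod[OF x y] by simp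
  have nn: "0 \<le> bform A z z" if "z \<in> carrier_vec n" for z
    using A that
    by (metis form_between_def lo mult_nonneg_nonneg order.trans order_less_imp_le scalar_prod_self_nonneg)
  have n0: "0 \<le> scalar_prod y y" "0 \<le> scalar_prod x x" using scalar_prod_self_nonneg by blast+
  have "(bform A x y)\<^sup>2 \<le> bform A x x * bform A y y"
    using bform_Cauchy_Schwarz[OF c nn x y] .
  also have "\<dots> \<le> (hi * scalar_prod x x) * bform A y y"
    using A x y nn by (intro mult_right_mono) (auto simp: form_between_def)
  finally have "scalar_prod x x * scalar_prod x x \<le> scalar_prod x x * (hi * bform A y y)"
    by (simp add: Ay power2_eq_square algebra_simps)
  then have "scalar_prod x x \<le> hi * bform A y y"
    using n0 nn[OF y] hi by (cases "scalar_prod x x = 0") auto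
  then show "1 / hi * scalar_prod x x \<le> bform (minv A) x x"
    using hi b by (simp add: field_simps)
  have q: "lo * scalar_prod y y \<le> bform A y y" using A y by (auto simp: form_between_def)
  have "(bform A y y)\<^sup>2 = (scalar_prod y x)\<^sup>2" using Ay by simp
  also have "\<dots> \<le> scalar_prod y y * scalar_prod x x" by (rule scalar_prod_Cauchy_Schwarz[OF y x])
  also have "\<dots> \<le> (bform A y y / lo) * scalar_prod x x"
    using q lo n0 by (intro mult_right_mono) (auto simp: field_simps)
  finally have "bform A y y * bform A y y \<le> bform A y y * (scalar_prod x x / lo)"
    by (simp add: power2_eq_square algebra_simps)
  then have "bform A y y \<le> scalar_prod x x / lo"
    using nn[OF y] n0 lo by (cases "bform A y y = 0") (auto simp del: times_divide_eq_right)
  then show "bform (minv A) x x \<le> 1 / lo * scalar_prod x x"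
    using b by simp
qed

text \<open>
  The eigenvalues \<open>\<alpha>\<^sub>i\<close> of \<open>Q\<^sup>-\<^sup>1 P\<close> are positive reals, since \<open>P v = d Q v\<close> makes \<open>d\<close> a quotient
  of values of two positive Hermitian forms; the claim is the sum of the inequalities
  \<open>ln \<alpha>\<^sub>i \<le> \<alpha>\<^sub>i - 1\<close>. They are the diagonal of a triangular complex matrix similar to \<open>Q\<^sup>-\<^sup>1 P\<close>,
  so that neither a square root of \<open>Q\<close> nor a diagonalisation is needed.
\<close>

lemma ln_det_le_mtrace:
  assumes P: "P \<in> carrier_mat n n" "sym_pos_def P" and Q: "Q \<in> carrier_mat n n" "sym_pos_def Q"
  shows "0 < det (minv Q * P)" "ln (det (minv Q * P)) \<le> mtrace (minv Q * P) - real n"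
proof -
  note i = sym_pos_def_minv[OF Q]
  have tP: "transpose_mat P = P" and tQ: "transpose_mat Q = Q" using P Q by (auto simp: sym_pos_def_def)
  define X where "X = minv Q * P"
  have X: "X \<in> carrier_mat n n" using i P by (auto simp: X_def)
  have QX: "Q * X = P" unfolding X_def using i P Q by (simp flip: assoc_mult_mat[of Q n n "minv Q" n P n])
  define Z where "Z = map_mat complex_of_real X"
  have Z: "Z \<in> carrier_mat n n" using X by (auto simp: Z_def)
  have eig: "\<exists>\<alpha>>0. d = complex_of_real \<alpha>" if "eigenvalue Z d" for d
  proof -
    obtain v where v: "v \<in> carrier_vec n" "v \<noteq> 0\<^sub>v n" "Z *\<^sub>v v = d \<cdot>\<^sub>v v"
      using \<open>eigenvalue Z d\<close> Z by (auto simp: eigenvalue_def eigenvector_def)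
    \<comment> \<open>the eigenvalue equation is split into real and imaginary parts, because only real quadratic forms are at hand\<close>
    define a b where "a = map_vec Re v" and "b = map_vec Im v"
    have ab: "a \<in> carrier_vec n" "b \<in> carrier_vec n" using v by (auto simp: a_def b_def)
    define f g where "f = Re d" and "g = Im d"
    have Xa: "X *\<^sub>v a = f \<cdot>\<^sub>v a + (- g) \<cdot>\<^sub>v b" and Xb: "X *\<^sub>v b = f \<cdot>\<^sub>v b + g \<cdot>\<^sub>v a"
    proof -
      have "(\<Sum>j<n. X $$ (i, j) * Re (v $ j)) = Re (d * v $ i) \<and>
            (\<Sum>j<n. X $$ (i, j) * Im (v $ j)) = Im (d * v $ i)" if "i < n" for i
      proof -
        have "(Z *\<^sub>v v) $ i = (\<Sum>j<n. complex_of_real (X $$ (i, j)) * v $ j)"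
          using that v(1) X unfolding Z_def by (simp add: scalar_prod_def atLeast0LessThan)
        moreover have "(Z *\<^sub>v v) $ i = d * v $ i" using v that by simp
        ultimately have e: "d * v $ i = (\<Sum>j<n. complex_of_real (X $$ (i, j)) * v $ j)" by simp
        show ?thesis unfolding e by simp
      qed
      then show "X *\<^sub>v a = f \<cdot>\<^sub>v a + (- g) \<cdot>\<^sub>v b" "X *\<^sub>v b = f \<cdot>\<^sub>v b + g \<cdot>\<^sub>v a"
        using X v ab by (auto intro!: eq_vecI simp: scalar_prod_def atLeast0LessThan a_def b_def f_def g_def)
    qed
    have Pa: "bform P w a = f * bform Q w a - g * bform Q w b"
      and Pb: "bform P w b = f * bform Q w b + g * bform Q w a" if w: "w \<in> carrier_vec n" for w
    proof -
      have "P *\<^sub>v a = Q *\<^sub>v (f \<cdot>\<^sub>v a + (- g) \<cdot>\<^sub>v b)" "P *\<^sub>v b = Q *\<^sub>v (f \<cdot>\<^sub>v b + g \<cdot>\<^sub>v a)"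
        unfolding Xa[symmetric] Xb[symmetric] using Q X ab
        by (simp_all add: QX flip: assoc_mult_mat_vec[of Q n n X n])
      then show "bform P w a = f * bform Q w a - g * bform Q w b"
         "bform P w b = f * bform Q w b + g * bform Q w a"
        using ab w Q by (simp_all add: mult_add_distrib_mat_vec[of _ n n] mult_mat_vec[of _ n n]
            scalar_prod_add_distrib[of _ n])
    qed
    have s: "bform P a b = bform P b a" "bform Q a b = bform Q b a"
      using bform_commute[OF P(1) tP ab] bform_commute[OF Q(1) tQ ab] .
    have pos: "0 \<le> bform R w w" "w \<noteq> 0\<^sub>v n \<Longrightarrow> 0 < bform R w w"
      if "w \<in> carrier_vec n" "R \<in> {P, Q}" for R w
    proof -
      show p: "0 < bform R w w" if "w \<noteq> 0\<^sub>v n"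
        using that \<open>w \<in> carrier_vec n\<close> \<open>R \<in> {P, Q}\<close> P Q by (auto simp: sym_pos_def_def)
      show "0 \<le> bform R w w"
        using that p P Q by (cases "w = 0\<^sub>v n") (auto simp: less_imp_le)
    qed
    have "a \<noteq> 0\<^sub>v n \<or> b \<noteq> 0\<^sub>v n"
    proof (rule ccontr)
      assume h: "\<not> (a \<noteq> 0\<^sub>v n \<or> b \<noteq> 0\<^sub>v n)"
      have "v $ i = 0" if "i < n" for i
      proof -
        have "a $ i = 0" "b $ i = 0" using h that by auto
        then show ?thesis using that v by (simp add: a_def b_def complex_eq_iff)
      qed
      then show False using v by (metis carrier_vecD eq_vecI index_zero_vec)
    qed
    then have pR: "0 < bform R a a + bform R b b" if "R \<in> {P, Q}" for R
      using pos[OF ab(1) that] pos[OF ab(2) that] by (auto intro: add_pos_nonneg add_nonneg_pos)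
    have "bform P b a - bform P a b = - g * (bform Q a a + bform Q b b)"
      using Pa[OF ab(2)] Pb[OF ab(1)] s by (simp add: algebra_simps)
    then have "g = 0" using s pR[of Q] by auto
    have "bform P a a + bform P b b = f * (bform Q a a + bform Q b b)"
      using Pa[OF ab(1)] Pb[OF ab(2)] s \<open>g = 0\<close> by (simp add: algebra_simps)
    then have "f > 0" using pR[of P] pR[of Q] by (metis insertI1 insertI2 zero_less_mult_pos2)
    then show ?thesis using \<open>g = 0\<close> by (intro exI[of _ f]) (auto simp: f_def g_def complex_eq_iff)
  qed
  \<comment> \<open>determinant and trace are read off from a Schur form\<close>
  obtain as where as: "char_poly Z = (\<Prod>a\<leftarrow>as. [:- a, 1:])"
    using char_poly_factorized[OF Z] by blast
  obtain T where T: "T \<in> carrier_mat n n" "upper_triangular T" "similar_mat Z T"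
    using schur_decomposition_exists[OF Z as] by blast
  have "\<exists>\<alpha>>0. T $$ (i, i) = complex_of_real \<alpha>" if "i < n" for i
  proof (rule eig)
    have "poly (char_poly T) (T $$ (i, i)) = 0"
      using that T by (auto simp: char_poly_upper_triangular[OF T(1,2)] poly_prod_list prod_list_zero_iff
         diag_mat_def)
    then show "eigenvalue Z (T $$ (i, i))"
      using char_poly_similar[OF T(3)] eigenvalue_root_char_poly[OF Z] by simp
  qed
  then obtain \<alpha> where \<alpha>: "\<And>i. i < n \<Longrightarrow> \<alpha> i > 0" "\<And>i. i < n \<Longrightarrow> T $$ (i, i) = complex_of_real (\<alpha> i)"
    by metis
  have "complex_of_real (det X) = det T"
    using det_similar[OF T(3)] by (simp add: Z_def of_real_hom.hom_det)
  also have "\<dots> = (\<Prod>i<n. T $$ (i, i))"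
    using T by (simp add: det_upper_triangular[OF T(2,1)] diag_mat_def atLeast0LessThan
      flip: prod.distinct_set_conv_list)
  also have "\<dots> = complex_of_real (\<Prod>i<n. \<alpha> i)" using \<alpha> by simp
  finally have det: "det X = (\<Prod>i<n. \<alpha> i)" by (metis of_real_eq_iff)
  have "complex_of_real (mtrace X) = mtrace T"
    using mtrace_similar[OF T(3)] X by (simp add: Z_def mtrace_def)
  also have "\<dots> = complex_of_real (\<Sum>i<n. \<alpha> i)" using \<alpha> T by (simp add: mtrace_def)
  finally have tr: "mtrace X = (\<Sum>i<n. \<alpha> i)" by (metis of_real_eq_iff)
  show "0 < det (minv Q * P)" using \<alpha> by (auto simp: det simp flip: X_def intro!: prod_pos)
  have "ln (det X) = (\<Sum>i<n. ln (\<alpha> i))" unfolding det by (intro ln_prod) (auto dest: \<alpha>(1))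
  also have "\<dots> \<le> (\<Sum>i<n. \<alpha> i - 1)" using \<alpha> by (intro sum_mono ln_le_minus_one) auto
  finally show "ln (det (minv Q * P)) \<le> mtrace (minv Q * P) - real n"
    by (simp add: tr sum_subtractf flip: X_def)
qed

section \<open>Log-determinants under deletion of off-block entries\<close>

definition frob2 :: "real mat \<Rightarrow> real" where
  "frob2 A = (\<Sum>i<dim_row A. \<Sum>j<dim_col A. (A $$ (i, j))\<^sup>2)"

lemma form_between_mono:
  assumes A: "form_between n lo hi A" and le: "lo' \<le> lo" "hi \<le> hi'"
  shows "form_between n lo' hi' A"
proof -
  have "lo' * scalar_prod x x \<le> lo * scalar_prod x x" "hi * scalar_prod x x \<le> hi' * scalar_prod x x"
    for x :: "real vec"
    using le scalar_prod_self_nonneg[of x] by (auto intro: mult_right_mono)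
  then show ?thesis using A unfolding form_between_def by (meson order.trans)
qed

lemma form_between_nonneg:
  assumes "form_between n lo hi A" "0 \<le> lo" "x \<in> carrier_vec n"
  shows "0 \<le> bform A x x"
  using form_between_mono[OF assms(1,2) order_refl] assms(3) by (auto simp: form_between_def)

lemma frob2_nonneg: "0 \<le> frob2 A"
  by (auto simp: frob2_def intro!: sum_nonneg)

lemma frob2_cols:
  assumes "A \<in> carrier_mat n m"
  shows "frob2 A = (\<Sum>j<m. scalar_prod (col A j) (col A j))"
  using assms unfolding frob2_def
  by (subst sum.swap) (auto simp: scalar_prod_def atLeast0LessThan power2_eq_square intro!: sum.cong)

lemma frob2_mult_le:
  assumes A: "form_between n 0 hi A" and hi: "0 \<le> hi" and E: "E \<in> carrier_mat n m"
  shows "frob2 (A * E) \<le> hi\<^sup>2 * frob2 E"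
proof -
  have c: "A \<in> carrier_mat n n" using A by (simp add: form_between_def)
  have "frob2 (A * E) = (\<Sum>j<m. scalar_prod (A *\<^sub>v col E j) (A *\<^sub>v col E j))"
    unfolding frob2_cols[OF mult_carrier_mat[OF c E]]
    by (intro sum.cong refl) (simp only: col_mult2[OF c E] lessThan_iff)
  also have "\<dots> \<le> (\<Sum>j<m. hi\<^sup>2 * scalar_prod (col E j) (col E j))"
    using E by (intro sum_mono norm_mat_vec_le[OF A _ hi]) auto
  finally show ?thesis using E by (simp add: frob2_cols[OF E] sum_distrib_left)
qed

lemma mtrace_mult_sq_le:
  assumes "A \<in> carrier_mat n n" "B \<in> carrier_mat n n"
  shows "(mtrace (A * B))\<^sup>2 \<le> frob2 A * frob2 B"
proof -
  have "mtrace (A * B) = (\<Sum>i<n. \<Sum>j<n. A $$ (i, j) * B $$ (j, i))"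
    using assms by (auto simp: mtrace_def scalar_prod_def atLeast0LessThan intro!: sum.cong)
  also have "\<dots> = (\<Sum>(i,j)\<in>{..<n} \<times> {..<n}. A $$ (i, j) * B $$ (j, i))"
    by (simp add: sum.cartesian_product)
  finally have "(mtrace (A * B))\<^sup>2 \<le>
      (\<Sum>(i,j)\<in>{..<n} \<times> {..<n}. (A $$ (i, j))\<^sup>2) * (\<Sum>(i,j)\<in>{..<n} \<times> {..<n}. (B $$ (j, i))\<^sup>2)"
    using Cauchy_Schwarz_ineq_sum[of "\<lambda>(i,j). A $$ (i, j)" "\<lambda>(i,j). B $$ (j, i)" "{..<n} \<times> {..<n}"]
    by (simp add: case_prod_unfold)
  also have "(\<Sum>(i,j)\<in>{..<n} \<times> {..<n}. (A $$ (i, j))\<^sup>2) = frob2 A"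
    using assms by (simp add: frob2_def sum.cartesian_product)
  also have "(\<Sum>(i,j)\<in>{..<n} \<times> {..<n}. (B $$ (j, i))\<^sup>2) = frob2 B"
    unfolding frob2_def using assms by (subst sum.swap) (simp add: sum.cartesian_product)
  finally show ?thesis .
qed

text \<open>
  The trace is the inner product of \<open>(AE)\<^sup>T\<close> and \<open>DE\<close>, so that Cauchy--Schwarz applies.
\<close>

lemma mtrace_mult4_le:
  assumes A: "form_between n 0 a A" "0 \<le> a" and D: "form_between n 0 d D" "0 \<le> d"
    and E: "E \<in> carrier_mat n n"
  shows "mtrace ((A * E) * (D * E)) \<le> a * d * frob2 E"
proof -
  have c: "A \<in> carrier_mat n n" "D \<in> carrier_mat n n" using A D by (simp_all add: form_between_def)
  have "(mtrace ((A * E) * (D * E)))\<^sup>2 \<le> frob2 (A * E) * frob2 (D * E)"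
    using c E by (intro mtrace_mult_sq_le) auto
  also have "\<dots> \<le> (a\<^sup>2 * frob2 E) * (d\<^sup>2 * frob2 E)"
    using A D E by (intro mult_mono frob2_mult_le) (auto simp: frob2_nonneg)
  also have "\<dots> = (a * d * frob2 E)\<^sup>2" by (simp add: power2_eq_square)
  finally show ?thesis
    using A D frob2_nonneg by (meson mult_nonneg_nonneg power2_le_imp_le)
qed

lemma same_block_commute: "same_block B i j \<longleftrightarrow> same_block B j i"
  by (auto simp: same_block_def)

lemma same_block_trans:
  "partition_on A B \<Longrightarrow> same_block B i j \<Longrightarrow> same_block B j k \<Longrightarrow> same_block B i k"
  unfolding same_block_def partition_on_def disjoint_def by blast

lemma same_block_refl: "partition_on A B \<Longrightarrow> i \<in> A \<Longrightarrow> same_block B i i"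
  by (auto simp: same_block_def partition_on_def)

lemma block_restrict_carrier [simp]: "A \<in> carrier_mat n m \<Longrightarrow> block_restrict B A \<in> carrier_mat n m"
  by (auto simp: block_restrict_def)

lemma dim_block_restrict [simp]:
  "dim_row (block_restrict B A) = dim_row A" "dim_col (block_restrict B A) = dim_col A"
  by (auto simp: block_restrict_def)

lemma block_restrict_index [simp]:
  "A \<in> carrier_mat n m \<Longrightarrow> i < n \<Longrightarrow> j < m \<Longrightarrow>
    block_restrict B A $$ (i, j) = (if same_block B i j then A $$ (i, j) else 0)"
  by (auto simp: block_restrict_def)

lemma block_restrict_eq_iff:
  assumes "A \<in> carrier_mat n m"
  shows "A = block_restrict B A \<longleftrightarrow> (\<forall>i<n. \<forall>j<m. A $$ (i, j) \<noteq> 0 \<longrightarrow> same_block B i j)"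
proof
  assume e: "A = block_restrict B A"
  show "\<forall>i<n. \<forall>j<m. A $$ (i, j) \<noteq> 0 \<longrightarrow> same_block B i j"
    using block_restrict_index[OF assms] by (subst (asm) e) (metis e)
next
  assume "\<forall>i<n. \<forall>j<m. A $$ (i, j) \<noteq> 0 \<longrightarrow> same_block B i j"
  then show "A = block_restrict B A"
    using assms by (intro eq_matI) (auto simp: block_restrict_def)
qed

lemma block_restrict_nonzero:
  assumes "A \<in> carrier_mat n m" "A = block_restrict B A" "i < n" "j < m" "A $$ (i, j) \<noteq> 0"
  shows "same_block B i j"
  using iffD1[OF block_restrict_eq_iff[OF assms(1)] assms(2)] assms(3-5) by (simp del: not_None_eq)

lemma block_restrict_idem [simp]: "block_restrict B (block_restrict B A) = block_restrict B A"
  by (rule eq_matI) (auto simp: block_restrict_def)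

text \<open>
  Writing the mask of a partition as a sum over blocks of products of indicators turns the
  quadratic form of a masked matrix into a sum of quadratic forms of the original one.
\<close>

lemma indicator_same_block:
  assumes "partition_on {..<n} B" "i < n" "j < n"
  shows "(\<Sum>G\<in>B. of_bool (i \<in> G) * of_bool (j \<in> G)) = (of_bool (same_block B i j) :: real)"
proof -
  have fin: "finite B" using assms finite_elements by blast
  obtain G where G: "G \<in> B" "i \<in> G" using assms by (auto simp: partition_on_def)
  have u: "H = G" if "H \<in> B" "i \<in> H" for H
    using assms(1) G that by (auto simp: partition_on_def disjoint_def)
  have "(\<Sum>H\<in>B. of_bool (i \<in> H) * of_bool (j \<in> H)) = (\<Sum>H\<in>B. if H = G then of_bool (j \<in> G) else (0::real))"
  proof (intro sum.cong refl)
    fix H assume "H \<in> B"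
    then have "i \<in> H \<longleftrightarrow> H = G" using u G by blast
    then show "of_bool (i \<in> H) * of_bool (j \<in> H) = (if H = G then of_bool (j \<in> G) else (0::real))"
      by simp
  qed
  also have "\<dots> = of_bool (j \<in> G)" using fin G by simp
  also have "j \<in> G \<longleftrightarrow> same_block B i j" using u G unfolding same_block_def by blast
  finally show ?thesis .
qed

text \<open>
  The form of the restricted matrix at \<open>x\<close> is the sum over the blocks of the form of \<open>A\<close> at the
  part of \<open>x\<close> on that block, and the squared norms of these parts add up to that of \<open>x\<close>.
\<close>

lemma form_between_block_restrict:
  assumes A: "form_between n lo hi A" and B: "partition_on {..<n} B"
  shows "form_between n lo hi (block_restrict B A)"
  unfolding form_between_def
proof (intro conjI ballI)
  have c: "A \<in> carrier_mat n n" and t: "transpose_mat A = A" using A by (auto simp: form_between_def)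
  show c': "block_restrict B A \<in> carrier_mat n n" using c by simp
  have "A $$ (i, j) = A $$ (j, i)" if "i < n" "j < n" for i j
    using c t that by (metis carrier_matD index_transpose_mat(1))
  then show "transpose_mat (block_restrict B A) = block_restrict B A"
    using c by (intro eq_matI) (auto simp: block_restrict_def same_block_commute)
  fix x :: "real vec" assume x: "x \<in> carrier_vec n"
  define r where "r G = vec n (\<lambda>i. of_bool (i \<in> G) * x $ i)" for G
  have r: "r G \<in> carrier_vec n" for G by (simp add: r_def)
  have "bform (block_restrict B A) x x
      = (\<Sum>i<n. \<Sum>j<n. (\<Sum>G\<in>B. of_bool (i \<in> G) * of_bool (j \<in> G)) * (x $ i * A $$ (i, j) * x $ j))"
    unfolding bform_sum[OF c' x x] using c
    by (intro sum.cong) (auto simp: indicator_same_block[OF B])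
  also have "\<dots> = (\<Sum>i<n. \<Sum>G\<in>B. \<Sum>j<n. of_bool (i \<in> G) * of_bool (j \<in> G) * (x $ i * A $$ (i, j) * x $ j))"
    by (simp add: sum_distrib_right sum.swap[of _ "{..<n}" B])
  also have "\<dots> = (\<Sum>G\<in>B. bform A (r G) (r G))"
    unfolding bform_sum[OF c r r]
    by (subst sum.swap) (auto simp: r_def intro!: sum.cong)
  finally have q: "bform (block_restrict B A) x x = (\<Sum>G\<in>B. bform A (r G) (r G))" .
  have "scalar_prod x x = (\<Sum>i<n. (\<Sum>G\<in>B. of_bool (i \<in> G) * of_bool (i \<in> G)) * (x $ i * x $ i))"
    unfolding scalar_prod_sum[OF x x]
    by (intro sum.cong) (auto simp: indicator_same_block[OF B] same_block_refl[OF B])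
  also have "\<dots> = (\<Sum>G\<in>B. scalar_prod (r G) (r G))"
    unfolding scalar_prod_sum[OF r r] sum_distrib_right
    by (subst sum.swap) (auto simp: r_def intro!: sum.cong)
  finally have s: "scalar_prod x x = (\<Sum>G\<in>B. scalar_prod (r G) (r G))" .
  show "lo * scalar_prod x x \<le> bform (block_restrict B A) x x"
    unfolding q s sum_distrib_left using A r by (intro sum_mono) (auto simp: form_between_def)
  show "bform (block_restrict B A) x x \<le> hi * scalar_prod x x"
    unfolding q s sum_distrib_left using A r by (intro sum_mono) (auto simp: form_between_def)
qed

lemma block_restrict_mult:
  assumes B: "partition_on {..<n} B" and A: "A \<in> carrier_mat n n" "A = block_restrict B A"
    and X: "X \<in> carrier_mat n n"
  shows "A * block_restrict B X = block_restrict B (A * X)"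
proof (rule eq_matI)
  have z: "same_block B i k" if "i < n" "k < n" "A $$ (i, k) \<noteq> 0" for i k
    by (rule block_restrict_nonzero[OF A that])
  fix i j assume "i < dim_row (block_restrict B (A * X))" "j < dim_col (block_restrict B (A * X))"
  then have ij: "i < n" "j < n" using A(1) X by auto
  have "(A * block_restrict B X) $$ (i, j) = (\<Sum>k<n. A $$ (i, k) * block_restrict B X $$ (k, j))"
    using A(1) X ij by (simp add: scalar_prod_def atLeast0LessThan del: block_restrict_index)
  also have "\<dots> = (\<Sum>k<n. if same_block B i j then A $$ (i, k) * X $$ (k, j) else 0)"
  proof (rule sum.cong[OF refl])
    fix k assume "k \<in> {..<n}"
    then show "A $$ (i, k) * block_restrict B X $$ (k, j) = (if same_block B i j then A $$ (i, k) * X $$ (k, j) else 0)"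
    proof (cases "A $$ (i, k) = 0")
      case False
      then have "same_block B i k" using z ij \<open>k \<in> {..<n}\<close> by blast
      then have "same_block B k j \<longleftrightarrow> same_block B i j"
        using same_block_trans[OF B] same_block_commute by blast
      then show ?thesis using ij \<open>k \<in> {..<n}\<close> X by simp
    qed simp
  qed
  also have "\<dots> = block_restrict B (A * X) $$ (i, j)"
    using A(1) X ij by (subst block_restrict_index[of _ n n]) (auto simp: scalar_prod_def atLeast0LessThan)
  finally show "(A * block_restrict B X) $$ (i, j) = block_restrict B (A * X) $$ (i, j)" .
qed (use A(1) X in \<open>auto simp: block_restrict_def\<close>)

text \<open>
  The restriction of the inverse to the blocks is a right inverse as well.
\<close>

lemma minv_block_restrict:
  assumes B: "partition_on {..<n} B" and A: "A \<in> carrier_mat n n" "sym_pos_def A" "A = block_restrict B A"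
  shows "minv A = block_restrict B (minv A)"
proof -
  note i = sym_pos_def_minv[OF A(1,2)]
  have "A * block_restrict B (minv A) = block_restrict B (1\<^sub>m n)"
    using block_restrict_mult[OF B A(1,3) i(1)] i by simp
  also have "\<dots> = 1\<^sub>m n"
    by (rule eq_matI) (auto simp: block_restrict_def same_block_refl[OF B])
  finally show ?thesis
    using inverse_mat_unique[OF A(1) _ i(1) _ i(3), of "block_restrict B (minv A)"] i by auto
qed

lemma mtrace_mult_off_block:
  assumes X: "X \<in> carrier_mat n n" "X = block_restrict B X" and E: "E \<in> carrier_mat n n"
    and off: "\<And>i j. i < n \<Longrightarrow> j < n \<Longrightarrow> same_block B i j \<Longrightarrow> E $$ (i, j) = 0"
  shows "mtrace (X * E) = 0"
proof -
  have "mtrace (X * E) = (\<Sum>i<n. \<Sum>j<n. X $$ (i, j) * E $$ (j, i))"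
    using X(1) E by (auto simp: mtrace_def scalar_prod_def atLeast0LessThan intro!: sum.cong)
  also have "\<dots> = 0"
  proof (intro sum.neutral ballI)
    fix i j assume ij: "i \<in> {..<n}" "j \<in> {..<n}"
    have "same_block B j i" if "X $$ (i, j) \<noteq> 0"
      using block_restrict_nonzero[OF X _ _ that] ij same_block_commute[of B i j] by simp
    then show "X $$ (i, j) * E $$ (j, i) = 0" using off[of j i] ij by auto
  qed
  finally show ?thesis .
qed

lemma sym_pos_def_one: "sym_pos_def (1\<^sub>m n)"
  using scalar_prod_self_pos by (auto simp: sym_pos_def_def)

lemma minv_one: "minv (1\<^sub>m n) = 1\<^sub>m n"
  using sym_pos_def_minv[OF one_carrier_mat sym_pos_def_one, of n] by simp

lemma det_sym_pos_def: "A \<in> carrier_mat n n \<Longrightarrow> sym_pos_def A \<Longrightarrow> 0 < det A"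
  using ln_det_le_mtrace(1)[of A n "1\<^sub>m n"] sym_pos_def_one minv_one by simp

lemma det_minv: "A \<in> carrier_mat n n \<Longrightarrow> sym_pos_def A \<Longrightarrow> det (minv A) = 1 / det A"
  using sym_pos_def_minv[of A n] det_mult[of A n "minv A"] det_sym_pos_def[of A n]
  by (auto simp: field_simps)

lemma ln_det_diff_le:
  assumes P: "P \<in> carrier_mat n n" "sym_pos_def P" and Q: "Q \<in> carrier_mat n n" "sym_pos_def Q"
  shows "ln (det P) - ln (det Q) \<le> mtrace (minv Q * P) - real n"
proof -
  have "det (minv Q * P) = det P / det Q"
    using det_mult[of "minv Q" n P] det_minv[OF Q] P sym_pos_def_minv[OF Q] by simp
  then show ?thesis
    using ln_det_le_mtrace[OF P Q] det_sym_pos_def[OF P] det_sym_pos_def[OF Q] by (simp add: ln_div)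
qed

text \<open>
  With \<open>D\<close> the restricted matrix and \<open>E = A - D\<close>, the trace inequality bounds the left-hand side
  by \<open>tr(A\<^sup>-\<^sup>1 D) - n = - tr(A\<^sup>-\<^sup>1 E)\<close>. The first-order part \<open>tr(D\<^sup>-\<^sup>1 E)\<close> vanishes because
  \<open>D\<^sup>-\<^sup>1\<close> has the block structure and \<open>E\<close> has no entries in the blocks; what remains is
  \<open>tr(A\<^sup>-\<^sup>1 E D\<^sup>-\<^sup>1 E)\<close>.
\<close>

lemma ln_det_off_block_loss:
  assumes A: "form_between n c hi A" and c: "0 < c" "0 < hi" and M: "partition_on {..<n} M"
  shows "ln (det (block_restrict M A)) - ln (det A) \<le> frob2 (A - block_restrict M A) / c\<^sup>2"
proof -
  define D where "D = block_restrict M A"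
  define E where "E = A - D"
  have D: "form_between n c hi D" unfolding D_def by (rule form_between_block_restrict[OF A M])
  have cA: "A \<in> carrier_mat n n" "sym_pos_def A" and cD: "D \<in> carrier_mat n n" "sym_pos_def D"
    using A D form_between_sym_pos_def c by (auto simp: form_between_def)
  have cE: "E \<in> carrier_mat n n" using cA cD by (auto simp: E_def intro: minus_carrier_mat)
  note iA = sym_pos_def_minv[OF cA] and iD = sym_pos_def_minv[OF cD]
  let ?A = "minv A" and ?D = "minv D"
  have fA: "form_between n 0 (1 / c) ?A" and fD: "form_between n 0 (1 / c) ?D"
    using form_between_mono[OF form_between_minv[OF A c]] form_between_mono[OF form_between_minv[OF D c]] c
    by auto
  have AE: "?A * E = 1\<^sub>m n - ?A * D"
    unfolding E_def using iA cA cD by (simp add: mult_minus_distrib_mat[of _ n n])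
  have "?A * D * ?D = ?A"
    using iA(1) iD cD(1) by (simp add: assoc_mult_mat[of ?A n n D n ?D n])
  moreover have "(1\<^sub>m n - ?A * D) * ?D = 1\<^sub>m n * ?D - ?A * D * ?D"
    by (rule minus_mult_distrib_mat[of _ n n]) (use iA(1) iD(1) cD(1) in auto)
  ultimately have AED: "?A * E * ?D = ?D - ?A"
    unfolding AE using iD(1) by simp
  have "(?A * E) * (?D * E) = (?A * E) * ?D * E"
    by (rule assoc_mult_mat[symmetric, of _ n n _ n _ n]) (use iA(1) iD(1) cE in auto)
  also have "\<dots> = ?D * E - ?A * E"
    unfolding AED by (rule minus_mult_distrib_mat[of _ n n]) (use iA(1) iD(1) cE in auto)
  finally have "(?A * E) * (?D * E) = ?D * E - ?A * E" .
  then have "mtrace ((?A * E) * (?D * E)) = mtrace (?D * E) - mtrace (?A * E)"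
    using iA iD cE by (simp add: mtrace_minus[of _ n])
  also have "mtrace (?D * E) = 0"
  proof (rule mtrace_mult_off_block[OF iD(1) _ cE])
    show "?D = block_restrict M ?D"
      using cD by (intro minv_block_restrict[OF M]) (auto simp: D_def)
  qed (use cA in \<open>auto simp: E_def D_def block_restrict_def\<close>)
  also have "mtrace (?A * E) = real n - mtrace (?A * D)"
    unfolding AE using iA cD by (simp add: mtrace_minus[of _ n] mtrace_one)
  finally have "mtrace (?A * D) - real n = mtrace ((?A * E) * (?D * E))" by simp
  also have "\<dots> \<le> (1 / c) * (1 / c) * frob2 E"
    using c by (intro mtrace_mult4_le[OF fA _ fD _ cE]) auto
  finally show ?thesis
    using ln_det_diff_le[OF cD cA] by (simp add: E_def D_def power2_eq_square)
qed

lemma minv_minv: "A \<in> carrier_mat n n \<Longrightarrow> sym_pos_def A \<Longrightarrow> sym_pos_def (minv A) \<Longrightarrow> minv (minv A) = A"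
  using sym_pos_def_minv[of A n] sym_pos_def_minv[of "minv A" n]
    inverse_mat_unique[of "minv A" n "minv (minv A)" A] by auto

text \<open>
  A lower bound cannot come from the trace inequality between \<open>A\<close> and \<open>D\<close> alone, where the
  first-order term vanishes and the inequality is just \<open>0 \<le> ln det D - ln det A\<close>. It is applied
  twice, through the third matrix \<open>W\<^sup>-\<^sup>1\<close> with \<open>W = D\<^sup>-\<^sup>1 - s E\<close>: passing from \<open>A\<close> to \<open>W\<^sup>-\<^sup>1\<close>
  gains \<open>s |E|\<^sup>2\<close>, as \<open>tr(W A) = n - s |E|\<^sup>2\<close>, and passing from \<open>W\<^sup>-\<^sup>1\<close> to \<open>D\<close> costs a term of
  order \<open>s\<^sup>2 |E|\<^sup>2\<close> only.
\<close>

lemma ln_det_off_block_gain: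
  assumes A: "form_between n c K A" and c: "0 < c" "0 < K" and M: "partition_on {..<n} M"
  shows "frob2 (A - block_restrict M A) / (8 * K\<^sup>2) \<le> ln (det (block_restrict M A)) - ln (det A)"
proof -
  define D where "D = block_restrict M A"
  define E where "E = A - D"
  \<comment> \<open>small enough for \<open>W\<close> to stay above \<open>1/(2K)\<close> and for the second-order cost to be half of the gain\<close>
  define s where "s = 1 / (4 * K\<^sup>2)"
  define W where "W = minv D - s \<cdot>\<^sub>m E"
  have s: "s > 0" using c by (simp add: s_def)
  have D: "form_between n c K D" unfolding D_def by (rule form_between_block_restrict[OF A M])
  have cA: "A \<in> carrier_mat n n" "sym_pos_def A" and cD: "D \<in> carrier_mat n n" "sym_pos_def D"
    using A D form_between_sym_pos_def c by (auto simp: form_between_def)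
  have cE: "E \<in> carrier_mat n n" using cA cD by (auto simp: E_def intro: minus_carrier_mat)
  note iD = sym_pos_def_minv[OF cD]
  let ?D = "minv D" and ?W = "minv W"
  have fD: "form_between n (1 / K) (1 / c) ?D" using form_between_minv[OF D c] .
  have cW: "W \<in> carrier_mat n n" using iD(1) cE by (auto simp: W_def intro!: minus_carrier_mat)
  have fW: "form_between n (1 / (2 * K)) (1 / c + s * K) W"
    unfolding form_between_def
  proof (intro conjI ballI)
    show "W \<in> carrier_mat n n" by (rule cW)
    have tE: "transpose_mat E = E"
      using A D cA cD by (simp add: E_def form_between_def transpose_minus[of _ n n])
    show "transpose_mat W = W"
    proof -
      have "transpose_mat (s \<cdot>\<^sub>m E) = s \<cdot>\<^sub>m transpose_mat E" by (rule eq_matI) auto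
      then show ?thesis
        unfolding W_def using fD cE iD(1) tE transpose_minus[of ?D n n "s \<cdot>\<^sub>m E"]
        by (simp add: form_between_def)
    qed
    fix x :: "real vec" assume x: "x \<in> carrier_vec n"
    have "bform E x x = bform A x x - bform D x x"
      unfolding E_def using x cA cD
      by (simp add: minus_mult_distrib_mat_vec[of _ n n] scalar_prod_minus_distrib[of _ n])
    moreover have "0 \<le> bform A x x" "bform A x x \<le> K * scalar_prod x x"
        "0 \<le> bform D x x" "bform D x x \<le> K * scalar_prod x x"
      using A D x c form_between_nonneg[OF A _ x] form_between_nonneg[OF D _ x]
      by (auto simp: form_between_def)
    ultimately have bE: "- (K * scalar_prod x x) \<le> bform E x x" "bform E x x \<le> K * scalar_prod x x"
      by auto
    have W: "bform W x x = bform ?D x x - s * bform E x x"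
    proof -
      have "bform (s \<cdot>\<^sub>m E) x x = s * bform E x x"
        using x cE by (simp add: bform_sum[of _ n] sum_distrib_left algebra_simps)
      then show ?thesis
        unfolding W_def using x cE iD(1)
          scalar_prod_minus_distrib[of x n "?D *\<^sub>v x" "s \<cdot>\<^sub>m E *\<^sub>v x"]
          mult_mat_vec_carrier[OF smult_carrier_mat[OF cE] x]
        by (simp add: minus_mult_distrib_mat_vec[of _ n n])
    qed
    have "s * bform E x x \<le> s * (K * scalar_prod x x)" "s * (- (K * scalar_prod x x)) \<le> s * bform E x x"
      using mult_left_mono[OF bE(2), of s] mult_left_mono[OF bE(1), of s] s by auto
    moreover have "s * (K * scalar_prod x x) = (1 / (4 * K)) * scalar_prod x x"
      using c by (simp add: s_def power2_eq_square)
    moreover have "1 / K * scalar_prod x x \<le> bform ?D x x" "bform ?D x x \<le> 1 / c * scalar_prod x x"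
      using fD x by (auto simp: form_between_def)
    moreover have "0 \<le> 1 / (4 * K) * scalar_prod x x"
      using c scalar_prod_self_nonneg by simp
    moreover have "1 / K * scalar_prod x x = 4 * (1 / (4 * K) * scalar_prod x x)"
        "1 / (2 * K) * scalar_prod x x = 2 * (1 / (4 * K) * scalar_prod x x)"
      using c by (simp_all add: field_simps)
    ultimately show "1 / (2 * K) * scalar_prod x x \<le> bform W x x"
      "bform W x x \<le> (1 / c + s * K) * scalar_prod x x"
      unfolding W by (auto simp: algebra_simps)
  qed
  have pos: "0 < 1 / (2 * K)" "0 < 1 / c + s * K" using c s by (auto intro: add_pos_pos)
  have sW: "sym_pos_def W" using form_between_sym_pos_def[OF fW pos(1)] .
  note iW = sym_pos_def_minv[OF cW sW]
  have fiW: "form_between n (1 / (1 / c + s * K)) (2 * K) ?W"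
    using form_between_minv[OF fW pos] by simp
  have siW: "sym_pos_def ?W" by (rule form_between_sym_pos_def[OF fiW]) (use pos in simp)
  have siD: "sym_pos_def ?D" by (rule form_between_sym_pos_def[OF fD]) (use c in simp)
  have DM: "D = block_restrict M D" by (simp add: D_def)
  have off: "E $$ (i, j) = 0" if "i < n" "j < n" "same_block M i j" for i j
    using that cA by (simp add: E_def D_def)
  have tr0: "mtrace (?D * E) = 0" "mtrace (D * E) = 0"
    using mtrace_mult_off_block[OF iD(1) minv_block_restrict[OF M cD DM] cE off]
      mtrace_mult_off_block[OF cD(1) DM cE off] by auto
  have AE: "A = D + E" using cA cD by (auto simp: E_def intro!: eq_matI)
  have EE: "mtrace (E * E) = frob2 E"
  proof -
    have "E $$ (i, j) = E $$ (j, i)" if "i < n" "j < n" for i j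
      using A D cA cD that unfolding form_between_def E_def
      by (metis carrier_matD index_minus_mat(1) index_transpose_mat(1))
    then show ?thesis
      using cE by (auto simp: mtrace_def frob2_def scalar_prod_def atLeast0LessThan power2_eq_square intro!: sum.cong)
  qed
  have "W * A = ?D * A - s \<cdot>\<^sub>m (E * A)"
    unfolding W_def using iD cE cA by (simp add: minus_mult_distrib_mat[of _ n n] mult_smult_assoc_mat[of _ n n])
  also have "?D * A = 1\<^sub>m n + ?D * E"
    unfolding AE using iD cD cE by (simp add: mult_add_distrib_mat[of _ n n])
  also have "E * A = E * D + E * E"
    unfolding AE using cD cE by (simp add: mult_add_distrib_mat[of _ n n])
  finally have "mtrace (W * A) = real n + mtrace (?D * E) - s * (mtrace (E * D) + mtrace (E * E))"
    using iD cE cD by (simp add: mtrace_minus[of _ n] mtrace_add[of _ n] mtrace_smult[of _ n] mtrace_one)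
  then have WA: "mtrace (W * A) = real n - s * frob2 E"
    using tr0 EE mtrace_mult_commute[OF cE cD(1)] by simp
  have "ln (det A) - ln (det ?W) \<le> mtrace (minv ?W * A) - real n"
    by (rule ln_det_diff_le[OF cA iW(1) siW])
  then have 1: "ln (det A) + ln (det W) \<le> - s * frob2 E"
    using WA minv_minv[OF cW sW siW] det_minv[OF cW sW] det_sym_pos_def[OF cW sW] by (simp add: ln_div)
  \<comment> \<open>\<open>W\<^sup>-\<^sup>1\<close> is expanded around \<open>D\<close> to exhibit the vanishing first-order term of \<open>tr(W\<^sup>-\<^sup>1 E)\<close>\<close>
  have Dd: "?D = W + s \<cdot>\<^sub>m E" using iD cE by (auto simp: W_def intro!: eq_matI)
  have WD: "?W * ?D = 1\<^sub>m n + s \<cdot>\<^sub>m (?W * E)"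
    using mult_add_distrib_mat[of ?W n n W n "s \<cdot>\<^sub>m E"] mult_smult_distrib[of ?W n n E n s] iW cE cW
    by (simp flip: Dd)
  have "?W = ?W * ?D * D" using iW(1) iD cD(1) by (simp add: assoc_mult_mat[of ?W n n ?D n D n])
  also have "\<dots> = 1\<^sub>m n * D + s \<cdot>\<^sub>m (?W * E) * D"
    unfolding WD by (rule add_mult_distrib_mat[of _ n n]) (use iW(1) cE cD(1) in auto)
  also have "\<dots> = D + s \<cdot>\<^sub>m (?W * E * D)"
    using mult_smult_assoc_mat[of "?W * E" n n D n s] iW(1) cE cD(1) by simp
  finally have W_expand: "?W = D + s \<cdot>\<^sub>m (?W * E * D)" .
  have cWE: "?W * E \<in> carrier_mat n n" "?W * E * D \<in> carrier_mat n n"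
    using iW(1) cE cD(1) by auto
  have "?W * E = (D + s \<cdot>\<^sub>m (?W * E * D)) * E" by (rule arg_cong[OF W_expand])
  also have "\<dots> = D * E + s \<cdot>\<^sub>m (?W * E * D) * E"
    by (rule add_mult_distrib_mat[of _ n n]) (use cWE cE cD(1) in auto)
  also have "s \<cdot>\<^sub>m (?W * E * D) * E = s \<cdot>\<^sub>m ((?W * E * D) * E)"
    by (rule mult_smult_assoc_mat[OF cWE(2) cE])
  also have "(?W * E * D) * E = (?W * E) * (D * E)"
    by (rule assoc_mult_mat[OF cWE(1) cD(1) cE])
  finally have WE: "?W * E = D * E + s \<cdot>\<^sub>m ((?W * E) * (D * E))" .
  have cp: "D * E \<in> carrier_mat n n" "(?W * E) * (D * E) \<in> carrier_mat n n"
    using cWE cE cD(1) by auto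
  have "mtrace (?W * E) = mtrace (D * E) + mtrace (s \<cdot>\<^sub>m ((?W * E) * (D * E)))"
    by (subst WE, rule mtrace_add) (use cp in auto)
  also have "\<dots> = s * mtrace ((?W * E) * (D * E))"
    using mtrace_smult[OF cp(2), of s] tr0 by simp
  also have "\<dots> \<le> s * (2 * K * K * frob2 E)"
    using c s pos form_between_mono[OF fiW, of 0 "2 * K"] form_between_mono[OF D, of 0 K]
    by (intro mult_left_mono mtrace_mult4_le[OF _ _ _ _ cE]) auto
  finally have WE_le: "mtrace (?W * E) \<le> s * (2 * K * K * frob2 E)" .
  have "mtrace (?W * ?D) - real n = s * mtrace (?W * E)"
    unfolding WD using mtrace_add[OF one_carrier_mat, of "s \<cdot>\<^sub>m (?W * E)"] cWE(1)
    by (simp add: mtrace_smult[OF cWE(1)] mtrace_one)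
  also have "\<dots> \<le> s * (s * (2 * K * K * frob2 E))"
    using s by (intro mult_left_mono WE_le) auto
  finally have "mtrace (?W * ?D) - real n \<le> s * (s * (2 * K * K * frob2 E))"
    .
  also have "s * (s * (2 * K * K * frob2 E)) = s * frob2 E / 2"
    using c by (simp add: s_def power2_eq_square)
  finally have 2: "- ln (det D) - ln (det W) \<le> s * frob2 E / 2"
    using ln_det_diff_le[OF iD(1) siD cW sW] det_minv[OF cD] det_sym_pos_def[OF cD] by (simp add: ln_div)
  have "s * frob2 E / 2 \<le> ln (det D) - ln (det A)" using 1 2 by (simp add: algebra_simps)
  then show ?thesis by (simp add: s_def D_def E_def)
qed

section \<open>Partitions and the penalised likelihood\<close>

lemma sum_swap_inner:
  "(\<Sum>i\<in>I. \<Sum>j\<in>J. \<Sum>k\<in>K. f i j k) = (\<Sum>k\<in>K. \<Sum>i\<in>I. \<Sum>j\<in>J. f i j k)"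
proof -
  have "(\<Sum>i\<in>I. \<Sum>j\<in>J. \<Sum>k\<in>K. f i j k) = (\<Sum>i\<in>I. \<Sum>k\<in>K. \<Sum>j\<in>J. f i j k)"
    by (intro sum.cong refl sum.swap)
  also have "\<dots> = (\<Sum>k\<in>K. \<Sum>i\<in>I. \<Sum>j\<in>J. f i j k)" by (rule sum.swap)
  finally show ?thesis .
qed

lemma sum_same_block:
  fixes g :: "nat \<Rightarrow> nat \<Rightarrow> real"
  assumes B: "partition_on {..<n} B"
  shows "(\<Sum>i<n. \<Sum>j<n. of_bool (same_block B i j) * g i j) = (\<Sum>G\<in>B. \<Sum>i\<in>G. \<Sum>j\<in>G. g i j)"
proof -
  have sub: "G \<subseteq> {..<n}" if "G \<in> B" for G using B that by (auto simp: partition_on_def)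
  have "(\<Sum>i<n. \<Sum>j<n. of_bool (same_block B i j) * g i j)
      = (\<Sum>i<n. \<Sum>j<n. \<Sum>G\<in>B. of_bool (i \<in> G) * (of_bool (j \<in> G) * g i j))"
    by (intro sum.cong) (auto simp: sum_distrib_right mult.assoc simp flip: indicator_same_block[OF B])
  also have "\<dots> = (\<Sum>G\<in>B. \<Sum>i<n. of_bool (i \<in> G) * (\<Sum>j<n. of_bool (j \<in> G) * g i j))"
    by (simp only: sum_swap_inner[where K = B] sum_distrib_left)
  also have "\<dots> = (\<Sum>G\<in>B. \<Sum>i\<in>G. \<Sum>j\<in>G. g i j)"
  proof (rule sum.cong[OF refl])
    fix G assume "G \<in> B"
    have h: "(\<Sum>i<n. of_bool (i \<in> G) * f i) = (\<Sum>i\<in>G. f i)" for f :: "nat \<Rightarrow> real"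
      using sub[OF \<open>G \<in> B\<close>] by (intro sum.mono_neutral_cong_right) auto
    show "(\<Sum>i<n. of_bool (i \<in> G) * (\<Sum>j<n. of_bool (j \<in> G) * g i j)) = (\<Sum>i\<in>G. \<Sum>j\<in>G. g i j)"
      by (simp only: h)
  qed
  finally show ?thesis .
qed

text \<open>
  In this form the penalty of a partition is additive over pairs of indices, and two penalties can
  be compared pair by pair.
\<close>

lemma sum_card_sq_same_block:
  assumes B: "partition_on {..<n} B"
  shows "(\<Sum>G\<in>B. (real (card G))\<^sup>2) = (\<Sum>i<n. \<Sum>j<n. of_bool (same_block B i j))"
  using sum_same_block[OF B, of "\<lambda>_ _. 1"] by (simp add: power2_eq_square)

lemma same_block_refines: "refines A B B' \<Longrightarrow> same_block B i j \<Longrightarrow> same_block B' i j"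
  unfolding same_block_def refines_def by blast

lemma refinesI_same_block:
  assumes "partition_on A B" "partition_on A B'"
    and "\<And>i j. i \<in> A \<Longrightarrow> j \<in> A \<Longrightarrow> same_block B i j \<Longrightarrow> same_block B' i j"
  shows "refines A B B'"
  unfolding refines_def
proof (intro conjI ballI assms(1,2))
  fix X assume X: "X \<in> B"
  then obtain i where i: "i \<in> X" "i \<in> A"
    using assms(1) unfolding partition_on_def by (metis UnionI ex_in_conv)
  obtain Y where Y: "Y \<in> B'" "i \<in> Y" using i assms(2) by (auto simp: partition_on_def)
  have "j \<in> Y" if "j \<in> X" for j
  proof -
    have "same_block B' i j"
      using X i that assms(1) by (intro assms(3)) (auto simp: same_block_def partition_on_def)
    then show ?thesis using Y assms(2) unfolding same_block_def partition_on_def disjoint_def by blast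
  qed
  then show "\<exists>Y\<in>B'. X \<subseteq> Y" using Y by blast
qed

lemma partition_eqI_same_block:
  assumes "partition_on A B" "partition_on A B'"
    and "\<And>i j. i \<in> A \<Longrightarrow> j \<in> A \<Longrightarrow> same_block B i j \<longleftrightarrow> same_block B' i j"
  shows "B = B'"
  using assms by (intro refines_asym[of A] refinesI_same_block) auto

lemma same_block_common_refinement:
  assumes P: "\<And>B. B \<in> \<P> \<Longrightarrow> partition_on A B" "\<P> \<noteq> {}" and i: "i \<in> A"
  shows "same_block (common_refinement \<P>) i j \<longleftrightarrow> (\<forall>B\<in>\<P>. same_block B i j)"
proof
  show "same_block (common_refinement \<P>) i j \<Longrightarrow> \<forall>B\<in>\<P>. same_block B i j"
    using same_block_refines[OF refines_common_refinement[OF P(1)]] by blast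
next
  assume s: "\<forall>B\<in>\<P>. same_block B i j"
  obtain X where X: "X \<in> common_refinement \<P>" "i \<in> X"
    using partition_on_common_refinement[OF P] i by (auto simp: partition_on_def)
  then obtain f where f: "f \<in> (\<Pi> B\<in>\<P>. B)" "X = \<Inter> (f ` \<P>)"
    by (auto simp: common_refinement)
  have "j \<in> f B" if "B \<in> \<P>" for B
  proof -
    have "f B \<in> B" "i \<in> f B" using f X that by auto
    moreover obtain G where "G \<in> B" "i \<in> G" "j \<in> G" using s[rule_format, OF \<open>B \<in> \<P>\<close>] by (auto simp: same_block_def)
    ultimately show ?thesis using P(1)[OF that] unfolding partition_on_def disjoint_def by blast
  qed
  then have "j \<in> X" using f by auto
  then show "same_block (common_refinement \<P>) i j" using X by (auto simp: same_block_def)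
qed

text \<open>
  The finest partition is the common refinement of all partitions whose blocks contain the support
  of \<open>A\<close>. The family of these partitions is not empty, because it contains the trivial partition,
  which is \<open>{}\<close> when \<open>n = 0\<close>.
\<close>

lemma finest_blocks_properties:
  assumes A: "A \<in> carrier_mat n n"
  shows partition_on_finest_blocks: "partition_on {..<n} (finest_blocks A)"
    and block_restrict_finest_blocks: "A = block_restrict (finest_blocks A) A"
    and finest_blocks_refines: "\<And>B. partition_on {..<n} B \<Longrightarrow> A = block_restrict B A \<Longrightarrow> refines {..<n} (finest_blocks A) B"
proof -
  define V where "V = {B. partition_on {..<n} B \<and> A = block_restrict B A}"
  define F where "F = common_refinement V"
  have "\<exists>B. B \<in> V"
  proof (cases "n = 0")
    case True
    then have "{} \<in> V" using A by (auto simp: V_def partition_on_def block_restrict_eq_iff)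
    then show ?thesis by blast
  next
    case False
    then have "{{..<n}} \<in> V"
      unfolding V_def using A by (auto simp: partition_on_def block_restrict_eq_iff[of _ n n] same_block_def)
    then show ?thesis by blast
  qed
  then have V: "V \<noteq> {}" by blast
  have pV: "partition_on {..<n} B" if "B \<in> V" for B using that by (simp add: V_def)
  have F: "partition_on {..<n} F" "A = block_restrict F A"
    and F': "\<And>B. partition_on {..<n} B \<Longrightarrow> A = block_restrict B A \<Longrightarrow> refines {..<n} F B"
  proof -
    show "partition_on {..<n} F" unfolding F_def by (rule partition_on_common_refinement[OF pV V])
    have "same_block F i j" if "i < n" "j < n" "A $$ (i, j) \<noteq> 0" for i j
      unfolding F_def using that same_block_common_refinement[OF pV V, of i j] block_restrict_eq_iff[OF A]
      by (auto simp: V_def)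
    then show "A = block_restrict F A" using block_restrict_eq_iff[OF A] by blast
    show "refines {..<n} F B" if "partition_on {..<n} B" "A = block_restrict B A" for B
      unfolding F_def using that by (intro refines_common_refinement pV) (simp_all add: V_def)
  qed
  have "finest_blocks A = F"
    unfolding finest_blocks_def
  proof (rule the_equality)
    show "partition_on {..<dim_row A} F \<and> A = block_restrict F A \<and>
      (\<forall>B'. partition_on {..<dim_row A} B' \<and> A = block_restrict B' A \<longrightarrow> refines {..<dim_row A} F B')"
      using F F' A by auto
    fix B assume "partition_on {..<dim_row A} B \<and> A = block_restrict B A \<and>
      (\<forall>B'. partition_on {..<dim_row A} B' \<and> A = block_restrict B' A \<longrightarrow> refines {..<dim_row A} B B')"
    then show "B = F" using F F' A by (intro refines_asym[of "{..<n}"]) auto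
  qed
  then show "partition_on {..<n} (finest_blocks A)" "A = block_restrict (finest_blocks A) A"
     "\<And>B. partition_on {..<n} B \<Longrightarrow> A = block_restrict B A \<Longrightarrow> refines {..<n} (finest_blocks A) B"
    using F F' by auto
qed

lemma block_restrict_finer:
  assumes "A \<in> carrier_mat n n" "refines {..<n} B B'"
  shows "block_restrict B (block_restrict B' A) = block_restrict B A"
  using assms same_block_refines[OF assms(2)] by (intro eq_matI) (auto simp: block_restrict_def)

lemma finest_blocks_block_restrict:
  assumes S: "S \<in> carrier_mat n n" and B: "partition_on {..<n} B"
  shows "refines {..<n} (finest_blocks (block_restrict B S)) B"
    "block_restrict (finest_blocks (block_restrict B S)) S = block_restrict B S"
proof -
  show r: "refines {..<n} (finest_blocks (block_restrict B S)) B"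
    using S by (intro finest_blocks_refines B) auto
  show "block_restrict (finest_blocks (block_restrict B S)) S = block_restrict B S"
    using block_restrict_finer[OF S r] block_restrict_finest_blocks[of "block_restrict B S" n] S by simp
qed

lemma pen_sum_same_block:
  assumes "A \<in> carrier_mat n n"
  shows "pen A = (\<Sum>i<n. \<Sum>j<n. of_bool (same_block (finest_blocks A) i j))"
  unfolding pen_def by (rule sum_card_sq_same_block[OF partition_on_finest_blocks[OF assms]])

text \<open>
  The trace term of the likelihood is the constant \<open>p\<close>, as \<open>(S\<^sub>B)\<^sup>-\<^sup>1\<close> has no entries outside the
  blocks and therefore does not see the difference of \<open>S\<close> and \<open>S\<^sub>B\<close>.
\<close>

lemma Psi_eq:
  assumes S: "form_between p c K S" "0 < c" and B: "partition_on {..<p} B" and p: "0 < p"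
  shows "real p * Psi \<kappa> S B = ln (det (block_restrict B S)) + real p + real p * \<kappa> * pen (block_restrict B S)"
proof -
  define D where "D = block_restrict B S"
  define E where "E = S - D"
  have cS: "S \<in> carrier_mat p p" using S by (simp add: form_between_def)
  have fD: "form_between p c K D" unfolding D_def by (rule form_between_block_restrict[OF S(1) B])
  have cD: "D \<in> carrier_mat p p" "sym_pos_def D"
    using fD form_between_sym_pos_def S by (auto simp: form_between_def)
  have cE: "E \<in> carrier_mat p p" using cS cD by (auto simp: E_def intro: minus_carrier_mat)
  note iD = sym_pos_def_minv[OF cD]
  have "minv D * S = 1\<^sub>m p + minv D * E"
  proof -
    have "S = D + E" using cS cD by (auto simp: E_def intro!: eq_matI)
    then show ?thesis using iD cD cE by (simp add: mult_add_distrib_mat[of _ p p])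
  qed
  moreover have "mtrace (minv D * E) = 0"
    using cS by (intro mtrace_mult_off_block[OF iD(1) minv_block_restrict[OF B cD] cE])
      (auto simp: D_def E_def)
  ultimately have "mtrace (minv D * S) = real p"
    using iD cE by (simp add: mtrace_add[of _ p] mtrace_one)
  then have "(\<Sum>i<dim_row S. (minv D * S) $$ (i, i)) = real p"
    using iD cS by (simp add: mtrace_def)
  then show ?thesis
    using p cS by (simp add: Psi_def Phi_def neg_log_lik_def field_simps flip: D_def)
qed

lemma sum_of_bool_eq_0D:
  fixes n :: nat
  assumes "(\<Sum>i<n. \<Sum>j<n. of_bool (R i j)) = (0::real)" "i < n" "j < n"
  shows "\<not> R i j"
proof
  assume R: "R i j"
  have "(1::real) \<le> (\<Sum>j<n. of_bool (R i j))"
    using R assms(3) member_le_sum[of j "{..<n}" "\<lambda>j. of_bool (R i j) :: real"]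
    by (simp del: sum_of_bool_eq)
  also have "\<dots> \<le> (\<Sum>i<n. \<Sum>j<n. of_bool (R i j))"
    using assms(2) by (intro member_le_sum[of i "{..<n}" "\<lambda>i. \<Sum>j<n. of_bool (R i j) :: real"])
      (auto intro: sum_nonneg)
  finally show False using assms(1) by simp
qed

text \<open>
  Cutting only the block \<open>H\<close> along \<open>P\<close> yields a partition strictly finer than \<open>B\<close> all of whose
  additional cuts lie in \<open>H\<close>. A separation hypothesis about strictly finer partitions thus
  produces a large entry inside every single block that \<open>P\<close> cuts, and not just one large entry
  overall.
\<close>

lemma split_one_block:
  assumes B: "partition_on A B" and P: "partition_on A P" and H: "H \<in> B"
    and ij: "i \<in> H" "j \<in> H" "\<not> same_block P i j"
  defines "Q \<equiv> (B - {H}) \<union> ((\<lambda>G. G \<inter> H) ` P - {{}})"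
  shows "refines A Q B" "Q \<noteq> B"
    "\<And>k l. same_block B k l \<Longrightarrow> \<not> same_block Q k l \<Longrightarrow> k \<in> H \<and> l \<in> H \<and> \<not> same_block P k l"
proof -
  have HA: "H \<subseteq> A" using B H by (auto simp: partition_on_def)
  have QI: "R \<inter> H \<in> Q" if "R \<in> P" "x \<in> R" "x \<in> H" for R x
  proof -
    have "R \<inter> H \<noteq> {}" using that by auto
    then have "R \<inter> H \<in> (\<lambda>G. G \<inter> H) ` P - {{}}" using that(1) by (intro DiffI imageI) simp_all
    then show ?thesis unfolding Q_def by (rule UnI2)
  qed
  have "partition_on A Q"
  proof (rule partition_onI)
    show "{} \<notin> Q" using B by (auto simp: Q_def partition_on_def)
    show "\<Union>Q = A"
    proof
      show "\<Union>Q \<subseteq> A" using B HA by (auto simp: Q_def partition_on_def)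
      show "A \<subseteq> \<Union>Q"
      proof
        fix x assume x: "x \<in> A"
        obtain G where G: "G \<in> B" "x \<in> G" using x B by (auto simp: partition_on_def)
        obtain R where R: "R \<in> P" "x \<in> R" using x P by (auto simp: partition_on_def)
        show "x \<in> \<Union>Q"
        proof (cases "G = H")
          case True
          then have "R \<inter> H \<in> Q" "x \<in> R \<inter> H" using QI R G by auto
          then show ?thesis by blast
        next
          case False
          then show ?thesis using G by (auto simp: Q_def)
        qed
      qed
    qed
    fix X Y assume "X \<in> Q" "Y \<in> Q" "X \<noteq> Y"
    moreover have "disjnt X Y" if "X \<in> B - {H}" "Y \<in> (\<lambda>G. G \<inter> H) ` P" for X Y
      using that B H by (auto simp: partition_on_def disjoint_def disjnt_def)
    moreover have "disjnt X Y" if "X \<in> B" "Y \<in> B" "X \<noteq> Y" for X Y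
      using that B by (auto simp: partition_on_def disjoint_def disjnt_def)
    moreover have "disjnt (R \<inter> H) (R' \<inter> H)" if "R \<in> P" "R' \<in> P" "R \<inter> H \<noteq> R' \<inter> H" for R R'
      using that P unfolding partition_on_def disjoint_def disjnt_def by blast
    ultimately show "disjnt X Y"
      unfolding Q_def by (smt (verit) Diff_iff UnE disjnt_sym imageE)
  qed
  then show "refines A Q B"
    using B H unfolding refines_def Q_def by blast
  show "Q \<noteq> B"
  proof
    assume "Q = B"
    then have "H \<in> Q" using H by simp
    then obtain G where "G \<in> P" "H = G \<inter> H" by (auto simp: Q_def)
    then show False using ij by (auto simp: same_block_def)
  qed
  fix k l assume kl: "same_block B k l" "\<not> same_block Q k l"
  then obtain G where G: "G \<in> B" "k \<in> G" "l \<in> G" by (auto simp: same_block_def)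
  then have "G = H" using kl by (auto simp: same_block_def Q_def)
  with G have H': "k \<in> H" "l \<in> H" by auto
  have "\<not> same_block P k l"
  proof
    assume "same_block P k l"
    then obtain R where R: "R \<in> P" "k \<in> R" "l \<in> R" by (auto simp: same_block_def)
    have "same_block Q k l"
      unfolding same_block_def using R H' by (intro bexI[OF _ QI[OF R(1,2) H'(1)]]) simp
    with kl(2) show False by contradiction
  qed
  with H' show "k \<in> H \<and> l \<in> H \<and> \<not> same_block P k l" by blast
qed

text \<open>
  Let \<open>P\<close> be the finest partition representing \<open>S\<^sub>B\<close>, \<open>M\<close> the common refinement of \<open>P\<close> and \<open>Bs\<close>,
  \<open>N\<^sub>1\<close> the number of pairs joined by \<open>P\<close> but not by \<open>Bs\<close>, and \<open>N\<^sub>2\<close> the number of pairs joined by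
  \<open>Bs\<close> but not by \<open>P\<close>. The penalty of \<open>P\<close> exceeds that of \<open>Bs\<close> by at least \<open>N\<^sub>1 - N\<^sub>2\<close> units.
  Passing from \<open>P\<close> to \<open>M\<close> deletes \<open>N\<^sub>1\<close> entries of size at most \<open>e\<close>, which costs less than the
  penalty for them; passing from \<open>Bs\<close> to \<open>M\<close> cuts blocks of size at most \<open>m\<close>, each losing an entry
  of size at least \<open>b\<close>, which costs more than the penalty for at most \<open>m\<^sup>2\<close> pairs per block. So
  \<open>N\<^sub>1 = N\<^sub>2 = 0\<close>.
\<close>

theorem Psi_le_imp_finest_blocks_eq:
  assumes S: "form_between p c K S" and cK: "0 < c" "0 < K" and p: "0 < p"
    and Bs: "partition_on {..<p} Bs" and B: "partition_on {..<p} B"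
    and m: "\<And>G. G \<in> Bs \<Longrightarrow> card G \<le> m"
    and small: "\<And>i j. i < p \<Longrightarrow> j < p \<Longrightarrow> \<not> same_block Bs i j \<Longrightarrow> \<bar>S $$ (i, j)\<bar> \<le> e"
    and big: "\<And>Q. strictly_finer p Q Bs \<Longrightarrow>
        \<exists>i<p. \<exists>j<p. same_block Bs i j \<and> \<not> same_block Q i j \<and> b \<le> \<bar>S $$ (i, j)\<bar>"
    and b: "0 \<le> b"
    and pen_large: "e\<^sup>2 / c\<^sup>2 < real p * \<kappa>" and pen_small: "real p * \<kappa> * (real m)\<^sup>2 < b\<^sup>2 / (8 * K\<^sup>2)"
    and le: "Psi \<kappa> S B \<le> Psi \<kappa> S Bs"
  shows "finest_blocks (block_restrict B S) = Bs"
proof -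
  define P where "P = finest_blocks (block_restrict B S)"
  define M where "M = common_refinement {P, Bs}"
  define q where "q = real p * \<kappa>"
  have cS: "S \<in> carrier_mat p p" using S by (simp add: form_between_def)
  have P: "partition_on {..<p} P" unfolding P_def using cS by (intro partition_on_finest_blocks) simp
  have PS: "block_restrict P S = block_restrict B S"
    unfolding P_def by (rule finest_blocks_block_restrict(2)[OF cS B])
  have pM: "partition_on {..<p} M" unfolding M_def by (rule partition_on_common_refinement) (use P Bs in auto)
  have sM: "same_block M i j \<longleftrightarrow> same_block P i j \<and> same_block Bs i j" if "i < p" for i j
    unfolding M_def using same_block_common_refinement[of "{P, Bs}" "{..<p}" i j] P Bs that by auto
  have rM: "refines {..<p} M P" "refines {..<p} M Bs"
    unfolding M_def using P Bs by (auto intro!: refines_common_refinement)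
  define N1 N2 :: real where
    "N1 = (\<Sum>i<p. \<Sum>j<p. of_bool (same_block P i j \<and> \<not> same_block Bs i j))" and
    "N2 = (\<Sum>i<p. \<Sum>j<p. of_bool (same_block Bs i j \<and> \<not> same_block P i j))"
  have N: "0 \<le> N1" "0 \<le> N2" by (auto simp: N1_def N2_def intro!: sum_nonneg)
  have "pen (block_restrict B S) - pen (block_restrict Bs S) \<ge> N1 - N2"
  proof -
    have "pen (block_restrict B S) = (\<Sum>i<p. \<Sum>j<p. of_bool (same_block P i j))"
      unfolding P_def using cS by (intro pen_sum_same_block) auto
    moreover have "pen (block_restrict Bs S) \<le> (\<Sum>i<p. \<Sum>j<p. of_bool (same_block Bs i j))"
      unfolding pen_sum_same_block[OF block_restrict_carrier[OF cS]]
      using same_block_refines[OF finest_blocks_block_restrict(1)[OF cS Bs]]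
      by (intro sum_mono) simp
    moreover have "(\<Sum>i<p. \<Sum>j<p. of_bool (same_block P i j)) - (\<Sum>i<p. \<Sum>j<p. of_bool (same_block Bs i j)) = N1 - N2"
      unfolding N1_def N2_def sum_subtractf[symmetric] by (intro sum.cong) auto
    ultimately show ?thesis by linarith
  qed
  then have 1: "q * (pen (block_restrict B S) - pen (block_restrict Bs S)) \<ge> q * (N1 - N2)"
  proof (rule mult_left_mono)
    have "0 \<le> e\<^sup>2 / c\<^sup>2" by simp
    then show "0 \<le> q" unfolding q_def using pen_large by linarith
  qed
  have fr: "frob2 (block_restrict R S - block_restrict M (block_restrict R S))
      = (\<Sum>i<p. \<Sum>j<p. of_bool (same_block R i j \<and> \<not> same_block M i j) * (S $$ (i, j))\<^sup>2)" for R
  proof -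
    have "dim_row S = p" "dim_col S = p" using cS by auto
    then show ?thesis unfolding frob2_def by (intro sum.cong) (auto simp: block_restrict_def)
  qed
  have fP: "form_between p c K (block_restrict P S)" and fBs: "form_between p c K (block_restrict Bs S)"
    by (rule form_between_block_restrict[OF S P], rule form_between_block_restrict[OF S Bs])
  have "frob2 (block_restrict P S - block_restrict M (block_restrict P S)) \<le> e\<^sup>2 * N1"
    unfolding fr N1_def sum_distrib_left
  proof (intro sum_mono)
    fix i j assume ij: "i \<in> {..<p}" "j \<in> {..<p}"
    have "(S $$ (i, j))\<^sup>2 \<le> e\<^sup>2" if "\<not> same_block Bs i j"
      using power_mono[OF small[of i j], of 2] that ij by simp
    then show "of_bool (same_block P i j \<and> \<not> same_block M i j) * (S $$ (i, j))\<^sup>2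
       \<le> e\<^sup>2 * of_bool (same_block P i j \<and> \<not> same_block Bs i j)"
      using sM ij by auto
  qed
  then have "frob2 (block_restrict P S - block_restrict M (block_restrict P S)) / c\<^sup>2 \<le> e\<^sup>2 / c\<^sup>2 * N1"
    using cK by (simp add: field_simps)
  then have 2: "ln (det (block_restrict M S)) - ln (det (block_restrict P S)) \<le> e\<^sup>2 / c\<^sup>2 * N1"
    using ln_det_off_block_loss[OF fP cK pM] block_restrict_finer[OF cS rM(1)] by simp
  \<comment> \<open>each block cut by \<open>P\<close> contains a deleted entry of size at least \<open>b\<close> and at most \<open>m\<^sup>2\<close> separated pairs\<close>
  have "b\<^sup>2 * N2 \<le> (real m)\<^sup>2 * frob2 (block_restrict Bs S - block_restrict M (block_restrict Bs S))"
  proof -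
    let ?g = "\<lambda>i j. of_bool (\<not> same_block P i j) * (S $$ (i, j))\<^sup>2"
    have "frob2 (block_restrict Bs S - block_restrict M (block_restrict Bs S))
       = (\<Sum>i<p. \<Sum>j<p. of_bool (same_block Bs i j) * ?g i j)"
      unfolding fr by (intro sum.cong) (auto simp: sM)
    also have "\<dots> = (\<Sum>H\<in>Bs. \<Sum>i\<in>H. \<Sum>j\<in>H. ?g i j)" by (rule sum_same_block[OF Bs])
    finally have e1: "frob2 (block_restrict Bs S - block_restrict M (block_restrict Bs S)) = \<dots>" .
    have "N2 = (\<Sum>i<p. \<Sum>j<p. of_bool (same_block Bs i j) * of_bool (\<not> same_block P i j))"
      unfolding N2_def by (intro sum.cong) auto
    also have "\<dots> = (\<Sum>H\<in>Bs. \<Sum>i\<in>H. \<Sum>j\<in>H. of_bool (\<not> same_block P i j))" by (rule sum_same_block[OF Bs])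
    finally have e2: "N2 = \<dots>" .
    have "b\<^sup>2 * (\<Sum>i\<in>H. \<Sum>j\<in>H. of_bool (\<not> same_block P i j)) \<le> (real m)\<^sup>2 * (\<Sum>i\<in>H. \<Sum>j\<in>H. ?g i j)"
      if H: "H \<in> Bs" for H
    proof (cases "\<exists>i\<in>H. \<exists>j\<in>H. \<not> same_block P i j")
      case False
      then show ?thesis by (auto intro!: mult_nonneg_nonneg sum_nonneg)
    next
      case True
      then obtain k l where kl: "k \<in> H" "l \<in> H" "\<not> same_block P k l" by blast
      have finH: "finite H" using Bs H finite_subset[of H "{..<p}"] by (auto simp: partition_on_def)
      note sp = split_one_block[OF Bs P H kl]
      obtain i j where ij: "i \<in> H" "j \<in> H" "\<not> same_block P i j" "b \<le> \<bar>S $$ (i, j)\<bar>"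
        using big[of "(Bs - {H}) \<union> ((\<lambda>G. G \<inter> H) ` P - {{}})"] sp unfolding strictly_finer_def by blast
      have "b\<^sup>2 \<le> (S $$ (i, j))\<^sup>2" using power_mono[OF ij(4) b, of 2] by simp
      also have "\<dots> = ?g i j" using ij by simp
      also have "\<dots> \<le> (\<Sum>j\<in>H. ?g i j)" using ij finH by (intro member_le_sum) auto
      also have "\<dots> \<le> (\<Sum>i\<in>H. \<Sum>j\<in>H. ?g i j)"
        using ij finH by (intro member_le_sum) (auto intro!: sum_nonneg)
      finally have u: "b\<^sup>2 \<le> (\<Sum>i\<in>H. \<Sum>j\<in>H. ?g i j)" .
      have "(\<Sum>i\<in>H. \<Sum>j\<in>H. of_bool (\<not> same_block P i j)) \<le> (\<Sum>i\<in>H. \<Sum>j\<in>H. 1 :: real)"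
        by (intro sum_mono) auto
      also have "\<dots> = (real (card H))\<^sup>2" by (simp add: power2_eq_square)
      also have "\<dots> \<le> (real m)\<^sup>2" using m[OF H] by (intro power_mono) auto
      finally have "b\<^sup>2 * (\<Sum>i\<in>H. \<Sum>j\<in>H. of_bool (\<not> same_block P i j)) \<le> b\<^sup>2 * (real m)\<^sup>2"
        by (intro mult_left_mono) auto
      also have "\<dots> \<le> (\<Sum>i\<in>H. \<Sum>j\<in>H. ?g i j) * (real m)\<^sup>2"
        using u by (intro mult_right_mono) auto
      finally show ?thesis by (simp add: mult.commute)
    qed
    then show ?thesis unfolding e1 e2 sum_distrib_left[of _ _ Bs] by (intro sum_mono)
  qed
  moreover have "frob2 (block_restrict Bs S - block_restrict M (block_restrict Bs S))
      \<le> 8 * K\<^sup>2 * (ln (det (block_restrict M S)) - ln (det (block_restrict Bs S)))"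
    using ln_det_off_block_gain[OF fBs cK pM] block_restrict_finer[OF cS rM(2)] cK by (simp add: field_simps)
  ultimately have 3: "b\<^sup>2 * N2 \<le> (real m)\<^sup>2 * (8 * K\<^sup>2 * (ln (det (block_restrict M S)) - ln (det (block_restrict Bs S))))"
    by (meson order.trans mult_left_mono zero_le_power2)
  have 4: "ln (det (block_restrict P S)) - ln (det (block_restrict Bs S)) + q * (N1 - N2) \<le> 0"
  proof -
    have "real p * Psi \<kappa> S B \<le> real p * Psi \<kappa> S Bs" using le p by simp
    then show ?thesis
      unfolding Psi_eq[OF S cK(1) B p] Psi_eq[OF S cK(1) Bs p] using 1
      by (simp add: PS q_def algebra_simps)
  qed
  define L where "L = ln (det (block_restrict M S)) - ln (det (block_restrict Bs S))"
  have 5: "(q - e\<^sup>2 / c\<^sup>2) * N1 + L \<le> q * N2"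
    using 2 4 by (simp add: L_def algebra_simps)
  have q: "0 < q - e\<^sup>2 / c\<^sup>2" using pen_large by (simp add: q_def)
  have q': "q * (real m)\<^sup>2 * (8 * K\<^sup>2) < b\<^sup>2" using pen_small cK by (simp add: q_def field_simps)
  have "N2 = 0"
  proof (rule ccontr)
    assume "N2 \<noteq> 0"
    then have "N2 > 0" using N by simp
    have "b\<^sup>2 * N2 \<le> (real m)\<^sup>2 * (8 * K\<^sup>2) * L" using 3 by (simp add: L_def)
    also have "\<dots> \<le> (real m)\<^sup>2 * (8 * K\<^sup>2) * (q * N2)"
      using 5 mult_nonneg_nonneg[OF less_imp_le[OF q] N(1)] by (intro mult_left_mono) auto
    also have "\<dots> < b\<^sup>2 * N2"
      using mult_strict_right_mono[OF q' \<open>N2 > 0\<close>] by (simp add: mult_ac)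
    finally show False by simp
  qed
  have "N1 = 0"
  proof (rule ccontr)
    assume "N1 \<noteq> 0"
    then have "0 < (q - e\<^sup>2 / c\<^sup>2) * N1" using N q by simp
    moreover have "0 \<le> frob2 (block_restrict Bs S - block_restrict M (block_restrict Bs S)) / (8 * K\<^sup>2)"
      using frob2_nonneg by (intro divide_nonneg_nonneg) auto
    then have "0 \<le> L"
      using ln_det_off_block_gain[OF fBs cK pM] block_restrict_finer[OF cS rM(2)] unfolding L_def by simp
    ultimately show False using 5 \<open>N2 = 0\<close> by simp
  qed
  show "finest_blocks (block_restrict B S) = Bs"
    unfolding P_def[symmetric]
  proof (rule partition_eqI_same_block[OF P Bs])
    fix i j assume ij: "i \<in> {..<p}" "j \<in> {..<p}"
    have "\<not> (same_block P i j \<and> \<not> same_block Bs i j)" "\<not> (same_block Bs i j \<and> \<not> same_block P i j)"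
      using sum_of_bool_eq_0D[OF \<open>N1 = 0\<close>[unfolded N1_def], of i j]
        sum_of_bool_eq_0D[OF \<open>N2 = 0\<close>[unfolded N2_def], of i j] ij by auto
    then show "same_block P i j \<longleftrightarrow> same_block Bs i j" by blast
  qed
qed

text \<open>
  The thresholded matrix has the block structure \<open>Bs\<close> by \<open>off\<close>, and no strictly finer one by \<open>on\<close>.
\<close>

lemma threshold_blocks_eq:
  assumes S: "S \<in> carrier_mat p p" and Bs: "partition_on {..<p} Bs"
    and off: "\<And>i j. i < p \<Longrightarrow> j < p \<Longrightarrow> \<not> same_block Bs i j \<Longrightarrow> \<bar>correlation S $$ (i, j)\<bar> \<le> t"
    and on: "\<And>Q. strictly_finer p Q Bs \<Longrightarrow>
        \<exists>i<p. \<exists>j<p. \<not> same_block Q i j \<and> t < \<bar>correlation S $$ (i, j)\<bar>"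
    and t: "0 \<le> t"
  shows "threshold_blocks S t = Bs"
proof -
  define C where "C = correlation S"
  define T where "T = mat p p (\<lambda>(i, j). if \<bar>C $$ (i, j)\<bar> > t then C $$ (i, j) else 0)"
  have T: "T \<in> carrier_mat p p" by (simp add: T_def)
  have e: "threshold_blocks S t = finest_blocks T"
  proof -
    have "dim_row (correlation S) = p" "dim_col (correlation S) = p"
      using S by (simp_all add: correlation_def)
    then show ?thesis unfolding threshold_blocks_def Let_def T_def C_def by simp
  qed
  have nz: "T $$ (i, j) \<noteq> 0 \<longleftrightarrow> t < \<bar>C $$ (i, j)\<bar>" if "i < p" "j < p" for i j
    using that t by (auto simp: T_def)
  have "T = block_restrict Bs T"
    unfolding block_restrict_eq_iff[OF T] using nz off by (fastforce simp: C_def)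
  then have r: "refines {..<p} (finest_blocks T) Bs" by (rule finest_blocks_refines[OF T Bs])
  have "finest_blocks T = Bs"
  proof (rule ccontr)
    assume "finest_blocks T \<noteq> Bs"
    then obtain i j where "i < p" "j < p" "\<not> same_block (finest_blocks T) i j" "t < \<bar>C $$ (i, j)\<bar>"
      using on[of "finest_blocks T"] r by (auto simp: strictly_finer_def C_def)
    then show False
      using nz[of i j] block_restrict_nonzero[OF T block_restrict_finest_blocks[OF T], of i j] by simp
  qed
  then show ?thesis using e by simp
qed

section \<open>The variational formula for conditional variances\<close>

lemma bij_betw_pick:
  assumes "finite I"
  shows "bij_betw (pick I) {..<card I} I"
  unfolding bij_betw_def
proof
  have m: "pick I i < pick I j" if "i < j" "j < card I" for i j
    using pick_mono_le that by blast
  show inj: "inj_on (pick I) {..<card I}"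
    by (rule linorder_inj_onI) (use m in force)+
  have "pick I ` {..<card I} \<subseteq> I" using pick_in_set_le by blast
  then show "pick I ` {..<card I} = I"
    using inj assms by (intro card_subset_eq) (auto simp: card_image)
qed

lemma sum_pick: "finite I \<Longrightarrow> (\<Sum>k<card I. f (pick I k)) = (\<Sum>i\<in>I. f i)"
  using sum.reindex_bij_betw[OF bij_betw_pick] .

lemma subset_lessThan_Collect: "I \<subseteq> {..<p::nat} \<Longrightarrow> {i. i < p \<and> i \<in> I} = I"
  by auto

lemma subvector_carrier:
  "x \<in> carrier_vec p \<Longrightarrow> I \<subseteq> {..<p} \<Longrightarrow> subvector x I \<in> carrier_vec (card I)"
  by (auto simp: subvector_def subset_lessThan_Collect)

lemma submatrix_carrier:
  "A \<in> carrier_mat p p \<Longrightarrow> I \<subseteq> {..<p} \<Longrightarrow> J \<subseteq> {..<p} \<Longrightarrow> submatrix A I J \<in> carrier_mat (card I) (card J)"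
  by (auto simp: submatrix_def subset_lessThan_Collect)

lemma subvector_index:
  "x \<in> carrier_vec p \<Longrightarrow> I \<subseteq> {..<p} \<Longrightarrow> k < card I \<Longrightarrow> subvector x I $ k = x $ pick I k"
  by (simp add: subvector_def subset_lessThan_Collect)

lemma submatrix_index':
  "A \<in> carrier_mat p p \<Longrightarrow> I \<subseteq> {..<p} \<Longrightarrow> J \<subseteq> {..<p} \<Longrightarrow> k < card I \<Longrightarrow> l < card J \<Longrightarrow>
    submatrix A I J $$ (k, l) = A $$ (pick I k, pick J l)"
  by (simp add: submatrix_def subset_lessThan_Collect)

text \<open>
  All computations with submatrices go through this formula, which replaces the enumeration of an
  index set by a sum over it.
\<close>

lemma bform_subvector:
  assumes A: "A \<in> carrier_mat p p" and IJ: "I \<subseteq> {..<p}" "J \<subseteq> {..<p}"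
    and x: "x \<in> carrier_vec p" and y: "y \<in> carrier_vec p"
  shows "scalar_prod (subvector x I) (submatrix A I J *\<^sub>v subvector y J)
     = (\<Sum>i\<in>I. \<Sum>j\<in>J. x $ i * A $$ (i, j) * y $ j)"
proof -
  have fin: "finite I" "finite J" using IJ finite_subset by blast+
  note c = submatrix_carrier[OF A IJ] subvector_carrier[OF x IJ(1)] subvector_carrier[OF y IJ(2)]
  have "scalar_prod (subvector x I) (submatrix A I J *\<^sub>v subvector y J)
     = (\<Sum>k<card I. \<Sum>l<card J. subvector x I $ k * submatrix A I J $$ (k, l) * subvector y J $ l)"
    using c by (auto simp: scalar_prod_def atLeast0LessThan sum_distrib_left mult.assoc intro!: sum.cong)
  also have "\<dots> = (\<Sum>k<card I. \<Sum>l<card J. x $ pick I k * A $$ (pick I k, pick J l) * y $ pick J l)"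
    by (intro sum.cong refl)
      (simp add: subvector_index[OF x IJ(1)] subvector_index[OF y IJ(2)] submatrix_index'[OF A IJ])
  also have "\<dots> = (\<Sum>i\<in>I. \<Sum>j\<in>J. x $ i * A $$ (i, j) * y $ j)"
    by (subst sum_pick[OF fin(1), symmetric], subst sum_pick[OF fin(2), symmetric]) simp
  finally show ?thesis .
qed

lemma transpose_mat_index:
  "A \<in> carrier_mat p p \<Longrightarrow> transpose_mat A = A \<Longrightarrow> i < p \<Longrightarrow> j < p \<Longrightarrow> A $$ (i, j) = A $$ (j, i)"
  by (metis carrier_matD index_transpose_mat(1))

lemma bform_supported:
  assumes A: "A \<in> carrier_mat p p" and I: "I \<subseteq> {..<p}" and x: "x \<in> carrier_vec p"
    and supp: "\<And>i. i < p \<Longrightarrow> i \<notin> I \<Longrightarrow> x $ i = 0"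
  shows "bform A x x = (\<Sum>i\<in>I. \<Sum>j\<in>I. x $ i * A $$ (i, j) * x $ j)"
  unfolding bform_sum[OF A x x]
proof (rule sum.mono_neutral_cong_right)
  fix i assume "i \<in> I"
  show "(\<Sum>j<p. x $ i * A $$ (i, j) * x $ j) = (\<Sum>j\<in>I. x $ i * A $$ (i, j) * x $ j)"
    using I supp by (intro sum.mono_neutral_right) auto
qed (use I supp in auto)

lemma embed_subvector:
  assumes z: "z \<in> carrier_vec (card I)" and I: "I \<subseteq> {..<p}"
  obtains x where "x \<in> carrier_vec p" "subvector x I = z" "\<And>i. i < p \<Longrightarrow> i \<notin> I \<Longrightarrow> x $ i = 0"
proof -
  define x where "x = vec p (\<lambda>i. if i \<in> I then z $ card {a\<in>I. a < i} else 0)"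
  have x: "x \<in> carrier_vec p" by (simp add: x_def)
  have "subvector x I = z"
  proof (rule eq_vecI)
    fix k assume "k < dim_vec z"
    then have k: "k < card I" using z by simp
    have "pick I k \<in> I" using pick_in_set_le[OF k] .
    then show "subvector x I $ k = z $ k"
      unfolding subvector_index[OF x I k] using I card_pick_le[OF k] by (auto simp: x_def)
  qed (use z subvector_carrier[OF x I] in auto)
  then show ?thesis by (intro that[OF x]) (auto simp: x_def)
qed

lemma sym_pos_def_submatrix:
  assumes A: "A \<in> carrier_mat p p" "sym_pos_def A" and I: "I \<subseteq> {..<p}"
  shows "sym_pos_def (submatrix A I I)"
proof -
  have c: "submatrix A I I \<in> carrier_mat (card I) (card I)" by (rule submatrix_carrier[OF A(1) I I])
  have t: "transpose_mat A = A" using A by (simp add: sym_pos_def_def)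
  have fin: "finite I" using I finite_subset by blast
  have pk: "pick I k < p" if "k < card I" for k using pick_in_set_le[OF that] I by auto
  have "transpose_mat (submatrix A I I) = submatrix A I I"
    using c pk by (intro eq_matI) (auto simp: submatrix_index'[OF A(1) I I] transpose_mat_index[OF A(1) t])
  moreover have "0 < bform (submatrix A I I) z z" if z: "z \<in> carrier_vec (card I)" "z \<noteq> 0\<^sub>v (card I)" for z
  proof -
    obtain x where x: "x \<in> carrier_vec p" "subvector x I = z" "\<And>i. i < p \<Longrightarrow> i \<notin> I \<Longrightarrow> x $ i = 0"
      using embed_subvector[OF z(1) I] by blast
    have "x \<noteq> 0\<^sub>v p"
    proof
      assume "x = 0\<^sub>v p"
      have "z $ k = 0" if "k < card I" for k
        using subvector_index[OF x(1) I that] pk[OF that] \<open>x = 0\<^sub>v p\<close> x(2) by simp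
      then have "z = 0\<^sub>v (card I)" using z by (intro eq_vecI) auto
      then show False using z by simp
    qed
    then have "0 < bform A x x" using A x by (auto simp: sym_pos_def_def)
    also have "\<dots> = bform (submatrix A I I) z z"
      using bform_supported[OF A(1) I x(1,3)] bform_subvector[OF A(1) I I x(1) x(1)] x(2) by simp
    finally show ?thesis .
  qed
  ultimately show ?thesis using c by (auto simp: sym_pos_def_def)
qed

text \<open>
  The square is completed in the coordinates of \<open>x\<close> in \<open>v\<close>; the minimiser is minus the regression
  of the fixed part on them.
\<close>

lemma cond_var_complete_square:
  assumes A: "A \<in> carrier_mat p p" "sym_pos_def A" and b: "b \<in> carrier_vec p"
    and G: "G \<subseteq> {..<p}" "v \<subseteq> G" and x: "x \<in> carrier_vec p"
    and xb: "\<And>i. i \<in> G - v \<Longrightarrow> x $ i = b $ i" and supp: "\<And>i. i < p \<Longrightarrow> i \<notin> G \<Longrightarrow> x $ i = 0"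
  defines "u \<equiv> subvector x v + minv (submatrix A v v) *\<^sub>v (submatrix A v (G - v) *\<^sub>v subvector b (G - v))"
  shows "bform A x x = cond_var A b G v + bform (submatrix A v v) u u"
    and "u \<in> carrier_vec (card v)"
proof -
  let ?w = "G - v"
  have sub: "v \<subseteq> {..<p}" "?w \<subseteq> {..<p}" using G by auto
  have fin: "finite v" "finite ?w" using sub finite_subset by blast+
  define Av where "Av = submatrix A v v"
  define N where "N = minv Av"
  define R where "R = submatrix A ?w v"
  define L where "L = submatrix A v ?w"
  define P where "P = submatrix A ?w ?w"
  define bw where "bw = subvector b ?w"
  define z where "z = subvector x v"
  define g where "g = L *\<^sub>v bw"
  have t: "transpose_mat A = A" using A by (simp add: sym_pos_def_def)
  have cAv: "Av \<in> carrier_mat (card v) (card v)" and sAv: "sym_pos_def Av"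
    unfolding Av_def by (rule submatrix_carrier[OF A(1) sub(1) sub(1)], rule sym_pos_def_submatrix[OF A sub(1)])
  have tAv: "transpose_mat Av = Av" using sAv by (simp add: sym_pos_def_def)
  have N: "N \<in> carrier_mat (card v) (card v)" "Av * N = 1\<^sub>m (card v)" and tN: "transpose_mat N = N"
    unfolding N_def using sym_pos_def_minv[OF cAv sAv] transpose_minv[OF cAv sAv] by auto
  have c: "R \<in> carrier_mat (card ?w) (card v)" "L \<in> carrier_mat (card v) (card ?w)" "P \<in> carrier_mat (card ?w) (card ?w)"
    unfolding R_def L_def P_def using submatrix_carrier[OF A(1)] sub by auto
  have bw: "bw \<in> carrier_vec (card ?w)" unfolding bw_def by (rule subvector_carrier[OF b sub(2)])
  have z: "z \<in> carrier_vec (card v)" unfolding z_def by (rule subvector_carrier[OF x sub(1)])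
  have g: "g \<in> carrier_vec (card v)" using c bw by (simp add: g_def)
  have Ng: "N *\<^sub>v g \<in> carrier_vec (card v)" using N g by auto
  have u: "u = z + 1 \<cdot>\<^sub>v (N *\<^sub>v g)" by (simp add: u_def z_def N_def Av_def g_def L_def bw_def)
  show "u \<in> carrier_vec (card v)" unfolding u using z Ng by auto
  have xw: "subvector x ?w = bw"
    using sub fin xb pick_in_set_le[of _ ?w]
    by (intro eq_vecI) (auto simp: bw_def subvector_index[OF x sub(2)] subvector_index[OF b sub(2)]
      subvector_carrier[OF x sub(2), THEN carrier_vecD] subvector_carrier[OF b sub(2), THEN carrier_vecD])
  have RT: "scalar_prod bw (R *\<^sub>v y) = scalar_prod g y" if y: "y \<in> carrier_vec (card v)" for y
  proof -
    have RL: "R $$ (k, l) = L $$ (l, k)" if "k < card ?w" "l < card v" for k l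
      using that sub pick_in_set_le[of k ?w] pick_in_set_le[of l v]
      by (simp add: R_def L_def submatrix_index'[OF A(1)] transpose_mat_index[OF A(1) t] subset_eq)
    have "scalar_prod bw (R *\<^sub>v y) = (\<Sum>k<card ?w. \<Sum>l<card v. bw $ k * L $$ (l, k) * y $ l)"
      using c bw y RL by (auto simp: scalar_prod_def atLeast0LessThan sum_distrib_left mult.assoc intro!: sum.cong)
    also have "\<dots> = (\<Sum>l<card v. \<Sum>k<card ?w. bw $ k * L $$ (l, k) * y $ l)" by (rule sum.swap)
    also have "\<dots> = scalar_prod g y"
      using c bw y unfolding g_def
      by (auto simp: scalar_prod_def atLeast0LessThan sum_distrib_left mult_ac intro!: sum.cong)
    finally show ?thesis .
  qed
  have "cond_var A b G v = scalar_prod bw ((P - R * N * L) *\<^sub>v bw)"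
    by (simp add: cond_var_def Let_def bw_def P_def R_def N_def L_def Av_def)
  also have "(P - R * N * L) *\<^sub>v bw = P *\<^sub>v bw - (R * N * L) *\<^sub>v bw"
    by (rule minus_mult_distrib_mat_vec) (use c N bw in auto)
  also have "(R * N * L) *\<^sub>v bw = R *\<^sub>v (N *\<^sub>v g)"
    using c N(1) bw assoc_mult_mat_vec[of "R * N" "card ?w" "card v" L "card ?w" bw]
      assoc_mult_mat_vec[of R "card ?w" "card v" N "card v" g] g by (simp add: g_def)
  also have "scalar_prod bw (P *\<^sub>v bw - R *\<^sub>v (N *\<^sub>v g)) = scalar_prod bw (P *\<^sub>v bw) - scalar_prod bw (R *\<^sub>v (N *\<^sub>v g))"
    by (rule scalar_prod_minus_distrib) (use c bw Ng in auto)
  finally have cv: "cond_var A b G v = scalar_prod bw (P *\<^sub>v bw) - scalar_prod g (N *\<^sub>v g)"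
    using RT[OF Ng] by simp
  have AN: "Av *\<^sub>v (N *\<^sub>v g) = g"
    using N g cAv by (simp flip: assoc_mult_mat_vec[of Av "card v" "card v" N "card v" g])
  have uc: "z + 1 \<cdot>\<^sub>v (N *\<^sub>v g) \<in> carrier_vec (card v)" using z Ng by auto
  have "bform Av u u = bform Av z z + bform Av z (N *\<^sub>v g) + (bform Av (N *\<^sub>v g) z + bform Av (N *\<^sub>v g) (N *\<^sub>v g))"
    unfolding u bform_linear(1)[OF cAv z Ng uc] bform_linear(2)[OF cAv z Ng z] bform_linear(2)[OF cAv z Ng Ng]
    by simp
  also have "\<dots> = bform Av z z + 2 * scalar_prod z g + scalar_prod g (N *\<^sub>v g)"
    using bform_commute[OF cAv tAv Ng z] AN comm_scalar_prod[OF Ng g] by simp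
  finally have bu: "bform Av u u = \<dots>" .
  have "bform A x x = (\<Sum>i\<in>G. \<Sum>j\<in>G. x $ i * A $$ (i, j) * x $ j)"
    by (rule bform_supported[OF A(1) G(1) x supp])
  also have "\<dots> = (\<Sum>i\<in>?w. \<Sum>j\<in>?w. x $ i * A $$ (i, j) * x $ j) + (\<Sum>i\<in>?w. \<Sum>j\<in>v. x $ i * A $$ (i, j) * x $ j)
     + ((\<Sum>i\<in>v. \<Sum>j\<in>?w. x $ i * A $$ (i, j) * x $ j) + (\<Sum>i\<in>v. \<Sum>j\<in>v. x $ i * A $$ (i, j) * x $ j))"
  proof -
    have sp: "(\<Sum>i\<in>G. f i) = (\<Sum>i\<in>?w. f i) + (\<Sum>i\<in>v. f i)" for f :: "nat \<Rightarrow> real"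
      using sum.subset_diff[OF G(2), of f] finite_subset[OF G(1)] by simp
    show ?thesis unfolding sp sum.distrib by simp
  qed
  also have "\<dots> = scalar_prod bw (P *\<^sub>v bw) + scalar_prod bw (R *\<^sub>v z) + (scalar_prod z g + bform Av z z)"
    by (simp only: bform_subvector[OF A(1) _ _ x x, symmetric] sub xw P_def[symmetric] R_def[symmetric]
      L_def[symmetric] z_def[symmetric] Av_def[symmetric] g_def[symmetric])
  also have "scalar_prod bw (R *\<^sub>v z) = scalar_prod z g" using RT[OF z] comm_scalar_prod[OF z g] by simp
  finally show "bform A x x = cond_var A b G v + bform (submatrix A v v) u u"
    using bu cv by (simp add: Av_def)
qed

text \<open>
  The vectors competing in the minimisation: the coordinates in \<open>v\<close> are free, as conditioning on
  \<open>X\<^sub>v\<close> allows for the subtraction of any linear combination of them.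
\<close>

definition feasible :: "nat \<Rightarrow> real vec \<Rightarrow> nat set \<Rightarrow> nat set \<Rightarrow> real vec \<Rightarrow> bool" where
  "feasible p b G v x \<longleftrightarrow> x \<in> carrier_vec p \<and> (\<forall>i\<in>G - v. x $ i = b $ i) \<and> (\<forall>i<p. i \<notin> G \<longrightarrow> x $ i = 0)"

lemma cond_var_le:
  assumes A: "A \<in> carrier_mat p p" "sym_pos_def A" and b: "b \<in> carrier_vec p"
    and G: "G \<subseteq> {..<p}" "v \<subseteq> G" and x: "feasible p b G v x"
  shows "cond_var A b G v \<le> bform A x x"
proof -
  have v: "v \<subseteq> {..<p}" using G by auto
  let ?u = "subvector x v + minv (submatrix A v v) *\<^sub>v (submatrix A v (G - v) *\<^sub>v subvector b (G - v))"
  have e: "bform A x x = cond_var A b G v + bform (submatrix A v v) ?u ?u" and u: "?u \<in> carrier_vec (card v)"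
    using cond_var_complete_square[OF A b G, of x] x by (simp_all add: feasible_def)
  have "0 \<le> bform (submatrix A v v) ?u ?u"
  proof (cases "?u = 0\<^sub>v (card v)")
    case True
    then show ?thesis using submatrix_carrier[OF A(1) v v] by (simp only: True) simp
  next
    case False
    then show ?thesis
      using sym_pos_def_submatrix[OF A v] submatrix_carrier[OF A(1) v v] u
      unfolding sym_pos_def_def by (intro less_imp_le) simp
  qed
  then show ?thesis using e by linarith
qed

lemma cond_var_attained:
  assumes A: "A \<in> carrier_mat p p" "sym_pos_def A" and b: "b \<in> carrier_vec p"
    and G: "G \<subseteq> {..<p}" "v \<subseteq> G"
  obtains x where "feasible p b G v x" "bform A x x = cond_var A b G v"
proof -
  have v: "v \<subseteq> {..<p}" and w: "G - v \<subseteq> {..<p}" using G by auto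
  let ?g = "minv (submatrix A v v) *\<^sub>v (submatrix A v (G - v) *\<^sub>v subvector b (G - v))"
  note cA = submatrix_carrier[OF A(1) v v]
  have g: "?g \<in> carrier_vec (card v)"
    using sym_pos_def_minv(1)[OF cA sym_pos_def_submatrix[OF A v]] by (intro carrier_vecI) simp
  then have "- ?g \<in> carrier_vec (card v)" by simp
  then obtain y where y: "y \<in> carrier_vec p" "subvector y v = - ?g" "\<And>i. i < p \<Longrightarrow> i \<notin> v \<Longrightarrow> y $ i = 0"
    using embed_subvector[OF _ v] by metis
  \<comment> \<open>the free coordinates are chosen such that the completed square vanishes\<close>
  define x where "x = vec p (\<lambda>i. if i \<in> G - v then b $ i else y $ i)"
  have x: "x \<in> carrier_vec p" by (simp add: x_def)
  have f: "feasible p b G v x" using x G y(3) by (auto simp: feasible_def x_def)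
  have "subvector x v = subvector y v"
  proof (rule eq_vecI)
    fix k assume "k < dim_vec (subvector y v)"
    then have k: "k < card v" using subvector_carrier[OF y(1) v] by simp
    show "subvector x v $ k = subvector y v $ k"
      unfolding subvector_index[OF x v k] subvector_index[OF y(1) v k]
      using pick_in_set_le[OF k] v by (auto simp: x_def)
  qed (use subvector_carrier[OF x v] subvector_carrier[OF y(1) v] in simp)
  then have u: "subvector x v + ?g = 0\<^sub>v (card v)"
    using y(2) g by simp
  have "bform A x x = cond_var A b G v + bform (submatrix A v v) (subvector x v + ?g) (subvector x v + ?g)"
    using cond_var_complete_square(1)[OF A b G, of x] f by (simp add: feasible_def)
  then have "bform A x x = cond_var A b G v" unfolding u using cA by simp
  then show ?thesis using that f by blast
qed

section \<open>Shapley effects of block diagonal covariance matrices\<close>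

lemma bform_add_disconnected:
  assumes A: "A \<in> carrier_mat p p" "transpose_mat A = A" and x: "x \<in> carrier_vec p" and y: "y \<in> carrier_vec p"
    and zero: "\<And>i j. i < p \<Longrightarrow> j < p \<Longrightarrow> x $ i \<noteq> 0 \<Longrightarrow> y $ j \<noteq> 0 \<Longrightarrow> A $$ (i, j) = 0"
  shows "bform A (x + y) (x + y) = bform A x x + bform A y y"
proof -
  have c: "x + 1 \<cdot>\<^sub>v y \<in> carrier_vec p" using x y by auto
  have "bform A x y = 0"
    unfolding bform_sum[OF A(1) x y] using zero by (intro sum.neutral ballI) (metis lessThan_iff mult_eq_0_iff)
  moreover have "bform A (x + 1 \<cdot>\<^sub>v y) (x + 1 \<cdot>\<^sub>v y) = bform A x x + bform A x y + (bform A y x + bform A y y)"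
    unfolding bform_linear(1)[OF A(1) x y c] bform_linear(2)[OF A(1) x y x] bform_linear(2)[OF A(1) x y y]
    by simp
  ultimately show ?thesis using bform_commute[OF A y x] by simp
qed

text \<open>
  Minimising a sum of two forms in separate coordinates can be done separately: competitors on \<open>H\<close>
  and \<open>G - H\<close> add up to a competitor on \<open>G\<close>, and conversely a competitor on \<open>G\<close> can be cut.
\<close>

lemma cond_var_split:
  assumes A: "A \<in> carrier_mat p p" "sym_pos_def A" and b: "b \<in> carrier_vec p"
    and G: "G \<subseteq> {..<p}" "v \<subseteq> G" and H: "H \<subseteq> G"
    and zero: "\<And>i j. i \<in> H \<Longrightarrow> j \<in> G - H \<Longrightarrow> A $$ (i, j) = 0"
  shows "cond_var A b G v = cond_var A b H (v \<inter> H) + cond_var A b (G - H) (v - H)"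
proof (rule antisym)
  have t: "transpose_mat A = A" using A by (simp add: sym_pos_def_def)
  have sub: "H \<subseteq> {..<p}" "G - H \<subseteq> {..<p}" "v \<inter> H \<subseteq> H" "v - H \<subseteq> G - H" using G H by auto
  have sum: "bform A (x + y) (x + y) = bform A x x + bform A y y"
    if "x \<in> carrier_vec p" "y \<in> carrier_vec p"
      "\<And>i. i < p \<Longrightarrow> i \<notin> H \<Longrightarrow> x $ i = 0" "\<And>i. i < p \<Longrightarrow> i \<notin> G - H \<Longrightarrow> y $ i = 0" for x y
    using that zero by (intro bform_add_disconnected[OF A(1) t]) blast+
  show "cond_var A b G v \<le> cond_var A b H (v \<inter> H) + cond_var A b (G - H) (v - H)"
  proof -
    obtain x where x: "feasible p b H (v \<inter> H) x" "bform A x x = cond_var A b H (v \<inter> H)"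
      using cond_var_attained[OF A b sub(1,3)] by blast
    obtain y where y: "feasible p b (G - H) (v - H) y" "bform A y y = cond_var A b (G - H) (v - H)"
      using cond_var_attained[OF A b sub(2,4)] by blast
    have "feasible p b G v (x + y)"
      unfolding feasible_def
    proof (intro conjI ballI allI impI)
      show "x + y \<in> carrier_vec p" using x y by (simp add: feasible_def)
      fix i assume i: "i \<in> G - v"
      then have ip: "i < p" using G by auto
      show "(x + y) $ i = b $ i"
        using i ip x(1) y(1) by (cases "i \<in> H") (auto simp: feasible_def)
    next
      fix i assume "i < p" "i \<notin> G"
      then show "(x + y) $ i = 0" using x(1) y(1) H by (auto simp: feasible_def)
    qed
    then have "cond_var A b G v \<le> bform A (x + y) (x + y)" by (rule cond_var_le[OF A b G])
    also have "\<dots> = bform A x x + bform A y y"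
      using x(1) y(1) by (intro sum) (auto simp: feasible_def)
    finally show ?thesis using x y by simp
  qed
  show "cond_var A b H (v \<inter> H) + cond_var A b (G - H) (v - H) \<le> cond_var A b G v"
  proof -
    obtain z where z: "feasible p b G v z" "bform A z z = cond_var A b G v"
      using cond_var_attained[OF A b G] by blast
    define x where "x = vec p (\<lambda>i. if i \<in> H then z $ i else 0)"
    define y where "y = vec p (\<lambda>i. if i \<in> G - H then z $ i else 0)"
    have xy: "x \<in> carrier_vec p" "y \<in> carrier_vec p" by (simp_all add: x_def y_def)
    have "z = x + y" using z(1) H by (intro eq_vecI) (auto simp: x_def y_def feasible_def)
    moreover have "bform A (x + y) (x + y) = bform A x x + bform A y y"
      by (intro sum xy) (auto simp: x_def y_def)
    moreover have "cond_var A b H (v \<inter> H) \<le> bform A x x"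
      using z(1) G H by (intro cond_var_le[OF A b sub(1,3)]) (auto simp: feasible_def x_def subset_eq)
    moreover have "cond_var A b (G - H) (v - H) \<le> bform A y y"
      using z(1) G H by (intro cond_var_le[OF A b sub(2,4)]) (auto simp: feasible_def y_def subset_eq)
    ultimately show ?thesis using z(2) by simp
  qed
qed

text \<open>
  This identity says that the Shapley weights are consistent: in a game of \<open>g + 1\<close> players, a
  coalition of \<open>k\<close> of them and its extension by an irrelevant player together have the weight that
  the former has in the game without the irrelevant player.
\<close>

lemma inverse_binomial_sum:
  assumes "k < g"
  shows "1 / real (g choose k) + 1 / real (g choose Suc k) = (real g + 1) / (real g * real ((g - 1) choose k))"
proof -
  obtain h where g: "g = Suc h" using assms by (cases g) auto
  have k: "k \<le> h" using assms g by simp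
  define c where "c = real (h choose k)"
  have c: "c > 0" using k by (simp add: c_def)
  have "(Suc h - k) * (Suc h choose k) = Suc h * (h choose k)"
    using binomial_absorb_comp[of "Suc h" k] by simp
  then have "real ((Suc h - k) * (Suc h choose k)) = real (Suc h * (h choose k))" by (rule arg_cong)
  then have 1: "(real g - real k) * real (g choose k) = real g * c"
    using k unfolding c_def g of_nat_mult by (simp add: of_nat_diff)
  have 2: "real (Suc k) * real (g choose Suc k) = real g * c"
    unfolding c_def g by (simp only: of_nat_mult[symmetric] Suc_times_binomial)
  have p: "real (g choose k) > 0" "real (g choose Suc k) > 0" using assms by auto
  have "1 / real (g choose k) = (real g - real k) / (real g * c)"
    unfolding 1[symmetric] using p assms by simp
  moreover have "1 / real (g choose Suc k) = real (Suc k) / (real g * c)"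
    unfolding 2[symmetric] using p by simp
  ultimately have "1 / real (g choose k) + 1 / real (g choose Suc k) = (real g - real k + real (Suc k)) / (real g * c)"
    by (simp only: add_divide_distrib)
  then show ?thesis by (simp add: c_def g)
qed

lemma shapley_average_insert:
  fixes f :: "nat set \<Rightarrow> real"
  assumes G: "finite G" "i \<in> G" "x \<notin> G" and f: "\<And>u. u \<subseteq> G \<Longrightarrow> f (insert x u) = f u"
  shows "(1 / real (card (insert x G))) * (\<Sum>u\<in>Pow (insert x G - {i}). 1 / real ((card (insert x G) - 1) choose card u) * f u)
    = (1 / real (card G)) * (\<Sum>u\<in>Pow (G - {i}). 1 / real ((card G - 1) choose card u) * f u)"
proof -
  let ?g = "card G"
  have g: "?g > 0" using G card_gt_0_iff by blast
  have e: "insert x G - {i} = insert x (G - {i})" using G by auto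
  have c: "card (insert x G) = Suc ?g" using G by simp
  have fin: "finite (Pow (G - {i}))" using G by simp
  have inj: "inj_on (insert x) (Pow (G - {i}))"
    using G by (intro inj_onI) (metis DiffD1 PowD insert_ident subset_iff)
  have dj: "Pow (G - {i}) \<inter> insert x ` Pow (G - {i}) = {}" using G by auto
  have "(\<Sum>u\<in>Pow (insert x G - {i}). 1 / real (?g choose card u) * f u)
     = (\<Sum>u\<in>Pow (G - {i}). 1 / real (?g choose card u) * f u)
       + (\<Sum>u\<in>Pow (G - {i}). 1 / real (?g choose card (insert x u)) * f (insert x u))"
    unfolding e Pow_insert using fin dj by (simp add: sum.union_disjoint sum.reindex[OF inj])
  also have "\<dots> = (\<Sum>u\<in>Pow (G - {i}). (real ?g + 1) / (real ?g * real ((?g - 1) choose card u)) * f u)"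
    unfolding sum.distrib[symmetric]
  proof (rule sum.cong[OF refl])
    fix u assume u: "u \<in> Pow (G - {i})"
    then have "finite u" "x \<notin> u" "u \<subseteq> G" using G finite_subset[of u G] by auto
    moreover have "card u < ?g" using u G by (intro psubset_card_mono) auto
    ultimately have u': "f (insert x u) = f u" "card (insert x u) = Suc (card u)" "card u < ?g"
      using f by auto
    show "1 / real (?g choose card u) * f u + 1 / real (?g choose card (insert x u)) * f (insert x u)
       = (real ?g + 1) / (real ?g * real ((?g - 1) choose card u)) * f u"
      by (simp only: u'(1,2) inverse_binomial_sum[OF u'(3), symmetric] distrib_right)
  qed
  also have "\<dots> = (real ?g + 1) / real ?g * (\<Sum>u\<in>Pow (G - {i}). 1 / real ((?g - 1) choose card u) * f u)"
    by (simp add: sum_distrib_left divide_inverse mult_ac)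
  finally show ?thesis unfolding c using g by (simp add: field_simps)
qed

text \<open>
  Players without influence are removed one at a time.
\<close>

lemma shapley_average_restrict:
  fixes f :: "nat set \<Rightarrow> real"
  assumes D: "finite D" and H: "finite H" "i \<in> H" "D \<inter> H = {}"
  shows "(1 / real (card (H \<union> D))) * (\<Sum>u\<in>Pow (H \<union> D - {i}). 1 / real ((card (H \<union> D) - 1) choose card u) * f (u \<inter> H))
    = (1 / real (card H)) * (\<Sum>u\<in>Pow (H - {i}). 1 / real ((card H - 1) choose card u) * f u)"
  using D H(3)
proof (induction D)
  case empty
  have "u \<inter> H = u" if "u \<in> Pow (H - {i})" for u using that by auto
  then show ?case by simp
next
  case (insert x D)
  have "x \<notin> H \<union> D" using insert by auto
  moreover have "f (insert x u \<inter> H) = f (u \<inter> H)" for u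
    using insert.prems by (auto intro!: arg_cong[of _ _ f])
  ultimately show ?case
    using shapley_average_insert[of "H \<union> D" i x "\<lambda>u. f (u \<inter> H)"] insert H by simp
qed

lemma shapley_weights_sum:
  fixes G :: "nat set"
  assumes "finite G" "i \<in> G"
  shows "(1 / real (card G)) * (\<Sum>u\<in>Pow (G - {i}). 1 / real ((card G - 1) choose card u)) = 1"
proof -
  have eq: "{i} \<union> (G - {i}) = G" using assms by auto
  have "(1 / real (card G)) * (\<Sum>u\<in>Pow (G - {i}). 1 / real ((card G - 1) choose card u) * 1)
      = (1 / real (card {i})) * (\<Sum>u\<in>Pow ({i} - {i}). 1 / real ((card {i} - 1) choose card u) * 1)"
    by (rule shapley_average_restrict[of "G - {i}" "{i}" i "\<lambda>_. 1", unfolded eq]) (use assms in auto)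
  also have "\<dots> = 1" by simp
  finally show ?thesis by (simp only: mult_1_right)
qed

text \<open>
  The numerator of a Shapley effect. It depends on the block of \<open>i\<close> only, whereas the variance in
  the denominator involves all coordinates, and the two are perturbed separately.
\<close>

definition shapley_num :: "real mat \<Rightarrow> real vec \<Rightarrow> nat set \<Rightarrow> nat \<Rightarrow> real" where
  "shapley_num \<Gamma> b G i = 1 / real (card G) *
     (\<Sum>u\<in>Pow (G - {i}). 1 / real ((card G - 1) choose card u) * (cond_var \<Gamma> b G u - cond_var \<Gamma> b G (insert i u)))"

lemma shapley_on_eq: "shapley_on \<Gamma> b G i = shapley_num \<Gamma> b G i / bform \<Gamma> b b"
  by (simp add: shapley_on_def shapley_num_def)

text \<open>
  If the entries linking \<open>H\<close> to the rest of \<open>G\<close> vanish, the coordinates outside \<open>H\<close> contribute the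
  same amount to both conditional variances of a term, and the increments depend on \<open>u \<inter> H\<close> only.
\<close>

lemma shapley_num_reduce:
  assumes A: "A \<in> carrier_mat p p" "sym_pos_def A" and b: "b \<in> carrier_vec p"
    and G: "G \<subseteq> {..<p}" and H: "H \<subseteq> G" "i \<in> H"
    and zero: "\<And>i j. i \<in> H \<Longrightarrow> j \<in> G - H \<Longrightarrow> A $$ (i, j) = 0"
  shows "shapley_num A b G i = shapley_num A b H i"
proof -
  let ?f = "\<lambda>w. cond_var A b H w - cond_var A b H (insert i w)"
  have fin: "finite G" using G finite_subset by blast
  have "cond_var A b G u - cond_var A b G (insert i u) = ?f (u \<inter> H)" if "u \<in> Pow (G - {i})" for u
  proof -
    have u: "u \<subseteq> G" "insert i u \<subseteq> G" using that H by auto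
    have "insert i u \<inter> H = insert i (u \<inter> H)" "insert i u - H = u - H" using H by auto
    then show ?thesis
      using cond_var_split[OF A b G u(1) H(1) zero] cond_var_split[OF A b G u(2) H(1) zero] by simp
  qed
  then have "shapley_num A b G i = 1 / real (card G) *
     (\<Sum>u\<in>Pow (G - {i}). 1 / real ((card G - 1) choose card u) * ?f (u \<inter> H))"
    unfolding shapley_num_def by (intro arg_cong2[of _ _ _ _ "(*)"] sum.cong) auto
  also have "\<dots> = shapley_num A b H i"
  proof -
    have "H \<union> (G - H) = G" "(G - H) \<inter> H = {}" "finite H" using H finite_subset[OF _ fin] by auto
    then show ?thesis
      using shapley_average_restrict[of "G - H" H i ?f] fin H by (simp add: shapley_num_def)
  qed
  finally show ?thesis .
qed

section \<open>Perturbation of the numerators of Shapley effects\<close>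

definition norm_on :: "nat set \<Rightarrow> real vec \<Rightarrow> real" where
  "norm_on G x = L2_set (\<lambda>i. x $ i) G"

lemma norm_on_sq: "(norm_on G x)\<^sup>2 = (\<Sum>i\<in>G. (x $ i)\<^sup>2)"
  by (simp add: norm_on_def L2_set_def sum_nonneg)

lemma norm_on_nonneg: "0 \<le> norm_on G x" by (simp add: norm_on_def)

lemma norm_on_supported:
  assumes "x \<in> carrier_vec p" "G \<subseteq> {..<p}" "\<And>i. i < p \<Longrightarrow> i \<notin> G \<Longrightarrow> x $ i = 0"
  shows "scalar_prod x x = (norm_on G x)\<^sup>2"
proof -
  have "(norm_on G x)\<^sup>2 = (\<Sum>i\<in>G. x $ i * x $ i)" unfolding norm_on_sq by (simp add: power2_eq_square)
  then show ?thesis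
    using assms(2,3) by (simp only: scalar_prod_sum[OF assms(1,1)]) (intro sum.mono_neutral_right, auto)
qed

lemma cond_var_bounds:
  assumes A: "form_between p c K A" "0 < c" "0 < K" and b: "b \<in> carrier_vec p"
    and G: "G \<subseteq> {..<p}" "v \<subseteq> G"
  shows "0 \<le> cond_var A b G v" "cond_var A b G v \<le> K * (norm_on G b)\<^sup>2"
proof -
  have cA: "A \<in> carrier_mat p p" "sym_pos_def A"
    using A form_between_sym_pos_def by (auto simp: form_between_def)
  obtain x where x: "feasible p b G v x" "bform A x x = cond_var A b G v"
    using cond_var_attained[OF cA b G] by blast
  then show "0 \<le> cond_var A b G v"
    using form_between_nonneg[OF A(1), of x] A by (simp add: feasible_def)
  define y where "y = vec p (\<lambda>i. if i \<in> G then b $ i else 0)"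
  have y: "feasible p b G v y" "y \<in> carrier_vec p" using G by (auto simp: feasible_def y_def)
  have "cond_var A b G v \<le> bform A y y" by (rule cond_var_le[OF cA b G y(1)])
  also have "\<dots> \<le> K * scalar_prod y y" using A y by (simp add: form_between_def)
  also have "scalar_prod y y = (norm_on G y)\<^sup>2"
    by (rule norm_on_supported[OF y(2) G(1)]) (simp add: y_def)
  also have "norm_on G y = norm_on G b"
    unfolding norm_on_def using G by (intro L2_set_cong) (auto simp: y_def)
  finally show "cond_var A b G v \<le> K * (norm_on G b)\<^sup>2" .
qed

lemma bform_diff_le:
  assumes A: "A \<in> carrier_mat p p" "A' \<in> carrier_mat p p" and G: "G \<subseteq> {..<p}" "card G \<le> m"
    and x: "x \<in> carrier_vec p" "\<And>i. i < p \<Longrightarrow> i \<notin> G \<Longrightarrow> x $ i = 0"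
    and e: "\<And>i j. i \<in> G \<Longrightarrow> j \<in> G \<Longrightarrow> \<bar>A' $$ (i, j) - A $$ (i, j)\<bar> \<le> e" "0 \<le> e"
  shows "\<bar>bform A' x x - bform A x x\<bar> \<le> e * real m * (norm_on G x)\<^sup>2"
proof -
  have fin: "finite G" using G finite_subset by blast
  have "bform A' x x - bform A x x = (\<Sum>i\<in>G. \<Sum>j\<in>G. x $ i * (A' $$ (i, j) - A $$ (i, j)) * x $ j)"
  proof -
    have "bform A x x = (\<Sum>i\<in>G. \<Sum>j\<in>G. x $ i * A $$ (i, j) * x $ j)"
      by (rule bform_supported[OF A(1) G(1) x])
    moreover have "bform A' x x = (\<Sum>i\<in>G. \<Sum>j\<in>G. x $ i * A' $$ (i, j) * x $ j)"
      by (rule bform_supported[OF A(2) G(1) x])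
    ultimately show ?thesis
      by (simp only: sum_subtractf[symmetric] right_diff_distrib left_diff_distrib)
  qed
  also have "\<bar>\<dots>\<bar> \<le> (\<Sum>i\<in>G. \<Sum>j\<in>G. e * (\<bar>x $ i\<bar> * \<bar>x $ j\<bar>))"
  proof (intro order.trans[OF sum_abs] sum_mono)
    fix i j assume "i \<in> G" "j \<in> G"
    then show "\<bar>x $ i * (A' $$ (i, j) - A $$ (i, j)) * x $ j\<bar> \<le> e * (\<bar>x $ i\<bar> * \<bar>x $ j\<bar>)"
      using mult_right_mono[OF e(1)[of i j], of "\<bar>x $ i\<bar> * \<bar>x $ j\<bar>"] by (simp add: abs_mult mult_ac)
  qed
  also have "\<dots> = e * (\<Sum>i\<in>G. \<bar>x $ i\<bar> * 1)\<^sup>2"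
  proof -
    have "(\<Sum>i\<in>G. \<bar>x $ i\<bar> * 1)\<^sup>2 = (\<Sum>i\<in>G. \<Sum>j\<in>G. \<bar>x $ i\<bar> * \<bar>x $ j\<bar>)"
      by (simp add: power2_eq_square sum_product)
    then show ?thesis by (simp only: sum_distrib_left)
  qed
  also have "\<dots> \<le> e * ((\<Sum>i\<in>G. \<bar>x $ i\<bar>\<^sup>2) * (\<Sum>i\<in>G. 1\<^sup>2))"
    using e by (intro mult_left_mono Cauchy_Schwarz_ineq_sum) auto
  also have "\<dots> = e * (real (card G) * (norm_on G x)\<^sup>2)" by (simp add: norm_on_sq)
  also have "\<dots> \<le> e * (real m * (norm_on G x)\<^sup>2)"
    using G e by (intro mult_left_mono mult_right_mono) auto
  finally show ?thesis by (simp add: mult.assoc)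
qed

text \<open>
  The minimiser \<open>x\<close> for \<open>(A, b)\<close>, corrected by \<open>b' - b\<close> on the fixed coordinates, is a competitor
  for \<open>(A', b')\<close>. Its norm is controlled by \<open>c |x|\<^sup>2 \<le> x\<^sup>T A x \<le> K |b|\<^sup>2\<close>, so no derivative of the
  inverse matrix is needed.
\<close>

lemma cond_var_perturb:
  assumes A: "form_between p c K A" and A': "form_between p c K A'" and cK: "0 < c" "0 < K"
    and b: "b \<in> carrier_vec p" "b' \<in> carrier_vec p"
    and G: "G \<subseteq> {..<p}" "card G \<le> m" "v \<subseteq> G"
    and e: "\<And>i j. i \<in> G \<Longrightarrow> j \<in> G \<Longrightarrow> \<bar>A' $$ (i, j) - A $$ (i, j)\<bar> \<le> e" "0 \<le> e"
    and R: "norm_on G b \<le> R"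
  shows "cond_var A' b' G v \<le> cond_var A b G v + e * real m * (K / c) * R\<^sup>2
     + 2 * K * sqrt (K / c) * R * norm_on G (b' - b) + K * (norm_on G (b' - b))\<^sup>2"
proof -
  let ?t = "norm_on G (b' - b)"
  have cA: "A \<in> carrier_mat p p" "sym_pos_def A" and cA': "A' \<in> carrier_mat p p" "sym_pos_def A'"
    and t': "transpose_mat A' = A'"
    using A A' cK form_between_sym_pos_def by (auto simp: form_between_def)
  obtain x where x: "feasible p b G v x" "bform A x x = cond_var A b G v"
    using cond_var_attained[OF cA b(1) G(1,3)] by blast
  have xc: "x \<in> carrier_vec p" and xs: "\<And>i. i < p \<Longrightarrow> i \<notin> G \<Longrightarrow> x $ i = 0"
    using x by (auto simp: feasible_def)
  have xx: "scalar_prod x x = (norm_on G x)\<^sup>2" by (rule norm_on_supported[OF xc G(1) xs])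
  have "c * (norm_on G x)\<^sup>2 \<le> K * (norm_on G b)\<^sup>2"
  proof -
    have "c * (norm_on G x)\<^sup>2 \<le> bform A x x" using A xc by (simp add: form_between_def flip: xx)
    also have "\<dots> \<le> K * (norm_on G b)\<^sup>2" using cond_var_bounds(2)[OF A cK b(1) G(1,3)] x by simp
    finally show ?thesis .
  qed
  moreover have "(norm_on G b)\<^sup>2 \<le> R\<^sup>2" using R by (intro power_mono norm_on_nonneg) auto
  ultimately have "c * (norm_on G x)\<^sup>2 \<le> K * R\<^sup>2" using cK by (smt (verit) mult_left_mono)
  then have nx: "(norm_on G x)\<^sup>2 \<le> K / c * R\<^sup>2" using cK by (simp add: field_simps)
  have R0: "0 \<le> R" using R norm_on_nonneg[of G b] by linarith
  have nx': "norm_on G x \<le> sqrt (K / c) * R"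
  proof -
    have "norm_on G x = sqrt ((norm_on G x)\<^sup>2)" using norm_on_nonneg by simp
    also have "\<dots> \<le> sqrt (K / c * R\<^sup>2)" by (rule real_sqrt_le_mono[OF nx])
    also have "\<dots> = sqrt (K / c) * sqrt (R\<^sup>2)" by (rule real_sqrt_mult)
    finally show ?thesis using R0 by simp
  qed
  define h where "h = vec p (\<lambda>i. if i \<in> G - v then b' $ i - b $ i else 0)"
  have h: "h \<in> carrier_vec p" by (simp add: h_def)
  have "(norm_on G h)\<^sup>2 \<le> ?t\<^sup>2"
    unfolding norm_on_sq using G b by (intro sum_mono) (auto simp: h_def subset_eq)
  then have nh: "norm_on G h \<le> ?t" using norm_on_nonneg power2_le_imp_le by blast
  have hh: "scalar_prod h h = (norm_on G h)\<^sup>2" using h G(1) by (rule norm_on_supported) (simp add: h_def)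
  have f: "feasible p b' G v (x + h)"
    using x(1) h G unfolding feasible_def by (auto simp: h_def)
  have xh: "x + 1 \<cdot>\<^sub>v h \<in> carrier_vec p" using xc h by auto
  have "cond_var A' b' G v \<le> bform A' (x + h) (x + h)" by (rule cond_var_le[OF cA' b(2) G(1,3) f])
  also have "\<dots> = bform A' (x + 1 \<cdot>\<^sub>v h) (x + 1 \<cdot>\<^sub>v h)" by simp
  also have "\<dots> = bform A' x x + bform A' x h + (bform A' h x + bform A' h h)"
    unfolding bform_linear(1)[OF cA'(1) xc h xh] bform_linear(2)[OF cA'(1) xc h xc] bform_linear(2)[OF cA'(1) xc h h]
    by simp
  also have "\<dots> = bform A' x x + 2 * bform A' x h + bform A' h h"
    using bform_commute[OF cA'(1) t' h xc] by simp
  also have "bform A' x x \<le> bform A x x + e * real m * (norm_on G x)\<^sup>2"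
    using bform_diff_le[OF cA(1) cA'(1) G(1,2) xc xs e] by simp
  also have "e * real m * (norm_on G x)\<^sup>2 \<le> e * real m * (K / c * R\<^sup>2)"
    using nx e by (intro mult_left_mono) auto
  also have "bform A' h h \<le> K * ?t\<^sup>2"
  proof -
    have "bform A' h h \<le> K * (norm_on G h)\<^sup>2" using A' h by (simp add: form_between_def flip: hh)
    also have "\<dots> \<le> K * ?t\<^sup>2" using nh cK by (intro mult_left_mono power_mono) (simp_all add: norm_on_nonneg)
    finally show ?thesis .
  qed
  also have "bform A' x h \<le> K * (sqrt (K / c) * R) * ?t"
  proof -
    have nn: "0 \<le> bform A' z z" if "z \<in> carrier_vec p" for z using form_between_nonneg[OF A' _ that] cK by simp
    have "(bform A' x h)\<^sup>2 \<le> bform A' x x * bform A' h h"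
      by (rule bform_Cauchy_Schwarz[OF cA'(1) t' nn xc h])
    also have "\<dots> \<le> (K * (norm_on G x)\<^sup>2) * (K * (norm_on G h)\<^sup>2)"
      using A' xc h nn cK by (intro mult_mono) (auto simp: form_between_def xx[symmetric] hh[symmetric] scalar_prod_self_nonneg)
    also have "\<dots> = (K * norm_on G x * norm_on G h)\<^sup>2" by (simp add: power2_eq_square)
    finally have "(bform A' x h)\<^sup>2 \<le> (K * norm_on G x * norm_on G h)\<^sup>2" .
    moreover have "0 \<le> K * norm_on G x * norm_on G h"
      using cK by (simp add: norm_on_nonneg)
    ultimately have "bform A' x h \<le> K * norm_on G x * norm_on G h"
      by (rule power2_le_imp_le)
    also have "\<dots> \<le> K * (sqrt (K / c) * R) * ?t"
      using cK nx' nh R0 by (intro mult_mono mult_left_mono) (simp_all add: norm_on_nonneg)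
    finally show ?thesis .
  qed
  finally show ?thesis using x(2) by (simp add: algebra_simps)
qed

definition perturb_const :: "real \<Rightarrow> real \<Rightarrow> nat \<Rightarrow> real" where
  "perturb_const c K m = real m * (K / c) + 2 * K * sqrt (K / c) + K"

text \<open>
  The one-sided estimate is used twice, with the roles of the two pairs exchanged. In the second
  use \<open>R\<close> has to bound \<open>b'\<close> and becomes \<open>R + |b' - b|\<close>, which is the origin of the factors 2 and
  3.
\<close>

lemma cond_var_perturb_abs:
  assumes A: "form_between p c K A" and A': "form_between p c K A'" and cK: "0 < c" "0 < K"
    and b: "b \<in> carrier_vec p" "b' \<in> carrier_vec p"
    and G: "G \<subseteq> {..<p}" "card G \<le> m" "v \<subseteq> G"
    and e: "\<And>i j. i \<in> G \<Longrightarrow> j \<in> G \<Longrightarrow> \<bar>A' $$ (i, j) - A $$ (i, j)\<bar> \<le> e" "0 \<le> e" "e \<le> 1"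
    and R: "norm_on G b \<le> R"
  shows "\<bar>cond_var A' b' G v - cond_var A b G v\<bar>
     \<le> perturb_const c K m * (2 * R\<^sup>2 * e + 3 * (norm_on G (b' - b))\<^sup>2 + R * norm_on G (b' - b))"
proof -
  define t where "t = norm_on G (b' - b)"
  have t: "0 \<le> t" by (simp add: t_def norm_on_nonneg)
  have R0: "0 \<le> R" using R norm_on_nonneg[of G b] by linarith
  have sy: "norm_on G (b - b') = t"
    unfolding t_def norm_on_def L2_set_def using b G
    by (intro arg_cong[of _ _ sqrt] sum.cong) (auto simp: power2_commute subset_eq)
  have "norm_on G b' \<le> norm_on G b + t"
  proof -
    have "norm_on G b' = L2_set (\<lambda>i. b $ i + (b' - b) $ i) G"
      unfolding norm_on_def using b G by (intro L2_set_cong) (auto simp: subset_eq)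
    also have "\<dots> \<le> norm_on G b + t" unfolding norm_on_def t_def by (rule L2_set_triangle_ineq)
    finally show ?thesis .
  qed
  then have R': "norm_on G b' \<le> R + t" and R'': "norm_on G b \<le> R + t" using R t by auto
  have e': "\<bar>A $$ (i, j) - A' $$ (i, j)\<bar> \<le> e" if "i \<in> G" "j \<in> G" for i j
    using e(1)[OF that] by (simp add: abs_minus_commute)
  have "\<bar>cond_var A' b' G v - cond_var A b G v\<bar> \<le> e * real m * (K / c) * (R + t)\<^sup>2
     + 2 * K * sqrt (K / c) * (R + t) * t + K * t\<^sup>2"
    using cond_var_perturb[OF A A' cK b G e(1,2) R''] cond_var_perturb[OF A' A cK b(2,1) G e' e(2) R']
    by (simp add: sy flip: t_def)
  also have "\<dots> \<le> perturb_const c K m * (2 * R\<^sup>2 * e + 3 * t\<^sup>2 + R * t)"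
  proof -
    let ?X = "2 * R\<^sup>2 * e + 3 * t\<^sup>2 + R * t"
    have "0 \<le> (R - t)\<^sup>2" by simp
    then have "(R + t)\<^sup>2 \<le> 2 * R\<^sup>2 + 2 * t\<^sup>2" by (simp add: power2_eq_square algebra_simps)
    then have "e * (R + t)\<^sup>2 \<le> e * (2 * R\<^sup>2 + 2 * t\<^sup>2)" using e by (intro mult_left_mono) auto
    also have "\<dots> \<le> 2 * R\<^sup>2 * e + 2 * t\<^sup>2"
      using mult_right_mono[OF e(3), of "t\<^sup>2"] by (simp add: algebra_simps)
    also have "\<dots> \<le> ?X" using R0 t by simp
    finally have "e * (R + t)\<^sup>2 \<le> ?X" .
    moreover have "(R + t) * t \<le> ?X" "t\<^sup>2 \<le> ?X"
      using R0 t e by (auto simp: power2_eq_square algebra_simps intro!: add_nonneg_nonneg mult_nonneg_nonneg)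
    ultimately have "real m * (K / c) * (e * (R + t)\<^sup>2) + 2 * K * sqrt (K / c) * ((R + t) * t) + K * t\<^sup>2
       \<le> real m * (K / c) * ?X + 2 * K * sqrt (K / c) * ?X + K * ?X"
      using cK by (intro add_mono mult_left_mono) auto
    then show ?thesis by (simp add: perturb_const_def algebra_simps)
  qed
  finally show ?thesis by (simp add: t_def)
qed

lemma weighted_average_le:
  fixes w g :: "'b \<Rightarrow> real"
  assumes "\<And>u. u \<in> U \<Longrightarrow> 0 \<le> w u" "\<And>u. u \<in> U \<Longrightarrow> \<bar>g u\<bar> \<le> M" "0 \<le> s" "s * (\<Sum>u\<in>U. w u) = 1"
  shows "\<bar>s * (\<Sum>u\<in>U. w u * g u)\<bar> \<le> M"
proof -
  have "\<bar>s * (\<Sum>u\<in>U. w u * g u)\<bar> \<le> s * (\<Sum>u\<in>U. w u * M)"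
    unfolding abs_mult using assms(1-3)
    by (intro mult_mono order.trans[OF sum_abs] sum_mono) (auto simp: abs_mult intro!: mult_mono sum_nonneg)
  also have "\<dots> = M * (s * (\<Sum>u\<in>U. w u))" by (simp add: sum_distrib_left mult_ac)
  finally show ?thesis using assms(4) by simp
qed

lemma shapley_num_perturb:
  assumes A: "form_between p c K A" and A': "form_between p c K A'" and cK: "0 < c" "0 < K"
    and b: "b \<in> carrier_vec p" "b' \<in> carrier_vec p"
    and G: "G \<subseteq> {..<p}" "card G \<le> m" "i \<in> G"
    and e: "\<And>i j. i \<in> G \<Longrightarrow> j \<in> G \<Longrightarrow> \<bar>A' $$ (i, j) - A $$ (i, j)\<bar> \<le> e" "0 \<le> e" "e \<le> 1"
    and R: "norm_on G b \<le> R"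
  shows "\<bar>shapley_num A' b' G i - shapley_num A b G i\<bar>
     \<le> 2 * (perturb_const c K m * (2 * R\<^sup>2 * e + 3 * (norm_on G (b' - b))\<^sup>2 + R * norm_on G (b' - b)))"
    (is "_ \<le> 2 * ?M")
proof -
  have fin: "finite G" using G finite_subset by blast
  let ?d = "\<lambda>v. cond_var A' b' G v - cond_var A b G v"
  have "shapley_num A' b' G i - shapley_num A b G i
     = 1 / real (card G) * (\<Sum>u\<in>Pow (G - {i}). 1 / real ((card G - 1) choose card u) * (?d u - ?d (insert i u)))"
    unfolding shapley_num_def right_diff_distrib[symmetric] sum_subtractf[symmetric]
    by (intro arg_cong2[of _ _ _ _ "(*)"] sum.cong refl) (simp add: algebra_simps)
  also have "\<bar>\<dots>\<bar> \<le> 2 * ?M"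
  proof (rule weighted_average_le)
    fix u assume u: "u \<in> Pow (G - {i})"
    have sub: "u \<subseteq> G" "insert i u \<subseteq> G" using u G by auto
    have "\<bar>?d u\<bar> \<le> ?M"
      by (rule cond_var_perturb_abs[OF A A' cK b G(1,2) sub(1) e(1) e(2,3) R])
    moreover have "\<bar>?d (insert i u)\<bar> \<le> ?M"
      by (rule cond_var_perturb_abs[OF A A' cK b G(1,2) sub(2) e(1) e(2,3) R])
    ultimately show "\<bar>?d u - ?d (insert i u)\<bar> \<le> 2 * ?M" by linarith
  qed (use shapley_weights_sum[OF fin G(3)] in auto)
  finally show ?thesis .
qed

lemma shapley_num_bound:
  assumes A: "form_between p c K A" and cK: "0 < c" "0 < K" and b: "b \<in> carrier_vec p"
    and G: "G \<subseteq> {..<p}" "i \<in> G" and R: "norm_on G b \<le> R"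
  shows "\<bar>shapley_num A b G i\<bar> \<le> K * R\<^sup>2"
  unfolding shapley_num_def
proof (rule weighted_average_le)
  fix u assume u: "u \<in> Pow (G - {i})"
  have v: "0 \<le> cond_var A b G v" "cond_var A b G v \<le> K * R\<^sup>2" if "v \<subseteq> G" for v
  proof -
    have "(norm_on G b)\<^sup>2 \<le> R\<^sup>2" using R by (intro power_mono norm_on_nonneg) auto
    then have "K * (norm_on G b)\<^sup>2 \<le> K * R\<^sup>2" using cK by (intro mult_left_mono) auto
    then show "0 \<le> cond_var A b G v" "cond_var A b G v \<le> K * R\<^sup>2"
      using cond_var_bounds[OF A cK b G(1) that] by auto
  qed
  have "u \<subseteq> G" "insert i u \<subseteq> G" using u G by auto
  from v[OF this(1)] v[OF this(2)] show "\<bar>cond_var A b G u - cond_var A b G (insert i u)\<bar> \<le> K * R\<^sup>2"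
    by linarith
qed (use shapley_weights_sum[OF finite_subset[OF G(1)] G(2)] in auto)

section \<open>Exponential inequalities for sums of normal variables\<close>

lemma sets_normal_law [measurable_cong, simp]: "sets (normal_law m s) = sets borel"
  by (simp add: normal_law_def)

lemma space_normal_law [simp]: "space (normal_law m s) = UNIV"
  by (simp add: normal_law_def)

lemma nn_integral_normal_law:
  assumes "0 < s" and [measurable]: "f \<in> borel_measurable borel"
  shows "(\<integral>\<^sup>+x. ennreal (f x) \<partial>normal_law m s) = (\<integral>\<^sup>+x. ennreal (normal_density m s x * f x) \<partial>lborel)"
proof -
  have "(\<integral>\<^sup>+x. ennreal (f x) \<partial>normal_law m s) = (\<integral>\<^sup>+x. ennreal (normal_density m s x) * ennreal (f x) \<partial>lborel)"
    using assms(1) by (simp add: normal_law_def nn_integral_density)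
  also have "\<dots> = (\<integral>\<^sup>+x. ennreal (normal_density m s x * f x) \<partial>lborel)"
    by (intro nn_integral_cong) (simp add: ennreal_mult')
  finally show ?thesis .
qed

lemma nn_integral_normal_law_0: "f \<in> borel_measurable borel \<Longrightarrow> (\<integral>\<^sup>+x. ennreal (f x) \<partial>normal_law m 0) = ennreal (f m)"
  by (simp add: normal_law_def nn_integral_return)

lemma nn_integral_scaled_normal_density:
  assumes "0 < s" "0 \<le> a"
  shows "(\<integral>\<^sup>+x. ennreal (a * normal_density m s x) \<partial>lborel) = ennreal a"
proof -
  have "(\<integral>\<^sup>+x. ennreal (normal_density m s x) \<partial>lborel) = 1"
    using assms by (subst nn_integral_eq_integral) auto
  then show ?thesis
    using assms by (simp add: ennreal_mult' nn_integral_cmult)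
qed

lemma normal_law_exp_square:
  assumes s: "0 \<le> s" and t: "2 * t * s\<^sup>2 < 1"
  shows "(\<integral>\<^sup>+x. ennreal (exp (t * x\<^sup>2)) \<partial>normal_law 0 s) = ennreal (1 / sqrt (1 - 2 * t * s\<^sup>2))"
proof (cases "s = 0")
  case True
  then show ?thesis by (simp add: nn_integral_normal_law_0)
next
  case False
  then have s: "s > 0" using s by simp
  define r where "r = sqrt (1 - 2 * t * s\<^sup>2)"
  have r: "r > 0" "r\<^sup>2 = 1 - 2 * t * s\<^sup>2" using t by (auto simp: r_def)
  have "normal_density 0 s x * exp (t * x\<^sup>2) = (1 / r) * normal_density 0 (s / r) x" for x
  proof -
    have e: "t * x\<^sup>2 - x\<^sup>2 / (2 * s\<^sup>2) = - (x\<^sup>2 / (2 * (s / r)\<^sup>2))"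
    proof -
      have "x\<^sup>2 / (2 * (s / r)\<^sup>2) = x\<^sup>2 * r\<^sup>2 / (2 * s\<^sup>2)" using r(1) by (simp add: power_divide)
      also have "\<dots> = x\<^sup>2 / (2 * s\<^sup>2) - t * x\<^sup>2"
        unfolding r(2) using s by (simp add: field_simps)
      finally show ?thesis by simp
    qed
    have q: "sqrt (2 * pi * (s / r)\<^sup>2) = sqrt (2 * pi * s\<^sup>2) / r"
      using r(1) by (simp add: power_divide real_sqrt_divide real_sqrt_mult)
    show ?thesis
      unfolding normal_density_def q using r s e
      by (simp add: exp_add[symmetric] algebra_simps)
  qed
  then have "(\<integral>\<^sup>+x. ennreal (exp (t * x\<^sup>2)) \<partial>normal_law 0 s)
      = (\<integral>\<^sup>+x. ennreal ((1 / r) * normal_density 0 (s / r) x) \<partial>lborel)"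
    by (subst nn_integral_normal_law[OF s]) simp_all
  also have "\<dots> = ennreal (1 / r)"
    using s r by (intro nn_integral_scaled_normal_density) auto
  finally show ?thesis by (simp add: r_def)
qed

lemma normal_law_exp_linear:
  assumes s: "0 \<le> s"
  shows "(\<integral>\<^sup>+x. ennreal (exp (t * x)) \<partial>normal_law 0 s) = ennreal (exp (t\<^sup>2 * s\<^sup>2 / 2))"
proof (cases "s = 0")
  case True
  then show ?thesis by (simp add: nn_integral_normal_law_0)
next
  case False
  then have s: "s > 0" using s by simp
  have "normal_density 0 s x * exp (t * x) = exp (t\<^sup>2 * s\<^sup>2 / 2) * normal_density (t * s\<^sup>2) s x" for x
  proof -
    have "- (x - 0)\<^sup>2 / (2 * s\<^sup>2) + t * x = t\<^sup>2 * s\<^sup>2 / 2 + - (x - t * s\<^sup>2)\<^sup>2 / (2 * s\<^sup>2)"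
      using s by (simp add: field_simps power2_eq_square)
    then have e: "exp (- (x - 0)\<^sup>2 / (2 * s\<^sup>2)) * exp (t * x)
        = exp (t\<^sup>2 * s\<^sup>2 / 2) * exp (- (x - t * s\<^sup>2)\<^sup>2 / (2 * s\<^sup>2))"
      by (simp only: exp_add[symmetric])
    show ?thesis
      unfolding normal_density_def mult.assoc e by (rule mult.left_commute)
  qed
  then have "(\<integral>\<^sup>+x. ennreal (exp (t * x)) \<partial>normal_law 0 s)
      = (\<integral>\<^sup>+x. ennreal (exp (t\<^sup>2 * s\<^sup>2 / 2) * normal_density (t * s\<^sup>2) s x) \<partial>lborel)"
    by (subst nn_integral_normal_law[OF s]) simp_all
  also have "\<dots> = ennreal (exp (t\<^sup>2 * s\<^sup>2 / 2))"
    using s by (intro nn_integral_scaled_normal_density) auto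
  finally show ?thesis .
qed

text \<open>
  The normal density is at most \<open>1/(s sqrt(2\<pi>))\<close>, and the other factor is a Gaussian integral,
  which does not depend on the centre. This uniformity in \<open>c\<close> and \<open>m\<close> makes the small ball
  estimate for sums of squares valid for arbitrary intercepts.
\<close>

lemma normal_law_small_ball:
  assumes s: "0 < s" and t: "0 < t"
  shows "(\<integral>\<^sup>+x. ennreal (exp (- t * (c + x)\<^sup>2)) \<partial>normal_law m s) \<le> ennreal (1 / (s * sqrt (2 * t)))"
proof -
  define r where "r = 1 / sqrt (2 * t)"
  have r: "r > 0" "r\<^sup>2 = 1 / (2 * t)" using t by (auto simp: r_def power_divide)
  have "normal_density m s x * exp (- t * (c + x)\<^sup>2) \<le> (r / s) * normal_density (- c) r x" for x
  proof -
    have "normal_density m s x \<le> 1 / sqrt (2 * pi * s\<^sup>2)"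
      unfolding normal_density_def using s by (simp add: divide_simps)
    then have "normal_density m s x * exp (- t * (c + x)\<^sup>2) \<le> 1 / sqrt (2 * pi * s\<^sup>2) * exp (- t * (c + x)\<^sup>2)"
      by (intro mult_right_mono) auto
    also have "\<dots> = (r / s) * normal_density (- c) r x"
    proof -
      have q: "sqrt (2 * pi * s\<^sup>2) = sqrt (2 * pi) * s" "sqrt (2 * pi * r\<^sup>2) = sqrt (2 * pi) * r"
        using s r(1) by (simp_all add: real_sqrt_mult)
      have e: "- (x - - c)\<^sup>2 / (2 * r\<^sup>2) = - t * (c + x)\<^sup>2" using r(2) t by (simp add: add.commute)
      show ?thesis unfolding normal_density_def q e using s r(1) by simp
    qed
    finally show ?thesis .
  qed
  then have "(\<integral>\<^sup>+x. ennreal (exp (- t * (c + x)\<^sup>2)) \<partial>normal_law m s)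
      \<le> (\<integral>\<^sup>+x. ennreal ((r / s) * normal_density (- c) r x) \<partial>lborel)"
    using s by (subst nn_integral_normal_law) (auto intro!: nn_integral_mono ennreal_leI)
  also have "\<dots> = ennreal (r / s)"
    using r s by (intro nn_integral_scaled_normal_density) auto
  finally show ?thesis using s by (simp add: r_def mult.commute)
qed

lemma prod_mono_ennreal:
  fixes f g :: "'b \<Rightarrow> ennreal"
  assumes "\<And>i. i \<in> I \<Longrightarrow> f i \<le> g i"
  shows "(\<Prod>i\<in>I. f i) \<le> (\<Prod>i\<in>I. g i)"
  using assms by (induction I rule: infinite_finite_induct) (auto intro: mult_mono)

text \<open>
  Markov's inequality for the exponential of the sum, which factorises by independence. All tail
  estimates of this section are instances with a suitable \<open>f\<close>.
\<close>

lemma (in prob_space) Chernoff_indep: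
  fixes w :: "nat \<Rightarrow> 'a \<Rightarrow> real" and f :: "real \<Rightarrow> real"
  assumes w: "indep_vars (\<lambda>_. borel) w {..<n}" and f [measurable]: "f \<in> borel_measurable borel"
    and a: "\<And>l. l < n \<Longrightarrow> (\<integral>\<^sup>+x. ennreal (exp (f x)) \<partial>distr M borel (w l)) \<le> ennreal a" "0 \<le> a"
  shows "prob {\<omega> \<in> space M. T \<le> (\<Sum>l<n. f (w l \<omega>))} \<le> exp (- T) * a ^ n"
proof -
  have [measurable]: "w l \<in> borel_measurable M" if "l < n" for l
    using w that by (auto simp: indep_vars_def)
  have [measurable]: "(\<lambda>\<omega>. \<Sum>l<n. f (w l \<omega>)) \<in> borel_measurable M"
    by (intro borel_measurable_sum) (auto intro: measurable_compose[OF _ f])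
  have "emeasure M {\<omega> \<in> space M. T \<le> (\<Sum>l<n. f (w l \<omega>))}
      = emeasure M {\<omega> \<in> space M. 1 \<le> ennreal (exp (- T)) * ennreal (exp (\<Sum>l<n. f (w l \<omega>)))}"
    by (intro arg_cong[of _ _ "emeasure M"])
      (auto simp flip: ennreal_mult' ennreal_1 exp_add simp: mult_exp_exp)
  also have "\<dots> \<le> ennreal (exp (- T)) * (\<integral>\<^sup>+\<omega>. ennreal (exp (\<Sum>l<n. f (w l \<omega>))) * indicator (space M) \<omega> \<partial>M)"
    by (rule nn_integral_Markov_inequality) auto
  also have "(\<integral>\<^sup>+\<omega>. ennreal (exp (\<Sum>l<n. f (w l \<omega>))) * indicator (space M) \<omega> \<partial>M)
      = (\<integral>\<^sup>+\<omega>. (\<Prod>l<n. ennreal (exp (f (w l \<omega>)))) \<partial>M)"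
    by (intro nn_integral_cong) (simp add: exp_sum prod_ennreal)
  also have "\<dots> = (\<Prod>l<n. \<integral>\<^sup>+\<omega>. ennreal (exp (f (w l \<omega>))) \<partial>M)"
    by (rule indep_vars_nn_integral) (auto intro!: indep_vars_compose2[OF w])
  also have "\<dots> \<le> (\<Prod>l<n. ennreal a)"
  proof (rule prod_mono_ennreal)
    fix l assume "l \<in> {..<n}"
    then show "(\<integral>\<^sup>+\<omega>. ennreal (exp (f (w l \<omega>))) \<partial>M) \<le> ennreal a"
      using a(1)[of l] by (simp add: nn_integral_distr)
  qed
  also have "\<dots> = ennreal (a ^ n)" using a(2) by (simp add: ennreal_power)
  finally have "emeasure M {\<omega> \<in> space M. T \<le> (\<Sum>l<n. f (w l \<omega>))} \<le> ennreal (exp (- T) * a ^ n)"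
    by (simp add: ennreal_mult' mult_left_mono)
  then show ?thesis
    using a(2) by (simp add: emeasure_eq_measure)
qed

text \<open>
  The choice \<open>t = 1/(4L)\<close> keeps the exponential moment of \<open>t w\<^sup>2\<close> below \<open>sqrt 2\<close>.
\<close>

lemma (in prob_space) normal_sum_squares_upper_tail:
  fixes w :: "nat \<Rightarrow> 'a \<Rightarrow> real"
  assumes w: "indep_vars (\<lambda>_. borel) w {..<n}" "\<And>l. l < n \<Longrightarrow> distr M borel (w l) = normal_law 0 s"
    and s: "0 \<le> s" "s\<^sup>2 \<le> L" "0 < L"
  shows "prob {\<omega> \<in> space M. T * real n \<le> (\<Sum>l<n. (w l \<omega>)\<^sup>2)} \<le> (sqrt 2 * exp (- T / (4 * L))) ^ n"
proof -
  define t where "t = 1 / (4 * L)"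
  have t: "t > 0" using s by (simp add: t_def)
  have ts: "2 * t * s\<^sup>2 \<le> 1 / 2" using s by (simp add: t_def field_simps)
  have "(\<integral>\<^sup>+x. ennreal (exp (t * x\<^sup>2)) \<partial>distr M borel (w l)) \<le> ennreal (sqrt 2)" if "l < n" for l
  proof -
    have "1 / sqrt (1 - 2 * t * s\<^sup>2) \<le> 1 / sqrt (1 / 2)"
      using ts by (intro divide_left_mono real_sqrt_le_mono) auto
    also have "\<dots> = sqrt 2" by (simp add: real_sqrt_divide)
    finally show ?thesis
      unfolding w(2)[OF that] using normal_law_exp_square[OF s(1), of t] ts by (simp add: ennreal_leI)
  qed
  then have "prob {\<omega> \<in> space M. t * (T * real n) \<le> (\<Sum>l<n. t * (w l \<omega>)\<^sup>2)} \<le> exp (- (t * (T * real n))) * sqrt 2 ^ n"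
    by (intro Chernoff_indep[OF w(1)]) auto
  also have "{\<omega> \<in> space M. t * (T * real n) \<le> (\<Sum>l<n. t * (w l \<omega>)\<^sup>2)} = {\<omega> \<in> space M. T * real n \<le> (\<Sum>l<n. (w l \<omega>)\<^sup>2)}"
    using t by (simp flip: sum_distrib_left)
  also have "exp (- (t * (T * real n))) = exp (- T / (4 * L)) ^ n"
    by (simp add: t_def mult_ac flip: exp_of_nat_mult)
  finally show ?thesis by (simp add: power_mult_distrib mult.commute)
qed

text \<open>
  The exponent \<open>n\<close> is essential: the probability is of the order of \<open>r^n\<close>, hence beats the number
  \<open>(C/r)^p\<close> of points of a net of mesh \<open>r\<close> if \<open>p/n\<close> stays below 1.
\<close>

lemma (in prob_space) normal_sum_squares_small_ball:
  fixes w :: "nat \<Rightarrow> 'a \<Rightarrow> real"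
  assumes w: "indep_vars (\<lambda>_. borel) w {..<n}" "\<And>l. l < n \<Longrightarrow> distr M borel (w l) = normal_law m s"
    and s: "0 < s0" "s0 \<le> s" and r: "0 < r"
  shows "prob {\<omega> \<in> space M. (\<Sum>l<n. (c + w l \<omega>)\<^sup>2) \<le> r\<^sup>2 * real n} \<le> (exp (1 / 2) * r / s0) ^ n"
proof -
  define t where "t = 1 / (2 * r\<^sup>2)"
  have t: "t > 0" using r by (simp add: t_def)
  have q: "1 / sqrt (2 * t) = r" using r by (simp add: t_def real_sqrt_divide)
  have "(\<integral>\<^sup>+x. ennreal (exp (- t * (c + x)\<^sup>2)) \<partial>distr M borel (w l)) \<le> ennreal (r / s0)" if "l < n" for l
  proof -
    have "1 / (s * sqrt (2 * t)) = (1 / sqrt (2 * t)) / s" by simp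
    also have "\<dots> = r / s" unfolding q ..
    also have "\<dots> \<le> r / s0" using s r by (intro divide_left_mono) auto
    finally have "1 / (s * sqrt (2 * t)) \<le> r / s0" .
    then show ?thesis
      unfolding w(2)[OF that] using normal_law_small_ball[of s t m c] s t
      by (auto intro: order.trans ennreal_leI)
  qed
  then have "prob {\<omega> \<in> space M. - (1 / 2 * real n) \<le> (\<Sum>l<n. - t * (c + w l \<omega>)\<^sup>2)} \<le> exp (- (- (1 / 2 * real n))) * (r / s0) ^ n"
    using s r by (intro Chernoff_indep[OF w(1)]) auto
  also have "{\<omega> \<in> space M. - (1 / 2 * real n) \<le> (\<Sum>l<n. - t * (c + w l \<omega>)\<^sup>2)} = {\<omega> \<in> space M. (\<Sum>l<n. (c + w l \<omega>)\<^sup>2) \<le> r\<^sup>2 * real n}"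
    using r by (auto simp: t_def field_simps sum_negf simp flip: sum_divide_distrib)
  also have "exp (- (- (1 / 2 * real n))) = exp (1 / 2) ^ n"
    by (simp add: mult_ac flip: exp_of_nat_mult)
  finally show ?thesis by (simp add: power_mult_distrib power_divide)
qed

lemma neg_ln_one_minus_le:
  fixes u :: real
  assumes "\<bar>u\<bar> \<le> 1 / 2"
  shows "- ln (1 - u) \<le> u + 2 * u\<^sup>2"
proof (cases "0 \<le> u")
  case True
  then show ?thesis using ln_one_minus_pos_lower_bound[of u] assms by simp
next
  case False
  then have "- u - u\<^sup>2 \<le> ln (1 - u)" using ln_one_plus_pos_lower_bound[of "- u"] assms by simp
  then show ?thesis using zero_le_power2[of u] by linarith
qed

lemma normal_law_exp_centred_square:
  assumes s: "0 \<le> s" "s\<^sup>2 \<le> L" and t: "\<bar>t\<bar> * L \<le> 1 / 4"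
  shows "(\<integral>\<^sup>+x. ennreal (exp (t * (x\<^sup>2 - s\<^sup>2))) \<partial>normal_law 0 s) \<le> ennreal (exp (4 * t\<^sup>2 * L\<^sup>2))"
proof -
  define u where "u = 2 * t * s\<^sup>2"
  have "\<bar>t\<bar> * s\<^sup>2 \<le> \<bar>t\<bar> * L" using s by (intro mult_left_mono) auto
  then have u: "\<bar>u\<bar> \<le> 1 / 2" using t by (simp add: u_def abs_mult)
  have "exp (- t * s\<^sup>2) * (1 / sqrt (1 - u)) = exp (- t * s\<^sup>2 - ln (1 - u) / 2)"
    using u by (simp add: exp_diff ln_sqrt[symmetric])
  also have "\<dots> \<le> exp (4 * t\<^sup>2 * L\<^sup>2)"
  proof -
    have "- t * s\<^sup>2 - ln (1 - u) / 2 \<le> u\<^sup>2" using neg_ln_one_minus_le[OF u] by (simp add: u_def)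
    also have "u\<^sup>2 = 4 * t\<^sup>2 * (s\<^sup>2)\<^sup>2" by (simp add: u_def power_mult_distrib)
    also have "\<dots> \<le> 4 * t\<^sup>2 * L\<^sup>2" using s by (intro mult_left_mono power_mono) auto
    finally show ?thesis by simp
  qed
  finally have le: "exp (- t * s\<^sup>2) * (1 / sqrt (1 - u)) \<le> exp (4 * t\<^sup>2 * L\<^sup>2)" .
  have "(\<integral>\<^sup>+x. ennreal (exp (t * (x\<^sup>2 - s\<^sup>2))) \<partial>normal_law 0 s)
     = (\<integral>\<^sup>+x. ennreal (exp (- t * s\<^sup>2)) * ennreal (exp (t * x\<^sup>2)) \<partial>normal_law 0 s)"
    by (intro nn_integral_cong) (simp add: algebra_simps flip: ennreal_mult' exp_add)
  also have "\<dots> = ennreal (exp (- t * s\<^sup>2)) * ennreal (1 / sqrt (1 - u))"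
    using normal_law_exp_square[OF s(1), of t] u by (subst nn_integral_cmult) (auto simp: u_def)
  also have "\<dots> \<le> ennreal (exp (4 * t\<^sup>2 * L\<^sup>2))"
    using le u by (simp add: ennreal_leI flip: ennreal_mult')
  finally show ?thesis .
qed

lemma (in prob_space) prob_abs_ge_le:
  fixes t a :: real
  assumes "Z \<in> borel_measurable M" "prob {\<omega> \<in> space M. t \<le> Z \<omega>} \<le> a" "prob {\<omega> \<in> space M. t \<le> - Z \<omega>} \<le> a"
  shows "prob {\<omega> \<in> space M. t \<le> \<bar>Z \<omega>\<bar>} \<le> 2 * a"
proof -
  note [measurable] = assms(1)
  have "prob {\<omega> \<in> space M. t \<le> \<bar>Z \<omega>\<bar>}
      = prob ({\<omega> \<in> space M. t \<le> Z \<omega>} \<union> {\<omega> \<in> space M. t \<le> - Z \<omega>})"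
    by (rule arg_cong[of _ _ prob]) auto
  moreover have "prob ({\<omega> \<in> space M. t \<le> Z \<omega>} \<union> {\<omega> \<in> space M. t \<le> - Z \<omega>})
      \<le> prob {\<omega> \<in> space M. t \<le> Z \<omega>} + prob {\<omega> \<in> space M. t \<le> - Z \<omega>}"
    by (intro measure_Un_le) measurable
  ultimately show ?thesis using assms(2,3) by linarith
qed

text \<open>
  The second-order bound \<open>exp(4 t\<^sup>2 L\<^sup>2)\<close> on the exponential moment is optimised at
  \<open>t = \<tau>/(8L\<^sup>2)\<close>, which is admissible because \<open>\<tau> \<le> L\<close>.
\<close>

lemma (in prob_space) normal_sum_squares_deviation:
  fixes w :: "nat \<Rightarrow> 'a \<Rightarrow> real"
  assumes w: "indep_vars (\<lambda>_. borel) w {..<n}" "\<And>l. l < n \<Longrightarrow> distr M borel (w l) = normal_law 0 s"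
    and s: "0 \<le> s" "s\<^sup>2 \<le> L" "0 < L" and \<tau>: "0 < \<tau>" "\<tau> \<le> L"
  shows "prob {\<omega> \<in> space M. \<tau> * real n \<le> \<bar>\<Sum>l<n. ((w l \<omega>)\<^sup>2 - s\<^sup>2)\<bar>} \<le> 2 * exp (- (real n * \<tau>\<^sup>2 / (16 * L\<^sup>2)))"
proof (rule prob_abs_ge_le)
  have [measurable]: "w l \<in> borel_measurable M" if "l < n" for l
    using w that by (auto simp: indep_vars_def)
  show "(\<lambda>\<omega>. \<Sum>l<n. ((w l \<omega>)\<^sup>2 - s\<^sup>2)) \<in> borel_measurable M"
    by (intro borel_measurable_sum) auto
  define t where "t = \<tau> / (8 * L\<^sup>2)"
  have t: "t > 0" using \<tau> s by (simp add: t_def)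
  have tL: "t * L \<le> 1 / 4" using \<tau> s by (simp add: t_def field_simps power2_eq_square)
  have main: "prob {\<omega> \<in> space M. t * \<tau> * real n \<le> (\<Sum>l<n. (\<sigma> * t) * ((w l \<omega>)\<^sup>2 - s\<^sup>2))} \<le> exp (- (real n * \<tau>\<^sup>2 / (16 * L\<^sup>2)))"
    if \<sigma>: "\<sigma> \<in> {1, -1}" for \<sigma>
  proof -
    have "(\<integral>\<^sup>+x. ennreal (exp ((\<sigma> * t) * (x\<^sup>2 - s\<^sup>2))) \<partial>distr M borel (w l)) \<le> ennreal (exp (4 * t\<^sup>2 * L\<^sup>2))" if "l < n" for l
      unfolding w(2)[OF that]
      using normal_law_exp_centred_square[OF s(1,2), of "\<sigma> * t"] tL t \<sigma> by (auto simp: abs_mult)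
    then have "prob {\<omega> \<in> space M. t * \<tau> * real n \<le> (\<Sum>l<n. (\<sigma> * t) * ((w l \<omega>)\<^sup>2 - s\<^sup>2))}
       \<le> exp (- (t * \<tau> * real n)) * exp (4 * t\<^sup>2 * L\<^sup>2) ^ n"
      by (intro Chernoff_indep[OF w(1)]) auto
    also have "\<dots> = exp (real n * (4 * t\<^sup>2 * L\<^sup>2) - t * \<tau> * real n)"
      by (simp only: exp_of_nat_mult[symmetric] mult_exp_exp diff_conv_add_uminus add.commute)
    also have "real n * (4 * t\<^sup>2 * L\<^sup>2) - t * \<tau> * real n = - (real n * \<tau>\<^sup>2 / (16 * L\<^sup>2))"
      using s by (simp add: t_def field_simps power2_eq_square)
    finally show ?thesis .
  qed
  have e: "(t * \<tau> * real n \<le> (\<Sum>l<n. (\<sigma> * t) * ((w l \<omega>)\<^sup>2 - s\<^sup>2))) \<longleftrightarrow> (\<tau> * real n \<le> \<sigma> * (\<Sum>l<n. ((w l \<omega>)\<^sup>2 - s\<^sup>2)))" for \<sigma> \<omega>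
  proof -
    have "(\<Sum>l<n. (\<sigma> * t) * ((w l \<omega>)\<^sup>2 - s\<^sup>2)) = t * (\<sigma> * (\<Sum>l<n. ((w l \<omega>)\<^sup>2 - s\<^sup>2)))"
      unfolding sum_distrib_left[symmetric] by simp
    then show ?thesis using t mult_le_cancel_left_pos[OF t, of "\<tau> * real n"] by (simp add: mult.assoc)
  qed
  show "prob {\<omega> \<in> space M. \<tau> * real n \<le> (\<Sum>l<n. ((w l \<omega>)\<^sup>2 - s\<^sup>2))} \<le> exp (- (real n * \<tau>\<^sup>2 / (16 * L\<^sup>2)))"
    using main[of 1] unfolding e by simp
  show "prob {\<omega> \<in> space M. \<tau> * real n \<le> - (\<Sum>l<n. ((w l \<omega>)\<^sup>2 - s\<^sup>2))} \<le> exp (- (real n * \<tau>\<^sup>2 / (16 * L\<^sup>2)))"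
    using main[of "- 1"] unfolding e by simp
qed

lemma (in prob_space) normal_sum_deviation:
  fixes w :: "nat \<Rightarrow> 'a \<Rightarrow> real"
  assumes w: "indep_vars (\<lambda>_. borel) w {..<n}" "\<And>l. l < n \<Longrightarrow> distr M borel (w l) = normal_law 0 s"
    and s: "0 \<le> s" "s\<^sup>2 \<le> L" "0 < L" and \<tau>: "0 < \<tau>"
  shows "prob {\<omega> \<in> space M. \<tau> * real n \<le> \<bar>\<Sum>l<n. w l \<omega>\<bar>} \<le> 2 * exp (- (real n * \<tau>\<^sup>2 / (2 * L)))"
proof (rule prob_abs_ge_le)
  have [measurable]: "w l \<in> borel_measurable M" if "l < n" for l
    using w that by (auto simp: indep_vars_def)
  show "(\<lambda>\<omega>. \<Sum>l<n. w l \<omega>) \<in> borel_measurable M"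
    by (intro borel_measurable_sum) auto
  define t where "t = \<tau> / L"
  have t: "t > 0" using \<tau> s by (simp add: t_def)
  have main: "prob {\<omega> \<in> space M. t * \<tau> * real n \<le> (\<Sum>l<n. (\<sigma> * t) * w l \<omega>)} \<le> exp (- (real n * \<tau>\<^sup>2 / (2 * L)))"
    if \<sigma>: "\<sigma> \<in> {1, -1}" for \<sigma>
  proof -
    have "(\<integral>\<^sup>+x. ennreal (exp ((\<sigma> * t) * x)) \<partial>distr M borel (w l)) \<le> ennreal (exp (t\<^sup>2 * L / 2))" if "l < n" for l
    proof -
      have "(\<sigma> * t)\<^sup>2 = t\<^sup>2" using \<sigma> by auto
      moreover have "t\<^sup>2 * s\<^sup>2 \<le> t\<^sup>2 * L" using s by (intro mult_left_mono) auto
      ultimately show ?thesis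
        unfolding w(2)[OF that] normal_law_exp_linear[OF s(1)] by (intro ennreal_leI) simp
    qed
    then have "prob {\<omega> \<in> space M. t * \<tau> * real n \<le> (\<Sum>l<n. (\<sigma> * t) * w l \<omega>)}
       \<le> exp (- (t * \<tau> * real n)) * exp (t\<^sup>2 * L / 2) ^ n"
      by (intro Chernoff_indep[OF w(1)]) auto
    also have "\<dots> = exp (real n * (t\<^sup>2 * L / 2) - t * \<tau> * real n)"
      by (simp only: exp_of_nat_mult[symmetric] mult_exp_exp diff_conv_add_uminus add.commute)
    also have "real n * (t\<^sup>2 * L / 2) - t * \<tau> * real n = - (real n * \<tau>\<^sup>2 / (2 * L))"
      using s by (simp add: t_def field_simps power2_eq_square)
    finally show ?thesis .
  qed
  have e: "(t * \<tau> * real n \<le> (\<Sum>l<n. (\<sigma> * t) * w l \<omega>)) \<longleftrightarrow> (\<tau> * real n \<le> \<sigma> * (\<Sum>l<n. w l \<omega>))" for \<sigma> \<omega>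
  proof -
    have "(\<Sum>l<n. (\<sigma> * t) * w l \<omega>) = t * (\<sigma> * (\<Sum>l<n. w l \<omega>))"
      unfolding sum_distrib_left[symmetric] by simp
    then show ?thesis using t mult_le_cancel_left_pos[OF t, of "\<tau> * real n"] by (simp add: mult.assoc)
  qed
  show "prob {\<omega> \<in> space M. \<tau> * real n \<le> (\<Sum>l<n. w l \<omega>)} \<le> exp (- (real n * \<tau>\<^sup>2 / (2 * L)))"
    using main[of 1] unfolding e by simp
  show "prob {\<omega> \<in> space M. \<tau> * real n \<le> - (\<Sum>l<n. w l \<omega>)} \<le> exp (- (real n * \<tau>\<^sup>2 / (2 * L)))"
    using main[of "- 1"] unfolding e by simp
qed

section \<open>Extreme singular values of Gaussian matrices\<close>

text \<open>
  A net of the unit ball of \<open>\<real>\<^sup>p\<close> made of points of the lattice of mesh \<open>\<eta>/sqrt p\<close>. By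
  Cauchy--Schwarz, \<open>l\<^sup>1\<close>-norm at most \<open>p/\<eta>\<close> of the integer coordinates is implied by membership in
  the unit ball, and it allows for counting by a generating function instead of volumes. The
  integer coordinates are extensional functions, which makes the set of them finite.
\<close>

definition lattice_net :: "nat \<Rightarrow> real \<Rightarrow> (nat \<Rightarrow> real) set" where
  "lattice_net p \<eta> = {u \<in> (\<lambda>k i. \<eta> / sqrt p * real_of_int (k i)) `
       {k \<in> {..<p} \<rightarrow>\<^sub>E {- \<lfloor>p / \<eta>\<rfloor>..\<lfloor>p / \<eta>\<rfloor>}. (\<Sum>i<p. \<bar>real_of_int (k i)\<bar>) \<le> p / \<eta>}.
     L2_set u {..<p} \<le> 1}"

lemma finite_lattice_net: "finite (lattice_net p \<eta>)"
proof -
  have "finite ({..<p} \<rightarrow>\<^sub>E {- \<lfloor>p / \<eta>\<rfloor>..\<lfloor>p / \<eta>\<rfloor>})" by (intro finite_PiE) auto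
  then have "finite ((\<lambda>k i. \<eta> / sqrt p * real_of_int (k i)) ` ({..<p} \<rightarrow>\<^sub>E {- \<lfloor>p / \<eta>\<rfloor>..\<lfloor>p / \<eta>\<rfloor>}))"
    by (rule finite_imageI)
  then show ?thesis by (rule rev_finite_subset) (auto simp: lattice_net_def)
qed

lemma sum_exp_abs_le:
  assumes "0 < \<eta>"
  shows "(\<Sum>j\<in>{- B..B}. exp (- \<eta> * \<bar>real_of_int j\<bar>)) \<le> 2 * (1 + 1 / \<eta>)"
proof (cases "0 \<le> B")
  case False
  then show ?thesis using assms by simp
next
  case True
  define q where "q = exp (- \<eta>)"
  have q: "0 < q" "q < 1" using assms by (auto simp: q_def)
  have geo: "(\<Sum>j<N. q ^ j) \<le> 1 + 1 / \<eta>" for N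
  proof -
    have "(\<Sum>j<N. q ^ j) = (1 - q ^ N) / (1 - q)" using q by (simp add: sum_gp_strict)
    also have "\<dots> \<le> 1 / (1 - q)" using q by (intro divide_right_mono) auto
    also have "\<dots> \<le> 1 + 1 / \<eta>"
    proof -
      have "(1 + \<eta>) * q \<le> exp \<eta> * q" using q by (intro mult_right_mono) auto
      also have "\<dots> = 1" by (simp add: q_def flip: exp_add)
      finally show ?thesis using q assms by (simp add: field_simps)
    qed
    finally show ?thesis .
  qed
  have "(\<Sum>j\<in>{- B..B}. exp (- \<eta> * \<bar>real_of_int j\<bar>))
      \<le> (\<Sum>j\<in>{0..B}. exp (- \<eta> * \<bar>real_of_int j\<bar>)) + (\<Sum>j\<in>{- B..0}. exp (- \<eta> * \<bar>real_of_int j\<bar>))"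
  proof -
    have "{- B..B} = {0..B} \<union> {- B..-1}" using True by auto
    then have "(\<Sum>j\<in>{- B..B}. exp (- \<eta> * \<bar>real_of_int j\<bar>))
        = (\<Sum>j\<in>{0..B}. exp (- \<eta> * \<bar>real_of_int j\<bar>)) + (\<Sum>j\<in>{- B..-1}. exp (- \<eta> * \<bar>real_of_int j\<bar>))"
      by (simp only:) (rule sum.union_disjoint, auto)
    also have "(\<Sum>j\<in>{- B..-1}. exp (- \<eta> * \<bar>real_of_int j\<bar>)) \<le> (\<Sum>j\<in>{- B..0}. exp (- \<eta> * \<bar>real_of_int j\<bar>))"
      by (intro sum_mono2) auto
    finally show ?thesis by simp
  qed
  also have "(\<Sum>j\<in>{- B..0}. exp (- \<eta> * \<bar>real_of_int j\<bar>)) = (\<Sum>j\<in>{0..B}. exp (- \<eta> * \<bar>real_of_int j\<bar>))"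
    by (rule sum.reindex_bij_witness[of _ uminus uminus]) auto
  also have "(\<Sum>j\<in>{0..B}. exp (- \<eta> * \<bar>real_of_int j\<bar>)) = (\<Sum>j<Suc (nat B). q ^ j)"
    by (rule sum.reindex_bij_witness[of _ int nat])
      (use True in \<open>auto simp: q_def exp_of_nat_mult[symmetric] mult.commute\<close>)
  also have "(\<Sum>j<Suc (nat B). q ^ j) + (\<Sum>j<Suc (nat B). q ^ j) \<le> (1 + 1 / \<eta>) + (1 + 1 / \<eta>)"
    by (intro add_mono geo)
  finally show ?thesis by simp
qed

text \<open>
  On the net the weight \<open>exp(p - \<eta> \<Sum>\<^sub>i |k\<^sub>i|)\<close> is at least 1, and its sum over all of the box
  factorises into \<open>p\<close> geometric sums.
\<close>

lemma card_lattice_net_le: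
  assumes \<eta>: "0 < \<eta>"
  shows "real (card (lattice_net p \<eta>)) \<le> (2 * exp 1 * (1 + 1 / \<eta>)) ^ p"
proof -
  define B where "B = \<lfloor>real p / \<eta>\<rfloor>"
  define K where "K = {k \<in> {..<p} \<rightarrow>\<^sub>E {- B..B}. (\<Sum>i<p. \<bar>real_of_int (k i)\<bar>) \<le> p / \<eta>}"
  have fP: "finite ({..<p} \<rightarrow>\<^sub>E {- B..B})" by (intro finite_PiE) auto
  have fin: "finite K" using fP by (simp add: K_def)
  have "lattice_net p \<eta> \<subseteq> (\<lambda>k i. \<eta> / sqrt p * real_of_int (k i)) ` K"
    by (auto simp: lattice_net_def K_def B_def)
  then have "card (lattice_net p \<eta>) \<le> card K" using fin by (meson card_image_le card_mono finite_imageI order.trans)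
  then have 1: "real (card (lattice_net p \<eta>)) \<le> real (card K)" by simp
  let ?w = "\<lambda>k. exp p * (\<Prod>i<p. exp (- \<eta> * \<bar>real_of_int (k i)\<bar>))"
  have 2: "real (card K) \<le> (\<Sum>k\<in>K. exp p * (\<Prod>i<p. exp (- \<eta> * \<bar>real_of_int (k i)\<bar>)))"
  proof -
    have "(\<Sum>k\<in>K. 1) \<le> (\<Sum>k\<in>K. ?w k)"
    proof (rule sum_mono)
    fix k assume k: "k \<in> K"
    have "exp p * (\<Prod>i<p. exp (- \<eta> * \<bar>real_of_int (k i)\<bar>)) = exp (p - \<eta> * (\<Sum>i<p. \<bar>real_of_int (k i)\<bar>))"
    proof -
      have "(\<Prod>i<p. exp (- \<eta> * \<bar>real_of_int (k i)\<bar>)) = exp (- \<eta> * (\<Sum>i<p. \<bar>real_of_int (k i)\<bar>))"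
        unfolding sum_distrib_left by (simp add: exp_sum)
      then show ?thesis by (simp only: mult_exp_exp) simp
    qed
    moreover have "\<eta> * (\<Sum>i<p. \<bar>real_of_int (k i)\<bar>) \<le> p" using k \<eta> by (simp add: K_def field_simps)
    ultimately show "1 \<le> exp p * (\<Prod>i<p. exp (- \<eta> * \<bar>real_of_int (k i)\<bar>))" by simp
    qed
    then show ?thesis by simp
  qed
  have 3: "(\<Sum>k\<in>K. ?w k) \<le> (\<Sum>k\<in>{..<p} \<rightarrow>\<^sub>E {- B..B}. ?w k)"
  proof (rule sum_mono2[OF fP])
    show "K \<subseteq> {..<p} \<rightarrow>\<^sub>E {- B..B}" by (auto simp: K_def)
    show "0 \<le> ?w k" for k by (intro mult_nonneg_nonneg prod_nonneg) auto
  qed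
  have 4: "(\<Sum>k\<in>{..<p} \<rightarrow>\<^sub>E {- B..B}. ?w k) = exp p * (\<Prod>i<p. \<Sum>j\<in>{- B..B}. exp (- \<eta> * \<bar>real_of_int j\<bar>))"
    unfolding sum_distrib_left[symmetric] by (subst prod_sum_PiE) auto
  have 5: "exp p * (\<Prod>i<p. \<Sum>j\<in>{- B..B}. exp (- \<eta> * \<bar>real_of_int j\<bar>)) \<le> exp p * (\<Prod>i<p. 2 * (1 + 1 / \<eta>))"
    using sum_exp_abs_le[OF \<eta>, of B] by (intro mult_left_mono prod_mono) (auto intro: sum_nonneg)
  have 6: "exp p * (\<Prod>i<p. 2 * (1 + 1 / \<eta>)) = (2 * exp 1 * (1 + 1 / \<eta>)) ^ p"
  proof -
    have "exp (real p) = exp 1 ^ p" using exp_of_nat_mult[of p "1 :: real"] by simp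
    then show ?thesis by (simp only: prod_constant card_lessThan power_mult_distrib mult_ac)
  qed
  show ?thesis using 1 2 3 4 5 6 by linarith
qed

lemma sum_abs_le_L2_set: "(\<Sum>i<p. \<bar>v i\<bar>) \<le> sqrt (real p) * L2_set v {..<p::nat}"
proof -
  have "(\<Sum>i<p. \<bar>v i\<bar>) = (\<Sum>i<p. \<bar>1\<bar> * \<bar>v i\<bar>)" by simp
  also have "\<dots> \<le> L2_set (\<lambda>_. 1) {..<p} * L2_set v {..<p}" by (rule L2_set_mult_ineq)
  also have "L2_set (\<lambda>_. 1) {..<p} = sqrt (real p)" by (simp add: L2_set_def)
  finally show ?thesis .
qed

text \<open>
  Rounding the coordinates towards 0, rather than to the nearest lattice point, keeps the point in
  the unit ball.
\<close>

lemma lattice_net_approx: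
  assumes \<eta>: "0 < \<eta>" and v: "L2_set v {..<p} \<le> 1"
  obtains u where "u \<in> lattice_net p \<eta>" "L2_set (\<lambda>i. v i - u i) {..<p} \<le> \<eta>"
proof (cases "p = 0")
  case True
  have "(\<lambda>i. \<eta> / sqrt p * real_of_int (undefined :: int)) \<in> lattice_net p \<eta>"
    using True by (auto simp: lattice_net_def PiE_def extensional_def image_iff)
  then show ?thesis using that True \<eta> by simp
next
  case False
  define h where "h = \<eta> / sqrt p"
  have h: "h > 0" using False \<eta> by (simp add: h_def)
  define k where "k = (\<lambda>i\<in>{..<p}. if 0 \<le> v i then \<lfloor>v i / h\<rfloor> else - \<lfloor>- v i / h\<rfloor>)"
  have k: "\<bar>h * real_of_int (k i)\<bar> \<le> \<bar>v i\<bar>" "\<bar>v i - h * real_of_int (k i)\<bar> \<le> h" if "i < p" for i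
  proof -
    have fl: "0 \<le> h * real_of_int \<lfloor>a / h\<rfloor>" "h * real_of_int \<lfloor>a / h\<rfloor> \<le> a" "a - h * real_of_int \<lfloor>a / h\<rfloor> \<le> h" if "0 \<le> a" for a
    proof -
      show "0 \<le> h * real_of_int \<lfloor>a / h\<rfloor>" using that h by simp
      show "h * real_of_int \<lfloor>a / h\<rfloor> \<le> a" using floor_divide_lower[OF h, of a] by (simp add: mult.commute)
      have "a / h \<le> real_of_int \<lfloor>a / h\<rfloor> + 1" using real_of_int_floor_add_one_ge[of "a / h"] by simp
      then show "a - h * real_of_int \<lfloor>a / h\<rfloor> \<le> h" using h by (simp add: field_simps)
    qed
    show "\<bar>h * real_of_int (k i)\<bar> \<le> \<bar>v i\<bar>" "\<bar>v i - h * real_of_int (k i)\<bar> \<le> h"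
      using fl[of "v i"] fl[of "- v i"] \<open>i < p\<close> by (auto simp: k_def)
  qed
  define u where "u = (\<lambda>i. \<eta> / sqrt p * real_of_int (k i))"
  have u: "u i = h * real_of_int (k i)" for i by (simp add: u_def h_def)
  have "h * (\<Sum>i<p. \<bar>real_of_int (k i)\<bar>) = (\<Sum>i<p. \<bar>h * real_of_int (k i)\<bar>)"
    using h by (simp add: sum_distrib_left abs_mult)
  also have "\<dots> \<le> (\<Sum>i<p. \<bar>v i\<bar>)" using k by (intro sum_mono) auto
  also have "\<dots> \<le> sqrt p * L2_set v {..<p}" by (rule sum_abs_le_L2_set)
  also have "\<dots> \<le> sqrt p * 1" using v by (intro mult_left_mono) auto
  finally have "(\<Sum>i<p. \<bar>real_of_int (k i)\<bar>) \<le> sqrt p / h" using h by (simp add: field_simps)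
  also have "sqrt p / h = p / \<eta>" using False \<eta> by (simp add: h_def field_simps)
  finally have l1: "(\<Sum>i<p. \<bar>real_of_int (k i)\<bar>) \<le> p / \<eta>" .
  have "k i \<in> {- \<lfloor>p / \<eta>\<rfloor>..\<lfloor>p / \<eta>\<rfloor>}" if "i < p" for i
  proof -
    have "\<bar>real_of_int (k i)\<bar> \<le> (\<Sum>i<p. \<bar>real_of_int (k i)\<bar>)" using that by (intro member_le_sum) auto
    then have "real_of_int \<bar>k i\<bar> \<le> p / \<eta>" using l1 by simp
    then have "\<bar>k i\<bar> \<le> \<lfloor>p / \<eta>\<rfloor>" by (simp add: le_floor_iff)
    then show ?thesis by auto
  qed
  then have "k \<in> {..<p} \<rightarrow>\<^sub>E {- \<lfloor>p / \<eta>\<rfloor>..\<lfloor>p / \<eta>\<rfloor>}" by (auto simp: k_def)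
  moreover have "L2_set u {..<p} \<le> 1"
  proof -
    have "L2_set u {..<p} = L2_set (\<lambda>i. \<bar>u i\<bar>) {..<p}" by (simp add: L2_set_def)
    also have "\<dots> \<le> L2_set (\<lambda>i. \<bar>v i\<bar>) {..<p}" using k by (intro L2_set_mono) (auto simp: u)
    also have "\<dots> = L2_set v {..<p}" by (simp add: L2_set_def)
    finally show ?thesis using v by linarith
  qed
  ultimately have "u \<in> lattice_net p \<eta>"
    unfolding lattice_net_def using l1 by (auto simp: u_def)
  moreover have "L2_set (\<lambda>i. v i - u i) {..<p} \<le> \<eta>"
  proof -
    have "L2_set (\<lambda>i. v i - u i) {..<p} = L2_set (\<lambda>i. \<bar>v i - u i\<bar>) {..<p}" by (simp add: L2_set_def)
    also have "\<dots> \<le> L2_set (\<lambda>_. h) {..<p}" using k by (intro L2_set_mono) (auto simp: u)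
    also have "\<dots> = \<eta>" using h False \<eta> by (simp add: L2_set_def real_sqrt_mult h_def)
    finally show ?thesis .
  qed
  ultimately show ?thesis by (rule that)
qed

text \<open>
  The \<open>l\<close>-th coordinate of the product of the matrix with rows \<open>z l\<close> and the vector \<open>v\<close>.
\<close>

definition row_form :: "nat \<Rightarrow> (nat \<Rightarrow> nat \<Rightarrow> real) \<Rightarrow> (nat \<Rightarrow> real) \<Rightarrow> nat \<Rightarrow> real" where
  "row_form p z v l = (\<Sum>i<p. v i * z l i)"

lemma row_form_diff: "row_form p z (\<lambda>i. v i - u i) l = row_form p z v l - row_form p z u l"
  by (simp add: row_form_def sum_subtractf left_diff_distrib)

lemma row_form_scale: "row_form p z (\<lambda>i. c * v i) l = c * row_form p z v l"
  by (simp add: row_form_def sum_distrib_left mult.assoc)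

lemma L2_set_scale: "L2_set (\<lambda>i. c * f i) A = \<bar>c\<bar> * L2_set f A"
  by (simp add: L2_set_def power_mult_distrib real_sqrt_mult flip: sum_distrib_left)

lemma L2_set_diff_ge: "L2_set (\<lambda>l. f l + g l) A \<ge> L2_set f A - L2_set g A"
proof -
  have "L2_set f A = L2_set (\<lambda>l. (f l + g l) + (- 1) * g l) A" by simp
  also have "\<dots> \<le> L2_set (\<lambda>l. f l + g l) A + L2_set (\<lambda>l. (- 1) * g l) A" by (rule L2_set_triangle_ineq)
  also have "L2_set (\<lambda>l. (- 1) * g l) A = L2_set g A" by (subst L2_set_scale) simp
  finally show ?thesis by simp
qed

lemma L2_set_row_form_Frobenius:
  "L2_set (row_form p z v) {..<n} \<le> sqrt (\<Sum>l<n. \<Sum>i<p. (z l i)\<^sup>2) * L2_set v {..<p}"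
proof (rule power2_le_imp_le)
  have "(L2_set (row_form p z v) {..<n})\<^sup>2 = (\<Sum>l<n. (row_form p z v l)\<^sup>2)"
    by (simp add: L2_set_def sum_nonneg)
  also have "\<dots> \<le> (\<Sum>l<n. (\<Sum>i<p. (v i)\<^sup>2) * (\<Sum>i<p. (z l i)\<^sup>2))"
    unfolding row_form_def by (intro sum_mono Cauchy_Schwarz_ineq_sum)
  also have "\<dots> = (sqrt (\<Sum>l<n. \<Sum>i<p. (z l i)\<^sup>2) * L2_set v {..<p})\<^sup>2"
    by (simp add: L2_set_def power_mult_distrib sum_nonneg mult.commute flip: sum_distrib_left)
  finally show "(L2_set (row_form p z v) {..<n})\<^sup>2 \<le> (sqrt (\<Sum>l<n. \<Sum>i<p. (z l i)\<^sup>2) * L2_set v {..<p})\<^sup>2" .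
qed (auto intro!: mult_nonneg_nonneg sum_nonneg)

text \<open>
  A unit vector is a point of the net plus half of a vector of norm at most 1. Iterating this \<open>k\<close>
  times leaves a remainder \<open>2^(-k) F\<close>, with the Frobenius norm \<open>F\<close> as an a priori bound, and gives
  the factor \<open>2 = \<Sum>\<^sub>k 2^(-k)\<close>.
\<close>

lemma row_form_upper_from_net:
  assumes net: "\<And>u. u \<in> lattice_net p (1 / 2) \<Longrightarrow> L2_set (row_form p z u) {..<n} \<le> A"
  shows "L2_set (row_form p z v) {..<n} \<le> 2 * A * L2_set v {..<p}"
proof -
  define F where "F = sqrt (\<Sum>l<n. \<Sum>i<p. (z l i)\<^sup>2)"
  have F: "0 \<le> F" by (simp add: F_def sum_nonneg)
  have Fle: "L2_set (row_form p z v) {..<n} \<le> F * L2_set v {..<p}" for v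
    unfolding F_def by (rule L2_set_row_form_Frobenius)
  have A: "0 \<le> A"
  proof -
    obtain u where "u \<in> lattice_net p (1 / 2)"
      using lattice_net_approx[of "1 / 2" "\<lambda>_. 0" p] by (auto simp: L2_set_def)
    from net[OF this] show ?thesis using L2_set_nonneg order.trans by blast
  qed
  have iter: "L2_set (row_form p z v) {..<n} \<le> 2 * A + F / 2 ^ k" if "L2_set v {..<p} \<le> 1" for v k
    using that
  proof (induction k arbitrary: v)
    case 0
    have "F * L2_set v {..<p} \<le> F * 1" using 0 F by (intro mult_left_mono) auto
    then show ?case using Fle[of v] A by simp
  next
    case (Suc k)
    obtain u where u: "u \<in> lattice_net p (1 / 2)" "L2_set (\<lambda>i. v i - u i) {..<p} \<le> 1 / 2"
      using lattice_net_approx[of "1 / 2" v p] Suc.prems by auto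
    define v' where "v' = (\<lambda>i. 2 * (v i - u i))"
    have "L2_set v' {..<p} \<le> 1" unfolding v'_def using u by (subst L2_set_scale) simp
    then have IH: "L2_set (row_form p z v') {..<n} \<le> 2 * A + F / 2 ^ k" by (rule Suc.IH)
    have "row_form p z v = (\<lambda>l. row_form p z u l + (1 / 2) * row_form p z v' l)"
      by (rule ext) (simp add: v'_def row_form_scale row_form_diff diff_divide_distrib)
    then have "L2_set (row_form p z v) {..<n}
        \<le> L2_set (row_form p z u) {..<n} + L2_set (\<lambda>l. (1 / 2) * row_form p z v' l) {..<n}"
      by (simp only: L2_set_triangle_ineq)
    also have "L2_set (\<lambda>l. (1 / 2) * row_form p z v' l) {..<n} = (1 / 2) * L2_set (row_form p z v') {..<n}"
      by (subst L2_set_scale) simp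
    finally have "L2_set (row_form p z v) {..<n}
        \<le> L2_set (row_form p z u) {..<n} + 1 / 2 * L2_set (row_form p z v') {..<n}" .
    also have "\<dots> \<le> A + 1 / 2 * (2 * A + F / 2 ^ k)"
      by (intro add_mono mult_left_mono IH net[OF u(1)]) simp
    also have "\<dots> = 2 * A + F / 2 ^ Suc k" by simp
    finally show ?case .
  qed
  have unit: "L2_set (row_form p z v) {..<n} \<le> 2 * A" if "L2_set v {..<p} \<le> 1" for v
  proof (rule LIMSEQ_le_const)
    show "(\<lambda>k. 2 * A + F / 2 ^ k) \<longlonglongrightarrow> 2 * A"
      using tendsto_add[OF tendsto_const tendsto_mult[OF tendsto_const LIMSEQ_inverse_realpow_zero[of 2]], of "2 * A" F]
      by (simp add: field_simps)
    show "\<exists>N. \<forall>k\<ge>N. L2_set (row_form p z v) {..<n} \<le> 2 * A + F / 2 ^ k" using iter[OF that] by blast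
  qed
  show ?thesis
  proof (cases "L2_set v {..<p} = 0")
    case True
    then show ?thesis using Fle[of v] by simp
  next
    case False
    then have pos: "0 < L2_set v {..<p}" using L2_set_nonneg[of v "{..<p}"] by linarith
    define v' where "v' = (\<lambda>i. (1 / L2_set v {..<p}) * v i)"
    have "L2_set v' {..<p} = 1" unfolding v'_def by (subst L2_set_scale) (use pos in simp)
    then have "L2_set (row_form p z v') {..<n} \<le> 2 * A" using unit by simp
    moreover have "L2_set (row_form p z v') {..<n} = 1 / L2_set v {..<p} * L2_set (row_form p z v) {..<n}"
    proof -
      have "row_form p z v' = (\<lambda>l. (1 / L2_set v {..<p}) * row_form p z v l)"
        unfolding v'_def by (rule ext, rule row_form_scale)
      then show ?thesis using pos by (simp only: L2_set_scale) simp
    qed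
    ultimately show ?thesis using pos by (simp add: field_simps)
  qed
qed

lemma L2_set_const: "L2_set (\<lambda>_. c) {..<n::nat} = \<bar>c\<bar> * sqrt (real n)"
  by (simp add: L2_set_def real_sqrt_mult)

text \<open>
  Replacing \<open>(c, v)\<close> by a point of the net moves the vector by at most \<open>2 \<epsilon> sqrt n\<close>: one \<open>\<epsilon>\<close> is
  due to rounding the intercept to a multiple of \<open>\<epsilon>\<close> and the other to the upper bound on the
  matrix. Intercepts larger than \<open>2K\<close> dominate everything else, so that finitely many multiples
  suffice.
\<close>

lemma row_form_lower_from_net:
  assumes up: "\<And>v. L2_set (row_form p z v) {..<n} \<le> K * sqrt (real n) * L2_set v {..<p}"
    and \<epsilon>: "0 < \<epsilon>" "\<epsilon> \<le> K / 2" and J: "2 * K / \<epsilon> \<le> real_of_int J"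
    and net: "\<And>u j. u \<in> lattice_net p (\<epsilon> / K) \<Longrightarrow> 1 / 2 \<le> L2_set u {..<p} \<Longrightarrow> j \<in> {- J..J} \<Longrightarrow>
        3 * \<epsilon> * sqrt (real n) \<le> L2_set (\<lambda>l. \<epsilon> * real_of_int j + row_form p z u l) {..<n}"
  shows "\<epsilon> * sqrt (real n) * L2_set v {..<p} \<le> L2_set (\<lambda>l. c + row_form p z v l) {..<n}"
proof -
  have K: "K > 0" using \<epsilon> by linarith
  let ?n = "sqrt (real n)"
  have unit: "\<epsilon> * ?n \<le> L2_set (\<lambda>l. c + row_form p z v l) {..<n}" if v: "L2_set v {..<p} = 1" for v c
  proof (cases "\<bar>c\<bar> \<le> 2 * K")
    case False
    have "\<epsilon> * ?n \<le> (\<bar>c\<bar> - K) * ?n" using False \<epsilon> K by (intro mult_right_mono) auto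
    also have "\<dots> \<le> L2_set (\<lambda>_. c) {..<n} - L2_set (row_form p z v) {..<n}"
      using up[of v] v by (simp add: L2_set_const algebra_simps)
    also have "\<dots> \<le> L2_set (\<lambda>l. c + row_form p z v l) {..<n}" by (rule L2_set_diff_ge)
    finally show ?thesis .
  next
    case True
    define j where "j = \<lfloor>c / \<epsilon>\<rfloor>"
    have c: "\<bar>c - \<epsilon> * real_of_int j\<bar> \<le> \<epsilon>"
    proof -
      have "\<epsilon> * real_of_int j \<le> c" using floor_divide_lower[OF \<epsilon>(1), of c] by (simp add: j_def mult.commute)
      moreover have "c / \<epsilon> \<le> real_of_int j + 1" unfolding j_def using real_of_int_floor_add_one_ge[of "c / \<epsilon>"] by simp
      then have "c \<le> \<epsilon> * real_of_int j + \<epsilon>" using \<epsilon> by (simp add: field_simps)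
      ultimately show ?thesis by simp
    qed
    have "j \<in> {- J..J}"
    proof -
      have "\<bar>c / \<epsilon>\<bar> \<le> real_of_int J" using True \<epsilon> J by (simp add: abs_divide divide_right_mono order.trans[rotated])
      then have "- real_of_int J \<le> c / \<epsilon>" "c / \<epsilon> \<le> real_of_int J" by linarith+
      then show ?thesis unfolding j_def by (auto simp: le_floor_iff floor_le_iff)
    qed
    obtain u where u: "u \<in> lattice_net p (\<epsilon> / K)" "L2_set (\<lambda>i. v i - u i) {..<p} \<le> \<epsilon> / K"
      using lattice_net_approx[of "\<epsilon> / K" v p] \<epsilon> K v by auto
    have "L2_set v {..<p} \<le> L2_set (\<lambda>i. v i - u i) {..<p} + L2_set u {..<p}"
      using L2_set_triangle_ineq[of "\<lambda>i. v i - u i" u "{..<p}"] by simp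
    moreover have "\<epsilon> / K \<le> 1 / 2" using \<epsilon> K by (simp add: field_simps)
    ultimately have "1 / 2 \<le> L2_set u {..<p}" using u v by linarith
    from net[OF u(1) this \<open>j \<in> _\<close>]
    have 1: "3 * \<epsilon> * ?n \<le> L2_set (\<lambda>l. \<epsilon> * real_of_int j + row_form p z u l) {..<n}" .
    let ?r = "\<lambda>l. (c - \<epsilon> * real_of_int j) + row_form p z (\<lambda>i. v i - u i) l"
    have "L2_set ?r {..<n} \<le> L2_set (\<lambda>_. c - \<epsilon> * real_of_int j) {..<n} + L2_set (row_form p z (\<lambda>i. v i - u i)) {..<n}"
      by (rule L2_set_triangle_ineq)
    also have "\<dots> \<le> \<epsilon> * ?n + K * ?n * (\<epsilon> / K)"
      using c u(2) K by (intro add_mono order.trans[OF up] mult_left_mono) (auto simp: L2_set_const intro!: mult_right_mono)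
    also have "\<dots> = 2 * \<epsilon> * ?n" using K by simp
    finally have 2: "L2_set ?r {..<n} \<le> 2 * \<epsilon> * ?n" .
    have "(\<lambda>l. c + row_form p z v l) = (\<lambda>l. (\<epsilon> * real_of_int j + row_form p z u l) + ?r l)"
      by (rule ext) (simp add: row_form_diff)
    then have "L2_set (\<lambda>l. \<epsilon> * real_of_int j + row_form p z u l) {..<n} - L2_set ?r {..<n}
        \<le> L2_set (\<lambda>l. c + row_form p z v l) {..<n}"
      by (simp only: L2_set_diff_ge)
    then show ?thesis using 1 2 by (simp add: algebra_simps)
  qed
  show ?thesis
  proof (cases "L2_set v {..<p} = 0")
    case True
    then show ?thesis by simp
  next
    case False
    then have pos: "0 < L2_set v {..<p}" using L2_set_nonneg[of v "{..<p}"] by linarith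
    define a where "a = 1 / L2_set v {..<p}"
    have a: "a > 0" using pos by (simp add: a_def)
    have "L2_set (\<lambda>i. a * v i) {..<p} = 1" unfolding L2_set_scale using pos by (simp add: a_def)
    then have "\<epsilon> * ?n \<le> L2_set (\<lambda>l. a * c + row_form p z (\<lambda>i. a * v i) l) {..<n}" by (rule unit)
    also have "(\<lambda>l. a * c + row_form p z (\<lambda>i. a * v i) l) = (\<lambda>l. a * (c + row_form p z v l))"
      by (simp add: row_form_scale algebra_simps)
    also have "L2_set \<dots> {..<n} = a * L2_set (\<lambda>l. c + row_form p z v l) {..<n}"
      using a by (simp add: L2_set_scale)
    finally show ?thesis using pos by (simp add: a_def field_simps)
  qed
qed

text \<open>
  A random matrix with rows \<open>z \<omega> l\<close>, known only through its products with fixed vectors \<open>v\<close>, whose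
  coordinates are independent and normal with standard deviation \<open>s v\<close>.
\<close>

locale gaussian_rows = prob_space M for M :: "'a measure" +
  fixes n p :: nat and z :: "'a \<Rightarrow> nat \<Rightarrow> nat \<Rightarrow> real" and s :: "(nat \<Rightarrow> real) \<Rightarrow> real" and lo hi :: real
  assumes rows_indep: "\<And>v. indep_vars (\<lambda>_. borel) (\<lambda>l \<omega>. row_form p (z \<omega>) v l) {..<n}"
    and rows_law: "\<And>v l. l < n \<Longrightarrow> distr M borel (\<lambda>\<omega>. row_form p (z \<omega>) v l) = normal_law 0 (s v)"
    and s_nonneg: "\<And>v. 0 \<le> s v"
    and s_bounds: "\<And>v. lo * (L2_set v {..<p})\<^sup>2 \<le> (s v)\<^sup>2" "\<And>v. (s v)\<^sup>2 \<le> hi * (L2_set v {..<p})\<^sup>2"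
    and lo_hi: "0 < lo" "0 < hi" and p_le: "p \<le> n"
begin

lemma row_form_measurable [measurable]: "l < n \<Longrightarrow> (\<lambda>\<omega>. row_form p (z \<omega>) v l) \<in> borel_measurable M"
  using rows_indep[of v] by (auto simp: indep_vars_def)

text \<open>
  The constant \<open>T\<close> makes the failure probability at a single point \<open>(12 e)^(-n)\<close>, against at most
  \<open>(6 e)^p\<close> points of a net of mesh \<open>1/2\<close>.
\<close>

lemma row_form_upper_event:
  defines "T \<equiv> 4 * hi * ln (12 * sqrt 2 * exp 1)"
  obtains E where "E \<in> events" "prob (space M - E) \<le> (1 / 2) ^ n"
    "\<And>\<omega> v. \<omega> \<in> E \<Longrightarrow> L2_set (row_form p (z \<omega>) v) {..<n} \<le> 2 * sqrt T * sqrt (real n) * L2_set v {..<p}"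
proof -
  define N where "N = lattice_net p (1 / 2)"
  have finN: "finite N" by (simp add: N_def finite_lattice_net)
  define A where "A u = {\<omega> \<in> space M. T * real n \<le> (\<Sum>l<n. (row_form p (z \<omega>) u l)\<^sup>2)}" for u
  have [measurable]: "(\<lambda>\<omega>. \<Sum>l<n. (row_form p (z \<omega>) u l)\<^sup>2) \<in> borel_measurable M" for u
    by (intro borel_measurable_sum) auto
  have A: "A u \<in> events" for u unfolding A_def by measurable
  have T: "exp (- T / (4 * hi)) = 1 / (12 * sqrt 2 * exp 1)"
    using lo_hi by (simp add: T_def exp_minus inverse_eq_divide)
  have "prob (A u) \<le> (1 / (12 * exp 1)) ^ n" if "u \<in> N" for u
  proof -
    have "(L2_set u {..<p})\<^sup>2 \<le> 1" using that by (simp add: N_def lattice_net_def power_le_one)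
    then have "hi * (L2_set u {..<p})\<^sup>2 \<le> hi * 1" using lo_hi by (intro mult_left_mono) auto
    then have "(s u)\<^sup>2 \<le> hi" using s_bounds(2)[of u] by simp
    then have "prob (A u) \<le> (sqrt 2 * exp (- T / (4 * hi))) ^ n"
      unfolding A_def using lo_hi by (intro normal_sum_squares_upper_tail[OF rows_indep rows_law s_nonneg]) auto
    then show ?thesis unfolding T by (simp add: field_simps)
  qed
  then have "(\<Sum>u\<in>N. prob (A u)) \<le> (\<Sum>u\<in>N. (1 / (12 * exp 1)) ^ n)" by (rule sum_mono)
  also have "\<dots> = real (card N) * (1 / (12 * exp 1)) ^ n" by simp
  also have "\<dots> \<le> (6 * exp 1) ^ n * (1 / (12 * exp 1)) ^ n"
  proof (rule mult_right_mono)
    have "real (card N) \<le> (2 * exp 1 * (1 + 1 / (1 / 2))) ^ p" unfolding N_def by (rule card_lattice_net_le) simp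
    also have "\<dots> = (6 * exp 1) ^ p" by simp
    also have "\<dots> \<le> (6 * exp 1) ^ n"
    proof (rule power_increasing[OF p_le])
      have "(1::real) \<le> exp 1" by simp
      then show "(1::real) \<le> 6 * exp 1" by linarith
    qed
    finally show "real (card N) \<le> (6 * exp 1) ^ n" .
  qed simp
  also have "\<dots> = (1 / 2) ^ n"
  proof -
    have "(6 * exp 1) * (1 / (12 * exp 1)) = (1 / 2 :: real)" by simp
    then show ?thesis by (simp only: power_mult_distrib[symmetric])
  qed
  finally have le: "(\<Sum>u\<in>N. prob (A u)) \<le> (1 / 2) ^ n" .
  define E where "E = space M - (\<Union>u\<in>N. A u)"
  have UA: "(\<Union>u\<in>N. A u) \<in> events" using A finN by (intro sets.finite_UN) auto
  show ?thesis
  proof (rule that)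
    show "E \<in> events" unfolding E_def using UA by auto
    have "space M - E = (\<Union>u\<in>N. A u)" unfolding E_def using sets.sets_into_space[OF UA] by auto
    then have "prob (space M - E) \<le> (\<Sum>u\<in>N. prob (A u))"
      using A finN by (simp only:) (intro finite_measure_subadditive_finite, auto)
    then show "prob (space M - E) \<le> (1 / 2) ^ n" using le by linarith
    fix \<omega> v assume \<omega>: "\<omega> \<in> E"
    have net: "L2_set (row_form p (z \<omega>) u) {..<n} \<le> sqrt T * sqrt (real n)" if "u \<in> lattice_net p (1 / 2)" for u
    proof -
      have "(\<Sum>l<n. (row_form p (z \<omega>) u l)\<^sup>2) \<le> T * real n"
        using \<omega> that by (auto simp: E_def A_def N_def)
      then have "L2_set (row_form p (z \<omega>) u) {..<n} \<le> sqrt (T * real n)"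
        unfolding L2_set_def by (rule real_sqrt_le_mono)
      then show ?thesis by (simp only: real_sqrt_mult)
    qed
    show "L2_set (row_form p (z \<omega>) v) {..<n} \<le> 2 * sqrt T * sqrt (real n) * L2_set v {..<p}"
      using row_form_upper_from_net[of p "z \<omega>" n "sqrt T * sqrt (real n)" v, OF net] by (simp add: mult.assoc)
  qed
qed

text \<open>
  A union bound over the points of the net of norm at least \<open>1/2\<close> and the \<open>2J + 1\<close> intercepts: at
  each of them the small ball estimate applies with variance at least \<open>lo/4\<close>. Condition \<open>small\<close>
  says that the net is small enough for the resulting bound to be exponentially small; it can be
  satisfied for \<open>y < 1\<close> by \<open>exists_small_ball_radius\<close>.
\<close>

lemma row_form_lower_event:
  assumes K: "K = 2 * sqrt (4 * hi * ln (12 * sqrt 2 * exp 1))"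
    and \<epsilon>: "0 < \<epsilon>" "\<epsilon> \<le> K / 2" and y: "0 \<le> y" "real p \<le> y * real n"
    and small: "(2 * exp 1 * (1 + K / \<epsilon>)) powr y * (exp (1 / 2) * (3 * \<epsilon>) / (sqrt lo / 2)) \<le> 1 / 2"
    and J: "2 * K / \<epsilon> \<le> real_of_int J"
  obtains E where "E \<in> events" "prob (space M - E) \<le> (2 * real_of_int J + 2) * (1 / 2) ^ n"
    "\<And>\<omega> v. \<omega> \<in> E \<Longrightarrow> L2_set (row_form p (z \<omega>) v) {..<n} \<le> K * sqrt (real n) * L2_set v {..<p}"
    "\<And>\<omega> v c. \<omega> \<in> E \<Longrightarrow> \<epsilon> * sqrt (real n) * L2_set v {..<p} \<le> L2_set (\<lambda>l. c + row_form p (z \<omega>) v l) {..<n}"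
proof -
  have K0: "K > 0" using \<epsilon> by linarith
  have J0: "0 \<le> J" using J K0 \<epsilon> by (smt (verit) divide_pos_pos of_int_less_0_iff mult_pos_pos)
  obtain E1 where E1: "E1 \<in> events" "prob (space M - E1) \<le> (1 / 2) ^ n"
    and up: "\<And>\<omega> v. \<omega> \<in> E1 \<Longrightarrow> L2_set (row_form p (z \<omega>) v) {..<n} \<le> K * sqrt (real n) * L2_set v {..<p}"
    using row_form_upper_event unfolding K by blast
  define N where "N = {u \<in> lattice_net p (\<epsilon> / K). 1 / 2 \<le> L2_set u {..<p}} \<times> {- J..J}"
  have finN: "finite N" by (simp add: N_def finite_lattice_net)
  define A where "A = (\<lambda>(u, j). {\<omega> \<in> space M. (\<Sum>l<n. (\<epsilon> * real_of_int j + row_form p (z \<omega>) u l)\<^sup>2) \<le> (3 * \<epsilon>)\<^sup>2 * real n})"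
  have [measurable]: "(\<lambda>\<omega>. \<Sum>l<n. (c + row_form p (z \<omega>) u l)\<^sup>2) \<in> borel_measurable M" for u c
    by (intro borel_measurable_sum) auto
  have A: "A x \<in> events" for x unfolding A_def by (cases x) simp
  define r where "r = exp (1 / 2) * (3 * \<epsilon>) / (sqrt lo / 2)"
  have r: "0 \<le> r" using \<epsilon> lo_hi by (simp add: r_def)
  have "prob (A x) \<le> r ^ n" if "x \<in> N" for x
  proof -
    obtain u j where x: "x = (u, j)" by (cases x)
    have u: "1 / 2 \<le> L2_set u {..<p}" using that by (simp add: N_def x)
    have "sqrt lo / 2 \<le> s u"
    proof (rule power2_le_imp_le[OF _ s_nonneg])
      have "lo * (1 / 2)\<^sup>2 \<le> lo * (L2_set u {..<p})\<^sup>2" using u lo_hi by (intro mult_left_mono power_mono) auto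
      also have "\<dots> \<le> (s u)\<^sup>2" by (rule s_bounds(1))
      finally have "lo * (1 / 2)\<^sup>2 \<le> (s u)\<^sup>2" .
      then show "(sqrt lo / 2)\<^sup>2 \<le> (s u)\<^sup>2" using lo_hi by (simp add: power_divide)
    qed
    then show ?thesis
      unfolding A_def x r_def prod.case using lo_hi \<epsilon>(1)
      by (intro normal_sum_squares_small_ball[OF rows_indep rows_law]) simp_all
  qed
  then have "(\<Sum>x\<in>N. prob (A x)) \<le> (\<Sum>x\<in>N. r ^ n)" by (rule sum_mono)
  also have "\<dots> = real (card N) * r ^ n" by simp
  also have "\<dots> \<le> ((2 * real_of_int J + 1) * ((2 * exp 1 * (1 + K / \<epsilon>)) powr y) ^ n) * r ^ n"
  proof (rule mult_right_mono)
    have "card N = card {u \<in> lattice_net p (\<epsilon> / K). 1 / 2 \<le> L2_set u {..<p}} * nat (2 * J + 1)"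
      by (simp add: N_def card_cartesian_product)
    also have "\<dots> \<le> card (lattice_net p (\<epsilon> / K)) * nat (2 * J + 1)"
      by (intro mult_right_mono card_mono finite_lattice_net) auto
    finally have "real (card N) \<le> real (card (lattice_net p (\<epsilon> / K)) * nat (2 * J + 1))" by (rule of_nat_mono)
    also have "\<dots> = (2 * real_of_int J + 1) * real (card (lattice_net p (\<epsilon> / K)))" using J0 by simp
    also have "\<dots> \<le> (2 * real_of_int J + 1) * ((2 * exp 1 * (1 + K / \<epsilon>)) powr y) ^ n"
    proof (rule mult_left_mono)
      have b: "1 \<le> 2 * exp 1 * (1 + K / \<epsilon>)"
      proof -
        have "1 * 1 \<le> (2 * exp 1) * (1 + K / \<epsilon>)"
        proof (rule mult_mono)
          have "(1::real) \<le> exp 1" by simp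
          then show "(1::real) \<le> 2 * exp 1" by linarith
        qed (use K0 \<epsilon> in auto)
        then show ?thesis by simp
      qed
      have "real (card (lattice_net p (\<epsilon> / K))) \<le> (2 * exp 1 * (1 + 1 / (\<epsilon> / K))) ^ p"
        using \<epsilon> K0 by (intro card_lattice_net_le) simp
      also have "\<dots> = (2 * exp 1 * (1 + K / \<epsilon>)) powr (real p)" using b by (simp add: powr_realpow)
      also have "\<dots> \<le> (2 * exp 1 * (1 + K / \<epsilon>)) powr (y * real n)" using b y by (intro powr_mono) auto
      also have "\<dots> = ((2 * exp 1 * (1 + K / \<epsilon>)) powr y) ^ n"
      proof -
        have "0 < (2 * exp 1 * (1 + K / \<epsilon>)) powr y"
          using b by (intro powr_gt_zero[THEN iffD2]) linarith
        then show ?thesis by (simp only: powr_powr[symmetric] powr_realpow)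
      qed
      finally show "real (card (lattice_net p (\<epsilon> / K))) \<le> ((2 * exp 1 * (1 + K / \<epsilon>)) powr y) ^ n" .
    qed (use J0 in simp)
    finally show "real (card N) \<le> (2 * real_of_int J + 1) * ((2 * exp 1 * (1 + K / \<epsilon>)) powr y) ^ n" .
  qed (use r in simp)
  also have "\<dots> = (2 * real_of_int J + 1) * ((2 * exp 1 * (1 + K / \<epsilon>)) powr y * r) ^ n" by (simp add: power_mult_distrib)
  also have "\<dots> \<le> (2 * real_of_int J + 1) * (1 / 2) ^ n"
  proof (intro mult_left_mono power_mono)
    show "(2 * exp 1 * (1 + K / \<epsilon>)) powr y * r \<le> 1 / 2" using small by (simp add: r_def)
    show "0 \<le> (2 * exp 1 * (1 + K / \<epsilon>)) powr y * r" using r by (intro mult_nonneg_nonneg) auto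
  qed (use J0 in simp)
  finally have le: "(\<Sum>x\<in>N. prob (A x)) \<le> (2 * real_of_int J + 1) * (1 / 2) ^ n" .
  define E where "E = E1 - (\<Union>x\<in>N. A x)"
  have UA: "(\<Union>x\<in>N. A x) \<in> events" using A finN by (intro sets.finite_UN) auto
  show ?thesis
  proof (rule that)
    show "E \<in> events" unfolding E_def using UA E1 by auto
    have "prob (space M - E) \<le> prob ((space M - E1) \<union> (\<Union>x\<in>N. A x))"
      unfolding E_def using UA E1 by (intro finite_measure_mono) auto
    also have "\<dots> \<le> prob (space M - E1) + prob (\<Union>x\<in>N. A x)" using UA E1 by (intro measure_Un_le) auto
    also have "prob (\<Union>x\<in>N. A x) \<le> (\<Sum>x\<in>N. prob (A x))"
      using A finN by (intro finite_measure_subadditive_finite) auto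
    finally show "prob (space M - E) \<le> (2 * real_of_int J + 2) * (1 / 2) ^ n" using le E1 by (simp add: algebra_simps)
    fix \<omega> assume \<omega>: "\<omega> \<in> E"
    then have \<omega>1: "\<omega> \<in> E1" "\<omega> \<in> space M" using E1 sets.sets_into_space by (auto simp: E_def)
    have up': "L2_set (row_form p (z \<omega>) v) {..<n} \<le> K * sqrt (real n) * L2_set v {..<p}" for v
      using up[OF \<omega>1(1)] .
    have low: "\<epsilon> * sqrt (real n) * L2_set v {..<p} \<le> L2_set (\<lambda>l. c + row_form p (z \<omega>) v l) {..<n}" for v c
    proof (rule row_form_lower_from_net[OF up' \<epsilon> J])
      fix u j assume "u \<in> lattice_net p (\<epsilon> / K)" "1 / 2 \<le> L2_set u {..<p}" "j \<in> {- J..J}"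
      then have "(u, j) \<in> N" by (simp add: N_def)
      then have "\<omega> \<notin> A (u, j)" using \<omega> by (auto simp: E_def)
      then have "(3 * \<epsilon>)\<^sup>2 * real n \<le> (\<Sum>l<n. (\<epsilon> * real_of_int j + row_form p (z \<omega>) u l)\<^sup>2)"
        using \<omega>1 by (simp add: A_def)
      then have "sqrt ((3 * \<epsilon>)\<^sup>2 * real n) \<le> L2_set (\<lambda>l. \<epsilon> * real_of_int j + row_form p (z \<omega>) u l) {..<n}"
        unfolding L2_set_def by (rule real_sqrt_le_mono)
      then show "3 * \<epsilon> * sqrt (real n) \<le> L2_set (\<lambda>l. \<epsilon> * real_of_int j + row_form p (z \<omega>) u l) {..<n}"
        using \<epsilon> by (simp add: real_sqrt_mult)
    qed
    fix v
    show "L2_set (row_form p (z \<omega>) v) {..<n} \<le> K * sqrt (real n) * L2_set v {..<p}" by (rule up')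
    fix c
    show "\<epsilon> * sqrt (real n) * L2_set v {..<p} \<le> L2_set (\<lambda>l. c + row_form p (z \<omega>) v l) {..<n}" by (rule low)
  qed
qed

end

text \<open>
  The left-hand side of the last inequality is of order \<open>\<epsilon>^(1 - y)\<close>.
\<close>

lemma exists_small_ball_radius:
  fixes K C y :: real
  assumes K: "0 < K" and C: "0 < C" and y: "0 \<le> y" "y < 1"
  obtains \<epsilon> where "0 < \<epsilon>" "\<epsilon> \<le> K / 2" "(2 * exp 1 * (1 + K / \<epsilon>)) powr y * (C * \<epsilon>) \<le> 1 / 2"
proof -
  define D where "D = (4 * exp 1 * K) powr y * C"
  have D: "D > 0" using K C by (simp add: D_def)
  define \<epsilon> where "\<epsilon> = min (K / 2) ((1 / (2 * D)) powr (1 / (1 - y)))"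
  have \<epsilon>: "0 < \<epsilon>" "\<epsilon> \<le> K / 2" using K D by (auto simp: \<epsilon>_def)
  have "(2 * exp 1 * (1 + K / \<epsilon>)) powr y \<le> (4 * exp 1 * K / \<epsilon>) powr y"
  proof (rule powr_mono2)
    have "1 \<le> K / \<epsilon>" using \<epsilon> by (simp add: field_simps)
    then have "2 * exp 1 * (1 + K / \<epsilon>) \<le> 2 * exp 1 * (2 * (K / \<epsilon>))" by (intro mult_left_mono) auto
    then show "2 * exp 1 * (1 + K / \<epsilon>) \<le> 4 * exp 1 * K / \<epsilon>" by simp
  qed (use y K \<epsilon> in auto)
  also have "\<dots> = (4 * exp 1 * K) powr y * \<epsilon> powr (- y)"
    using K \<epsilon> by (simp add: powr_divide powr_minus field_simps)
  finally have "(2 * exp 1 * (1 + K / \<epsilon>)) powr y * (C * \<epsilon>) \<le> (4 * exp 1 * K) powr y * \<epsilon> powr (- y) * (C * \<epsilon>)"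
    using C \<epsilon> by (intro mult_right_mono) auto
  also have "\<dots> = D * \<epsilon> powr (1 - y)"
    using \<epsilon> powr_add[of \<epsilon> "- y" 1] by (simp add: D_def mult_ac)
  also have "\<epsilon> powr (1 - y) \<le> ((1 / (2 * D)) powr (1 / (1 - y))) powr (1 - y)"
    using \<epsilon> y by (intro powr_mono2) (auto simp: \<epsilon>_def)
  also have "\<dots> = 1 / (2 * D)" using y D by (simp add: powr_powr)
  finally have "(2 * exp 1 * (1 + K / \<epsilon>)) powr y * (C * \<epsilon>) \<le> 1 / 2" using D by simp
  with \<epsilon> show ?thesis by (rule that)
qed

section \<open>Eigenvalues and quadratic forms\<close>

lemma abs_bform_le:
  assumes A: "A \<in> carrier_mat n n" and x: "x \<in> carrier_vec n"
  shows "\<bar>bform A x x\<bar> \<le> (\<Sum>i<n. \<Sum>j<n. \<bar>A $$ (i, j)\<bar>) * scalar_prod x x"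
proof -
  have sq: "\<bar>x $ i\<bar> * \<bar>x $ j\<bar> \<le> scalar_prod x x" if "i < n" "j < n" for i j
  proof -
    have m: "(x $ k)\<^sup>2 \<le> scalar_prod x x" if "k < n" for k
      unfolding scalar_prod_sum[OF x x] power2_eq_square using that by (intro member_le_sum) auto
    have "0 \<le> (\<bar>x $ i\<bar> - \<bar>x $ j\<bar>)\<^sup>2" by simp
    then have "2 * (\<bar>x $ i\<bar> * \<bar>x $ j\<bar>) \<le> (x $ i)\<^sup>2 + (x $ j)\<^sup>2"
      by (simp add: power2_diff)
    then show ?thesis using m[OF that(1)] m[OF that(2)] by linarith
  qed
  have "\<bar>bform A x x\<bar> \<le> (\<Sum>i<n. \<Sum>j<n. \<bar>x $ i * A $$ (i, j) * x $ j\<bar>)"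
    unfolding bform_sum[OF A x x] by (intro order.trans[OF sum_abs] sum_mono) simp
  also have "\<dots> \<le> (\<Sum>i<n. \<Sum>j<n. \<bar>A $$ (i, j)\<bar> * scalar_prod x x)"
  proof (intro sum_mono)
    fix i j assume "i \<in> {..<n}" "j \<in> {..<n}"
    then show "\<bar>x $ i * A $$ (i, j) * x $ j\<bar> \<le> \<bar>A $$ (i, j)\<bar> * scalar_prod x x"
      using mult_left_mono[OF sq[of i j], of "\<bar>A $$ (i, j)\<bar>"] by (simp add: abs_mult mult_ac)
  qed
  finally show ?thesis by (simp add: sum_distrib_right)
qed

lemma bform_minus_scalar:
  assumes "A \<in> carrier_mat n n" "x \<in> carrier_vec n"
  shows "bform (A - t \<cdot>\<^sub>m 1\<^sub>m n) x x = bform A x x - t * scalar_prod x x"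
proof -
  have c: "A - t \<cdot>\<^sub>m 1\<^sub>m n \<in> carrier_mat n n" by (intro minus_carrier_mat) auto
  have "bform (A - t \<cdot>\<^sub>m 1\<^sub>m n) x x = (\<Sum>i<n. \<Sum>j<n. x $ i * A $$ (i, j) * x $ j - (if j = i then t * (x $ i * x $ i) else 0))"
    unfolding bform_sum[OF c assms(2,2)] using assms by (intro sum.cong refl) (auto simp: algebra_simps)
  also have "\<dots> = bform A x x - t * scalar_prod x x"
    unfolding bform_sum[OF assms(1,2,2)] scalar_prod_sum[OF assms(2,2)]
    by (simp add: sum_subtractf sum_distrib_left)
  finally show ?thesis .
qed

text \<open>
  The largest \<open>t\<close> such that \<open>A - t\<close> is positive semidefinite is an eigenvalue: if \<open>Q = A - t\<close> were
  invertible, Cauchy--Schwarz for its form, applied to \<open>x\<close> and \<open>Q\<^sup>-\<^sup>1 x\<close>, would bound it below by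
  a positive multiple of \<open>|x|\<^sup>2\<close>, and \<open>t\<close> could be increased.
\<close>

lemma smallest_eigenvalue:
  fixes A :: "real mat"
  assumes A: "A \<in> carrier_mat n n" "transpose_mat A = A" and n: "0 < n"
  obtains \<mu> where "eigenvalue A \<mu>" "\<And>x. x \<in> carrier_vec n \<Longrightarrow> \<mu> * scalar_prod x x \<le> bform A x x"
proof -
  define T where "T = {t. \<forall>x\<in>carrier_vec n. t * scalar_prod x x \<le> bform A x x}"
  define \<mu> where "\<mu> = Sup T"
  have "- (\<Sum>i<n. \<Sum>j<n. \<bar>A $$ (i, j)\<bar>) \<in> T"
    unfolding T_def
  proof (intro CollectI ballI)
    fix x :: "real vec" assume "x \<in> carrier_vec n"
    from abs_bform_le[OF A(1) this]
    show "- (\<Sum>i<n. \<Sum>j<n. \<bar>A $$ (i, j)\<bar>) * scalar_prod x x \<le> bform A x x" by (simp add: abs_le_iff)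
  qed
  then have ne: "T \<noteq> {}" by blast
  have bdd: "bdd_above T"
  proof
    fix t assume "t \<in> T"
    define u :: "real vec" where "u = unit_vec n 0"
    have u: "u \<in> carrier_vec n" "scalar_prod u u = 1" using n by (simp_all add: u_def)
    have "t * scalar_prod u u \<le> bform A u u" using \<open>t \<in> T\<close> u(1) by (simp add: T_def)
    then show "t \<le> bform A (unit_vec n 0) (unit_vec n 0)" unfolding u(2) by (simp add: u_def)
  qed
  have low: "\<mu> * scalar_prod x x \<le> bform A x x" if x: "x \<in> carrier_vec n" for x
  proof (cases "scalar_prod x x = 0")
    case True
    then have "x = 0\<^sub>v n" using scalar_prod_self_pos[OF x] by fastforce
    then show ?thesis using A by simp
  next
    case False
    then have pos: "0 < scalar_prod x x" using scalar_prod_self_nonneg[of x] by linarith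
    have "\<mu> \<le> bform A x x / scalar_prod x x"
      unfolding \<mu>_def
    proof (rule cSup_least[OF ne])
      fix t assume "t \<in> T"
      then show "t \<le> bform A x x / scalar_prod x x" using pos x by (simp add: T_def field_simps)
    qed
    then show ?thesis using pos by (simp add: field_simps)
  qed
  have "eigenvalue A \<mu>"
  proof (rule ccontr)
    assume ev: "\<not> eigenvalue A \<mu>"
    define Q where "Q = A - \<mu> \<cdot>\<^sub>m 1\<^sub>m n"
    have Q: "Q \<in> carrier_mat n n" unfolding Q_def by (intro minus_carrier_mat) auto
    have tQ: "transpose_mat Q = Q"
    proof (rule eq_matI)
      fix i j assume "i < dim_row Q" "j < dim_col Q"
      then have "i < n" "j < n" using Q by auto
      then show "transpose_mat Q $$ (i, j) = Q $$ (i, j)"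
        using A(1) transpose_mat_index[OF A, of i j] by (simp add: Q_def)
    qed (use Q in auto)
    have psd: "0 \<le> bform Q x x" if "x \<in> carrier_vec n" for x
      using low[OF that] bform_minus_scalar[OF A(1) that] by (simp add: Q_def)
    have "x = 0\<^sub>v n" if x: "x \<in> carrier_vec n" "Q *\<^sub>v x = 0\<^sub>v n" for x
    proof (rule ccontr)
      assume "x \<noteq> 0\<^sub>v n"
      have "(\<mu> \<cdot>\<^sub>m 1\<^sub>m n) *\<^sub>v x = \<mu> \<cdot>\<^sub>v x"
        using x by (intro eq_vecI) (auto simp: scalar_prod_def if_distrib[of "\<lambda>a. \<mu> * a * _"] sum.delta' cong: if_cong)
      then have "A *\<^sub>v x - \<mu> \<cdot>\<^sub>v x = 0\<^sub>v n"
        using x A(1) minus_mult_distrib_mat_vec[of A n n "\<mu> \<cdot>\<^sub>m 1\<^sub>m n" x] by (simp add: Q_def)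
      then have "A *\<^sub>v x = \<mu> \<cdot>\<^sub>v x"
        using x A(1) by (intro eq_vecI) (auto simp: vec_eq_iff)
      then show False using ev x \<open>x \<noteq> 0\<^sub>v n\<close> A(1) by (auto simp: eigenvalue_def eigenvector_def)
    qed
    note N = minv_correct[OF Q this]
    define C where "C = (\<Sum>i<n. \<Sum>j<n. \<bar>minv Q $$ (i, j)\<bar>) + 1"
    have C: "C > 0" unfolding C_def by (intro add_nonneg_pos sum_nonneg) auto
    have "scalar_prod x x / C \<le> bform Q x x" if x: "x \<in> carrier_vec n" for x
    proof -
      define y where "y = minv Q *\<^sub>v x"
      have y: "y \<in> carrier_vec n" and Qy: "Q *\<^sub>v y = x"
        using x N Q by (auto simp: y_def simp flip: assoc_mult_mat_vec[of Q n n "minv Q" n x])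
      have "(bform Q x y)\<^sup>2 \<le> bform Q x x * bform Q y y" by (rule bform_Cauchy_Schwarz[OF Q tQ psd x y])
      also have "bform Q y y = bform (minv Q) x x" using Qy comm_scalar_prod[OF x y] by (simp add: y_def)
      also have "bform Q x x * bform (minv Q) x x \<le> bform Q x x * (C * scalar_prod x x)"
      proof (rule mult_left_mono[OF _ psd[OF x]])
        have "bform (minv Q) x x \<le> (C - 1) * scalar_prod x x"
          using abs_bform_le[OF N(1) x] by (simp add: C_def)
        then show "bform (minv Q) x x \<le> C * scalar_prod x x"
          using scalar_prod_self_nonneg[of x] by (simp add: algebra_simps)
      qed
      finally have le: "scalar_prod x x * scalar_prod x x \<le> scalar_prod x x * (C * bform Q x x)"
        unfolding Qy by (simp add: power2_eq_square mult_ac)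
      have "scalar_prod x x \<le> C * bform Q x x"
      proof (cases "scalar_prod x x = 0")
        case True
        then show ?thesis using psd[OF x] C by simp
      next
        case False
        then have "0 < scalar_prod x x" using scalar_prod_self_nonneg[of x] by linarith
        then show ?thesis using le by (rule mult_left_le_imp_le[rotated])
      qed
      then show ?thesis using C by (simp add: field_simps)
    qed
    then have "\<mu> + 1 / C \<in> T"
      unfolding T_def using bform_minus_scalar[OF A(1), of _ \<mu>] by (auto simp: Q_def algebra_simps)
    then have "\<mu> + 1 / C \<le> \<mu>" unfolding \<mu>_def by (rule cSup_upper[OF _ bdd])
    then show False using C by simp
  qed
  then show ?thesis using low by (rule that)
qed

text \<open>
  The upper bound is the lower bound for \<open>- A\<close>.
\<close>

lemma form_between_eigenvalues:
  fixes A :: "real mat"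
  assumes A: "A \<in> carrier_mat n n" "transpose_mat A = A" and n: "0 < n"
    and ev: "\<And>k. eigenvalue A k \<Longrightarrow> lo \<le> k \<and> k \<le> hi"
  shows "form_between n lo hi A"
proof -
  obtain \<mu> where \<mu>: "eigenvalue A \<mu>" "\<And>x. x \<in> carrier_vec n \<Longrightarrow> \<mu> * scalar_prod x x \<le> bform A x x"
    using smallest_eigenvalue[OF A n] by blast
  have mA: "- A \<in> carrier_mat n n" "transpose_mat (- A) = - A"
    using A by (simp_all add: transpose_uminus)
  obtain \<nu> where \<nu>: "eigenvalue (- A) \<nu>" "\<And>x. x \<in> carrier_vec n \<Longrightarrow> \<nu> * scalar_prod x x \<le> bform (- A) x x"
    using smallest_eigenvalue[OF mA n] by blast
  have neg: "bform (- A) x y = - bform A x y" if "x \<in> carrier_vec n" "y \<in> carrier_vec n" for x y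
    unfolding bform_sum[OF mA(1) that] bform_sum[OF A(1) that] using A(1) by (simp add: sum_negf)
  obtain w where w: "w \<in> carrier_vec n" "w \<noteq> 0\<^sub>v n" "(- A) *\<^sub>v w = \<nu> \<cdot>\<^sub>v w"
    using \<nu>(1) mA by (auto simp: eigenvalue_def eigenvector_def)
  have "A *\<^sub>v w = (- \<nu>) \<cdot>\<^sub>v w"
  proof (rule eq_vecI)
    fix i assume "i < dim_vec ((- \<nu>) \<cdot>\<^sub>v w)"
    then have i: "i < n" using w by simp
    have "((- A) *\<^sub>v w) $ i = \<nu> * w $ i" using w i by simp
    then show "(A *\<^sub>v w) $ i = ((- \<nu>) \<cdot>\<^sub>v w) $ i"
      using A(1) i w(1) by (simp add: scalar_prod_def sum_negf)
  qed (use A w in auto)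
  then have "eigenvalue A (- \<nu>)" using w A by (auto simp: eigenvalue_def eigenvector_def)
  then have "- \<nu> \<le> hi" "lo \<le> \<mu>" using ev \<mu> by blast+
  have "lo * scalar_prod x x \<le> bform A x x" "bform A x x \<le> hi * scalar_prod x x" if x: "x \<in> carrier_vec n" for x
  proof -
    have "lo * scalar_prod x x \<le> \<mu> * scalar_prod x x" "- \<nu> * scalar_prod x x \<le> hi * scalar_prod x x"
      using mult_right_mono[OF \<open>lo \<le> \<mu>\<close> scalar_prod_self_nonneg] mult_right_mono[OF \<open>- \<nu> \<le> hi\<close> scalar_prod_self_nonneg] .
    then show "lo * scalar_prod x x \<le> bform A x x" "bform A x x \<le> hi * scalar_prod x x"
      using \<mu>(2)[OF x] \<nu>(2)[OF x] neg[OF x x] by linarith+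
  qed
  then show ?thesis using A by (simp add: form_between_def)
qed

section \<open>Empirical covariance matrix and least squares\<close>

lemma scalar_prod_L2_set:
  fixes v :: "real vec"
  assumes "v \<in> carrier_vec p"
  shows "scalar_prod v v = (L2_set (\<lambda>i. v $ i) {..<p})\<^sup>2"
  by (simp add: scalar_prod_sum[OF assms assms] L2_set_def sum_nonneg power2_eq_square)

lemma sample_cov_carrier [simp]: "sample_cov n p x \<in> carrier_mat p p"
  by (simp add: sample_cov_def)

lemma bform_sample_cov:
  assumes v: "v \<in> carrier_vec p"
  shows "bform (sample_cov n p x) v v = (\<Sum>l<n. (\<Sum>i<p. v $ i * (x l i - sample_mean n x i))\<^sup>2) / real n"
proof -
  let ?a = "\<lambda>l i. x l i - sample_mean n x i"
  have "bform (sample_cov n p x) v v = (\<Sum>i<p. \<Sum>j<p. v $ i * ((\<Sum>l<n. ?a l i * ?a l j) / real n) * v $ j)"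
    unfolding bform_sum[OF sample_cov_carrier v v] by (intro sum.cong refl) (simp add: sample_cov_def)
  also have "\<dots> = (\<Sum>i<p. \<Sum>j<p. \<Sum>l<n. (v $ i * ?a l i) * (v $ j * ?a l j)) / real n"
    unfolding sum_divide_distrib by (intro sum.cong refl) (simp add: sum_distrib_left sum_distrib_right mult_ac)
  also have "\<dots> = (\<Sum>l<n. (\<Sum>i<p. v $ i * ?a l i)\<^sup>2) / real n"
    by (subst sum_swap_inner) (simp only: power2_eq_square sum_product)
  finally show ?thesis .
qed

text \<open>
  Subtracting the sample mean amounts to adding an intercept to the products with the rows centred
  at \<open>\<mu>\<close>.
\<close>

lemma centred_row_sum:
  assumes n: "0 < n"
  shows "(\<Sum>i<p. v i * (x l i - sample_mean n x i))
    = - ((\<Sum>l<n. row_form p (\<lambda>l i. x l i - \<mu> i) v l) / real n) + row_form p (\<lambda>l i. x l i - \<mu> i) v l"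
proof -
  have m: "sample_mean n x i = \<mu> i + (\<Sum>l<n. x l i - \<mu> i) / real n" for i
    using n by (simp add: sample_mean_def sum_subtractf field_simps)
  have "(\<Sum>l<n. row_form p (\<lambda>l i. x l i - \<mu> i) v l) = (\<Sum>i<p. v i * (\<Sum>l<n. x l i - \<mu> i))"
    unfolding row_form_def sum_distrib_left by (rule sum.swap)
  then have "(\<Sum>l<n. row_form p (\<lambda>l i. x l i - \<mu> i) v l) / real n = (\<Sum>i<p. v i * (\<Sum>l<n. x l i - \<mu> i)) / real n"
    by (simp only:)
  also have "\<dots> = (\<Sum>i<p. v i * (\<Sum>l<n. x l i - \<mu> i) / real n)" by (rule sum_divide_distrib)
  finally have e: "(\<Sum>l<n. row_form p (\<lambda>l i. x l i - \<mu> i) v l) / real n = (\<Sum>i<p. v i * ((\<Sum>l<n. x l i - \<mu> i) / real n))"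
    by (simp only: times_divide_eq_right)
  show ?thesis
    unfolding m e unfolding row_form_def sum_negf[symmetric] sum.distrib[symmetric]
    by (intro sum.cong refl) (simp add: algebra_simps)
qed

text \<open>
  The empirical variance of \<open>v\<^sup>T X\<close> is the minimum over \<open>c\<close> of the mean of the squares of
  \<open>c + v\<^sup>T (X - \<mu>)\<close>: the lower bound follows from the value at the minimising intercept, the upper
  bound by comparison with \<open>c = 0\<close>.
\<close>

lemma form_between_sample_cov:
  assumes n: "0 < n" and \<epsilon>: "0 \<le> \<epsilon>" and K: "0 \<le> K"
    and up: "\<And>v. L2_set (row_form p (\<lambda>l i. x l i - \<mu> i) v) {..<n} \<le> K * sqrt (real n) * L2_set v {..<p}"
    and low: "\<And>v c. \<epsilon> * sqrt (real n) * L2_set v {..<p} \<le> L2_set (\<lambda>l. c + row_form p (\<lambda>l i. x l i - \<mu> i) v l) {..<n}"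
  shows "form_between p (\<epsilon>\<^sup>2) (K\<^sup>2) (sample_cov n p x)"
  unfolding form_between_def
proof (intro conjI ballI)
  show "transpose_mat (sample_cov n p x) = sample_cov n p x"
    by (rule eq_matI) (auto simp: sample_cov_def mult.commute)
  fix v :: "real vec" assume v: "v \<in> carrier_vec p"
  let ?w = "row_form p (\<lambda>l i. x l i - \<mu> i) (\<lambda>i. v $ i)"
  let ?L = "L2_set (\<lambda>i. v $ i) {..<p}"
  define c where "c = (\<Sum>l<n. ?w l) / real n"
  have b: "real n * bform (sample_cov n p x) v v = (\<Sum>l<n. (- c + ?w l)\<^sup>2)"
    unfolding bform_sample_cov[OF v] centred_row_sum[OF n, where \<mu> = \<mu>] c_def using n by simp
  have "(\<epsilon> * sqrt (real n) * ?L)\<^sup>2 \<le> (L2_set (\<lambda>l. - c + ?w l) {..<n})\<^sup>2"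
    using \<epsilon> by (intro power_mono low) (auto intro!: mult_nonneg_nonneg)
  also have "\<dots> = (\<Sum>l<n. (- c + ?w l)\<^sup>2)" by (simp add: L2_set_def sum_nonneg)
  finally have "real n * (\<epsilon>\<^sup>2 * ?L\<^sup>2) \<le> real n * bform (sample_cov n p x) v v"
    unfolding b by (simp add: power_mult_distrib mult_ac)
  then show "\<epsilon>\<^sup>2 * scalar_prod v v \<le> bform (sample_cov n p x) v v"
    unfolding scalar_prod_L2_set[OF v] using n by (simp add: mult_le_cancel_left_pos)
  have "(\<Sum>l<n. (- c + ?w l)\<^sup>2) = (\<Sum>l<n. (?w l)\<^sup>2) - real n * c\<^sup>2"
  proof -
    have "(\<Sum>l<n. (- c + ?w l)\<^sup>2) = (\<Sum>l<n. (?w l)\<^sup>2 + (c\<^sup>2 - 2 * c * ?w l))"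
      by (intro sum.cong refl) (simp add: power2_eq_square algebra_simps)
    also have "\<dots> = (\<Sum>l<n. (?w l)\<^sup>2) + (real n * c\<^sup>2 - 2 * c * (\<Sum>l<n. ?w l))"
      by (simp add: sum.distrib sum_subtractf sum_distrib_left)
    also have "(\<Sum>l<n. ?w l) = real n * c" using n by (simp add: c_def)
    finally show ?thesis by (simp add: power2_eq_square)
  qed
  then have "real n * bform (sample_cov n p x) v v \<le> (\<Sum>l<n. (?w l)\<^sup>2)"
    unfolding b by simp
  also have "\<dots> = (L2_set ?w {..<n})\<^sup>2" by (simp add: L2_set_def sum_nonneg)
  also have "\<dots> \<le> (K * sqrt (real n) * ?L)\<^sup>2" by (intro power_mono up) simp
  finally have "real n * bform (sample_cov n p x) v v \<le> real n * (K\<^sup>2 * ?L\<^sup>2)"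
    by (simp add: power_mult_distrib mult_ac)
  then show "bform (sample_cov n p x) v v \<le> K\<^sup>2 * scalar_prod v v"
    unfolding scalar_prod_L2_set[OF v] using n by (simp add: mult_le_cancel_left_pos)
qed simp

lemma sample_cov_entry:
  assumes n: "0 < n" and ij: "i < p" "j < p"
  shows "sample_cov n p x $$ (i, j) = (\<Sum>l<n. (x l i - \<mu> i) * (x l j - \<mu> j)) / real n
     - ((\<Sum>l<n. x l i - \<mu> i) / real n) * ((\<Sum>l<n. x l j - \<mu> j) / real n)"
proof -
  define d where "d i = (\<Sum>l<n. x l i - \<mu> i) / real n" for i
  have m: "sample_mean n x i = \<mu> i + d i" for i
    using n by (simp add: sample_mean_def d_def sum_subtractf field_simps)
  have d: "(\<Sum>l<n. x l i - \<mu> i) = real n * d i" for i using n by (simp add: d_def)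
  have "(\<Sum>l<n. (x l i - sample_mean n x i) * (x l j - sample_mean n x j))
      = (\<Sum>l<n. (x l i - \<mu> i) * (x l j - \<mu> j) + (d i * d j - d j * (x l i - \<mu> i) - d i * (x l j - \<mu> j)))"
    unfolding m by (intro sum.cong refl) (simp add: algebra_simps)
  also have "\<dots> = (\<Sum>l<n. (x l i - \<mu> i) * (x l j - \<mu> j))
      + (real n * (d i * d j) - d j * (\<Sum>l<n. x l i - \<mu> i) - d i * (\<Sum>l<n. x l j - \<mu> j))"
  proof -
    have "(\<Sum>l<n. c - a * f l - b * g l) = real n * c - a * (\<Sum>l<n. f l) - b * (\<Sum>l<n. g l)"
      for a b c :: real and f g
      by (simp add: sum_subtractf sum_distrib_left)
    then show ?thesis by (simp only: sum.distrib)
  qed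
  finally have "(\<Sum>l<n. (x l i - sample_mean n x i) * (x l j - sample_mean n x j))
      = (\<Sum>l<n. (x l i - \<mu> i) * (x l j - \<mu> j)) - real n * (d i * d j)"
    unfolding d by simp
  then show ?thesis
    using ij n unfolding d_def[symmetric] by (simp add: sample_cov_def diff_divide_distrib)
qed

text \<open>
  The squared mean is the price of centring at \<open>\<mu>\<close> instead of the sample mean.
\<close>

lemma sample_cov_entry_error:
  assumes n: "0 < n" and ij: "i < p" "j < p"
    and prod: "\<bar>(\<Sum>l<n. (x l i - \<mu> i) * (x l j - \<mu> j)) - real n * g\<bar> \<le> real n * \<tau>"
    and mean: "\<bar>\<Sum>l<n. x l i - \<mu> i\<bar> \<le> real n * \<tau>'" "\<bar>\<Sum>l<n. x l j - \<mu> j\<bar> \<le> real n * \<tau>'"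
  shows "\<bar>sample_cov n p x $$ (i, j) - g\<bar> \<le> \<tau> + \<tau>'\<^sup>2"
proof -
  define a b where "a = (\<Sum>l<n. x l i - \<mu> i) / real n" and "b = (\<Sum>l<n. x l j - \<mu> j) / real n"
  define P where "P = (\<Sum>l<n. (x l i - \<mu> i) * (x l j - \<mu> j)) / real n"
  have "P - g = ((\<Sum>l<n. (x l i - \<mu> i) * (x l j - \<mu> j)) - real n * g) / real n"
    using n by (simp add: P_def diff_divide_distrib)
  then have "\<bar>P - g\<bar> = \<bar>(\<Sum>l<n. (x l i - \<mu> i) * (x l j - \<mu> j)) - real n * g\<bar> / real n" by simp
  also have "\<dots> \<le> \<tau>" using prod n by (simp add: field_simps)
  finally have P: "\<bar>P - g\<bar> \<le> \<tau>" .
  have "\<bar>a\<bar> \<le> \<tau>'" "\<bar>b\<bar> \<le> \<tau>'" using mean n by (simp_all add: a_def b_def field_simps)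
  then have "\<bar>a\<bar> * \<bar>b\<bar> \<le> \<tau>' * \<tau>'" by (intro mult_mono) auto
  then have "\<bar>a * b\<bar> \<le> \<tau>'\<^sup>2" by (simp add: abs_mult power2_eq_square)
  moreover have "sample_cov n p x $$ (i, j) = P - a * b"
    unfolding sample_cov_entry[OF n ij, of x \<mu>] P_def a_def b_def ..
  ultimately show ?thesis using P by linarith
qed

lemma design_matrix_mult:
  assumes \<theta>: "\<theta> \<in> carrier_vec (p + 1)" and l: "l < n"
  shows "(design_matrix n p x *\<^sub>v \<theta>) $ l
    = (\<theta> $ 0 + (\<Sum>i<p. \<theta> $ (i + 1) * \<mu> i)) + row_form p (\<lambda>l i. x l i - \<mu> i) (\<lambda>i. \<theta> $ (i + 1)) l"
proof -
  have "(design_matrix n p x *\<^sub>v \<theta>) $ l = (\<Sum>k<Suc p. (if k = 0 then 1 else x l (k - 1)) * \<theta> $ k)"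
    using \<theta> l by (simp add: design_matrix_def scalar_prod_def atLeast0LessThan del: sum.lessThan_Suc)
  also have "\<dots> = \<theta> $ 0 + (\<Sum>i<p. x l i * \<theta> $ (i + 1))"
    by (subst sum.lessThan_Suc_shift) simp
  also have "(\<Sum>i<p. x l i * \<theta> $ (i + 1)) = (\<Sum>i<p. \<theta> $ (i + 1) * \<mu> i) + row_form p (\<lambda>l i. x l i - \<mu> i) (\<lambda>i. \<theta> $ (i + 1)) l"
    unfolding row_form_def sum.distrib[symmetric] by (intro sum.cong refl) (simp add: algebra_simps)
  finally show ?thesis by simp
qed

text \<open>
  With \<open>d\<close> the error of the coefficients, intercept included, the normal equations give
  \<open>A\<^sup>T A d = A\<^sup>T noise\<close>, hence \<open>|A d|\<^sup>2 = noise \<bullet> A d \<le> |noise| |A d|\<close>. The lower bound on the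
  design, uniform in the intercept, turns this into a bound for the slopes alone.
\<close>

lemma slope_estimate_error:
  assumes n: "0 < n" and \<epsilon>: "0 < \<epsilon>" and \<beta>: "\<beta> \<in> carrier_vec p"
    and low: "\<And>v c. \<epsilon> * sqrt (real n) * L2_set v {..<p} \<le> L2_set (\<lambda>l. c + row_form p (\<lambda>l i. x l i - \<mu> i) v l) {..<n}"
    and y: "\<And>l. l < n \<Longrightarrow> y l = \<beta>\<^sub>0 + scalar_prod \<beta> (vec p (x l)) + noise l"
    and noise: "(\<Sum>l<n. (noise l)\<^sup>2) \<le> T * real n"
  shows "(L2_set (\<lambda>i. slope_estimate n p x y $ i - \<beta> $ i) {..<p})\<^sup>2 \<le> T / \<epsilon>\<^sup>2"
proof -
  define A where "A = design_matrix n p x"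
  define G where "G = transpose_mat A * A"
  have A: "A \<in> carrier_mat n (p + 1)" by (simp add: A_def design_matrix_def)
  have G: "G \<in> carrier_mat (p + 1) (p + 1)" using A by (simp add: G_def)
  have L2A: "L2_set (\<lambda>l. (A *\<^sub>v \<theta>) $ l) {..<n} \<ge> \<epsilon> * sqrt (real n) * L2_set (\<lambda>i. \<theta> $ (i + 1)) {..<p}"
    if "\<theta> \<in> carrier_vec (p + 1)" for \<theta>
  proof -
    have "L2_set (\<lambda>l. (A *\<^sub>v \<theta>) $ l) {..<n} = L2_set (\<lambda>l. (\<theta> $ 0 + (\<Sum>i<p. \<theta> $ (i + 1) * \<mu> i))
        + row_form p (\<lambda>l i. x l i - \<mu> i) (\<lambda>i. \<theta> $ (i + 1)) l) {..<n}"
      unfolding A_def by (intro L2_set_cong refl design_matrix_mult[OF that]) simp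
    then show ?thesis using low by simp
  qed
  have form: "scalar_prod \<theta> (G *\<^sub>v \<theta>) = (L2_set (\<lambda>l. (A *\<^sub>v \<theta>) $ l) {..<n})\<^sup>2"
    if \<theta>: "\<theta> \<in> carrier_vec (p + 1)" for \<theta>
  proof -
    have A\<theta>: "A *\<^sub>v \<theta> \<in> carrier_vec n" using A \<theta> by auto
    have "G *\<^sub>v \<theta> = transpose_mat A *\<^sub>v (A *\<^sub>v \<theta>)"
      unfolding G_def using A \<theta> by (intro assoc_mult_mat_vec) auto
    moreover have "scalar_prod (transpose_mat A *\<^sub>v (A *\<^sub>v \<theta>)) \<theta> = scalar_prod (A *\<^sub>v \<theta>) (A *\<^sub>v \<theta>)"
      by (rule transpose_vec_mult_scalar[OF A \<theta> A\<theta>])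
    moreover have "scalar_prod \<theta> (G *\<^sub>v \<theta>) = scalar_prod (G *\<^sub>v \<theta>) \<theta>"
      using G \<theta> by (intro comm_scalar_prod) auto
    ultimately show ?thesis using scalar_prod_L2_set[OF A\<theta>] by simp
  qed
  have "\<theta> = 0\<^sub>v (p + 1)" if \<theta>: "\<theta> \<in> carrier_vec (p + 1)" "G *\<^sub>v \<theta> = 0\<^sub>v (p + 1)" for \<theta>
  proof -
    have "(L2_set (\<lambda>l. (A *\<^sub>v \<theta>) $ l) {..<n})\<^sup>2 = 0" unfolding form[OF \<theta>(1), symmetric] \<theta>(2) using \<theta>(1) by simp
    then have z: "L2_set (\<lambda>l. (A *\<^sub>v \<theta>) $ l) {..<n} = 0" by simp
    then have "\<epsilon> * sqrt (real n) * L2_set (\<lambda>i. \<theta> $ (i + 1)) {..<p} \<le> 0" using L2A[OF \<theta>(1)] by simp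
    moreover have "0 < \<epsilon> * sqrt (real n)" using \<epsilon> n by simp
    ultimately have "L2_set (\<lambda>i. \<theta> $ (i + 1)) {..<p} \<le> 0"
      by (intro mult_left_le_imp_le[of "\<epsilon> * sqrt (real n)" _ 0]) simp_all
    then have "L2_set (\<lambda>i. \<theta> $ (i + 1)) {..<p} = 0" using L2_set_nonneg[of "\<lambda>i. \<theta> $ (i + 1)" "{..<p}"] by linarith
    then have s0: "\<theta> $ (i + 1) = 0" if "i < p" for i using that by (simp add: L2_set_eq_0_iff)
    have "(A *\<^sub>v \<theta>) $ 0 = 0" using z n by (simp add: L2_set_eq_0_iff)
    then have "\<theta> $ 0 = 0"
      using design_matrix_mult[OF \<theta>(1) n, of x \<mu>] s0 by (simp add: A_def row_form_def)
    have "\<theta> $ k = 0" if "k < p + 1" for k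
      using \<open>\<theta> $ 0 = 0\<close> s0[of "k - 1"] that by (cases k) auto
    then show ?thesis using \<theta>(1) by (intro eq_vecI) auto
  qed
  note N = minv_correct[OF G this]
  define e where "e = vec n noise"
  define \<theta> where "\<theta> = vec (p + 1) (\<lambda>k. if k = 0 then \<beta>\<^sub>0 else \<beta> $ (k - 1))"
  define h where "h = least_squares n p x y"
  define d where "d = h - \<theta>"
  have e: "e \<in> carrier_vec n" and \<theta>: "\<theta> \<in> carrier_vec (p + 1)" by (simp_all add: e_def \<theta>_def)
  have vy: "vec n y = A *\<^sub>v \<theta> + e"
  proof (rule eq_vecI)
    fix l assume "l < dim_vec (A *\<^sub>v \<theta> + e)"
    then have l: "l < n" using e by simp
    have "(A *\<^sub>v \<theta>) $ l = \<theta> $ 0 + (\<Sum>i<p. \<theta> $ (i + 1) * x l i)"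
      using design_matrix_mult[OF \<theta> l, of x "\<lambda>_. 0"] by (simp add: A_def row_form_def)
    also have "\<dots> = \<beta>\<^sub>0 + scalar_prod \<beta> (vec p (x l))"
      using scalar_prod_sum[OF \<beta>, of "vec p (x l)"] by (simp add: \<theta>_def)
    finally show "vec n y $ l = (A *\<^sub>v \<theta> + e) $ l" using y[OF l] l e by (simp add: e_def)
  qed (use e in simp)
  have cy: "vec n y \<in> carrier_vec n" by simp
  have At: "transpose_mat A \<in> carrier_mat (p + 1) n" using A by simp
  have h': "h = minv G *\<^sub>v (transpose_mat A *\<^sub>v vec n y)"
    unfolding h_def least_squares_def Let_def A_def[symmetric] G_def[symmetric]
    by (rule assoc_mult_mat_vec[OF N(1) At cy])
  have hc: "h \<in> carrier_vec (p + 1)" using N(1) At cy by (simp add: h')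
  have d: "d \<in> carrier_vec (p + 1)" using hc \<theta> by (simp add: d_def)
  have Aty: "transpose_mat A *\<^sub>v vec n y \<in> carrier_vec (p + 1)" using At cy by auto
  have "G *\<^sub>v h = (G * minv G) *\<^sub>v (transpose_mat A *\<^sub>v vec n y)"
    unfolding h' by (rule assoc_mult_mat_vec[symmetric, OF G N(1) Aty])
  then have Gh: "G *\<^sub>v h = transpose_mat A *\<^sub>v vec n y" using N(2) Aty by simp
  have A\<theta>: "A *\<^sub>v \<theta> \<in> carrier_vec n" and Ad: "A *\<^sub>v d \<in> carrier_vec n" using A \<theta> d by auto
  have "transpose_mat A *\<^sub>v vec n y = transpose_mat A *\<^sub>v (A *\<^sub>v \<theta>) + transpose_mat A *\<^sub>v e"
    unfolding vy by (rule mult_add_distrib_mat_vec[OF At A\<theta> e])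
  also have "transpose_mat A *\<^sub>v (A *\<^sub>v \<theta>) = G *\<^sub>v \<theta>"
    unfolding G_def by (rule assoc_mult_mat_vec[symmetric, OF At A \<theta>])
  finally have "G *\<^sub>v h = G *\<^sub>v \<theta> + transpose_mat A *\<^sub>v e" using Gh by simp
  moreover have "G *\<^sub>v d = G *\<^sub>v h - G *\<^sub>v \<theta>" unfolding d_def by (rule mult_minus_distrib_mat_vec[OF G hc \<theta>])
  moreover have c3: "G *\<^sub>v \<theta> \<in> carrier_vec (p + 1)" "transpose_mat A *\<^sub>v e \<in> carrier_vec (p + 1)" using G \<theta> At e by auto
  moreover have "(u + w) - u = w" if "u \<in> carrier_vec k" "w \<in> carrier_vec k" for u w :: "real vec" and k
    using that by (intro eq_vecI) auto
  ultimately have Gd: "G *\<^sub>v d = transpose_mat A *\<^sub>v e" by metis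
  have "scalar_prod d (G *\<^sub>v d) = scalar_prod e (A *\<^sub>v d)"
    unfolding Gd using comm_scalar_prod[OF d c3(2)] transpose_vec_mult_scalar[OF A d e] by simp
  then have "(L2_set (\<lambda>l. (A *\<^sub>v d) $ l) {..<n})\<^sup>2 = scalar_prod e (A *\<^sub>v d)" using form[OF d] by simp
  moreover have "(scalar_prod e (A *\<^sub>v d))\<^sup>2 \<le> scalar_prod e e * scalar_prod (A *\<^sub>v d) (A *\<^sub>v d)"
    by (rule scalar_prod_Cauchy_Schwarz[OF e Ad])
  moreover have "scalar_prod e e = (\<Sum>l<n. (noise l)\<^sup>2)"
    unfolding scalar_prod_sum[OF e e] by (simp add: e_def power2_eq_square)
  moreover have "scalar_prod (A *\<^sub>v d) (A *\<^sub>v d) = (L2_set (\<lambda>l. (A *\<^sub>v d) $ l) {..<n})\<^sup>2" by (rule scalar_prod_L2_set[OF Ad])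
  moreover define q where "q = (L2_set (\<lambda>l. (A *\<^sub>v d) $ l) {..<n})\<^sup>2"
  ultimately have "q * q \<le> (\<Sum>l<n. (noise l)\<^sup>2) * q" by (simp add: power2_eq_square)
  then have "q \<le> (\<Sum>l<n. (noise l)\<^sup>2)"
    using zero_le_power2[of "L2_set (\<lambda>l. (A *\<^sub>v d) $ l) {..<n}"] sum_nonneg[of "{..<n}" "\<lambda>l. (noise l)\<^sup>2"]
    by (cases "q = 0") (auto simp: q_def[symmetric])
  then have q: "q \<le> T * real n" using noise by linarith
  let ?s = "L2_set (\<lambda>i. d $ (i + 1)) {..<p}"
  have "(\<epsilon> * sqrt (real n) * ?s)\<^sup>2 \<le> q"
    unfolding q_def using \<epsilon> by (intro power_mono L2A[OF d]) (auto intro!: mult_nonneg_nonneg)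
  then have "real n * (\<epsilon>\<^sup>2 * ?s\<^sup>2) \<le> real n * T" using q by (simp add: power_mult_distrib mult_ac)
  then have "\<epsilon>\<^sup>2 * ?s\<^sup>2 \<le> T" using n by (simp add: mult_le_cancel_left_pos)
  moreover have "?s = L2_set (\<lambda>i. slope_estimate n p x y $ i - \<beta> $ i) {..<p}"
    using hc \<theta> by (intro L2_set_cong) (auto simp: d_def slope_estimate_def h_def \<theta>_def)
  ultimately show ?thesis using \<epsilon> by (simp add: field_simps)
qed

section \<open>The partition estimators recover the true blocks\<close>

lemma form_between_diagonal:
  assumes A: "form_between p c K A" and i: "i < p"
  shows "c \<le> A $$ (i, i)" "A $$ (i, i) \<le> K"
proof -
  define u :: "real vec" where "u = unit_vec p i"
  have u: "u \<in> carrier_vec p" "scalar_prod u u = 1" using i by (simp_all add: u_def)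
  have cA: "A \<in> carrier_mat p p" using A by (simp add: form_between_def)
  have "bform A u u = (\<Sum>k\<in>{i}. \<Sum>l\<in>{i}. u $ k * A $$ (k, l) * u $ l)"
    using i by (intro bform_supported[OF cA _ u(1)]) (auto simp: u_def)
  then have "bform A u u = A $$ (i, i)" using i by (simp add: u_def)
  then show "c \<le> A $$ (i, i)" "A $$ (i, i) \<le> K"
    using A u unfolding form_between_def by force+
qed

lemma correlation_bounds:
  assumes S: "form_between p c K S" and c: "0 < c" and ij: "i < p" "j < p"
  shows "\<bar>S $$ (i, j)\<bar> / K \<le> \<bar>correlation S $$ (i, j)\<bar>" "\<bar>correlation S $$ (i, j)\<bar> \<le> \<bar>S $$ (i, j)\<bar> / c"
proof -
  have cS: "S \<in> carrier_mat p p" using S by (simp add: form_between_def)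
  note di = form_between_diagonal[OF S ij(1)] and dj = form_between_diagonal[OF S ij(2)]
  define r where "r = sqrt (S $$ (i, i) * S $$ (j, j))"
  have K: "0 < K" using di c by linarith
  have "sqrt (c * c) \<le> r" unfolding r_def using di dj c by (intro real_sqrt_le_mono mult_mono) auto
  then have rc: "c \<le> r" using c by simp
  have "r \<le> sqrt (K * K)" unfolding r_def using di dj c by (intro real_sqrt_le_mono mult_mono) auto
  then have rK: "r \<le> K" using K by simp
  have e: "\<bar>correlation S $$ (i, j)\<bar> = \<bar>S $$ (i, j)\<bar> / r"
    using cS ij rc c by (simp add: correlation_def abs_divide flip: r_def)
  show "\<bar>S $$ (i, j)\<bar> / K \<le> \<bar>correlation S $$ (i, j)\<bar>"
    unfolding e using rK rc c by (intro divide_left_mono) auto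
  show "\<bar>correlation S $$ (i, j)\<bar> \<le> \<bar>S $$ (i, j)\<bar> / c"
    unfolding e using rc c by (intro divide_left_mono) auto
qed

lemma correlation_symmetric:
  assumes "S \<in> carrier_mat p p" "transpose_mat S = S" "i < p" "j < p"
  shows "correlation S $$ (i, j) = correlation S $$ (j, i)"
  using assms transpose_mat_index[OF assms] by (simp add: correlation_def mult.commute)

text \<open>
  Correlations and covariances differ by factors between \<open>1/K\<close> and \<open>1/c\<close>, so every threshold
  between \<open>e/c\<close> and \<open>b/K\<close> returns \<open>Bs\<close>. Such a threshold occurs among those of each of the three
  estimators based on thresholds, and the minimisers of the criterion are covered by
  \<open>Psi_le_imp_finest_blocks_eq\<close>. A minimiser over all partitions need not equal \<open>Bs\<close> when \<open>S\<close> has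
  vanishing entries; the conclusion retains what the plug-in estimator depends on.
\<close>

theorem estimators_recover_blocks:
  assumes S: "form_between p c K S" and cK: "0 < c" "0 < K" and p: "m < p"
    and Bs: "partition_on {..<p} Bs" and B: "partition_on {..<p} B"
    and m: "\<And>G. G \<in> Bs \<Longrightarrow> card G \<le> m"
    and small: "\<And>i j. i < p \<Longrightarrow> j < p \<Longrightarrow> \<not> same_block Bs i j \<Longrightarrow> \<bar>S $$ (i, j)\<bar> \<le> e"
    and big: "\<And>Q. strictly_finer p Q Bs \<Longrightarrow>
        \<exists>i<p. \<exists>j<p. same_block Bs i j \<and> \<not> same_block Q i j \<and> b \<le> \<bar>S $$ (i, j)\<bar>"
    and b: "0 \<le> b" and e: "0 \<le> e"
    and pen_large: "e\<^sup>2 / c\<^sup>2 < real p * \<kappa>" and pen_small: "real p * \<kappa> * (real m)\<^sup>2 < b\<^sup>2 / (8 * K\<^sup>2)"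
    and grid: "e / c + 1 / real p < b / K" "e / c + 1 / real p \<le> 1"
    and thr: "e / c \<le> real n powr (- 1 / 3)" "real n powr (- 1 / 3) < b / K"
    and est: "is_B_tot \<kappa> S B \<or> is_B_corr \<kappa> S B \<or> is_B_threshold n S B \<or> is_B_grid m \<kappa> S B"
  shows "refines {..<p} Bs B" "block_restrict B S = block_restrict Bs S"
proof -
  have cS: "S \<in> carrier_mat p p" and tS: "transpose_mat S = S" using S by (auto simp: form_between_def)
  have dS: "dim_row S = p" using cS by simp
  have p0: "0 < p" using p by simp
  have min: "refines {..<p} Bs B \<and> block_restrict B S = block_restrict Bs S" if "Psi \<kappa> S B \<le> Psi \<kappa> S Bs"
  proof -
    have "finest_blocks (block_restrict B S) = Bs"
      by (rule Psi_le_imp_finest_blocks_eq[OF S cK p0 Bs B m small big b pen_large pen_small that])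
    then show ?thesis using finest_blocks_block_restrict[OF cS B] by simp
  qed
  have off: "\<bar>correlation S $$ (i, j)\<bar> \<le> e / c" if "i < p" "j < p" "\<not> same_block Bs i j" for i j
    using correlation_bounds(2)[OF S cK(1) that(1,2)] divide_right_mono[OF small[OF that], of c] cK by linarith
  have on: "\<exists>i<p. \<exists>j<p. \<not> same_block Q i j \<and> t < \<bar>correlation S $$ (i, j)\<bar>" if Q: "strictly_finer p Q Bs" and t: "t < b / K" for Q t
  proof -
    obtain i j where ij: "i < p" "j < p" "\<not> same_block Q i j" "b \<le> \<bar>S $$ (i, j)\<bar>" using big[OF Q] by blast
    have "b / K \<le> \<bar>S $$ (i, j)\<bar> / K" using ij cK by (intro divide_right_mono) auto
    also have "\<dots> \<le> \<bar>correlation S $$ (i, j)\<bar>" by (rule correlation_bounds(1)[OF S cK(1) ij(1,2)])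
    finally have "t < \<bar>correlation S $$ (i, j)\<bar>" using t by linarith
    then show ?thesis using ij by blast
  qed
  have thr_eq: "threshold_blocks S t = Bs"
    if "0 \<le> t" "t < b / K" "\<And>i j. i < p \<Longrightarrow> j < p \<Longrightarrow> \<not> same_block Bs i j \<Longrightarrow> \<bar>correlation S $$ (i, j)\<bar> \<le> t" for t
    by (rule threshold_blocks_eq[OF cS Bs that(3) on[OF _ that(2)] that(1)])
  have "refines {..<p} Bs B \<and> block_restrict B S = block_restrict Bs S"
    using est
  proof (elim disjE)
    assume "is_B_tot \<kappa> S B"
    then have "\<not> Psi \<kappa> S Bs < Psi \<kappa> S B" using Bs unfolding is_B_tot_def is_arg_min_def dS by blast
    then show ?thesis by (intro min) simp
  next
    assume "is_B_threshold n S B"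
    then have "B = threshold_blocks S (real n powr (- 1 / 3))" by (simp add: is_B_threshold_def)
    also have "\<dots> = Bs" by (rule thr_eq[OF _ thr(2) order.trans[OF off thr(1)]]) auto
    finally show ?thesis using refines_refl[OF Bs] by simp
  next
    assume B_corr: "is_B_corr \<kappa> S B"
    define W where "W = {(i, j). i < p \<and> j < p \<and> i < j \<and> \<not> same_block Bs i j}"
    have finW: "finite W" by (rule finite_subset[of _ "{..<p} \<times> {..<p}"]) (auto simp: W_def)
    \<comment> \<open>the largest correlation between different blocks serves as the threshold; as \<open>m < p\<close>, there is more than one block\<close>
    have "W \<noteq> {}"
    proof
      assume "W = {}"
      then have sb: "same_block Bs 0 j" if "j < p" for j
        using that p0 same_block_refl[OF Bs, of 0] by (cases "j = 0") (auto simp: W_def)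
      obtain G where G: "G \<in> Bs" "0 \<in> G" using Bs p0 by (auto simp: partition_on_def)
      have "{..<p} \<subseteq> G"
      proof
        fix j assume "j \<in> {..<p}"
        then obtain H where "H \<in> Bs" "0 \<in> H" "j \<in> H" using sb by (auto simp: same_block_def)
        then show "j \<in> G" using G Bs unfolding partition_on_def disjoint_def by blast
      qed
      moreover have "finite G" using G Bs finite_subset[of G "{..<p}"] by (auto simp: partition_on_def)
      ultimately have "p \<le> card G" using card_mono[of G "{..<p}"] by simp
      then show False using m[OF G(1)] p by simp
    qed
    define t where "t = Max ((\<lambda>(i, j). \<bar>correlation S $$ (i, j)\<bar>) ` W)"
    have "t \<in> (\<lambda>(i, j). \<bar>correlation S $$ (i, j)\<bar>) ` W"
      unfolding t_def using finW \<open>W \<noteq> {}\<close> by (intro Max_in) auto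
    then obtain i j where ij: "(i, j) \<in> W" "t = \<bar>correlation S $$ (i, j)\<bar>" by auto
    have "t \<le> e / c" using ij off[of i j] by (auto simp: W_def)
    moreover have "0 < 1 / real p" using p0 by simp
    ultimately have tb: "t < b / K" using grid(1) by linarith
    have "threshold_blocks S t = Bs"
    proof (rule thr_eq[OF _ tb])
      show "0 \<le> t" using ij by simp
      fix k l assume kl: "k < p" "l < p" "\<not> same_block Bs k l"
      have le: "\<bar>correlation S $$ (k', l')\<bar> \<le> t" if "(k', l') \<in> W" for k' l'
        unfolding t_def using finW that by (intro Max_ge) force+
      have "k \<noteq> l" using kl same_block_refl[OF Bs, of k] by auto
      then show "\<bar>correlation S $$ (k, l)\<bar> \<le> t"
        using kl le[of k l] le[of l k] correlation_symmetric[OF cS tS kl(1,2)] same_block_commute[of Bs k l]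
        by (cases "k < l") (auto simp: W_def)
    qed
    then have "\<exists>t\<in>{\<bar>correlation S $$ (i, j)\<bar> | i j. i < j \<and> j < dim_row S}. Bs = threshold_blocks S t"
      using ij by (intro bexI[of _ t]) (auto simp: W_def dS)
    then have "\<not> Psi \<kappa> S Bs < Psi \<kappa> S B" using B_corr unfolding is_B_corr_def is_arg_min_def by blast
    then show ?thesis by (intro min) simp
  next
    assume B_grid: "is_B_grid m \<kappa> S B"
    \<comment> \<open>the first grid point above \<open>e/c\<close>; it overshoots by less than the mesh \<open>1/p\<close>\<close>
    define k where "k = nat \<lceil>real p * (e / c)\<rceil>"
    have ec: "0 \<le> e / c" using e cK by simp
    have k1: "real p * (e / c) \<le> real k" unfolding k_def by (rule real_nat_ceiling_ge)
    have "real k = of_int \<lceil>real p * (e / c)\<rceil>"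
    proof -
      have "0 \<le> real p * (e / c)" using ec by (intro mult_nonneg_nonneg) auto
      then show ?thesis unfolding k_def by (intro of_nat_nat) linarith
    qed
    then have k2: "real k < real p * (e / c) + 1" using ceiling_correct[of "real p * (e / c)"] by linarith
    have t1: "e / c \<le> real k / real p" using k1 p0 by (simp add: field_simps)
    have "real k / real p < (real p * (e / c) + 1) / real p" using k2 p0 by (intro divide_strict_right_mono) auto
    also have "\<dots> = e / c + 1 / real p" using p0 by (simp add: field_simps)
    finally have t2: "real k / real p < e / c + 1 / real p" .
    then have kp: "k \<le> p" using grid(2) p0 by (simp add: field_simps)
    have eq: "threshold_blocks S (real k / real p) = Bs"
      by (rule thr_eq[OF order.trans[OF ec t1] less_trans[OF t2 grid(1)] order.trans[OF off t1]])
    then have "grid_start m S \<le> k"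
      unfolding grid_start_def dS using m by (intro Least_le) simp
    then have "\<exists>t\<in>{real k / real (dim_row S) | k. grid_start m S \<le> k \<and> k \<le> dim_row S}. Bs = threshold_blocks S t"
      using kp eq by (intro bexI[of _ "real k / real p"]) (auto simp: dS)
    then have "\<not> Psi \<kappa> S Bs < Psi \<kappa> S B" using B_grid unfolding is_B_grid_def is_arg_min_def by blast
    then show ?thesis by (intro min) simp
  qed
  then show "refines {..<p} Bs B" "block_restrict B S = block_restrict Bs S" by auto
qed

section \<open>Total error of the Shapley effects\<close>

lemma the_block:
  assumes B: "partition_on A B" and i: "i \<in> A"
  shows "(THE G. G \<in> B \<and> i \<in> G) \<in> B" "i \<in> (THE G. G \<in> B \<and> i \<in> G)"
    "j \<in> (THE G. G \<in> B \<and> i \<in> G) \<longleftrightarrow> same_block B i j"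
proof -
  obtain G where G: "G \<in> B" "i \<in> G" using B i by (auto simp: partition_on_def)
  have u: "H = G" if "H \<in> B" "i \<in> H" for H
    using B G that unfolding partition_on_def disjoint_def by blast
  have e: "(THE G. G \<in> B \<and> i \<in> G) = G" by (rule the_equality) (use G u in blast)+
  show "(THE G. G \<in> B \<and> i \<in> G) \<in> B" "i \<in> (THE G. G \<in> B \<and> i \<in> G)" unfolding e using G by blast+
  show "j \<in> (THE G. G \<in> B \<and> i \<in> G) \<longleftrightarrow> same_block B i j"
    unfolding e same_block_def using G u by blast
qed

abbreviation block_of :: "nat set set \<Rightarrow> nat \<Rightarrow> nat set" where
  "block_of B i \<equiv> (THE G. G \<in> B \<and> i \<in> G)"

text \<open>
  Every \<open>j\<close> is counted once for each of the at most \<open>m\<close> members of its block.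
\<close>

lemma sum_same_block_le:
  assumes B: "partition_on {..<p} B" and m: "\<And>G. G \<in> B \<Longrightarrow> card G \<le> m" and f: "\<And>j. 0 \<le> f j"
  shows "(\<Sum>i<p. \<Sum>j\<in>block_of B i. f j) \<le> real m * (\<Sum>j<p. f j)"
proof -
  have b: "block_of B i \<subseteq> {..<p}" if "i < p" for i
    using the_block(1)[OF B] that B by (auto simp: partition_on_def)
  have s: "(\<Sum>j\<in>block_of B i. g j) = (\<Sum>j<p. of_bool (same_block B i j) * g j)" if "i < p" for i and g :: "nat \<Rightarrow> real"
    using b[OF that] the_block(3)[OF B, of i] that
    by (intro sum.mono_neutral_cong_left) auto
  have "(\<Sum>i<p. \<Sum>j\<in>block_of B i. f j) = (\<Sum>i<p. \<Sum>j<p. of_bool (same_block B i j) * f j)"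
  proof (rule sum.cong[OF refl])
    fix i assume "i \<in> {..<p}"
    then show "(\<Sum>j\<in>block_of B i. f j) = (\<Sum>j<p. of_bool (same_block B i j) * f j)" by (intro s) simp
  qed
  also have "\<dots> = (\<Sum>j<p. \<Sum>i<p. of_bool (same_block B j i) * f j)"
    by (subst sum.swap) (simp only: same_block_commute)
  also have "\<dots> = (\<Sum>j<p. \<Sum>i\<in>block_of B j. f j)"
  proof (rule sum.cong[OF refl])
    fix j assume "j \<in> {..<p}"
    then show "(\<Sum>i<p. of_bool (same_block B j i) * f j) = (\<Sum>i\<in>block_of B j. f j)" by (intro s[symmetric]) simp
  qed
  also have "\<dots> = (\<Sum>j<p. real (card (block_of B j)) * f j)" by simp
  also have "\<dots> \<le> (\<Sum>j<p. real m * f j)"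
    using m the_block(1)[OF B] f by (intro sum_mono mult_right_mono) auto
  finally show ?thesis by (simp add: sum_distrib_left)
qed

text \<open>
  The first summand stems from the numerators and the second one from the common denominator; \<open>lo\<close>
  and \<open>hi\<close> bound the absolute values of the coefficients, and \<open>Q\<close> bounds the squared error of
  their estimates.
\<close>

definition error_const :: "real \<Rightarrow> real \<Rightarrow> nat \<Rightarrow> real \<Rightarrow> real \<Rightarrow> real \<Rightarrow> real" where
  "error_const c K m Q lo hi =
     4 * (2 * perturb_const c K m * (2 * (sqrt m * hi)\<^sup>2 + 3 * (real m * Q) + sqrt m * hi * sqrt (real m * Q))) / (c * lo\<^sup>2)
   + 4 * (K * (sqrt m * hi)\<^sup>2) * (hi\<^sup>2 * real m + 2 * (K * sqrt Q * hi) + K * Q) / (c\<^sup>2 * lo ^ 4)"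

lemma quotient_difference_le:
  fixes N N' D D' :: real
  assumes "0 < d" "d \<le> D" "0 < d'" "d' \<le> D'" "\<bar>N' - N\<bar> \<le> a" "\<bar>N\<bar> \<le> k" "\<bar>D' - D\<bar> \<le> g"
  shows "\<bar>N' / D' - N / D\<bar> \<le> a / d' + k * g / (d * d')"
proof -
  have pos: "0 < D" "0 < D'" using assms by linarith+
  have k: "0 \<le> k" "0 \<le> g" "0 \<le> a" using assms by linarith+
  have "N' / D' - N / D = (N' - N) / D' + N * (D - D') / (D * D')"
    using pos by (simp add: field_simps)
  also have "\<bar>\<dots>\<bar> \<le> \<bar>N' - N\<bar> / D' + \<bar>N\<bar> * \<bar>D' - D\<bar> / (D * D')"
    using pos by (intro order.trans[OF abs_triangle_ineq]) (simp add: abs_mult abs_divide abs_minus_commute)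
  also have "\<dots> \<le> a / d' + k * g / (d * d')"
    using assms pos k by (intro add_mono frac_le mult_mono) auto
  finally show ?thesis .
qed

text \<open>
  After the reduction to the blocks of \<open>Bs\<close>, the numerators are functions of at most \<open>m\<close>
  coordinates and have error \<open>O(e + t\<^sub>i\<^sup>2 + t\<^sub>i)\<close>, where \<open>t\<^sub>i\<close> is the error of the coefficients on
  the block of \<open>i\<close>. As \<open>\<Sum>\<^sub>i t\<^sub>i\<^sup>2 \<le> m Q\<close>, the sum of these errors is \<open>O(p e + sqrt p)\<close>. The
  denominators are of order \<open>p\<close> and have error \<open>O(p e + sqrt p)\<close> as well, since a bounded change
  of a vector of norm \<open>O(sqrt p)\<close> changes the form by \<open>O(sqrt p)\<close>. Everything is measured in units
  of \<open>p \<rho>\<close> with \<open>\<rho> = e + 1/sqrt p\<close>, and dividing by \<open>p\<close> gives the claim.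
\<close>

theorem shapley_total_error:
  assumes \<Sigma>: "form_between p c K \<Sigma>" and S: "form_between p c K S" and cK: "0 < c" "0 < K" and p: "0 < p"
    and Bs: "partition_on {..<p} Bs" and \<Sigma>B: "\<Sigma> = block_restrict Bs \<Sigma>" and m: "\<And>G. G \<in> Bs \<Longrightarrow> card G \<le> m"
    and B: "refines {..<p} Bs B" "block_restrict B S = block_restrict Bs S"
    and b: "\<beta> \<in> carrier_vec p" "b' \<in> carrier_vec p" "dim_vec \<beta> = p"
    and beta: "0 < lo" "\<And>j. j < p \<Longrightarrow> lo \<le> \<bar>\<beta> $ j\<bar> \<and> \<bar>\<beta> $ j\<bar> \<le> hi"
    and h: "(L2_set (\<lambda>i. b' $ i - \<beta> $ i) {..<p})\<^sup>2 \<le> Q"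
    and e: "\<And>i j. i < p \<Longrightarrow> j < p \<Longrightarrow> \<bar>S $$ (i, j) - \<Sigma> $$ (i, j)\<bar> \<le> e" "0 \<le> e" "e \<le> 1"
    and large: "4 * Q \<le> real p * lo\<^sup>2"
  shows "(\<Sum>i<p. \<bar>block_shapley B (block_restrict B S) b' i - shapley_effect \<Sigma> \<beta> i\<bar>)
    \<le> error_const c K m Q lo hi * (e + 1 / sqrt (real p))"
proof -
  define S' where "S' = block_restrict Bs S"
  define H where "H i = block_of Bs i" for i
  define d where "d = b' - \<beta>"
  define R where "R = sqrt m * hi"
  define t where "t i = norm_on (H i) d" for i
  define \<rho> where "\<rho> = e + 1 / sqrt (real p)"
  have pB: "partition_on {..<p} B" using B(1) by (simp add: refines_def)
  have hi: "0 < hi" using beta(1) beta(2)[OF p] by linarith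
  have S': "form_between p c K S'" unfolding S'_def by (rule form_between_block_restrict[OF S Bs])
  have cS: "S \<in> carrier_mat p p" "S' \<in> carrier_mat p p" "\<Sigma> \<in> carrier_mat p p"
    using S S' \<Sigma> by (auto simp: form_between_def)
  have spd: "sym_pos_def S'" "sym_pos_def \<Sigma>" using form_between_sym_pos_def S' \<Sigma> cK by auto
  have tS': "transpose_mat S' = S'" using S' by (simp add: form_between_def)
  have d: "d \<in> carrier_vec p" using b by (simp add: d_def)
  have Hsub: "H i \<subseteq> {..<p}" "i \<in> H i" "card (H i) \<le> m" if "i < p" for i
    using the_block[OF Bs, of i] that Bs m by (auto simp: H_def partition_on_def)
  have Hsb: "j \<in> H i \<longleftrightarrow> same_block Bs i j" if "i < p" for i j
    using the_block(3)[OF Bs, of i j] that by (simp add: H_def)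
  have Q: "(norm_on {..<p} d)\<^sup>2 \<le> Q"
  proof -
    have "norm_on {..<p} d = L2_set (\<lambda>i. b' $ i - \<beta> $ i) {..<p}"
      unfolding norm_on_def d_def using b by (intro L2_set_cong) auto
    then show ?thesis using h by simp
  qed
  have Q0: "0 \<le> Q" using Q by (meson order.trans zero_le_power2)
  have nd: "norm_on {..<p} d \<le> sqrt Q" using Q real_le_rsqrt by blast
  have p1: "1 \<le> sqrt (real p)" using p by simp
  have \<rho>: "real p * e \<le> real p * \<rho>" "sqrt (real p) \<le> real p * \<rho>" "1 \<le> real p * \<rho>" "0 \<le> \<rho>"
  proof -
    have "real p * (1 / sqrt (real p)) = sqrt (real p)" by (simp add: real_div_sqrt)
    then have pr: "real p * \<rho> = real p * e + sqrt (real p)" by (simp add: \<rho>_def distrib_left)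
    have "0 \<le> real p * e" using e by simp
    then show "real p * e \<le> real p * \<rho>" "sqrt (real p) \<le> real p * \<rho>" "1 \<le> real p * \<rho>"
      unfolding pr using p1 by linarith+
    show "0 \<le> \<rho>" using e by (simp add: \<rho>_def)
  qed
  \<comment> \<open>both effects are quotients whose numerators involve the block \<open>H i\<close> of \<open>Bs\<close> only; for the estimate, the block
  of \<open>B\<close> may be larger, but \<open>S'\<close> has no entries linking \<open>H i\<close> to the rest of it\<close>
  define N' where "N' i = shapley_num S' b' (H i) i" for i
  define N where "N i = shapley_num \<Sigma> \<beta> (H i) i" for i
  define D' where "D' = bform S' b' b'"
  define D where "D = bform \<Sigma> \<beta> \<beta>"
  have red': "block_shapley B (block_restrict B S) b' i = N' i / D'" if i: "i < p" for i
  proof -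
    have G: "block_of B i \<in> B" "i \<in> block_of B i" "\<And>j. j \<in> block_of B i \<longleftrightarrow> same_block B i j"
      using the_block[OF pB, of i] i by auto
    have Gp: "block_of B i \<subseteq> {..<p}" using G(1) pB by (auto simp: partition_on_def)
    have HG: "H i \<subseteq> block_of B i" using G(3) Hsb[OF i] same_block_refines[OF B(1)] by auto
    have "shapley_num S' b' (block_of B i) i = shapley_num S' b' (H i) i"
    proof (rule shapley_num_reduce[OF cS(2) spd(1) b(2) Gp HG Hsub(2)[OF i]])
      fix k j assume kj: "k \<in> H i" "j \<in> block_of B i - H i"
      then have "k < p" "j < p" using Hsub(1)[OF i] Gp by auto
      moreover have "\<not> same_block Bs k j" using kj Hsb[OF i] same_block_trans[OF Bs] by blast
      ultimately show "S' $$ (k, j) = 0" using cS(1) by (simp add: S'_def)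
    qed
    then show ?thesis unfolding block_shapley_def B(2) S'_def[symmetric] shapley_on_eq by (simp add: N'_def D'_def)
  qed
  have red: "shapley_effect \<Sigma> \<beta> i = N i / D" if i: "i < p" for i
  proof -
    have "shapley_num \<Sigma> \<beta> {..<p} i = shapley_num \<Sigma> \<beta> (H i) i"
    proof (rule shapley_num_reduce[OF cS(3) spd(2) b(1) subset_refl Hsub(1)[OF i] Hsub(2)[OF i]])
      fix k j assume kj: "k \<in> H i" "j \<in> {..<p} - H i"
      then have "k < p" "j < p" using Hsub(1)[OF i] by auto
      moreover have "\<not> same_block Bs k j" using kj Hsb[OF i] same_block_trans[OF Bs] by blast
      ultimately show "\<Sigma> $$ (k, j) = 0" using block_restrict_nonzero[OF cS(3) \<Sigma>B] by blast
    qed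
    then show ?thesis unfolding shapley_effect_def shapley_on_eq b(3) by (simp add: N_def D_def)
  qed
  \<comment> \<open>the norm of \<open>\<beta>\<close> on a block is bounded by \<open>R\<close>, so the perturbation bound is uniform over the blocks\<close>
  have nR: "norm_on (H i) \<beta> \<le> R" if i: "i < p" for i
  proof (rule power2_le_imp_le)
    have "(norm_on (H i) \<beta>)\<^sup>2 = (\<Sum>j\<in>H i. \<bar>\<beta> $ j\<bar>\<^sup>2)" by (simp add: norm_on_sq)
    also have "\<dots> \<le> (\<Sum>j\<in>H i. hi\<^sup>2)"
      using Hsub(1)[OF i] beta by (intro sum_mono power_mono) auto
    also have "\<dots> \<le> real m * hi\<^sup>2" using Hsub(3)[OF i] by (simp add: mult_right_mono)
    also have "\<dots> = R\<^sup>2" by (simp add: R_def power_mult_distrib)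
    finally show "(norm_on (H i) \<beta>)\<^sup>2 \<le> R\<^sup>2" .
    show "0 \<le> R" using hi by (simp add: R_def)
  qed
  let ?P = "perturb_const c K m"
  have P0: "0 \<le> ?P" using cK by (simp add: perturb_const_def)
  have dN: "\<bar>N' i - N i\<bar> \<le> 2 * (?P * (2 * R\<^sup>2 * e + 3 * (t i)\<^sup>2 + R * t i))" if i: "i < p" for i
    unfolding N'_def N_def t_def d_def
  proof (rule shapley_num_perturb[OF \<Sigma> S' cK b(1,2) Hsub(1,3,2)[OF i] _ e(2,3) nR[OF i]])
    fix k j assume kj: "k \<in> H i" "j \<in> H i"
    then have "k < p" "j < p" using Hsub(1)[OF i] by auto
    moreover have "same_block Bs k j" using kj Hsb[OF i] same_block_trans[OF Bs] same_block_commute by blast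
    ultimately show "\<bar>S' $$ (k, j) - \<Sigma> $$ (k, j)\<bar> \<le> e" using cS(1) e(1) by (simp add: S'_def)
  qed
  have t2: "(\<Sum>i<p. (t i)\<^sup>2) \<le> real m * Q"
  proof -
    have "(\<Sum>i<p. (t i)\<^sup>2) = (\<Sum>i<p. \<Sum>j\<in>block_of Bs i. (d $ j)\<^sup>2)" by (simp add: t_def norm_on_sq H_def)
    also have "\<dots> \<le> real m * (\<Sum>j<p. (d $ j)\<^sup>2)" by (rule sum_same_block_le[OF Bs m]) auto
    also have "\<dots> \<le> real m * Q" using Q by (intro mult_left_mono) (auto simp: norm_on_sq)
    finally show ?thesis .
  qed
  have t1: "(\<Sum>i<p. t i) \<le> sqrt (real p) * sqrt (real m * Q)"
  proof -
    have "(\<Sum>i<p. t i) \<le> (\<Sum>i<p. \<bar>t i\<bar>)" by (intro sum_mono) auto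
    also have "\<dots> \<le> sqrt (real p) * L2_set t {..<p}" by (rule sum_abs_le_L2_set)
    also have "\<dots> \<le> sqrt (real p) * sqrt (real m * Q)"
      unfolding L2_set_def using t2 by (intro mult_left_mono real_sqrt_le_mono) auto
    finally show ?thesis .
  qed
  define X where "X = 2 * ?P * (2 * R\<^sup>2 + 3 * (real m * Q) + R * sqrt (real m * Q))"
  have R0: "0 \<le> R" using hi by (simp add: R_def)
  have sumN: "(\<Sum>i<p. 2 * (?P * (2 * R\<^sup>2 * e + 3 * (t i)\<^sup>2 + R * t i))) \<le> X * (real p * \<rho>)"
  proof -
    have "(\<Sum>i<p. 2 * (?P * (2 * R\<^sup>2 * e + 3 * (t i)\<^sup>2 + R * t i)))
       = 2 * ?P * (2 * R\<^sup>2 * (real p * e) + 3 * (\<Sum>i<p. (t i)\<^sup>2) + R * (\<Sum>i<p. t i))"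
      by (simp add: sum.distrib distrib_left sum_distrib_left mult_ac)
    also have "\<dots> \<le> 2 * ?P * (2 * R\<^sup>2 * (real p * \<rho>) + 3 * (real m * Q * (real p * \<rho>)) + R * (sqrt (real m * Q) * (real p * \<rho>)))"
    proof (intro mult_left_mono add_mono)
      show "(\<Sum>i<p. (t i)\<^sup>2) \<le> real m * Q * (real p * \<rho>)"
        using t2 mult_left_mono[OF \<rho>(3), of "real m * Q"] Q0 by simp
      show "(\<Sum>i<p. t i) \<le> sqrt (real m * Q) * (real p * \<rho>)"
        using t1 mult_left_mono[OF \<rho>(2), of "sqrt (real m * Q)"] Q0 by (simp add: mult.commute)
      show "e \<le> \<rho>" by (simp add: \<rho>_def)
    qed (use \<rho>(4) P0 R0 in auto)
    also have "\<dots> = X * (real p * \<rho>)" by (simp add: X_def algebra_simps)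
    finally show ?thesis .
  qed
  \<comment> \<open>the variances in the denominators are at least of order \<open>p\<close>; for the estimate this needs \<open>Q\<close> to be small against \<open>p\<close>\<close>
  have n\<beta>: "(norm_on {..<p} \<beta>)\<^sup>2 \<le> real p * hi\<^sup>2" "real p * lo\<^sup>2 \<le> (norm_on {..<p} \<beta>)\<^sup>2"
  proof -
    have e2: "(norm_on {..<p} \<beta>)\<^sup>2 = (\<Sum>j<p. \<bar>\<beta> $ j\<bar>\<^sup>2)" by (simp add: norm_on_sq)
    have "(\<Sum>j<p. \<bar>\<beta> $ j\<bar>\<^sup>2) \<le> (\<Sum>j<p. hi\<^sup>2)" using beta by (intro sum_mono power_mono) auto
    then show "(norm_on {..<p} \<beta>)\<^sup>2 \<le> real p * hi\<^sup>2" unfolding e2 by simp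
    have "(\<Sum>j<p. lo\<^sup>2) \<le> (\<Sum>j<p. \<bar>\<beta> $ j\<bar>\<^sup>2)" using beta by (intro sum_mono power_mono) auto
    then show "real p * lo\<^sup>2 \<le> (norm_on {..<p} \<beta>)\<^sup>2" unfolding e2 by simp
  qed
  have sp: "scalar_prod x x = (norm_on {..<p} x)\<^sup>2" if "x \<in> carrier_vec p" for x
    using scalar_prod_L2_set[OF that] by (simp add: norm_on_def)
  have Dlow: "c * (real p * lo\<^sup>2) \<le> D"
  proof -
    have "c * (real p * lo\<^sup>2) \<le> c * scalar_prod \<beta> \<beta>" unfolding sp[OF b(1)] using n\<beta> cK by (intro mult_left_mono) auto
    also have "\<dots> \<le> D" using \<Sigma> b(1) by (simp add: form_between_def D_def)
    finally show ?thesis .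
  qed
  have D'low: "c * (real p * lo\<^sup>2) / 4 \<le> D'"
  proof -
    have "sqrt (real p) * lo \<le> norm_on {..<p} \<beta>"
      by (rule power2_le_imp_le[OF _ norm_on_nonneg]) (use n\<beta>(2) in \<open>simp add: power_mult_distrib\<close>)
    moreover have "norm_on {..<p} \<beta> \<le> norm_on {..<p} b' + norm_on {..<p} d"
    proof -
      have "norm_on {..<p} \<beta> = L2_set (\<lambda>i. b' $ i + (- 1) * d $ i) {..<p}"
        unfolding norm_on_def d_def using b by (intro L2_set_cong) auto
      also have "\<dots> \<le> L2_set (\<lambda>i. b' $ i) {..<p} + L2_set (\<lambda>i. (- 1) * d $ i) {..<p}" by (rule L2_set_triangle_ineq)
      also have "L2_set (\<lambda>i. (- 1) * d $ i) {..<p} = norm_on {..<p} d" by (subst L2_set_scale) (simp add: norm_on_def)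
      finally show ?thesis unfolding norm_on_def .
    qed
    moreover have "norm_on {..<p} d \<le> sqrt (real p) * lo / 2"
    proof (rule power2_le_imp_le)
      show "(norm_on {..<p} d)\<^sup>2 \<le> (sqrt (real p) * lo / 2)\<^sup>2"
        using Q large by (simp add: power_mult_distrib power_divide)
    qed (use beta in simp)
    ultimately have "sqrt (real p) * lo / 2 \<le> norm_on {..<p} b'" by linarith
    then have "(sqrt (real p) * lo / 2)\<^sup>2 \<le> (norm_on {..<p} b')\<^sup>2" using beta by (intro power_mono) auto
    then have "real p * lo\<^sup>2 / 4 \<le> scalar_prod b' b'"
      unfolding sp[OF b(2)] by (simp add: power_mult_distrib power_divide)
    then have "c * (real p * lo\<^sup>2 / 4) \<le> c * scalar_prod b' b'" using cK by (intro mult_left_mono) auto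
    also have "\<dots> \<le> D'" using S' b(2) by (simp add: form_between_def D'_def)
    finally show ?thesis by simp
  qed
  define Y where "Y = hi\<^sup>2 * real m + 2 * (K * sqrt Q * hi) + K * Q"
  have dD: "\<bar>D' - D\<bar> \<le> Y * (real p * \<rho>)"
  proof -
    have bc: "\<beta> + 1 \<cdot>\<^sub>v d \<in> carrier_vec p" using b(1) d by auto
    have "b' = \<beta> + 1 \<cdot>\<^sub>v d" using b by (intro eq_vecI) (auto simp: d_def)
    then have "D' = bform S' \<beta> \<beta> + 2 * bform S' \<beta> d + bform S' d d"
      unfolding D'_def using bform_linear(1)[OF cS(2) b(1) d bc, of 1] bform_linear(2)[OF cS(2) b(1) d b(1), of 1]
        bform_linear(2)[OF cS(2) b(1) d d, of 1] bform_commute[OF cS(2) tS' d b(1)] by simp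
    moreover have "\<bar>bform S' \<beta> \<beta> - D\<bar> \<le> hi\<^sup>2 * real m * (real p * \<rho>)"
    proof -
      have "bform S' \<beta> \<beta> - D = (\<Sum>i<p. \<Sum>j<p. \<beta> $ i * (S' $$ (i, j) - \<Sigma> $$ (i, j)) * \<beta> $ j)"
        unfolding D_def bform_sum[OF cS(2) b(1) b(1)] bform_sum[OF cS(3) b(1) b(1)] sum_subtractf[symmetric]
        by (intro sum.cong refl) (simp add: algebra_simps)
      also have "\<bar>\<dots>\<bar> \<le> (\<Sum>i<p. \<Sum>j<p. \<bar>\<beta> $ i * (S' $$ (i, j) - \<Sigma> $$ (i, j)) * \<beta> $ j\<bar>)"
        by (intro order.trans[OF sum_abs] sum_mono) simp
      also have "\<dots> \<le> (\<Sum>i<p. \<Sum>j<p. of_bool (same_block Bs i j) * (hi\<^sup>2 * e))"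
      proof (intro sum_mono)
        fix i j assume "i \<in> {..<p}" "j \<in> {..<p}"
        then have ij: "i < p" "j < p" by auto
        show "\<bar>\<beta> $ i * (S' $$ (i, j) - \<Sigma> $$ (i, j)) * \<beta> $ j\<bar> \<le> of_bool (same_block Bs i j) * (hi\<^sup>2 * e)"
        proof (cases "same_block Bs i j")
          case True
          have "\<bar>\<beta> $ i\<bar> * \<bar>S $$ (i, j) - \<Sigma> $$ (i, j)\<bar> * \<bar>\<beta> $ j\<bar> \<le> hi * e * hi"
            using beta(2)[OF ij(1)] beta(2)[OF ij(2)] e(1)[OF ij] hi e(2) by (intro mult_mono) auto
          then show ?thesis using True cS(1) ij by (simp add: S'_def abs_mult power2_eq_square mult_ac)
        next
          case False
          then have "S' $$ (i, j) = 0" "\<Sigma> $$ (i, j) = 0"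
            using cS(1) ij block_restrict_nonzero[OF cS(3) \<Sigma>B ij] by (auto simp: S'_def)
          then show ?thesis using False by simp
        qed
      qed
      also have "\<dots> = hi\<^sup>2 * e * (\<Sum>i<p. \<Sum>j<p. of_bool (same_block Bs i j) * 1)"
        by (simp add: sum_distrib_left mult_ac del: sum_mult_of_bool_eq sum_of_bool_mult_eq sum_of_bool_eq)
      also have "(\<Sum>i<p. \<Sum>j<p. of_bool (same_block Bs i j) * 1) \<le> (\<Sum>i<p. real m)"
      proof (rule sum_mono)
        fix i assume "i \<in> {..<p}"
        then have i: "i < p" by simp
        have "{..<p} \<inter> {j. same_block Bs i j} = H i" using Hsb[OF i] Hsub(1)[OF i] by auto
        then show "(\<Sum>j<p. of_bool (same_block Bs i j) * 1) \<le> real m" using Hsub(3)[OF i] by simp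
      qed
      finally have "\<bar>bform S' \<beta> \<beta> - D\<bar> \<le> hi\<^sup>2 * e * (real p * real m)"
        using e hi by (simp add: mult_left_mono)
      also have "\<dots> = hi\<^sup>2 * real m * (real p * e)" by simp
      also have "\<dots> \<le> hi\<^sup>2 * real m * (real p * \<rho>)" by (rule mult_left_mono[OF \<rho>(1)]) simp
      finally show ?thesis .
    qed
    moreover have dd: "0 \<le> bform S' d d" "bform S' d d \<le> K * Q"
    proof -
      show "0 \<le> bform S' d d" using form_between_nonneg[OF S' _ d] cK by simp
      have "bform S' d d \<le> K * (norm_on {..<p} d)\<^sup>2" using S' d by (simp add: form_between_def flip: sp[OF d])
      also have "\<dots> \<le> K * Q" using Q cK by (intro mult_left_mono) auto
      finally show "bform S' d d \<le> K * Q" .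
    qed
    moreover have "K * Q \<le> K * Q * (real p * \<rho>)" using mult_left_mono[OF \<rho>(3), of "K * Q"] Q0 cK by simp
    moreover have "\<bar>bform S' \<beta> d\<bar> \<le> K * sqrt Q * hi * (real p * \<rho>)"
    proof -
      have nn: "0 \<le> bform S' z z" if "z \<in> carrier_vec p" for z using form_between_nonneg[OF S' _ that] cK by simp
      have "bform S' \<beta> \<beta> \<le> K * (real p * hi\<^sup>2)"
      proof -
        have "bform S' \<beta> \<beta> \<le> K * (norm_on {..<p} \<beta>)\<^sup>2" using S' b(1) by (simp add: form_between_def flip: sp[OF b(1)])
        also have "\<dots> \<le> K * (real p * hi\<^sup>2)" using n\<beta> cK by (intro mult_left_mono) auto
        finally show ?thesis .
      qed
      then have "bform S' \<beta> \<beta> * bform S' d d \<le> (K * (real p * hi\<^sup>2)) * (K * Q)"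
        by (rule mult_mono[OF _ dd(2) _ dd(1)]) (use cK in simp)
      with bform_Cauchy_Schwarz[OF cS(2) tS' nn b(1) d]
      have "(bform S' \<beta> d)\<^sup>2 \<le> (K * (real p * hi\<^sup>2)) * (K * Q)"
        by (rule order.trans)
      also have "\<dots> = (K * sqrt Q * hi * sqrt (real p))\<^sup>2" using Q0 by (simp add: power_mult_distrib power2_eq_square mult_ac)
      finally have "\<bar>bform S' \<beta> d\<bar> \<le> \<bar>K * sqrt Q * hi * sqrt (real p)\<bar>"
        by (rule abs_le_square_iff[THEN iffD2])
      also have "\<dots> = K * sqrt Q * hi * sqrt (real p)" using cK Q0 hi by (intro abs_of_nonneg) simp
      finally have "\<bar>bform S' \<beta> d\<bar> \<le> K * sqrt Q * hi * sqrt (real p)" .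
      also have "\<dots> \<le> K * sqrt Q * hi * (real p * \<rho>)"
        by (rule mult_left_mono[OF \<rho>(2)]) (use cK Q0 hi in simp)
      finally show ?thesis .
    qed
    moreover have "Y * (real p * \<rho>) = hi\<^sup>2 * real m * (real p * \<rho>) + 2 * (K * sqrt Q * hi * (real p * \<rho>)) + K * Q * (real p * \<rho>)"
      unfolding Y_def by (simp only: distrib_right mult.assoc)
    ultimately show ?thesis by linarith
  qed
  \<comment> \<open>the factors \<open>p\<close> of the numerators' sum and of the denominators cancel\<close>
  have dpos: "0 < c * (real p * lo\<^sup>2)" using cK p beta by simp
  have "(\<Sum>i<p. \<bar>block_shapley B (block_restrict B S) b' i - shapley_effect \<Sigma> \<beta> i\<bar>) = (\<Sum>i<p. \<bar>N' i / D' - N i / D\<bar>)"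
    using red red' by (intro sum.cong refl) simp
  also have "\<dots> \<le> (\<Sum>i<p. 2 * (?P * (2 * R\<^sup>2 * e + 3 * (t i)\<^sup>2 + R * t i)) / (c * (real p * lo\<^sup>2) / 4)
      + K * R\<^sup>2 * (Y * (real p * \<rho>)) / (c * (real p * lo\<^sup>2) * (c * (real p * lo\<^sup>2) / 4)))"
  proof (rule sum_mono)
    fix i assume "i \<in> {..<p}"
    then have i: "i < p" by simp
    have "\<bar>N i\<bar> \<le> K * R\<^sup>2"
      unfolding N_def by (rule shapley_num_bound[OF \<Sigma> cK b(1) Hsub(1,2)[OF i] nR[OF i]])
    with dpos show "\<bar>N' i / D' - N i / D\<bar> \<le> 2 * (?P * (2 * R\<^sup>2 * e + 3 * (t i)\<^sup>2 + R * t i)) / (c * (real p * lo\<^sup>2) / 4)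
      + K * R\<^sup>2 * (Y * (real p * \<rho>)) / (c * (real p * lo\<^sup>2) * (c * (real p * lo\<^sup>2) / 4))"
      by (intro quotient_difference_le[OF _ Dlow _ D'low dN[OF i] _ dD]) simp_all
  qed
  also have "\<dots> = (\<Sum>i<p. 2 * (?P * (2 * R\<^sup>2 * e + 3 * (t i)\<^sup>2 + R * t i))) / (c * (real p * lo\<^sup>2) / 4)
      + real p * (K * R\<^sup>2 * (Y * (real p * \<rho>)) / (c * (real p * lo\<^sup>2) * (c * (real p * lo\<^sup>2) / 4)))"
    unfolding sum.distrib sum_divide_distrib[symmetric] by simp
  also have "\<dots> \<le> X * (real p * \<rho>) / (c * (real p * lo\<^sup>2) / 4)
      + real p * (K * R\<^sup>2 * (Y * (real p * \<rho>)) / (c * (real p * lo\<^sup>2) * (c * (real p * lo\<^sup>2) / 4)))"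
    using sumN dpos by (intro add_right_mono divide_right_mono) auto
  also have "\<dots> = (4 * X / (c * lo\<^sup>2) + 4 * (K * R\<^sup>2) * Y / (c\<^sup>2 * lo ^ 4)) * \<rho>"
  proof -
    have "X * (real p * \<rho>) / (c * (real p * lo\<^sup>2) / 4) = 4 * X / (c * lo\<^sup>2) * \<rho>"
      using p by simp
    moreover have "real p * (K * R\<^sup>2 * (Y * (real p * \<rho>)) / (c * (real p * lo\<^sup>2) * (c * (real p * lo\<^sup>2) / 4)))
        = 4 * (K * R\<^sup>2) * Y / (c\<^sup>2 * lo ^ 4) * \<rho>"
      using p cK beta(1) by (simp add: field_simps power2_eq_square power4_eq_xxxx)
    ultimately show ?thesis by (simp only: distrib_right)
  qed
  finally show ?thesis by (simp add: error_const_def X_def Y_def R_def \<rho>_def)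
qed

section \<open>Measurability of the estimation error\<close>

text \<open>
  Measurability is meant entrywise; the dimensions are constant, so that the index sets in the
  matrix operations do not depend on the sample.
\<close>

definition mat_measurable :: "'a measure \<Rightarrow> nat \<Rightarrow> nat \<Rightarrow> ('a \<Rightarrow> real mat) \<Rightarrow> bool" where
  "mat_measurable M r c F \<longleftrightarrow> (\<forall>\<omega>. F \<omega> \<in> carrier_mat r c) \<and> (\<forall>i<r. \<forall>j<c. (\<lambda>\<omega>. F \<omega> $$ (i, j)) \<in> borel_measurable M)"

definition vec_measurable :: "'a measure \<Rightarrow> nat \<Rightarrow> ('a \<Rightarrow> real vec) \<Rightarrow> bool" where
  "vec_measurable M r f \<longleftrightarrow> (\<forall>\<omega>. f \<omega> \<in> carrier_vec r) \<and> (\<forall>i<r. (\<lambda>\<omega>. f \<omega> $ i) \<in> borel_measurable M)"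

lemma mat_measurableD:
  assumes "mat_measurable M r c F"
  shows "F \<omega> \<in> carrier_mat r c" "i < r \<Longrightarrow> j < c \<Longrightarrow> (\<lambda>\<omega>. F \<omega> $$ (i, j)) \<in> borel_measurable M"
  using assms by (auto simp: mat_measurable_def)

lemma vec_measurableD:
  assumes "vec_measurable M r f"
  shows "f \<omega> \<in> carrier_vec r" "i < r \<Longrightarrow> (\<lambda>\<omega>. f \<omega> $ i) \<in> borel_measurable M"
  using assms by (auto simp: vec_measurable_def)

lemma mat_measurableI:
  assumes "\<And>\<omega>. F \<omega> = mat r c (\<lambda>(i, j). g i j \<omega>)" "\<And>i j. i < r \<Longrightarrow> j < c \<Longrightarrow> g i j \<in> borel_measurable M"
  shows "mat_measurable M r c F"
  using assms by (auto simp: mat_measurable_def cong: measurable_cong)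

lemma vec_measurableI:
  assumes "\<And>\<omega>. f \<omega> = vec r (\<lambda>i. g i \<omega>)" "\<And>i. i < r \<Longrightarrow> g i \<in> borel_measurable M"
  shows "vec_measurable M r f"
  using assms by (auto simp: vec_measurable_def cong: measurable_cong)

lemma mat_measurable_mult:
  assumes F: "mat_measurable M r k F" and G: "mat_measurable M k c G"
  shows "mat_measurable M r c (\<lambda>\<omega>. F \<omega> * G \<omega>)"
proof (rule mat_measurableI)
  fix \<omega>
  show "F \<omega> * G \<omega> = mat r c (\<lambda>(i, j). \<Sum>l<k. F \<omega> $$ (i, l) * G \<omega> $$ (l, j))"
    using mat_measurableD(1)[OF F, of \<omega>] mat_measurableD(1)[OF G, of \<omega>]
    by (intro eq_matI) (auto simp: scalar_prod_def atLeast0LessThan)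
next
  fix i j assume "i < r" "j < c"
  then show "(\<lambda>\<omega>. \<Sum>l<k. F \<omega> $$ (i, l) * G \<omega> $$ (l, j)) \<in> borel_measurable M"
    by (intro borel_measurable_sum borel_measurable_times mat_measurableD(2)[OF F] mat_measurableD(2)[OF G]) auto
qed

lemma mat_measurable_minus:
  assumes F: "mat_measurable M r c F" and G: "mat_measurable M r c G"
  shows "mat_measurable M r c (\<lambda>\<omega>. F \<omega> - G \<omega>)"
proof (rule mat_measurableI)
  fix \<omega>
  show "F \<omega> - G \<omega> = mat r c (\<lambda>(i, j). F \<omega> $$ (i, j) - G \<omega> $$ (i, j))"
    using mat_measurableD(1)[OF F, of \<omega>] mat_measurableD(1)[OF G, of \<omega>] by (intro eq_matI) auto
qed (intro borel_measurable_diff mat_measurableD(2)[OF F] mat_measurableD(2)[OF G])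

lemma mat_measurable_transpose:
  assumes F: "mat_measurable M r c F"
  shows "mat_measurable M c r (\<lambda>\<omega>. transpose_mat (F \<omega>))"
proof (rule mat_measurableI)
  fix \<omega>
  show "transpose_mat (F \<omega>) = mat c r (\<lambda>(i, j). F \<omega> $$ (j, i))"
    using mat_measurableD(1)[OF F, of \<omega>] by (intro eq_matI) auto
qed (rule mat_measurableD(2)[OF F])

lemma mat_measurable_submatrix:
  assumes F: "mat_measurable M r c F"
  shows "mat_measurable M (card {i. i < r \<and> i \<in> I}) (card {j. j < c \<and> j \<in> J}) (\<lambda>\<omega>. submatrix (F \<omega>) I J)"
proof (rule mat_measurableI)
  fix \<omega>
  show "submatrix (F \<omega>) I J = mat (card {i. i < r \<and> i \<in> I}) (card {j. j < c \<and> j \<in> J}) (\<lambda>(i, j). F \<omega> $$ (pick I i, pick J j))"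
    using mat_measurableD(1)[OF F, of \<omega>] by (simp add: submatrix_def)
next
  fix i j assume "i < card {i. i < r \<and> i \<in> I}" "j < card {j. j < c \<and> j \<in> J}"
  then show "(\<lambda>\<omega>. F \<omega> $$ (pick I i, pick J j)) \<in> borel_measurable M"
    by (intro mat_measurableD(2)[OF F] pick_le)
qed

lemma vec_measurable_subvector:
  assumes f: "vec_measurable M r f"
  shows "vec_measurable M (card {i. i < r \<and> i \<in> I}) (\<lambda>\<omega>. subvector (f \<omega>) I)"
proof (rule vec_measurableI)
  fix \<omega>
  show "subvector (f \<omega>) I = vec (card {i. i < r \<and> i \<in> I}) (\<lambda>i. f \<omega> $ pick I i)"
    using vec_measurableD(1)[OF f, of \<omega>] by (simp add: subvector_def)
next
  fix i assume "i < card {i. i < r \<and> i \<in> I}"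
  then show "(\<lambda>\<omega>. f \<omega> $ pick I i) \<in> borel_measurable M" by (intro vec_measurableD(2)[OF f] pick_le)
qed

lemma vec_measurable_mult:
  assumes F: "mat_measurable M r c F" and f: "vec_measurable M c f"
  shows "vec_measurable M r (\<lambda>\<omega>. F \<omega> *\<^sub>v f \<omega>)"
proof (rule vec_measurableI)
  fix \<omega>
  show "F \<omega> *\<^sub>v f \<omega> = vec r (\<lambda>i. \<Sum>j<c. F \<omega> $$ (i, j) * f \<omega> $ j)"
    using mat_measurableD(1)[OF F, of \<omega>] vec_measurableD(1)[OF f, of \<omega>]
    by (intro eq_vecI) (auto simp: scalar_prod_def atLeast0LessThan)
next
  fix i assume "i < r"
  then show "(\<lambda>\<omega>. \<Sum>j<c. F \<omega> $$ (i, j) * f \<omega> $ j) \<in> borel_measurable M"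
    by (intro borel_measurable_sum borel_measurable_times mat_measurableD(2)[OF F] vec_measurableD(2)[OF f]) auto
qed

lemma scalar_prod_measurable:
  assumes f: "vec_measurable M r f" and g: "vec_measurable M r g"
  shows "(\<lambda>\<omega>. scalar_prod (f \<omega>) (g \<omega>)) \<in> borel_measurable M"
proof -
  have "(\<lambda>\<omega>. scalar_prod (f \<omega>) (g \<omega>)) = (\<lambda>\<omega>. \<Sum>i<r. f \<omega> $ i * g \<omega> $ i)"
    using vec_measurableD(1)[OF f] vec_measurableD(1)[OF g] by (intro ext scalar_prod_sum)
  moreover have "\<dots> \<in> borel_measurable M"
    by (intro borel_measurable_sum borel_measurable_times vec_measurableD(2)[OF f] vec_measurableD(2)[OF g]) auto
  ultimately show ?thesis by simp
qed

lemma det_measurable: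
  assumes F: "mat_measurable M r r F"
  shows "(\<lambda>\<omega>. det (F \<omega>)) \<in> borel_measurable M"
proof -
  have "(\<lambda>\<omega>. det (F \<omega>)) = (\<lambda>\<omega>. \<Sum>q\<in>{q. q permutes {0..<r}}. signof q * (\<Prod>i = 0..<r. F \<omega> $$ (i, q i)))"
    using mat_measurableD(1)[OF F] by (intro ext det_def')
  moreover have "\<dots> \<in> borel_measurable M"
  proof (intro borel_measurable_sum borel_measurable_times borel_measurable_prod borel_measurable_const mat_measurableD(2)[OF F])
    fix q i assume "q \<in> {q. q permutes {0..<r}}" "i \<in> {0..<r}"
    then show "i < r" "q i < r" using permutes_in_image[of q "{0..<r}" i] by auto
  qed
  ultimately show ?thesis by simp
qed

text \<open>
  Cramer's rule expresses the entries of the inverse as rational functions, which makes inversion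
  measurable.
\<close>

lemma minv_eq_adj_mat:
  assumes A: "A \<in> carrier_mat n n"
  shows "minv A = mat n n (\<lambda>(i, j). if det A = 0 then 0 else adj_mat A $$ (i, j) / det A)"
proof (cases "det A = 0")
  case True
  have "mat_inverse A = None"
  proof (cases "mat_inverse A")
    case (Some B)
    then have B: "A * B = 1\<^sub>m n" "B \<in> carrier_mat n n" using mat_inverse(2)[OF A] by auto
    have "det (A * B) = 1" unfolding B(1) by simp
    then show ?thesis using det_mult[OF A B(2)] True by simp
  qed
  then show ?thesis using A True by (auto simp: minv_def intro!: eq_matI)
next
  case False
  define B where "B = (1 / det A) \<cdot>\<^sub>m adj_mat A"
  note adj = adj_mat[OF A]
  have B: "B \<in> carrier_mat n n" using adj by (simp add: B_def)
  have "x = 0\<^sub>v n" if "x \<in> carrier_vec n" "A *\<^sub>v x = 0\<^sub>v n" for x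
    using det_0_iff_vec_prod_zero[OF A] False that by blast
  note N = minv_correct[OF A this]
  have "A * B = (1 / det A) \<cdot>\<^sub>m (A * adj_mat A)"
    unfolding B_def by (rule mult_smult_distrib[OF A adj(1)])
  also have "\<dots> = 1\<^sub>m n" unfolding adj(2) using False by (intro eq_matI) auto
  finally have "B = minv A" using inverse_mat_unique[OF A B N(1) _ N(3)] by blast
  moreover have "B = mat n n (\<lambda>(i, j). if det A = 0 then 0 else adj_mat A $$ (i, j) / det A)"
    using adj(1) False by (intro eq_matI) (auto simp: B_def)
  ultimately show ?thesis by simp
qed

lemma mat_measurable_minv:
  assumes F: "mat_measurable M r r F"
  shows "mat_measurable M r r (\<lambda>\<omega>. minv (F \<omega>))"
proof (rule mat_measurableI[OF minv_eq_adj_mat[OF mat_measurableD(1)[OF F]]])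
  fix i j assume ij: "i < r" "j < r"
  have del: "mat_measurable M (r - 1) (r - 1) (\<lambda>\<omega>. mat_delete (F \<omega>) j i)"
  proof (rule mat_measurableI)
    fix \<omega>
    show "mat_delete (F \<omega>) j i = mat (r - 1) (r - 1) (\<lambda>(k, l). F \<omega> $$ (if k < j then k else Suc k, if l < i then l else Suc l))"
      using mat_measurableD(1)[OF F, of \<omega>] by (simp add: mat_delete_def)
  qed (use ij in \<open>intro mat_measurableD(2)[OF F], auto\<close>)
  have "(\<lambda>\<omega>. adj_mat (F \<omega>) $$ (i, j)) = (\<lambda>\<omega>. (- 1) ^ (j + i) * det (mat_delete (F \<omega>) j i))"
    using ij by (intro ext) (simp add: adj_mat_def cofactor_def carrier_matD[OF mat_measurableD(1)[OF F]])
  then have [measurable]: "(\<lambda>\<omega>. adj_mat (F \<omega>) $$ (i, j)) \<in> borel_measurable M"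
    using det_measurable[OF del] by simp
  note [measurable] = det_measurable[OF F]
  show "(\<lambda>\<omega>. if det (F \<omega>) = 0 then 0 else adj_mat (F \<omega>) $$ (i, j) / det (F \<omega>)) \<in> borel_measurable M"
    by measurable
qed

lemma cond_var_measurable:
  assumes F: "mat_measurable M p p F" and b: "vec_measurable M p b"
  shows "(\<lambda>\<omega>. cond_var (F \<omega>) (b \<omega>) G v) \<in> borel_measurable M"
proof -
  note sub = mat_measurable_submatrix[OF F]
  show ?thesis
  unfolding cond_var_def Let_def
  by (rule scalar_prod_measurable[OF vec_measurable_subvector[OF b] vec_measurable_mult[OF mat_measurable_minus[OF sub
     mat_measurable_mult[OF mat_measurable_mult[OF sub mat_measurable_minv[OF sub]] sub]] vec_measurable_subvector[OF b]]])
qed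

lemma shapley_on_measurable:
  assumes F: "mat_measurable M p p F" and b: "vec_measurable M p b"
  shows "(\<lambda>\<omega>. shapley_on (F \<omega>) (b \<omega>) G i) \<in> borel_measurable M"
proof -
  note [measurable] = cond_var_measurable[OF F b] scalar_prod_measurable[OF b vec_measurable_mult[OF F b]]
  show ?thesis unfolding shapley_on_def by measurable
qed

lemma sample_cov_measurable:
  assumes x: "\<And>l i. l < n \<Longrightarrow> i < p \<Longrightarrow> (\<lambda>\<omega>. x \<omega> l i) \<in> borel_measurable M"
  shows "mat_measurable M p p (\<lambda>\<omega>. sample_cov n p (x \<omega>))"
  unfolding sample_cov_def sample_mean_def
  by (rule mat_measurableI[OF refl])
    (intro borel_measurable_divide borel_measurable_sum borel_measurable_times borel_measurable_diff x borel_measurable_const, auto)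

lemma slope_estimate_measurable:
  assumes x: "\<And>l i. l < n \<Longrightarrow> i < p \<Longrightarrow> (\<lambda>\<omega>. x \<omega> l i) \<in> borel_measurable M"
    and y: "\<And>l. l < n \<Longrightarrow> (\<lambda>\<omega>. y \<omega> l) \<in> borel_measurable M"
  shows "vec_measurable M p (\<lambda>\<omega>. slope_estimate n p (x \<omega>) (y \<omega>))"
proof -
  have A: "mat_measurable M n (p + 1) (\<lambda>\<omega>. design_matrix n p (x \<omega>))"
    unfolding design_matrix_def
  proof (rule mat_measurableI[OF refl])
    fix l k assume "l < n" "k < p + 1"
    then show "(\<lambda>\<omega>. if k = 0 then 1 else x \<omega> l (k - 1)) \<in> borel_measurable M"
      using x[of l "k - 1"] by (cases "k = 0") auto
  qed
  have Y: "vec_measurable M n (\<lambda>\<omega>. vec n (y \<omega>))" by (rule vec_measurableI[OF refl]) (rule y)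
  have LS: "vec_measurable M (p + 1) (\<lambda>\<omega>. least_squares n p (x \<omega>) (y \<omega>))"
    unfolding least_squares_def Let_def
    by (rule vec_measurable_mult[OF mat_measurable_mult[OF mat_measurable_minv[OF
        mat_measurable_mult[OF mat_measurable_transpose[OF A] A]] mat_measurable_transpose[OF A]] Y])
  show ?thesis
    unfolding slope_estimate_def
    by (rule vec_measurableI[OF refl], rule vec_measurableD(2)[OF LS]) simp
qed

lemma finite_partitions: "finite {B. partition_on {..<p::nat} B}"
  by (rule finite_subset[of _ "Pow (Pow {..<p})"]) (auto simp: partition_on_def)

text \<open>
  The estimated partition takes finitely many values, and for a fixed partition the error is a
  measurable function of the sample.
\<close>

lemma shapley_error_measurable:
  assumes x: "\<And>l i. l < n \<Longrightarrow> i < p \<Longrightarrow> (\<lambda>\<omega>. x \<omega> l i) \<in> borel_measurable M"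
    and y: "\<And>l. l < n \<Longrightarrow> (\<lambda>\<omega>. y \<omega> l) \<in> borel_measurable M"
    and B: "B \<in> measurable M (count_space {B. partition_on {..<p} B})"
  shows "(\<lambda>\<omega>. \<Sum>i<p. \<bar>shapley_estimate n p (x \<omega>) (y \<omega>) (B \<omega>) i - a i\<bar>) \<in> borel_measurable M"
proof (rule measurable_compose_countable'[OF _ B, of "\<lambda>B \<omega>. \<Sum>i<p. \<bar>shapley_estimate n p (x \<omega>) (y \<omega>) B i - a i\<bar>"])
  fix P :: "nat set set"
  note S = sample_cov_measurable[OF x]
  have F: "mat_measurable M p p (\<lambda>\<omega>. block_restrict P (sample_cov n p (x \<omega>)))"
  proof (rule mat_measurableI)
    fix \<omega>
    show "block_restrict P (sample_cov n p (x \<omega>)) = mat p p (\<lambda>(i, j). if same_block P i j then sample_cov n p (x \<omega>) $$ (i, j) else 0)"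
      by (intro eq_matI) (auto simp: block_restrict_def sample_cov_def)
    fix i j assume "i < p" "j < p"
    then show "(\<lambda>\<omega>. if same_block P i j then sample_cov n p (x \<omega>) $$ (i, j) else 0) \<in> borel_measurable M"
      using mat_measurableD(2)[OF S] by (cases "same_block P i j") auto
  qed
  have "(\<lambda>\<omega>. shapley_estimate n p (x \<omega>) (y \<omega>) P i) \<in> borel_measurable M" for i
    unfolding shapley_estimate_def block_shapley_def
    by (rule shapley_on_measurable[OF F slope_estimate_measurable[OF x y]])
  then show "(\<lambda>\<omega>. \<Sum>i<p. \<bar>shapley_estimate n p (x \<omega>) (y \<omega>) P i - a i\<bar>) \<in> borel_measurable M"
    by measurable
next
  show "countable {B. partition_on {..<p} B}" by (rule countable_finite[OF finite_partitions])
qed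

section \<open>The good event for a Gaussian sample\<close>

lemma prob_space_normal_law: "0 \<le> s \<Longrightarrow> prob_space (normal_law m s)"
  by (cases "s = 0") (auto simp: normal_law_def prob_space_return intro: prob_space_normal_density)

lemma normal_law_shift:
  assumes s: "0 \<le> s"
  shows "distr (normal_law m s) borel (\<lambda>x. x - m) = normal_law 0 s"
proof (cases "s = 0")
  case True
  then show ?thesis by (simp add: normal_law_def distr_return)
next
  case False
  then have s: "s > 0" using s by simp
  interpret N: prob_space "normal_law m s" using s by (intro prob_space_normal_law) simp
  have "distr (normal_law m s) lborel (\<lambda>x. x) = normal_law m s"
    by (intro distr_id2) simp
  then have "distributed (normal_law m s) lborel (\<lambda>x. x) (normal_density m s)"
    using s by (auto simp: distributed_def normal_law_def)
  from N.normal_density_affine[OF this s, of 1 "- m"]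
  have "distributed (normal_law m s) lborel (\<lambda>x. - m + 1 * x) (normal_density 0 s)" by simp
  then have "distr (normal_law m s) lborel (\<lambda>x. x - m) = density lborel (normal_density 0 s)"
    by (simp add: distributed_def)
  moreover have "distr (normal_law m s) borel (\<lambda>x. x - m) = distr (normal_law m s) lborel (\<lambda>x. x - m)"
    by (intro distr_cong) auto
  ultimately show ?thesis using s by (simp add: normal_law_def)
qed

lemma scalar_prod_vec_sum: "a \<in> carrier_vec p \<Longrightarrow> scalar_prod (vec p v) a = (\<Sum>i<p. v i * a $ i)"
  by (subst scalar_prod_sum[of _ p]) auto

text \<open>
  Linear combinations of the coordinates of a Gaussian vector are normal by definition, with
  variance given by the form of \<open>\<Sigma>\<close>.
\<close>

lemma gaussian_rows_sample:
  fixes X :: "nat \<Rightarrow> 'a \<Rightarrow> nat \<Rightarrow> real"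
  assumes M: "prob_space M" and \<mu>: "\<mu> \<in> carrier_vec p" and \<Sigma>: "form_between p lo hi \<Sigma>" "0 < lo" "0 < hi"
    and law: "\<And>l. l < n \<Longrightarrow> gaussian_vector M p (X l) \<mu> \<Sigma>"
    and indep: "prob_space.indep_vars M (\<lambda>_. PiM {..<p} (\<lambda>_. borel)) X {..<n}" and p: "p \<le> n"
  shows "gaussian_rows M n p (\<lambda>\<omega> l i. X l \<omega> i - \<mu> $ i) (\<lambda>v. sqrt (bform \<Sigma> (vec p v) (vec p v))) lo hi"
proof -
  interpret prob_space M by (rule M)
  have nn: "0 \<le> bform \<Sigma> (vec p v) (vec p v)" for v
    using form_between_nonneg[OF \<Sigma>(1), of "vec p v"] \<Sigma>(2) by simp
  have L: "scalar_prod (vec p v) (vec p v) = (L2_set v {..<p})\<^sup>2" for v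
  proof -
    have "L2_set (\<lambda>i. vec p v $ i) {..<p} = L2_set v {..<p}" by (intro L2_set_cong) auto
    then show ?thesis using scalar_prod_L2_set[of "vec p v" p] by simp
  qed
  show ?thesis
  proof
    fix v :: "nat \<Rightarrow> real"
    define f where "f x = (\<Sum>i<p. v i * (x i - \<mu> $ i))" for x :: "nat \<Rightarrow> real"
    have f: "f \<in> borel_measurable (PiM {..<p} (\<lambda>_. borel))" unfolding f_def by measurable
    have rf: "row_form p (\<lambda>l i. X l \<omega> i - \<mu> $ i) v l = f (X l \<omega>)" for l \<omega> by (simp add: row_form_def f_def)
    show "indep_vars (\<lambda>_. borel) (\<lambda>l \<omega>. row_form p (\<lambda>l i. X l \<omega> i - \<mu> $ i) v l) {..<n}"
      unfolding rf by (rule indep_vars_compose2[OF indep]) (rule f)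
    show "0 \<le> sqrt (bform \<Sigma> (vec p v) (vec p v))" using nn by simp
    show "lo * (L2_set v {..<p})\<^sup>2 \<le> (sqrt (bform \<Sigma> (vec p v) (vec p v)))\<^sup>2"
        "(sqrt (bform \<Sigma> (vec p v) (vec p v)))\<^sup>2 \<le> hi * (L2_set v {..<p})\<^sup>2"
      using \<Sigma>(1) nn unfolding L[symmetric] form_between_def by (simp_all del: dim_vec)
    fix l assume l: "l < n"
    define g where "g \<omega> = scalar_prod (vec p v) (vec p (X l \<omega>))" for \<omega>
    let ?m = "scalar_prod (vec p v) \<mu>" and ?s = "sqrt (bform \<Sigma> (vec p v) (vec p v))"
    have "X l \<in> measurable M (PiM {..<p} (\<lambda>_. borel))" using law[OF l] by (simp add: gaussian_vector_def)
    from measurable_compose[OF this measurable_component_singleton]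
    have Xi: "(\<lambda>\<omega>. X l \<omega> i) \<in> borel_measurable M" if "i < p" for i
      using that by simp
    have g: "g \<in> borel_measurable M"
      unfolding g_def using Xi by (simp add: scalar_prod_vec_sum)
    have "(\<lambda>\<omega>. row_form p (\<lambda>l i. X l \<omega> i - \<mu> $ i) v l) = (\<lambda>\<omega>. g \<omega> - ?m)"
      using \<mu> by (intro ext) (simp add: g_def row_form_def scalar_prod_vec_sum right_diff_distrib sum_subtractf)
    then have "distr M borel (\<lambda>\<omega>. row_form p (\<lambda>l i. X l \<omega> i - \<mu> $ i) v l) = distr (distr M borel g) borel (\<lambda>x. x - ?m)"
      using g by (simp add: distr_distr comp_def)
    also have "distr M borel g = normal_law ?m ?s"
      using law[OF l] unfolding gaussian_vector_def g_def by simp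
    also have "distr (normal_law ?m ?s) borel (\<lambda>x. x - ?m) = normal_law 0 ?s"
      using nn by (intro normal_law_shift) simp
    finally show "distr M borel (\<lambda>\<omega>. row_form p (\<lambda>l i. X l \<omega> i - \<mu> $ i) v l) = normal_law 0 ?s" .
  qed (use \<Sigma> p in auto)
qed

context gaussian_rows
begin

text \<open>
  By polarisation, \<open>4 z\<^sub>i z\<^sub>j = (z\<^sub>i + z\<^sub>j)\<^sup>2 - (z\<^sub>i - z\<^sub>j)\<^sup>2\<close>, the products are controlled by
  squares of normal variables \<open>z\<^sub>i \<plusminus> z\<^sub>j\<close> of variance at most \<open>4 hi\<close>. The means are treated with
  the vectors \<open>e\<^sub>i + 0 e\<^sub>i\<close>; they need to be of order \<open>sqrt \<tau>\<close> only, as their products enter the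
  covariance.
\<close>

lemma entries_event:
  assumes \<Sigma>: "\<Sigma> \<in> carrier_mat p p" "transpose_mat \<Sigma> = \<Sigma>" and s: "\<And>v. (s v)\<^sup>2 = bform \<Sigma> (vec p v) (vec p v)"
    and \<tau>: "0 < \<tau>" "\<tau> \<le> 4 * hi"
  obtains E where "E \<in> events"
    "prob (space M - E) \<le> 4 * (real p)\<^sup>2 * exp (- (real n * \<tau>\<^sup>2 / (256 * hi\<^sup>2))) + 2 * real p * exp (- (real n * \<tau> / (8 * hi)))"
    "\<And>\<omega> i j. \<omega> \<in> E \<Longrightarrow> i < p \<Longrightarrow> j < p \<Longrightarrow> \<bar>(\<Sum>l<n. z \<omega> l i * z \<omega> l j) - real n * \<Sigma> $$ (i, j)\<bar> \<le> real n * \<tau>"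
    "\<And>\<omega> i. \<omega> \<in> E \<Longrightarrow> i < p \<Longrightarrow> \<bar>\<Sum>l<n. z \<omega> l i\<bar> \<le> real n * sqrt \<tau>"
proof -
  define v :: "nat \<Rightarrow> nat \<Rightarrow> real \<Rightarrow> nat \<Rightarrow> real" where "v i j \<sigma> k = of_bool (k = i) + \<sigma> * of_bool (k = j)" for i j \<sigma> k
  define a where "a = exp (- (real n * \<tau>\<^sup>2 / (256 * hi\<^sup>2)))"
  define b where "b = exp (- (real n * \<tau> / (8 * hi)))"
  have rv: "row_form p (z \<omega>) (v i j \<sigma>) l = z \<omega> l i + \<sigma> * z \<omega> l j" if "i < p" "j < p" for i j \<sigma> l \<omega>
  proof -
    have "row_form p (z \<omega>) (v i j \<sigma>) l = (\<Sum>k<p. (if k = i then z \<omega> l k else 0) + (if k = j then \<sigma> * z \<omega> l k else 0))"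
      unfolding row_form_def v_def by (intro sum.cong refl) (auto simp: distrib_right)
    then show ?thesis using that by (simp add: sum.distrib)
  qed
  have L2v: "(L2_set (v i j \<sigma>) {..<p})\<^sup>2 \<le> 4" if "\<bar>\<sigma>\<bar> \<le> 1" for i j \<sigma>
  proof -
    have one: "L2_set (\<lambda>k. of_bool (k = i)) {..<p} \<le> (1::real)" for i
    proof -
      have "(\<Sum>k<p. (of_bool (k = i))\<^sup>2) = (\<Sum>k<p. if k = i then 1 else (0::real))" by (intro sum.cong) auto
      also have "\<dots> \<le> 1" by simp
      finally show ?thesis unfolding L2_set_def using real_sqrt_le_mono by fastforce
    qed
    have "L2_set (v i j \<sigma>) {..<p} \<le> L2_set (\<lambda>k. of_bool (k = i)) {..<p} + L2_set (\<lambda>k. \<sigma> * of_bool (k = j)) {..<p}"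
      unfolding v_def by (rule L2_set_triangle_ineq)
    also have "\<dots> \<le> 1 + 1 * 1"
      unfolding L2_set_scale using one that by (intro add_mono mult_mono) auto
    finally have "(L2_set (v i j \<sigma>) {..<p})\<^sup>2 \<le> 2\<^sup>2" by (intro power_mono) auto
    then show ?thesis by simp
  qed
  have sv: "(s (v i j \<sigma>))\<^sup>2 \<le> 4 * hi" if "\<bar>\<sigma>\<bar> \<le> 1" for i j \<sigma>
  proof -
    have "hi * (L2_set (v i j \<sigma>) {..<p})\<^sup>2 \<le> hi * 4" using lo_hi by (intro mult_left_mono L2v[OF that]) simp
    then show ?thesis using s_bounds(2)[of "v i j \<sigma>"] by linarith
  qed
  have s\<Sigma>: "(s (v i j \<sigma>))\<^sup>2 = \<Sigma> $$ (i, i) + 2 * \<sigma> * \<Sigma> $$ (i, j) + \<sigma>\<^sup>2 * \<Sigma> $$ (j, j)" if ij: "i < p" "j < p" for i j \<sigma>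
  proof -
    define u w :: "real vec" where "u = unit_vec p i" and "w = unit_vec p j"
    have uw: "u \<in> carrier_vec p" "w \<in> carrier_vec p" by (simp_all add: u_def w_def)
    have c: "u + \<sigma> \<cdot>\<^sub>v w \<in> carrier_vec p" using uw by auto
    have e: "vec p (v i j \<sigma>) = u + \<sigma> \<cdot>\<^sub>v w" using ij by (intro eq_vecI) (auto simp: v_def u_def w_def)
    have bu: "bform \<Sigma> (unit_vec p k) (unit_vec p l) = \<Sigma> $$ (k, l)" if "k < p" "l < p" for k l
    proof -
      have "bform \<Sigma> (unit_vec p k) (unit_vec p l) = (\<Sum>i<p. if i = k then (\<Sum>j<p. if j = l then \<Sigma> $$ (i, j) else 0) else 0)"
        unfolding bform_sum[OF \<Sigma>(1) unit_vec_carrier unit_vec_carrier]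
      proof (rule sum.cong[OF refl])
        fix i assume "i \<in> {..<p}"
        then have i: "i < p" by simp
        show "(\<Sum>j<p. unit_vec p k $ i * \<Sigma> $$ (i, j) * unit_vec p l $ j)
            = (if i = k then (\<Sum>j<p. if j = l then \<Sigma> $$ (i, j) else 0) else 0)"
        proof (cases "i = k")
          case True
          have "(\<Sum>j<p. unit_vec p k $ i * \<Sigma> $$ (i, j) * unit_vec p l $ j) = (\<Sum>j<p. if j = l then \<Sigma> $$ (i, j) else 0)"
          proof (rule sum.cong[OF refl])
            fix j assume "j \<in> {..<p}"
            then show "unit_vec p k $ i * \<Sigma> $$ (i, j) * unit_vec p l $ j = (if j = l then \<Sigma> $$ (i, j) else 0)"
              using True that by simp
          qed
          then show ?thesis using True by simp
        next
          case False
          then have "unit_vec p k $ i = (0::real)" using i that by simp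
          then show ?thesis using False by simp
        qed
      qed
      then show ?thesis using that by simp
    qed
    have "\<Sigma> $$ (j, i) = \<Sigma> $$ (i, j)" using transpose_mat_index[OF \<Sigma> ij] by simp
    then show ?thesis
      unfolding s e bform_linear(1)[OF \<Sigma>(1) uw c] bform_linear(2)[OF \<Sigma>(1) uw uw(1)] bform_linear(2)[OF \<Sigma>(1) uw uw(2)]
      unfolding u_def w_def using bu ij by (simp add: power2_eq_square algebra_simps)
  qed
  define A where "A = (\<lambda>(i, j, \<sigma>). {\<omega> \<in> space M. \<tau> * real n \<le> \<bar>\<Sum>l<n. ((row_form p (z \<omega>) (v i j \<sigma>) l)\<^sup>2 - (s (v i j \<sigma>))\<^sup>2)\<bar>})"
  define A' where "A' i = {\<omega> \<in> space M. sqrt \<tau> * real n \<le> \<bar>\<Sum>l<n. row_form p (z \<omega>) (v i i 0) l\<bar>}" for i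
  define N where "N = {..<p} \<times> {..<p} \<times> {1, -1 :: real}"
  have finN: "finite N" by (simp add: N_def)
  have [measurable]: "(\<lambda>\<omega>. \<Sum>l<n. ((row_form p (z \<omega>) u l)\<^sup>2 - c)) \<in> borel_measurable M" for u c
    by (intro borel_measurable_sum) auto
  have [measurable]: "(\<lambda>\<omega>. \<Sum>l<n. row_form p (z \<omega>) u l) \<in> borel_measurable M" for u
    by (intro borel_measurable_sum) auto
  have A: "A x \<in> events" for x unfolding A_def by (cases x) simp
  have A': "A' i \<in> events" for i unfolding A'_def by measurable
  have pA: "prob (A x) \<le> 2 * a" if "x \<in> N" for x
  proof -
    obtain i j \<sigma> where x: "x = (i, j, \<sigma>)" by (cases x)
    have "\<bar>\<sigma>\<bar> \<le> 1" using that by (auto simp: N_def x)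
    then have "prob (A x) \<le> 2 * exp (- (real n * \<tau>\<^sup>2 / (16 * (4 * hi)\<^sup>2)))"
      unfolding A_def x prod.case using \<tau> lo_hi
      by (intro normal_sum_squares_deviation[OF rows_indep rows_law s_nonneg sv]) auto
    also have "16 * (4 * hi)\<^sup>2 = 256 * hi\<^sup>2" by (simp add: power_mult_distrib)
    finally show ?thesis by (simp add: a_def)
  qed
  have pA': "prob (A' i) \<le> 2 * b" for i
  proof -
    have "prob (A' i) \<le> 2 * exp (- (real n * (sqrt \<tau>)\<^sup>2 / (2 * (4 * hi))))"
      unfolding A'_def using \<tau> lo_hi by (intro normal_sum_deviation[OF rows_indep rows_law s_nonneg sv]) auto
    then show ?thesis using \<tau> by (simp add: b_def)
  qed
  define U where "U = (\<Union>x\<in>N. A x) \<union> (\<Union>i<p. A' i)"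
  have ev: "(\<Union>x\<in>N. A x) \<in> events" "(\<Union>i<p. A' i) \<in> events" using A A' finN by (auto intro!: sets.finite_UN)
  then have U: "U \<in> events" by (auto simp: U_def)
  have "prob U \<le> prob (\<Union>x\<in>N. A x) + prob (\<Union>i<p. A' i)" unfolding U_def by (intro measure_Un_le ev)
  also have "\<dots> \<le> (\<Sum>x\<in>N. prob (A x)) + (\<Sum>i<p. prob (A' i))"
    using A A' finN by (intro add_mono finite_measure_subadditive_finite) auto
  also have "\<dots> \<le> (\<Sum>x\<in>N. 2 * a) + (\<Sum>i<p. 2 * b)" using pA pA' by (intro add_mono sum_mono) auto
  also have "\<dots> = real (card N) * (2 * a) + real p * (2 * b)" by simp
  also have "card N = p * (p * 2)" by (simp add: N_def card_cartesian_product)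
  finally have pU: "prob U \<le> 4 * (real p)\<^sup>2 * a + 2 * real p * b" by (simp add: power2_eq_square mult_ac)
  show ?thesis
  proof (rule that[of "space M - U"])
    show "space M - U \<in> events" using U by auto
    have "space M - (space M - U) = U" using sets.sets_into_space[OF U] by auto
    then show "prob (space M - (space M - U)) \<le> 4 * (real p)\<^sup>2 * exp (- (real n * \<tau>\<^sup>2 / (256 * hi\<^sup>2))) + 2 * real p * exp (- (real n * \<tau> / (8 * hi)))"
      using pU by (simp add: a_def b_def)
    fix \<omega> i assume \<omega>: "\<omega> \<in> space M - U" and i: "i < p"
    have "\<omega> \<notin> A' i" using \<omega> i by (auto simp: U_def)
    then show "\<bar>\<Sum>l<n. z \<omega> l i\<bar> \<le> real n * sqrt \<tau>"
      using \<omega> rv[OF i i, of \<omega> 0] by (simp add: A'_def mult.commute)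
    fix j assume j: "j < p"
    have dev: "\<bar>(\<Sum>l<n. (z \<omega> l i + \<sigma> * z \<omega> l j)\<^sup>2) - real n * (s (v i j \<sigma>))\<^sup>2\<bar> \<le> \<tau> * real n" if "\<sigma> \<in> {1, -1}" for \<sigma>
    proof -
      have "(i, j, \<sigma>) \<in> N" using i j that by (simp add: N_def)
      then have "\<omega> \<notin> A (i, j, \<sigma>)" using \<omega> unfolding U_def by blast
      then have "\<bar>\<Sum>l<n. ((row_form p (z \<omega>) (v i j \<sigma>) l)\<^sup>2 - (s (v i j \<sigma>))\<^sup>2)\<bar> \<le> \<tau> * real n"
        using \<omega> unfolding A_def by auto
      then show ?thesis unfolding rv[OF i j] by (simp add: sum_subtractf)
    qed
    have dev1: "\<bar>(\<Sum>l<n. (z \<omega> l i + 1 * z \<omega> l j)\<^sup>2) - real n * (s (v i j 1))\<^sup>2\<bar> \<le> real n * \<tau>"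
      and dev2: "\<bar>(\<Sum>l<n. (z \<omega> l i + (- 1) * z \<omega> l j)\<^sup>2) - real n * (s (v i j (- 1)))\<^sup>2\<bar> \<le> real n * \<tau>"
      using dev[of 1] dev[of "- 1"] by (simp_all add: mult.commute)
    have polarised: "\<bar>Z - g\<bar> \<le> r" if "P - N = 4 * Z" "a - b = 4 * g" "\<bar>P - a\<bar> \<le> r" "\<bar>N - b\<bar> \<le> r"
      for P N Z a b g r :: real using that by linarith
    have "(\<Sum>l<n. (z \<omega> l i + 1 * z \<omega> l j)\<^sup>2) - (\<Sum>l<n. (z \<omega> l i + (- 1) * z \<omega> l j)\<^sup>2) = 4 * (\<Sum>l<n. z \<omega> l i * z \<omega> l j)"
      unfolding sum_subtractf[symmetric] sum_distrib_left by (intro sum.cong refl) (simp add: power2_eq_square algebra_simps)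
    moreover have "real n * (s (v i j 1))\<^sup>2 - real n * (s (v i j (- 1)))\<^sup>2 = 4 * (real n * \<Sigma> $$ (i, j))"
      unfolding s\<Sigma>[OF i j] by (simp add: algebra_simps)
    ultimately show "\<bar>(\<Sum>l<n. z \<omega> l i * z \<omega> l j) - real n * \<Sigma> $$ (i, j)\<bar> \<le> real n * \<tau>"
      using dev1 dev2 by (rule polarised)
  qed
qed

end

lemma max_norm_attained:
  assumes A: "A \<in> carrier_mat p p" "0 < p"
  obtains i j where "i < p" "j < p" "max_norm A = \<bar>A $$ (i, j)\<bar>"
proof -
  let ?S = "{\<bar>A $$ (i, j)\<bar> | i j. i < dim_row A \<and> j < dim_col A}"
  have "?S = (\<lambda>(i, j). \<bar>A $$ (i, j)\<bar>) ` ({..<p} \<times> {..<p})" using A by auto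
  then have "finite ?S" "?S \<noteq> {}" using A(2) by auto
  then have "max_norm A \<in> ?S" unfolding max_norm_def by (rule Max_in)
  then show ?thesis using that A by auto
qed

text \<open>
  For a fixed sample size: the good event is the intersection of the events for the singular
  values, for the entries of \<open>S\<close> and for the norm of the noise. On it, the deterministic estimates
  apply with entry error \<open>e = 2 \<tau>\<close>, of which one \<open>\<tau>\<close> is due to the products and the other to the
  centring. The separation \<open>2 b\<close> of \<open>\<Sigma>\<close> leaves entries of size \<open>b\<close> in \<open>S\<close> because \<open>2 \<tau> \<le> b\<close>.
\<close>

theorem error_bound_event:
  fixes X :: "nat \<Rightarrow> 'a \<Rightarrow> nat \<Rightarrow> real" and noise Y :: "nat \<Rightarrow> 'a \<Rightarrow> real"
  assumes M: "prob_space M" and p: "0 < p" "m < p" "p < n"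
    and car: "\<mu> \<in> carrier_vec p" "\<beta> \<in> carrier_vec p"
    and law: "\<And>l. l < n \<Longrightarrow> gaussian_vector M p (X l) \<mu> \<Sigma>"
    and indep: "prob_space.indep_vars M (\<lambda>_. PiM {..<p} (\<lambda>_. borel)) X {..<n}"
    and noise_law: "\<And>l. l < n \<Longrightarrow> distr M borel (noise l) = normal_law 0 \<sigma>"
    and noise_indep: "prob_space.indep_vars M (\<lambda>_. borel) noise {..<n}"
    and \<sigma>: "0 \<le> \<sigma>" "\<sigma>\<^sup>2 \<le> L" "0 < L"
    and Y: "\<And>l \<omega>. l < n \<Longrightarrow> \<omega> \<in> space M \<Longrightarrow> Y l \<omega> = \<beta>\<^sub>0 + scalar_prod \<beta> (vec p (X l \<omega>)) + noise l \<omega>"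
    and \<Sigma>: "form_between p lo hi \<Sigma>" "0 < lo" "0 < hi"
    and m: "\<And>G. G \<in> finest_blocks \<Sigma> \<Longrightarrow> card G \<le> m"
    and sep: "\<And>B. strictly_finer p B (finest_blocks \<Sigma>) \<Longrightarrow> 2 * b \<le> max_norm (block_restrict B \<Sigma> - \<Sigma>)"
    and beta: "0 < beta_lo" "\<And>j. j < p \<Longrightarrow> beta_lo \<le> \<bar>\<beta> $ j\<bar> \<and> \<bar>\<beta> $ j\<bar> \<le> beta_hi"
    and K: "K = 2 * sqrt (4 * hi * ln (12 * sqrt 2 * exp 1))"
    and \<epsilon>: "0 < \<epsilon>" "\<epsilon> \<le> K / 2" and y: "0 \<le> y" "real p \<le> y * real n"
    and small_ball: "(2 * exp 1 * (1 + K / \<epsilon>)) powr y * (exp (1 / 2) * (3 * \<epsilon>) / (sqrt lo / 2)) \<le> 1 / 2"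
    and J: "2 * K / \<epsilon> \<le> real_of_int J"
    and T: "T = 4 * L * ln (2 * sqrt 2)"
    and c: "c = min (\<epsilon>\<^sup>2) lo" and K': "K' = max (K\<^sup>2) hi"
    and \<tau>: "0 < \<tau>" "\<tau> \<le> 4 * hi" "2 * \<tau> \<le> 1"
    and b: "0 < b" "2 * \<tau> \<le> b"
    and pen_large: "(2 * \<tau>)\<^sup>2 / c\<^sup>2 < real p * \<kappa>" and pen_small: "real p * \<kappa> * (real m)\<^sup>2 < b\<^sup>2 / (8 * K'\<^sup>2)"
    and grid: "2 * \<tau> / c + 1 / real p < b / K'" "2 * \<tau> / c + 1 / real p \<le> 1"
    and thr: "2 * \<tau> / c \<le> real n powr (- 1 / 3)" "real n powr (- 1 / 3) < b / K'"
    and large: "4 * (T / \<epsilon>\<^sup>2) \<le> real p * beta_lo\<^sup>2"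
  obtains E where "E \<in> sets M"
    "measure M (space M - E) \<le> 4 * (real p)\<^sup>2 * exp (- (real n * \<tau>\<^sup>2 / (256 * hi\<^sup>2)))
       + 2 * real p * exp (- (real n * \<tau> / (8 * hi))) + (2 * real_of_int J + 3) * (1 / 2) ^ n"
    "\<And>\<omega> B S. \<omega> \<in> E \<Longrightarrow> partition_on {..<p} B \<Longrightarrow> S = sample_cov n p (\<lambda>l. X l \<omega>) \<Longrightarrow>
       is_B_tot \<kappa> S B \<or> is_B_corr \<kappa> S B \<or> is_B_threshold n S B \<or> is_B_grid m \<kappa> S B \<Longrightarrow>
       (\<Sum>i<p. \<bar>shapley_estimate n p (\<lambda>l. X l \<omega>) (\<lambda>l. Y l \<omega>) B i - shapley_effect \<Sigma> \<beta> i\<bar>)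
         \<le> error_const c K' m (T / \<epsilon>\<^sup>2) beta_lo beta_hi * (2 * \<tau> + 1 / sqrt (real p))"
proof -
  have n: "0 < n" using p by simp
  have K0: "0 < K" using \<epsilon> by linarith
  have cK: "0 < c" "0 < K'" using \<epsilon> \<Sigma> by (auto simp: c K' less_max_iff_disj)
  have c\<Sigma>: "\<Sigma> \<in> carrier_mat p p" "transpose_mat \<Sigma> = \<Sigma>" using \<Sigma> by (auto simp: form_between_def)
  define Bs where "Bs = finest_blocks \<Sigma>"
  have Bs: "partition_on {..<p} Bs" and \<Sigma>B: "\<Sigma> = block_restrict Bs \<Sigma>"
    unfolding Bs_def using partition_on_finest_blocks[OF c\<Sigma>(1)] block_restrict_finest_blocks[OF c\<Sigma>(1)] .
  let ?z = "\<lambda>\<omega> l i. X l \<omega> i - \<mu> $ i"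
  let ?s = "\<lambda>v. sqrt (bform \<Sigma> (vec p v) (vec p v))"
  interpret R: gaussian_rows M n p ?z ?s lo hi
    by (rule gaussian_rows_sample[OF M car(1) \<Sigma> law indep]) (use p in auto)
  have s2: "(?s v)\<^sup>2 = bform \<Sigma> (vec p v) (vec p v)" for v
    using form_between_nonneg[OF \<Sigma>(1), of "vec p v"] \<Sigma>(2) by simp
  obtain E1 where E1: "E1 \<in> sets M" "measure M (space M - E1) \<le> (2 * real_of_int J + 2) * (1 / 2) ^ n"
    and up: "\<And>\<omega> v. \<omega> \<in> E1 \<Longrightarrow> L2_set (row_form p (?z \<omega>) v) {..<n} \<le> K * sqrt (real n) * L2_set v {..<p}"
    and low: "\<And>\<omega> v c. \<omega> \<in> E1 \<Longrightarrow> \<epsilon> * sqrt (real n) * L2_set v {..<p} \<le> L2_set (\<lambda>l. c + row_form p (?z \<omega>) v l) {..<n}"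
    using R.row_form_lower_event[OF K \<epsilon> y small_ball J] by blast
  obtain E2 where E2: "E2 \<in> sets M" "measure M (space M - E2) \<le> 4 * (real p)\<^sup>2 * exp (- (real n * \<tau>\<^sup>2 / (256 * hi\<^sup>2))) + 2 * real p * exp (- (real n * \<tau> / (8 * hi)))"
    and prods: "\<And>\<omega> i j. \<omega> \<in> E2 \<Longrightarrow> i < p \<Longrightarrow> j < p \<Longrightarrow> \<bar>(\<Sum>l<n. ?z \<omega> l i * ?z \<omega> l j) - real n * \<Sigma> $$ (i, j)\<bar> \<le> real n * \<tau>"
    and means: "\<And>\<omega> i. \<omega> \<in> E2 \<Longrightarrow> i < p \<Longrightarrow> \<bar>\<Sum>l<n. ?z \<omega> l i\<bar> \<le> real n * sqrt \<tau>"
    using R.entries_event[OF c\<Sigma> s2 \<tau>(1,2)] by blast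
  define A where "A = {\<omega> \<in> space M. T * real n \<le> (\<Sum>l<n. (noise l \<omega>)\<^sup>2)}"
  have [measurable]: "noise l \<in> borel_measurable M" if "l < n" for l
    using noise_indep that by (auto simp: R.indep_vars_def)
  have "(\<lambda>\<omega>. \<Sum>l<n. (noise l \<omega>)\<^sup>2) \<in> borel_measurable M" by (intro borel_measurable_sum) auto
  then have A: "A \<in> sets M" unfolding A_def by measurable
  have pA: "measure M A \<le> (1 / 2) ^ n"
  proof -
    have "measure M A \<le> (sqrt 2 * exp (- T / (4 * L))) ^ n"
      unfolding A_def by (rule R.normal_sum_squares_upper_tail[OF noise_indep noise_law \<sigma>])
    also have "- T / (4 * L) = - ln (2 * sqrt 2)" using \<sigma> by (simp add: T)
    also have "sqrt 2 * exp (- ln (2 * sqrt 2)) = 1 / 2" by (simp add: exp_minus)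
    finally show ?thesis .
  qed
  define E where "E = E1 \<inter> E2 - A"
  show ?thesis
  proof (rule that)
    show E: "E \<in> sets M" using E1 E2 A by (auto simp: E_def)
    have s1: "space M - E1 \<in> sets M" "space M - E2 \<in> sets M" using E1 E2 by auto
    have "measure M (space M - E) \<le> measure M (((space M - E1) \<union> (space M - E2)) \<union> A)"
      using s1 A by (intro R.finite_measure_mono) (auto simp: E_def)
    also have "\<dots> \<le> measure M ((space M - E1) \<union> (space M - E2)) + measure M A" using s1 A by (intro measure_Un_le) auto
    also have "measure M ((space M - E1) \<union> (space M - E2)) \<le> measure M (space M - E1) + measure M (space M - E2)"
      using s1 by (intro measure_Un_le) auto
    finally show "measure M (space M - E) \<le> 4 * (real p)\<^sup>2 * exp (- (real n * \<tau>\<^sup>2 / (256 * hi\<^sup>2)))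
       + 2 * real p * exp (- (real n * \<tau> / (8 * hi))) + (2 * real_of_int J + 3) * (1 / 2) ^ n"
      using E1(2) E2(2) pA by (simp add: distrib_right)
    fix \<omega> B S
    assume \<omega>: "\<omega> \<in> E" and B: "partition_on {..<p} B" and S_eq: "S = sample_cov n p (\<lambda>l. X l \<omega>)"
      and est: "is_B_tot \<kappa> S B \<or> is_B_corr \<kappa> S B \<or> is_B_threshold n S B \<or> is_B_grid m \<kappa> S B"
    have \<omega>s: "\<omega> \<in> E1" "\<omega> \<in> E2" "\<omega> \<notin> A" "\<omega> \<in> space M"
      using \<omega> E sets.sets_into_space by (auto simp: E_def)
    have "form_between p (\<epsilon>\<^sup>2) (K\<^sup>2) S"
      unfolding S_eq using \<epsilon> K0 by (intro form_between_sample_cov[OF n _ _ up[OF \<omega>s(1)] low[OF \<omega>s(1)]]) auto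
    then have S: "form_between p c K' S" by (rule form_between_mono) (auto simp: c K')
    have \<Sigma>': "form_between p c K' \<Sigma>" using \<Sigma>(1) by (rule form_between_mono) (auto simp: c K')
    have err: "\<bar>S $$ (i, j) - \<Sigma> $$ (i, j)\<bar> \<le> 2 * \<tau>" if "i < p" "j < p" for i j
      using sample_cov_entry_error[OF n that prods[OF \<omega>s(2) that] means[OF \<omega>s(2) that(1)] means[OF \<omega>s(2) that(2)]] \<tau>(1)
      unfolding S_eq by simp
    have off: "\<bar>S $$ (i, j)\<bar> \<le> 2 * \<tau>" if "i < p" "j < p" "\<not> same_block Bs i j" for i j
    proof -
      have "\<Sigma> $$ (i, j) = 0" using block_restrict_nonzero[OF c\<Sigma>(1) \<Sigma>B that(1,2)] that(3) by blast
      then show ?thesis using err[OF that(1,2)] by simp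
    qed
    have on: "\<exists>i<p. \<exists>j<p. same_block Bs i j \<and> \<not> same_block Q i j \<and> b \<le> \<bar>S $$ (i, j)\<bar>"
      if Q: "strictly_finer p Q Bs" for Q
    proof -
      have cQ: "block_restrict Q \<Sigma> - \<Sigma> \<in> carrier_mat p p" using c\<Sigma>(1) by (intro minus_carrier_mat)
      obtain i j where ij: "i < p" "j < p" "max_norm (block_restrict Q \<Sigma> - \<Sigma>) = \<bar>(block_restrict Q \<Sigma> - \<Sigma>) $$ (i, j)\<bar>"
        using max_norm_attained[OF cQ p(1)] by blast
      have "2 * b \<le> \<bar>(block_restrict Q \<Sigma> - \<Sigma>) $$ (i, j)\<bar>" using sep[OF Q[unfolded Bs_def]] unfolding ij(3) .
      then have g: "\<not> same_block Q i j" "2 * b \<le> \<bar>\<Sigma> $$ (i, j)\<bar>"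
        using ij c\<Sigma>(1) b(1) by (auto split: if_splits)
      then have "same_block Bs i j" using block_restrict_nonzero[OF c\<Sigma>(1) \<Sigma>B ij(1,2)] b(1) by fastforce
      moreover have "b \<le> \<bar>S $$ (i, j)\<bar>" using err[OF ij(1,2)] g(2) b(2) by linarith
      ultimately show ?thesis using ij g(1) by blast
    qed
    have \<tau>0: "0 \<le> 2 * \<tau>" using \<tau>(1) by simp
    have b0: "0 \<le> b" using b by simp
    have m': "card G \<le> m" if "G \<in> Bs" for G using m that by (simp add: Bs_def)
    note rec = estimators_recover_blocks[OF S cK p(2) Bs B m' off on b0 \<tau>0 pen_large pen_small grid thr est]
    have noise_le: "(\<Sum>l<n. (noise l \<omega>)\<^sup>2) \<le> T * real n" using \<omega>s by (auto simp: A_def)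
    have slope: "(L2_set (\<lambda>i. slope_estimate n p (\<lambda>l. X l \<omega>) (\<lambda>l. Y l \<omega>) $ i - \<beta> $ i) {..<p})\<^sup>2 \<le> T / \<epsilon>\<^sup>2"
      by (rule slope_estimate_error[OF n \<epsilon>(1) car(2) low[OF \<omega>s(1)] Y[OF _ \<omega>s(4)] noise_le])
    have sl: "slope_estimate n p (\<lambda>l. X l \<omega>) (\<lambda>l. Y l \<omega>) \<in> carrier_vec p" by (simp add: slope_estimate_def)
    have "(\<Sum>i<p. \<bar>block_shapley B (block_restrict B S) (slope_estimate n p (\<lambda>l. X l \<omega>) (\<lambda>l. Y l \<omega>)) i - shapley_effect \<Sigma> \<beta> i\<bar>)
        \<le> error_const c K' m (T / \<epsilon>\<^sup>2) beta_lo beta_hi * (2 * \<tau> + 1 / sqrt (real p))"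
      by (rule shapley_total_error[OF \<Sigma>' S cK p(1) Bs \<Sigma>B m' rec car(2) sl _ beta slope err \<tau>0 \<tau>(3) large])
        (use car in auto)
    then show "(\<Sum>i<p. \<bar>shapley_estimate n p (\<lambda>l. X l \<omega>) (\<lambda>l. Y l \<omega>) B i - shapley_effect \<Sigma> \<beta> i\<bar>)
         \<le> error_const c K' m (T / \<epsilon>\<^sup>2) beta_lo beta_hi * (2 * \<tau> + 1 / sqrt (real p))"
      by (simp add: shapley_estimate_def S_eq)
  qed
qed

section \<open>Consistency of the estimated Shapley effects\<close>

theorem proposition17:
  fixes M :: "nat \<Rightarrow> 'a measure"
    and p :: "nat \<Rightarrow> nat"
    and n\<^sub>0 m :: nat
    and X :: "nat \<Rightarrow> nat \<Rightarrow> 'a \<Rightarrow> nat \<Rightarrow> real"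
    and noise Y :: "nat \<Rightarrow> nat \<Rightarrow> 'a \<Rightarrow> real"
    and \<mu> \<beta> :: "nat \<Rightarrow> real vec"
    and \<Sigma> :: "nat \<Rightarrow> real mat"
    and \<beta>\<^sub>0 \<sigma> \<kappa> :: "nat \<Rightarrow> real"
    and B_hat :: "nat \<Rightarrow> 'a \<Rightarrow> nat set set"
    and S :: "nat \<Rightarrow> 'a \<Rightarrow> real mat"
    and C_sup y lam_inf lam_sup a beta_inf beta_sup \<delta> \<gamma> :: real
  assumes prob: "\<And>n. n \<ge> n\<^sub>0 \<Longrightarrow> prob_space (M n)"
    and p_less: "\<And>n. n \<ge> n\<^sub>0 \<Longrightarrow> p n < n"
    and p_infty: "filterlim p at_top sequentially"
    and carriers: "\<And>n. n \<ge> n\<^sub>0 \<Longrightarrow> \<mu> n \<in> carrier_vec (p n)"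
      "\<And>n. n \<ge> n\<^sub>0 \<Longrightarrow> \<beta> n \<in> carrier_vec (p n)"
      "\<And>n. n \<ge> n\<^sub>0 \<Longrightarrow> \<Sigma> n \<in> carrier_mat (p n) (p n)"
    and Sigma_spd: "\<And>n. n \<ge> n\<^sub>0 \<Longrightarrow> sym_pos_def (\<Sigma> n)"
    and X_law: "\<And>n l. n \<ge> n\<^sub>0 \<Longrightarrow> l < n \<Longrightarrow> gaussian_vector (M n) (p n) (X n l) (\<mu> n) (\<Sigma> n)"
    and X_indep: "\<And>n. n \<ge> n\<^sub>0 \<Longrightarrow>
      prob_space.indep_vars (M n) (\<lambda>_. PiM {..<p n} (\<lambda>_. borel)) (X n) {..<n}"
    and noise_measurable: "\<And>n l. n \<ge> n\<^sub>0 \<Longrightarrow> l < n \<Longrightarrow> noise n l \<in> borel_measurable (M n)"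
    and noise_law: "\<And>n l. n \<ge> n\<^sub>0 \<Longrightarrow> l < n \<Longrightarrow> distr (M n) borel (noise n l) = normal_law 0 (\<sigma> n)"
    and noise_indep: "\<And>n. n \<ge> n\<^sub>0 \<Longrightarrow> prob_space.indep_vars (M n) (\<lambda>_. borel) (noise n) {..<n}"
    and X_noise_indep: "\<And>n. n \<ge> n\<^sub>0 \<Longrightarrow>
      prob_space.indep_set (M n)
        (sets (vimage_algebra (space (M n)) (\<lambda>\<omega>. \<lambda>l\<in>{..<n}. X n l \<omega>)
           (PiM {..<n} (\<lambda>_. PiM {..<p n} (\<lambda>_. borel)))))
        (sets (vimage_algebra (space (M n)) (\<lambda>\<omega>. \<lambda>l\<in>{..<n}. noise n l \<omega>)
           (PiM {..<n} (\<lambda>_. borel))))"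
    and sigma_bound: "\<And>n. n \<ge> n\<^sub>0 \<Longrightarrow> 0 \<le> \<sigma> n \<and> \<sigma> n \<le> C_sup"
    and Y_model: "\<And>n l \<omega>. n \<ge> n\<^sub>0 \<Longrightarrow> l < n \<Longrightarrow> \<omega> \<in> space (M n) \<Longrightarrow>
      Y n l \<omega> = \<beta>\<^sub>0 n + scalar_prod (\<beta> n) (vec (p n) (X n l \<omega>)) + noise n l \<omega>"
    and cond1: "(\<lambda>n. real (p n) / real n) \<longlonglongrightarrow> y" "0 < y" "y < 1"
    and cond2: "0 < lam_inf"
      "\<And>n k. n \<ge> n\<^sub>0 \<Longrightarrow> eigenvalue (\<Sigma> n) k \<Longrightarrow> lam_inf \<le> k \<and> k \<le> lam_sup"
    and cond3: "1 \<le> m"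
      "\<And>n G. n \<ge> n\<^sub>0 \<Longrightarrow> G \<in> finest_blocks (\<Sigma> n) \<Longrightarrow> card G \<le> m"
    and cond4: "0 < a"
      "\<And>n B. n \<ge> n\<^sub>0 \<Longrightarrow> strictly_finer (p n) B (finest_blocks (\<Sigma> n)) \<Longrightarrow>
         max_norm (block_restrict B (\<Sigma> n) - \<Sigma> n) \<ge> a * real n powr (- 1 / 4)"
    and cond5: "0 < beta_inf"
      "\<And>n j. n \<ge> n\<^sub>0 \<Longrightarrow> j < p n \<Longrightarrow> beta_inf \<le> \<bar>\<beta> n $ j\<bar> \<and> \<bar>\<beta> n $ j\<bar> \<le> beta_sup"
    and delta: "1 / 2 < \<delta>" "\<delta> < 1"
    and kappa: "\<And>n. \<kappa> n = 1 / (real (p n) * real n powr \<delta>)"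
    and S_eq: "\<And>n \<omega>. S n \<omega> = sample_cov n (p n) (\<lambda>l. X n l \<omega>)"
    and B_hat_measurable: "\<And>n. n \<ge> n\<^sub>0 \<Longrightarrow>
      B_hat n \<in> measurable (M n) (count_space {B. partition_on {..<p n} B})"
    and B_hat_estimator:
      "(\<forall>n\<ge>n\<^sub>0. AE \<omega> in M n. is_B_tot (\<kappa> n) (S n \<omega>) (B_hat n \<omega>)) \<or>
       (\<forall>n\<ge>n\<^sub>0. AE \<omega> in M n. is_B_corr (\<kappa> n) (S n \<omega>) (B_hat n \<omega>)) \<or>
       (\<forall>n\<ge>n\<^sub>0. AE \<omega> in M n. is_B_threshold n (S n \<omega>) (B_hat n \<omega>)) \<or>
       (\<forall>n\<ge>n\<^sub>0. AE \<omega> in M n. is_B_grid m (\<kappa> n) (S n \<omega>) (B_hat n \<omega>))"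
    and gamma: "1 / 2 < \<gamma>"
  shows "small_o_p M
    (\<lambda>n \<omega>. \<Sum>i<p n.
       \<bar>shapley_estimate n (p n) (\<lambda>l. X n l \<omega>) (\<lambda>l. Y n l \<omega>) (B_hat n \<omega>) i
        - shapley_effect (\<Sigma> n) (\<beta> n) i\<bar>)
    (\<lambda>n. ln (real n) powr \<gamma> / sqrt (real n))"
proof -
  define hi where "hi = max lam_sup lam_inf"
  define K where "K = 2 * sqrt (4 * hi * ln (12 * sqrt 2 * exp 1))"
  \<comment> \<open>any number strictly between \<open>y\<close> and 1; eventually \<open>p \<le> y' n\<close>\<close>
  define y' where "y' = (1 + y) / 2"
  define L where "L = C_sup\<^sup>2 + 1"
  define T where "T = 4 * L * ln (2 * sqrt 2)"
  have lo: "0 < lam_inf" by (rule cond2(1))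
  have hi: "0 < hi" using lo by (simp add: hi_def less_max_iff_disj)
  have K0: "0 < K"
  proof -
    have "1 * 1 < (12 * sqrt 2) * exp (1::real)"
    proof (rule mult_strict_mono)
      have "1 \<le> sqrt (2::real)" by simp
      then show "1 < 12 * sqrt (2::real)" by linarith
    qed auto
    then have "0 < ln (12 * sqrt 2 * exp (1::real))" by (intro ln_gt_zero) simp
    then show ?thesis using hi by (simp add: K_def)
  qed
  have y': "0 \<le> y'" "y' < 1" "y < y'" using cond1 by (auto simp: y'_def)
  have Cpos: "0 < exp (1 / 2) * 3 / (sqrt lam_inf / 2)" using lo by simp
  obtain \<epsilon> where \<epsilon>: "0 < \<epsilon>" "\<epsilon> \<le> K / 2"
    and sb: "(2 * exp 1 * (1 + K / \<epsilon>)) powr y' * ((exp (1 / 2) * 3 / (sqrt lam_inf / 2)) * \<epsilon>) \<le> 1 / 2"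
    using exists_small_ball_radius[OF K0 Cpos y'(1,2)] by blast
  have small_ball: "(2 * exp 1 * (1 + K / \<epsilon>)) powr y' * (exp (1 / 2) * (3 * \<epsilon>) / (sqrt lam_inf / 2)) \<le> 1 / 2"
    using sb by simp
  define J where "J = \<lceil>2 * K / \<epsilon>\<rceil>"
  have J: "2 * K / \<epsilon> \<le> real_of_int J" by (simp add: J_def)
  \<comment> \<open>spectral bounds common to \<open>S\<close> and \<open>\<Sigma>\<close>\<close>
  define c where "c = min (\<epsilon>\<^sup>2) lam_inf"
  define K' where "K' = max (K\<^sup>2) hi"
  have cK: "0 < c" "0 < K'" using \<epsilon> lo hi by (auto simp: c_def K'_def less_max_iff_disj)
  define EC where "EC = error_const c K' m (T / \<epsilon>\<^sup>2) beta_inf beta_sup"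
  define D where "D = \<bar>EC\<bar> + 1"
  have D: "0 < D" by (simp add: D_def)
  \<comment> \<open>the factor makes the union bound over the \<open>p\<^sup>2\<close> entries of order \<open>n\<^sup>2 n\<^sup>-\<^sup>4\<close>\<close>
  define \<tau> where "\<tau> n = 32 * hi * sqrt (ln (real n) / real n)" for n :: nat
  \<comment> \<open>half of the separation, the other half being lost to the error of \<open>S\<close>\<close>
  define b where "b n = a / 2 * real n powr (- 1 / 4)" for n :: nat
  define g where "g n = 4 * (real n)\<^sup>2 * exp (- 4 * ln (real n)) + 2 * real n * exp (- 4 * ln (real n))
     + (2 * real_of_int J + 3) * (1 / 2) ^ n" for n :: nat
  define Z where "Z n \<omega> = (\<Sum>i<p n. \<bar>shapley_estimate n (p n) (\<lambda>l. X n l \<omega>) (\<lambda>l. Y n l \<omega>) (B_hat n \<omega>) i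
        - shapley_effect (\<Sigma> n) (\<beta> n) i\<bar>)" for n \<omega>
  have L0: "0 < L" by (simp add: L_def add_nonneg_pos)
  have T0: "0 \<le> T"
  proof -
    have "1 \<le> sqrt (2::real)" by simp
    then have "0 \<le> ln (2 * sqrt (2::real))" by (intro ln_ge_zero) linarith
    then show ?thesis using L0 by (simp add: T_def)
  qed
  have Xi: "(\<lambda>\<omega>. X n l \<omega> i) \<in> borel_measurable (M n)" if "n \<ge> n\<^sub>0" "l < n" "i < p n" for n l i
  proof -
    have "X n l \<in> measurable (M n) (PiM {..<p n} (\<lambda>_. borel))"
      using X_law[OF that(1,2)] by (simp add: gaussian_vector_def)
    from measurable_compose[OF this measurable_component_singleton] show ?thesis using that(3) by simp
  qed
  have Ym: "(\<lambda>\<omega>. Y n l \<omega>) \<in> borel_measurable (M n)" if n: "n \<ge> n\<^sub>0" "l < n" for n l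
  proof -
    have "(\<lambda>\<omega>. \<beta>\<^sub>0 n + (\<Sum>i<p n. \<beta> n $ i * X n l \<omega> i) + noise n l \<omega>) \<in> borel_measurable (M n)"
      using Xi[OF n] noise_measurable[OF n] by (intro borel_measurable_add borel_measurable_sum borel_measurable_times) auto
    moreover have "Y n l \<omega> = \<beta>\<^sub>0 n + (\<Sum>i<p n. \<beta> n $ i * X n l \<omega> i) + noise n l \<omega>" if "\<omega> \<in> space (M n)" for \<omega>
      using Y_model[OF n that] scalar_prod_sum[OF carriers(2)[OF n(1)], of "vec (p n) (X n l \<omega>)"] by simp
    ultimately show ?thesis by (subst measurable_cong)
  qed
  have Zm: "Z n \<in> borel_measurable (M n)" if "n \<ge> n\<^sub>0" for n
    unfolding Z_def using Xi[OF that] Ym[OF that] by (intro shapley_error_measurable B_hat_measurable[OF that])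
  have est: "AE \<omega> in M n. is_B_tot (\<kappa> n) (S n \<omega>) (B_hat n \<omega>) \<or> is_B_corr (\<kappa> n) (S n \<omega>) (B_hat n \<omega>)
      \<or> is_B_threshold n (S n \<omega>) (B_hat n \<omega>) \<or> is_B_grid m (\<kappa> n) (S n \<omega>) (B_hat n \<omega>)" if n: "n \<ge> n\<^sub>0" for n
    using B_hat_estimator
  proof (elim disjE)
    assume "\<forall>n\<ge>n\<^sub>0. AE \<omega> in M n. is_B_tot (\<kappa> n) (S n \<omega>) (B_hat n \<omega>)"
    then have "AE \<omega> in M n. is_B_tot (\<kappa> n) (S n \<omega>) (B_hat n \<omega>)" using n by blast
    then show ?thesis by (rule eventually_mono) simp
  next
    assume "\<forall>n\<ge>n\<^sub>0. AE \<omega> in M n. is_B_corr (\<kappa> n) (S n \<omega>) (B_hat n \<omega>)"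
    then have "AE \<omega> in M n. is_B_corr (\<kappa> n) (S n \<omega>) (B_hat n \<omega>)" using n by blast
    then show ?thesis by (rule eventually_mono) simp
  next
    assume "\<forall>n\<ge>n\<^sub>0. AE \<omega> in M n. is_B_threshold n (S n \<omega>) (B_hat n \<omega>)"
    then have "AE \<omega> in M n. is_B_threshold n (S n \<omega>) (B_hat n \<omega>)" using n by blast
    then show ?thesis by (rule eventually_mono) simp
  next
    assume "\<forall>n\<ge>n\<^sub>0. AE \<omega> in M n. is_B_grid m (\<kappa> n) (S n \<omega>) (B_hat n \<omega>)"
    then have "AE \<omega> in M n. is_B_grid m (\<kappa> n) (S n \<omega>) (B_hat n \<omega>)" using n by blast
    then show ?thesis by (rule eventually_mono) simp
  qed
  have limit: "(\<lambda>n. measure (M n) {\<omega> \<in> space (M n). \<bar>Z n \<omega>\<bar> > r * (ln (real n) powr \<gamma> / sqrt (real n))}) \<longlonglongrightarrow> 0"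
    if r: "0 < r" for r
  proof (rule tendsto_sandwich[of "\<lambda>_. 0"])
    show "g \<longlonglongrightarrow> 0" unfolding g_def by real_asymp
    have a0: "0 < a" and d: "1 / 2 < \<delta>" "\<delta> < 1" and y0: "0 < y" and bi: "0 < beta_inf" and ga: "1 / 2 < \<gamma>"
      using cond4(1) delta cond1(2) cond5(1) gamma by auto
    note pos = hi cK a0 y0
    have "\<forall>\<^sub>F n in sequentially. y / 2 < real (p n) / real n"
      by (rule order_tendstoD(1)[OF cond1(1)]) (use y0 in simp)
    moreover have "\<forall>\<^sub>F n in sequentially. real (p n) / real n < y'"
      by (rule order_tendstoD(2)[OF cond1(1) y'(3)])
    moreover have "\<forall>\<^sub>F n in sequentially. m < p n"
      by (rule eventually_compose_filterlim[OF eventually_gt_at_top p_infty])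
    moreover have "\<forall>\<^sub>F n in sequentially. 0 < \<tau> n" "\<forall>\<^sub>F n in sequentially. \<tau> n \<le> 4 * hi" "\<forall>\<^sub>F n in sequentially. 2 * \<tau> n \<le> 1"
      unfolding \<tau>_def using hi by real_asymp+
    moreover have "\<forall>\<^sub>F n in sequentially. 2 * \<tau> n \<le> b n"
      unfolding \<tau>_def b_def using hi a0 by real_asymp
    \<comment> \<open>the penalty per pair, \<open>n^(-\<delta>)\<close>, lies between \<open>ln n / n\<close> and \<open>n^(-1/2)\<close> because \<open>1/2 < \<delta> < 1\<close>\<close>
    moreover have "\<forall>\<^sub>F n in sequentially. (2 * \<tau> n)\<^sup>2 / c\<^sup>2 < 1 / real n powr \<delta>"
      unfolding \<tau>_def using hi cK d by real_asymp
    moreover have "\<forall>\<^sub>F n in sequentially. 1 / real n powr \<delta> * (real m)\<^sup>2 < (b n)\<^sup>2 / (8 * K'\<^sup>2)"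
      unfolding b_def using cond3(1) a0 cK d by real_asymp
    moreover have "\<forall>\<^sub>F n in sequentially. 2 * \<tau> n / c + 2 / (y * real n) < b n / K'"
      unfolding \<tau>_def b_def using pos by real_asymp
    moreover have "\<forall>\<^sub>F n in sequentially. 2 * \<tau> n / c + 2 / (y * real n) \<le> 1"
      unfolding \<tau>_def using pos by real_asymp
    moreover have "\<forall>\<^sub>F n in sequentially. 2 * \<tau> n / c \<le> real n powr (- 1 / 3)"
      unfolding \<tau>_def using pos by real_asymp
    moreover have "\<forall>\<^sub>F n in sequentially. real n powr (- 1 / 3) < b n / K'"
      unfolding b_def using pos by real_asymp
    moreover have "\<forall>\<^sub>F n in sequentially. 4 * (T / \<epsilon>\<^sup>2) \<le> y / 2 * real n * beta_inf\<^sup>2"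
      using y0 bi by real_asymp
    \<comment> \<open>here \<open>\<gamma> > 1/2\<close> absorbs the constant in front of \<open>sqrt(ln n / n)\<close>\<close>
    moreover have "\<forall>\<^sub>F n in sequentially. D * (2 * \<tau> n + sqrt (2 / y) / sqrt (real n)) \<le> r * (ln (real n) powr \<gamma> / sqrt (real n))"
      unfolding \<tau>_def using D hi y0 r ga by real_asymp
    moreover have "\<forall>\<^sub>F n in sequentially. n \<ge> max n\<^sub>0 1" by (rule eventually_ge_at_top)
    ultimately show "\<forall>\<^sub>F n in sequentially.
        measure (M n) {\<omega> \<in> space (M n). \<bar>Z n \<omega>\<bar> > r * (ln (real n) powr \<gamma> / sqrt (real n))} \<le> g n"
    proof eventually_elim
      case (elim n)
      then have n: "n \<ge> n\<^sub>0" "0 < n" by auto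
      have pn: "y / 2 * real n < real (p n)" "real (p n) \<le> y' * real n"
        using elim(1,2) n by (simp_all add: field_simps)
      have p0: "0 < p n" "m < p n" "p n < n" using elim(3) p_less[OF n(1)] by auto
      have ip: "1 / real (p n) \<le> 2 / (y * real n)"
      proof -
        have "1 / real (p n) \<le> 1 / (y / 2 * real n)" using pn(1) y0 n p0 by (intro divide_left_mono) auto
        then show ?thesis by simp
      qed
      interpret prob_space "M n" by (rule prob[OF n(1)])
      have S\<Sigma>: "form_between (p n) lam_inf hi (\<Sigma> n)"
      proof -
        have "transpose_mat (\<Sigma> n) = \<Sigma> n" using Sigma_spd[OF n(1)] by (simp add: sym_pos_def_def)
        then have "form_between (p n) lam_inf lam_sup (\<Sigma> n)"
          using cond2(2)[OF n(1)] by (intro form_between_eigenvalues[OF carriers(3)[OF n(1)] _ p0(1)])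
        then show ?thesis by (rule form_between_mono) (auto simp: hi_def)
      qed
      have pk: "real (p n) * \<kappa> n = 1 / real n powr \<delta>" using p0 by (simp add: kappa)
      have sg: "(\<sigma> n)\<^sup>2 \<le> L"
      proof -
        have "(\<sigma> n)\<^sup>2 \<le> C_sup\<^sup>2" using sigma_bound[OF n(1)] by (intro power_mono) auto
        then show ?thesis by (simp add: L_def)
      qed
      have b0: "0 < b n" using a0 n by (simp add: b_def)
      have sep: "2 * b n \<le> max_norm (block_restrict B (\<Sigma> n) - \<Sigma> n)" if "strictly_finer (p n) B (finest_blocks (\<Sigma> n))" for B
        using cond4(2)[OF n(1) that] by (simp add: b_def)
      have grid: "2 * \<tau> n / c + 1 / real (p n) < b n / K'" "2 * \<tau> n / c + 1 / real (p n) \<le> 1"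
        using elim(10,11) ip by linarith+
      have large: "4 * (T / \<epsilon>\<^sup>2) \<le> real (p n) * beta_inf\<^sup>2"
        using elim(14) mult_right_mono[OF less_imp_le[OF pn(1)], of "beta_inf\<^sup>2"] by simp
      have pen_l: "(2 * \<tau> n)\<^sup>2 / c\<^sup>2 < real (p n) * \<kappa> n" unfolding pk by (rule elim(8))
      have pen_s: "real (p n) * \<kappa> n * (real m)\<^sup>2 < (b n)\<^sup>2 / (8 * K'\<^sup>2)" unfolding pk by (rule elim(9))
      note eb = error_bound_event[OF prob[OF n(1)] p0 carriers(1,2)[OF n(1)] X_law[OF n(1)] X_indep[OF n(1)]
            noise_law[OF n(1)] noise_indep[OF n(1)] sigma_bound[OF n(1), THEN conjunct1] sg L0 Y_model[OF n(1)] S\<Sigma> lo hi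
            cond3(2)[OF n(1)] sep cond5(1) cond5(2)[OF n(1)] K_def \<epsilon> y'(1) pn(2) small_ball J T_def c_def K'_def
            elim(4,5,6) b0 elim(7) pen_l pen_s grid elim(12,13) large]
      obtain E where E: "E \<in> events"
        "prob (space (M n) - E) \<le> 4 * (real (p n))\<^sup>2 * exp (- (real n * (\<tau> n)\<^sup>2 / (256 * hi\<^sup>2)))
           + 2 * real (p n) * exp (- (real n * \<tau> n / (8 * hi))) + (2 * real_of_int J + 3) * (1 / 2) ^ n"
        and bound: "\<And>\<omega> B S. \<omega> \<in> E \<Longrightarrow> partition_on {..<p n} B \<Longrightarrow> S = sample_cov n (p n) (\<lambda>l. X n l \<omega>) \<Longrightarrow>
           is_B_tot (\<kappa> n) S B \<or> is_B_corr (\<kappa> n) S B \<or> is_B_threshold n S B \<or> is_B_grid m (\<kappa> n) S B \<Longrightarrow>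
           (\<Sum>i<p n. \<bar>shapley_estimate n (p n) (\<lambda>l. X n l \<omega>) (\<lambda>l. Y n l \<omega>) B i - shapley_effect (\<Sigma> n) (\<beta> n) i\<bar>)
             \<le> error_const c K' m (T / \<epsilon>\<^sup>2) beta_inf beta_sup * (2 * \<tau> n + 1 / sqrt (real (p n)))"
      proof (rule eb)
        fix E
        assume "E \<in> events"
          and "prob (space (M n) - E) \<le> 4 * (real (p n))\<^sup>2 * exp (- (real n * (\<tau> n)\<^sup>2 / (256 * hi\<^sup>2)))
           + 2 * real (p n) * exp (- (real n * \<tau> n / (8 * hi))) + (2 * real_of_int J + 3) * (1 / 2) ^ n"
        and "\<And>\<omega> B S. \<omega> \<in> E \<Longrightarrow> partition_on {..<p n} B \<Longrightarrow> S = sample_cov n (p n) (\<lambda>l. X n l \<omega>) \<Longrightarrow>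
           is_B_tot (\<kappa> n) S B \<or> is_B_corr (\<kappa> n) S B \<or> is_B_threshold n S B \<or> is_B_grid m (\<kappa> n) S B \<Longrightarrow>
           (\<Sum>i<p n. \<bar>shapley_estimate n (p n) (\<lambda>l. X n l \<omega>) (\<lambda>l. Y n l \<omega>) B i - shapley_effect (\<Sigma> n) (\<beta> n) i\<bar>)
             \<le> error_const c K' m (T / \<epsilon>\<^sup>2) beta_inf beta_sup * (2 * \<tau> n + 1 / sqrt (real (p n)))"
        then show thesis by (rule that)
      qed
      obtain N where N: "{\<omega> \<in> space (M n). \<not> (is_B_tot (\<kappa> n) (S n \<omega>) (B_hat n \<omega>) \<or> is_B_corr (\<kappa> n) (S n \<omega>) (B_hat n \<omega>)
          \<or> is_B_threshold n (S n \<omega>) (B_hat n \<omega>) \<or> is_B_grid m (\<kappa> n) (S n \<omega>) (B_hat n \<omega>))} \<subseteq> N"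
        and N': "emeasure (M n) N = 0" "N \<in> events"
        by (rule AE_E[OF est[OF n(1)]])
      have N0: "prob N = 0" using N'(1) by (simp add: measure_def)
      have sub: "{\<omega> \<in> space (M n). \<bar>Z n \<omega>\<bar> > r * (ln (real n) powr \<gamma> / sqrt (real n))} \<subseteq> (space (M n) - E) \<union> N"
      proof
        fix \<omega> assume \<omega>: "\<omega> \<in> {\<omega> \<in> space (M n). \<bar>Z n \<omega>\<bar> > r * (ln (real n) powr \<gamma> / sqrt (real n))}"
        show "\<omega> \<in> (space (M n) - E) \<union> N"
        proof (rule ccontr)
          assume "\<omega> \<notin> (space (M n) - E) \<union> N"
          then have \<omega>E: "\<omega> \<in> E" "\<omega> \<notin> N" "\<omega> \<in> space (M n)" using \<omega> by auto
          have "partition_on {..<p n} (B_hat n \<omega>)"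
            using measurable_space[OF B_hat_measurable[OF n(1)] \<omega>E(3)] by simp
          moreover have "is_B_tot (\<kappa> n) (S n \<omega>) (B_hat n \<omega>) \<or> is_B_corr (\<kappa> n) (S n \<omega>) (B_hat n \<omega>)
              \<or> is_B_threshold n (S n \<omega>) (B_hat n \<omega>) \<or> is_B_grid m (\<kappa> n) (S n \<omega>) (B_hat n \<omega>)"
            using N \<omega>E by blast
          ultimately have "Z n \<omega> \<le> EC * (2 * \<tau> n + 1 / sqrt (real (p n)))"
            unfolding Z_def EC_def by (intro bound[OF \<omega>E(1) _ S_eq])
          also have "\<dots> \<le> D * (2 * \<tau> n + sqrt (2 / y) / sqrt (real n))"
          proof (rule mult_mono)
            show "EC \<le> D" by (simp add: D_def)
            have "1 / sqrt (real (p n)) = sqrt (1 / real (p n))" by (simp add: real_sqrt_divide)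
            also have "\<dots> \<le> sqrt (2 / (y * real n))" by (rule real_sqrt_le_mono[OF ip])
            also have "\<dots> = sqrt (2 / y) / sqrt (real n)" by (simp add: real_sqrt_divide real_sqrt_mult)
            finally show "2 * \<tau> n + 1 / sqrt (real (p n)) \<le> 2 * \<tau> n + sqrt (2 / y) / sqrt (real n)" by simp
            show "0 \<le> 2 * \<tau> n + 1 / sqrt (real (p n))" using elim(4) by simp
          qed (use D in simp)
          also have "\<dots> \<le> r * (ln (real n) powr \<gamma> / sqrt (real n))" by (rule elim(15))
          finally have "Z n \<omega> \<le> r * (ln (real n) powr \<gamma> / sqrt (real n))" .
          moreover have "0 \<le> Z n \<omega>" unfolding Z_def by (intro sum_nonneg) auto
          ultimately show False using \<omega> by simp
        qed
      qed
      have sE: "space (M n) - E \<in> events" using E(1) by auto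
      have "prob {\<omega> \<in> space (M n). \<bar>Z n \<omega>\<bar> > r * (ln (real n) powr \<gamma> / sqrt (real n))} \<le> prob ((space (M n) - E) \<union> N)"
        using sub sE N'(2) by (intro finite_measure_mono) auto
      also have "\<dots> \<le> prob (space (M n) - E) + prob N" using sE N'(2) by (intro measure_Un_le) auto
      also have "\<dots> \<le> g n"
      proof -
        have ln0: "0 \<le> ln (real n)" "ln (real n) \<le> real n" using n by (auto intro: less_imp_le[OF ln_less_self])
        have sq: "(sqrt (ln (real n) / real n))\<^sup>2 = ln (real n) / real n" using ln0 n by simp
        have t1: "real n * (\<tau> n)\<^sup>2 / (256 * hi\<^sup>2) = 4 * ln (real n)"
          using hi n unfolding \<tau>_def power_mult_distrib sq by simp
        have "ln (real n) / real n \<le> sqrt (ln (real n) / real n)"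
        proof (rule real_le_rsqrt)
          have "ln (real n) / real n \<le> 1" using ln0 n by simp
          then show "(ln (real n) / real n)\<^sup>2 \<le> ln (real n) / real n"
            using ln0 n mult_left_le_one_le[of "ln (real n) / real n" "ln (real n) / real n"] by (simp add: power2_eq_square)
        qed
        then have "real n * (ln (real n) / real n) \<le> real n * sqrt (ln (real n) / real n)" by (intro mult_left_mono) auto
        then have "ln (real n) \<le> real n * sqrt (ln (real n) / real n)" using n by simp
        moreover have "real n * \<tau> n / (8 * hi) = 4 * (real n * sqrt (ln (real n) / real n))" using hi by (simp add: \<tau>_def)
        ultimately have t2: "exp (- (real n * \<tau> n / (8 * hi))) \<le> exp (- 4 * ln (real n))" by simp
        have pn': "real (p n) \<le> real n" using p0 by simp
        have u1: "4 * (real (p n))\<^sup>2 * exp (- 4 * ln (real n)) \<le> 4 * (real n)\<^sup>2 * exp (- 4 * ln (real n))"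
          using pn' by (intro mult_right_mono mult_left_mono power_mono) auto
        have u2: "2 * real (p n) * exp (- (real n * \<tau> n / (8 * hi))) \<le> 2 * real n * exp (- 4 * ln (real n))"
          using pn' t2 by (intro mult_mono) auto
        have "- (4 * ln (real n)) = - 4 * ln (real n)" by simp
        note bd = E(2)[unfolded t1 this]
        show ?thesis unfolding g_def N0 add_0_right
          by (rule order_trans[OF bd]) (intro add_mono u1 u2 order_refl)
      qed
      finally show ?case .
    qed
  qed (auto simp: measure_nonneg)
  show ?thesis
    unfolding small_o_p_def Z_def[symmetric]
  proof (intro conjI allI impI)
    show "\<forall>\<^sub>F n in sequentially. (\<lambda>\<omega>. Z n \<omega>) \<in> borel_measurable (M n)"
      using Zm by (intro eventually_sequentiallyI[of n\<^sub>0])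
    fix r :: real assume "0 < r"
    then show "(\<lambda>n. measure (M n) {\<omega> \<in> space (M n). \<bar>Z n \<omega>\<bar> > r * (ln (real n) powr \<gamma> / sqrt (real n))}) \<longlonglongrightarrow> 0"
      by (rule limit)
  qed
qed

end
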